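(* Let $T>0$, $Q_T=(0,T)\times(0,1)$, $a=\alpha+\mu$ with $\alpha>0$, $\mu\in\mathcal M_+(Q_T)$, $\mu(Q_T)<\infty$, and let $b,f\in\mathcal D'(Q_T)$, $q,u_0\in\mathcal D'(0,1)$, $g_0,g_1\in\mathcal D'(0,T)$. Let $(u_\varepsilon)_{\varepsilon\in(0,1]}$ and $(\widetilde u_\varepsilon)_{\varepsilon\in(0,1]}$ be two very weak solutions (as defined in the context) of $$\begin{cases}\partial_tu-\partial_x(a(t,x)\partial_xu)+b(t,x)\partial_xu+q(x)u=f(t,x), & (t,x)\in Q_T,\\ u(0,x)=u_0(x), & x\in(0,1),\\ u(t,0)=g_0(t),\quad u(t,1)=g_1(t), & t\in(0,T),\end{cases}$$ generated respectively by regularising families $(a_\varepsilon,b_\varepsilon,q_\varepsilon,f_\varepsilon,u_{0,\varepsilon},g_{0,\varepsilon},g_{1,\varepsilon})$ and $(\widetilde a_\varepsilon,\widetilde b_\varepsilon,\widetilde q_\varepsilon,\widetilde f_\varepsilon,\widetilde u_{0,\varepsilon},\widetilde g_{0,\varepsilon},\widetilde g_{1,\varepsilon})$, each satisfying conditions (R1)–(R5) of the context, with the same ellipticity lower bound $\alpha$. Assume that - $a_\varepsilon-\widetilde a_\varepsilon$ is $W^{1,\infty}(Q_T)$-negligible, - $b_\varepsilon-\widetilde b_\varepsilon$ is $L^\infty(0,T;W^{1,\infty}(0,1))$-negligible, - $q_\varepsilon-\widetilde q_\varepsilon$ is $L^\infty(0,1)$-negligible, - $f_\varepsilon-\widetilde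 f_\varepsilon$ is $L^2(Q_T)$-negligible, $u_{0,\varepsilon}-\widetilde u_{0,\varepsilon}$ is $H^1(0,1)$-negligible, and $g_{j,\varepsilon}-\widetilde g_{j,\varepsilon}$ is $H^1(0,T)$-negligible for $j=0,1$. Then $u_\varepsilon-\widetilde u_\varepsilon$ is negligible in $H^1(0,T;L^2(0,1))\cap L^2(0,T;H^2(0,1))$ (with the sum norm).
   Context: Notation. $\mathcal D(\Omega)=C_c^\infty(\Omega)$, $\mathcal D'(\Omega)$ is its dual; $\mathcal M_+(Q_T)$ is the set of nonnegative Radon measures on $Q_T$; $\alpha$ is identified with the corresponding constant distribution. All coefficients $a,b,q$ and their regularisations are real-valued. $H^{-1}(0,1)$ is the dual of $H_0^1(0,1)$; functions $u$ may be complex-valued. Nets. Let $X(\Omega)$ be a normed function space continuously embedded in $\mathcal D'(\Omega)$. A net $(v_\varepsilon)_{\varepsilon\in(0,1]}\subset X(\Omega)$ is an $X$-regularisation of $v\in\mathcal D'(\Omega)$ if $v_\varepsilon\to v$ in $\mathcal D'(\Omega)$ as $\varepsilon\to0$. It is $X$-moderate if there are $C>0$, $N\in\mathbb N$ with $\|v_\varepsilon\|_{X}\le C\varepsilon^{-N}$ for all $\varepsilon\in(0,1]$. It is $X$-negligible if for every $m\in\mathbb N$ there is $C_m>0$ with $\|v_\varepsilon\|_X\le C_m\varepsilon^m$ for all $\varepsilon\in(0,1]$. Conditions on a regularising family $(a_\varepsilon,b_\varepsilon,q_\varepsilon,f_\varepsilon,u_{0,\varepsilon},g_{0,\varepsilon},g_{1,\varepsilon})_{\varepsilon\in(0,1]}$.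 (R1) $(a_\varepsilon)$ is an admissible regularisation of $a$: $a_\varepsilon\in W^{1,\infty}(Q_T)$, $a_\varepsilon\to a$ in $\mathcal D'(Q_T)$ as $\varepsilon\to0$, the net is $W^{1,\infty}(Q_T)$-moderate, and $a_\varepsilon(t,x)\ge\alpha$ for a.e. $(t,x)\in Q_T$ and every $\varepsilon\in(0,1]$. (R2) $(b_\varepsilon)$ is an $L^\infty(0,T;W^{1,\infty}(0,1))$-moderate regularisation of $b$ with $\|\partial_xb_\varepsilon\|_{L^\infty(Q_T)}\le C(1+|\log\varepsilon|)$ for some $C>0$ and all $\varepsilon\in(0,1]$. (R3) $(q_\varepsilon)$ is an $L^\infty(0,1)$-moderate regularisation of $q$ with $\|q_{-,\varepsilon}\|_{L^\infty(0,1)}\le C(1+|\log\varepsilon|)$ for some $C>0$ and all $\varepsilon\in(0,1]$, where $q_{-,\varepsilon}:=\max\{-q_\varepsilon,0\}$. (R4) $(f_\varepsilon)\subset L^2(Q_T)$, $(u_{0,\varepsilon})\subset H^1(0,1)$, $(g_{j,\varepsilon})\subset H^1(0,T)$ ($j=0,1$) are moderate regularisations (moderate in the indicated spaces) of $f,u_0,g_j$ respectively. (R5) Compatibility: $u_{0,\varepsilon}(0)=g_{0,\varepsilon}(0)$ and $u_{0,\varepsilon}(1)=g_{1,\varepsilon}(0)$ for every $\varepsilon\in(0,1]$. Very weak solution. A net $(u_\varepsilon)_{\varepsilon\in(0,1]}$ is a very weak solution of the problem, generated by a regularising family satisfying (R1)–(R5), if, with $\psi_\varepsilon(t,x):=(1-x)g_{0,\varepsilon}(t)+xg_{1,\varepsilon}(t)$,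 for every $\varepsilon\in(0,1]$ $$u_\varepsilon\in L^2(0,T;H^1(0,1)),\quad u_\varepsilon-\psi_\varepsilon\in L^2(0,T;H_0^1(0,1)),\quad \partial_tu_\varepsilon\in L^2(0,T;H^{-1}(0,1)),$$ $u_\varepsilon$ is the unique weak solution of $$\begin{cases}\partial_tu_\varepsilon-\partial_x(a_\varepsilon\partial_xu_\varepsilon)+b_\varepsilon\partial_xu_\varepsilon+q_\varepsilon u_\varepsilon=f_\varepsilon & \text{in }Q_T,\\ u_\varepsilon(0,x)=u_{0,\varepsilon}(x), & x\in(0,1),\\ u_\varepsilon(t,0)=g_{0,\varepsilon}(t),\quad u_\varepsilon(t,1)=g_{1,\varepsilon}(t), & t\in(0,T),\end{cases}$$ and the net $(u_\varepsilon)$ is moderate in $H^1(0,T;L^2(0,1))\cap L^2(0,T;H^2(0,1))$ equipped with the sum norm. Here "weak solution" means: $u_\varepsilon$ is in the classes above, $u_\varepsilon(0)=u_{0,\varepsilon}$ in $L^2(0,1)$, and for every $\varphi\in H_0^1(0,1)$ and a.e. $t\in(0,T)$, $\langle\partial_tu_\varepsilon(t),\varphi\rangle_{H^{-1},H_0^1}+\int_0^1a_\varepsilon\,\partial_xu_\varepsilon\,\overline{\partial_x\varphi}\,dx+\int_0^1b_\varepsilon\,\partial_xu_\varepsilon\,\overline{\varphi}\,dx+\int_0^1q_\varepsilon u_\varepsilon\overline{\varphi}\,dx=\int_0^1f_\varepsilon\overline{\varphi}\,dx$. *)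

theory Defs
  imports "HOL-Probability.Essential_Supremum"
begin

text \<open>
  The scalar field \<open>'k\<close> of a function space is \<^typ>\<open>real\<close> (for the coefficients) or
  \<^typ>\<open>complex\<close> (for the data and the solutions). Elements of function spaces are represented by
  Lebesgue measurable functions, equality of elements being equality almost everywhere. All
  function spaces over \<open>\<Omega>\<close> only depend on the values of the representative on \<open>\<Omega>\<close>.
\<close>

subsection \<open>Test functions and distributions\<close>

primrec partials :: "'a::euclidean_space list \<Rightarrow> ('a \<Rightarrow> 'k::real_normed_vector) \<Rightarrow> 'a \<Rightarrow> 'k" where
  "partials [] f = f"
| "partials (i # is) f = (\<lambda>x. frechet_derivative (partials is f) (at x) i)"

definition smooth_fun :: "('a::euclidean_space \<Rightarrow> 'k::real_normed_vector) \<Rightarrow> bool" where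
  "smooth_fun f \<longleftrightarrow> (\<forall>is. set is \<subseteq> Basis \<longrightarrow> (\<forall>x. partials is f differentiable (at x)))"

definition supp :: "('a::euclidean_space \<Rightarrow> 'k::real_normed_vector) \<Rightarrow> 'a set" where
  "supp f = closure {x. f x \<noteq> 0}"

definition test_funs :: "'a::euclidean_space set \<Rightarrow> ('a \<Rightarrow> 'k::real_normed_vector) set" where
  "test_funs \<Omega> = {\<phi>. smooth_fun \<phi> \<and> compact (supp \<phi>) \<and> supp \<phi> \<subseteq> \<Omega>}"

text \<open>Continuity for the usual inductive limit topology on the test functions is expressed by the
  seminorm estimates on each compact subset. A distribution over the field \<^typ>\<open>real\<close> is a
  real-valued distribution.\<close>

definition distribution ::
  "'a::euclidean_space set \<Rightarrow> (('a \<Rightarrow> 'k::{real_normed_field, euclidean_space}) \<Rightarrow> 'k) \<Rightarrow> bool" where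
  "distribution \<Omega> v \<longleftrightarrow>
     (\<forall>\<phi>\<in>test_funs \<Omega>. \<forall>\<psi>\<in>test_funs \<Omega>. v (\<lambda>x. \<phi> x + \<psi> x) = v \<phi> + v \<psi>) \<and>
     (\<forall>c. \<forall>\<phi>\<in>test_funs \<Omega>. v (\<lambda>x. c * \<phi> x) = c * v \<phi>) \<and>
     (\<forall>K. compact K \<and> K \<subseteq> \<Omega> \<longrightarrow>
        (\<exists>C\<ge>0. \<exists>N::nat. \<forall>\<phi>\<in>test_funs \<Omega>. \<forall>M. supp \<phi> \<subseteq> K \<longrightarrow>
            (\<forall>is x. set is \<subseteq> Basis \<and> length is \<le> N \<longrightarrow> norm (partials is \<phi> x) \<le> M) \<longrightarrow>
            norm (v \<phi>) \<le> C * M))"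

definition dist_of_fun ::
  "'a::euclidean_space set \<Rightarrow> ('a \<Rightarrow> 'k::{real_normed_field, euclidean_space}) \<Rightarrow> ('a \<Rightarrow> 'k) \<Rightarrow> 'k" where
  "dist_of_fun \<Omega> u \<phi> = (\<integral>x. u x * \<phi> x \<partial>lebesgue_on \<Omega>)"

definition dist_of_measure ::
  "'a::euclidean_space measure \<Rightarrow> ('a \<Rightarrow> 'k::{real_normed_field, euclidean_space}) \<Rightarrow> 'k" where
  "dist_of_measure \<mu> \<phi> = (\<integral>x. \<phi> x \<partial>\<mu>)"

text \<open>On an open subset of a Euclidean space every Borel measure that is finite on compact sets
  is regular, so local finiteness is all that has to be required.\<close>

definition radon_measure_on :: "'a::euclidean_space set \<Rightarrow> 'a measure \<Rightarrow> bool" where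
  "radon_measure_on \<Omega> \<mu> \<longleftrightarrow>
     sets \<mu> = sets (restrict_space borel \<Omega>) \<and> (\<forall>K. compact K \<and> K \<subseteq> \<Omega> \<longrightarrow> emeasure \<mu> K < \<infinity>)"

subsection \<open>Lebesgue and Sobolev spaces\<close>

record 'f fspace =
  carr :: "'f set"
  nrm :: "'f \<Rightarrow> real"

definition L2 ::
  "'a::euclidean_space set \<Rightarrow> ('a \<Rightarrow> 'k::{real_normed_field, euclidean_space}) fspace" where
  "L2 \<Omega> = \<lparr>
     carr = {u. u \<in> borel_measurable (lebesgue_on \<Omega>) \<and>
                integrable (lebesgue_on \<Omega>) (\<lambda>x. (norm (u x))\<^sup>2)},
     nrm = (\<lambda>u. sqrt (\<integral>x. (norm (u x))\<^sup>2 \<partial>lebesgue_on \<Omega>))\<rparr>"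

definition Linf ::
  "'a::euclidean_space set \<Rightarrow> ('a \<Rightarrow> 'k::{real_normed_field, euclidean_space}) fspace" where
  "Linf \<Omega> = \<lparr>
     carr = {u. u \<in> borel_measurable (lebesgue_on \<Omega>) \<and>
                esssup (lebesgue_on \<Omega>) (\<lambda>x. ereal (norm (u x))) < \<infinity>},
     nrm = (\<lambda>u. real_of_ereal (esssup (lebesgue_on \<Omega>) (\<lambda>x. ereal (norm (u x)))))\<rparr>"

definition locally_integrable ::
  "'a::euclidean_space set \<Rightarrow> ('a \<Rightarrow> 'k::{real_normed_field, euclidean_space}) \<Rightarrow> bool" where
  "locally_integrable \<Omega> u \<longleftrightarrow> (\<forall>K. compact K \<and> K \<subseteq> \<Omega> \<longrightarrow> integrable (lebesgue_on K) u)"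

definition has_wderiv ::
  "'a::euclidean_space set \<Rightarrow> 'a \<Rightarrow> ('a \<Rightarrow> 'k::{real_normed_field, euclidean_space}) \<Rightarrow> ('a \<Rightarrow> 'k) \<Rightarrow> bool"
  where
  "has_wderiv \<Omega> i u v \<longleftrightarrow> locally_integrable \<Omega> u \<and> locally_integrable \<Omega> v \<and>
     (\<forall>\<phi>\<in>test_funs \<Omega>. (\<integral>x. u x * partials [i] \<phi> x \<partial>lebesgue_on \<Omega>) = - (\<integral>x. v x * \<phi> x \<partial>lebesgue_on \<Omega>))"

text \<open>The weak derivative is unique up to null sets; it is only meaningful where it exists.\<close>

definition wderiv ::
  "'a::euclidean_space set \<Rightarrow> 'a \<Rightarrow> ('a \<Rightarrow> 'k::{real_normed_field, euclidean_space}) \<Rightarrow> 'a \<Rightarrow> 'k" where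
  "wderiv \<Omega> i u = (SOME v. has_wderiv \<Omega> i u v)"

definition W1inf ::
  "'a::euclidean_space set \<Rightarrow> ('a \<Rightarrow> 'k::{real_normed_field, euclidean_space}) fspace" where
  "W1inf \<Omega> = \<lparr>
     carr = {u \<in> carr (Linf \<Omega>). \<forall>i\<in>Basis. \<exists>v\<in>carr (Linf \<Omega>). has_wderiv \<Omega> i u v},
     nrm = (\<lambda>u. nrm (Linf \<Omega>) u + (\<Sum>i\<in>Basis. nrm (Linf \<Omega>) (wderiv \<Omega> i u)))\<rparr>"

definition H1 ::
  "'a::euclidean_space set \<Rightarrow> ('a \<Rightarrow> 'k::{real_normed_field, euclidean_space}) fspace" where
  "H1 \<Omega> = \<lparr>
     carr = {u \<in> carr (L2 \<Omega>). \<forall>i\<in>Basis. \<exists>v\<in>carr (L2 \<Omega>). has_wderiv \<Omega> i u v},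
     nrm = (\<lambda>u. sqrt ((nrm (L2 \<Omega>) u)\<^sup>2 + (\<Sum>i\<in>Basis. (nrm (L2 \<Omega>) (wderiv \<Omega> i u))\<^sup>2)))\<rparr>"

definition H2 ::
  "'a::euclidean_space set \<Rightarrow> ('a \<Rightarrow> 'k::{real_normed_field, euclidean_space}) fspace" where
  "H2 \<Omega> = \<lparr>
     carr = {u \<in> carr (L2 \<Omega>). \<forall>i\<in>Basis. \<exists>v\<in>carr (H1 \<Omega>). has_wderiv \<Omega> i u v},
     nrm = (\<lambda>u. sqrt ((nrm (L2 \<Omega>) u)\<^sup>2 + (\<Sum>i\<in>Basis. (nrm (H1 \<Omega>) (wderiv \<Omega> i u))\<^sup>2)))\<rparr>"

definition H10 ::
  "'a::euclidean_space set \<Rightarrow> ('a \<Rightarrow> 'k::{real_normed_field, euclidean_space}) fspace" where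
  "H10 \<Omega> = \<lparr>
     carr = {u \<in> carr (H1 \<Omega>). \<exists>\<phi>. (\<forall>n::nat. \<phi> n \<in> test_funs \<Omega>) \<and> (\<lambda>n. nrm (H1 \<Omega>) (u - \<phi> n)) \<longlonglongrightarrow> 0},
     nrm = nrm (H1 \<Omega>)\<rparr>"

text \<open>The duality pairing of \<open>H\<^sup>-\<^sup>1\<close> and \<open>H\<^sub>0\<^sup>1\<close> extends the sesquilinear \<open>L\<^sup>2\<close> inner product, so the
  elements of the dual space are antilinear functionals (their values outside \<open>H\<^sub>0\<^sup>1\<close> are irrelevant).\<close>

definition Hm1 :: "'a::euclidean_space set \<Rightarrow> (('a \<Rightarrow> complex) \<Rightarrow> complex) fspace" where
  "Hm1 \<Omega> = \<lparr>
     carr = {F. (\<forall>\<phi>\<in>carr (H10 \<Omega>). \<forall>\<psi>\<in>carr (H10 \<Omega>). F (\<lambda>x. \<phi> x + \<psi> x) = F \<phi> + F \<psi>) \<and>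
                (\<forall>c. \<forall>\<phi>\<in>carr (H10 \<Omega>). F (\<lambda>x. c * \<phi> x) = cnj c * F \<phi>) \<and>
                (\<exists>C. \<forall>\<phi>\<in>carr (H10 \<Omega>). norm (F \<phi>) \<le> C * nrm (H10 \<Omega>) \<phi>)},
     nrm = (\<lambda>F. SUP \<phi>\<in>{\<phi> \<in> carr (H10 \<Omega>). nrm (H10 \<Omega>) \<phi> \<le> 1}. norm (F \<phi>))\<rparr>"

definition L2_pairing :: "'a::euclidean_space set \<Rightarrow> ('a \<Rightarrow> complex) \<Rightarrow> ('a \<Rightarrow> complex) \<Rightarrow> complex" where
  "L2_pairing \<Omega> u \<phi> = (\<integral>x. u x * cnj (\<phi> x) \<partial>lebesgue_on \<Omega>)"

definition inter_space :: "'f fspace \<Rightarrow> 'f fspace \<Rightarrow> 'f fspace" where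
  "inter_space X Y = \<lparr>carr = carr X \<inter> carr Y, nrm = (\<lambda>u. nrm X u + nrm Y u)\<rparr>"

text \<open>The value at \<open>p\<close> of the continuous representative on \<open>[a, b]\<close>.\<close>

definition has_cont_value :: "real \<Rightarrow> real \<Rightarrow> (real \<Rightarrow> complex) \<Rightarrow> real \<Rightarrow> complex \<Rightarrow> bool" where
  "has_cont_value a b h p c \<longleftrightarrow>
     (\<exists>w. continuous_on {a..b} w \<and> (AE x in lebesgue_on {a<..<b}. w x = h x) \<and> w p = c)"

subsection \<open>Bochner spaces on a time interval\<close>

abbreviation QT :: "real \<Rightarrow> (real \<times> real) set" where
  "QT T \<equiv> {0<..<T} \<times> {0<..<1}"

text \<open>Bochner measurability: almost everywhere limit, in the norm of \<open>X\<close>, of simple functions.\<close>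

definition strongly_measurable :: "real \<Rightarrow> 'f::minus fspace \<Rightarrow> (real \<Rightarrow> 'f) \<Rightarrow> bool" where
  "strongly_measurable T X U \<longleftrightarrow>
     (\<exists>s. (\<forall>n::nat. simple_function (lebesgue_on {0<..<T}) (s n) \<and> (\<forall>t\<in>{0<..<T}. s n t \<in> carr X)) \<and>
          (AE t in lebesgue_on {0<..<T}. (\<lambda>n. nrm X (s n t - U t)) \<longlonglongrightarrow> 0))"

text \<open>\<open>S\<close> is the scalar space \<open>L\<^sup>2\<close> or \<open>L\<^sup>\<infinity>\<close>.\<close>

definition bochner ::
  "(real set \<Rightarrow> (real \<Rightarrow> real) fspace) \<Rightarrow> real \<Rightarrow> 'f::minus fspace \<Rightarrow> (real \<Rightarrow> 'f) fspace" where
  "bochner S T X = \<lparr>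
     carr = {U. strongly_measurable T X U \<and> (AE t in lebesgue_on {0<..<T}. U t \<in> carr X) \<and>
                (\<lambda>t. nrm X (U t)) \<in> carr (S {0<..<T})},
     nrm = (\<lambda>U. nrm (S {0<..<T}) (\<lambda>t. nrm X (U t)))\<rparr>"

text \<open>If \<open>X\<close> is a space of functions on \<open>(0,1)\<close>, the elements of the Bochner space are
  identified with functions on \<open>QT T\<close>; a class always has a jointly measurable representative.\<close>

definition bochnerQ ::
  "(real set \<Rightarrow> (real \<Rightarrow> real) fspace) \<Rightarrow> real \<Rightarrow>
     (real \<Rightarrow> 'k::{real_normed_field, euclidean_space}) fspace \<Rightarrow> (real \<times> real \<Rightarrow> 'k) fspace" where
  "bochnerQ S T X = \<lparr>
     carr = {u. u \<in> borel_measurable (lebesgue_on (QT T)) \<and> curry u \<in> carr (bochner S T X)},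
     nrm = (\<lambda>u. nrm (bochner S T X) (curry u))\<rparr>"

text \<open>For \<open>u\<close> in \<open>L\<^sup>2(0,T;L\<^sup>2(0,1)) = L\<^sup>2(Q\<^sub>T)\<close> the \<open>L\<^sup>2(0,1)\<close>-valued weak derivative is the
  distributional derivative of \<open>u\<close> in the direction of \<open>t\<close>.\<close>

definition H1_L2 :: "real \<Rightarrow> (real \<times> real \<Rightarrow> complex) fspace" where
  "H1_L2 T = (let X = bochnerQ L2 T (L2 {0<..<1}) in \<lparr>
     carr = {u \<in> carr X. \<exists>v\<in>carr X. has_wderiv (QT T) (1, 0) u v},
     nrm = (\<lambda>u. sqrt ((nrm X u)\<^sup>2 + (nrm X (wderiv (QT T) (1, 0) u))\<^sup>2))\<rparr>)"

definition sol_space :: "real \<Rightarrow> (real \<times> real \<Rightarrow> complex) fspace" where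
  "sol_space T = inter_space (H1_L2 T) (bochnerQ L2 T (H2 {0<..<1}))"

text \<open>\<open>V = \<partial>\<^sub>t u\<close> in the sense of \<open>H\<^sup>-\<^sup>1(0,1)\<close>-valued distributions on \<open>(0,T)\<close>.\<close>

definition has_time_deriv ::
  "real \<Rightarrow> (real \<times> real \<Rightarrow> complex) \<Rightarrow> (real \<Rightarrow> (real \<Rightarrow> complex) \<Rightarrow> complex) \<Rightarrow> bool" where
  "has_time_deriv T u V \<longleftrightarrow>
     (\<forall>\<theta>\<in>test_funs {0<..<T}. \<forall>\<phi>\<in>carr (H10 {0<..<1}).
        (\<integral>t. partials [1] \<theta> t * L2_pairing {0<..<1} (curry u t) \<phi> \<partial>lebesgue_on {0<..<T}) =
        - (\<integral>t. \<theta> t * V t \<phi> \<partial>lebesgue_on {0<..<T}))"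

text \<open>\<open>u(0) = h\<close> in \<open>L\<^sup>2(0,1)\<close>, for the representative of \<open>u\<close> in \<open>C([0,T];L\<^sup>2(0,1))\<close>.\<close>

definition has_initial_value :: "real \<Rightarrow> (real \<times> real \<Rightarrow> complex) \<Rightarrow> (real \<Rightarrow> complex) \<Rightarrow> bool" where
  "has_initial_value T u h \<longleftrightarrow>
     (\<exists>w. (\<forall>t\<in>{0..T}. w t \<in> carr (L2 {0<..<1})) \<and>
          (\<forall>s\<in>{0..T}. ((\<lambda>t. nrm (L2 {0<..<1}) (w t - w s)) \<longlongrightarrow> 0) (at s within {0..T})) \<and>
          (AE t in lebesgue_on {0<..<T}. AE x in lebesgue_on {0<..<1}. w t x = u (t, x)) \<and>
          (AE x in lebesgue_on {0<..<1}. w 0 x = h x))"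

subsection \<open>Nets\<close>

definition regularisation ::
  "'a::euclidean_space set \<Rightarrow> ('a \<Rightarrow> 'k::{real_normed_field, euclidean_space}) fspace \<Rightarrow>
     (('a \<Rightarrow> 'k) \<Rightarrow> 'k) \<Rightarrow> (real \<Rightarrow> 'a \<Rightarrow> 'k) \<Rightarrow> bool" where
  "regularisation \<Omega> X v v\<^sub>\<epsilon> \<longleftrightarrow>
     (\<forall>\<epsilon>\<in>{0<..1}. v\<^sub>\<epsilon> \<epsilon> \<in> carr X) \<and>
     (\<forall>\<phi>\<in>test_funs \<Omega>. ((\<lambda>\<epsilon>. dist_of_fun \<Omega> (v\<^sub>\<epsilon> \<epsilon>) \<phi>) \<longlongrightarrow> v \<phi>) (at_right 0))"

definition moderate_net :: "'f fspace \<Rightarrow> (real \<Rightarrow> 'f) \<Rightarrow> bool" where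
  "moderate_net X v\<^sub>\<epsilon> \<longleftrightarrow>
     (\<forall>\<epsilon>\<in>{0<..1}. v\<^sub>\<epsilon> \<epsilon> \<in> carr X) \<and>
     (\<exists>C>0. \<exists>N::nat. \<forall>\<epsilon>\<in>{0<..1}. nrm X (v\<^sub>\<epsilon> \<epsilon>) \<le> C * \<epsilon> powr (- real N))"

definition negligible_net :: "'f fspace \<Rightarrow> (real \<Rightarrow> 'f) \<Rightarrow> bool" where
  "negligible_net X v\<^sub>\<epsilon> \<longleftrightarrow>
     (\<forall>\<epsilon>\<in>{0<..1}. v\<^sub>\<epsilon> \<epsilon> \<in> carr X) \<and>
     (\<forall>m::nat. \<exists>C>0. \<forall>\<epsilon>\<in>{0<..1}. nrm X (v\<^sub>\<epsilon> \<epsilon>) \<le> C * \<epsilon> ^ m)"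

subsection \<open>The initial boundary value problem\<close>

record reg_family =
  ra :: "real \<Rightarrow> real \<times> real \<Rightarrow> real"
  rb :: "real \<Rightarrow> real \<times> real \<Rightarrow> real"
  rq :: "real \<Rightarrow> real \<Rightarrow> real"
  rf :: "real \<Rightarrow> real \<times> real \<Rightarrow> complex"
  ru0 :: "real \<Rightarrow> real \<Rightarrow> complex"
  rg0 :: "real \<Rightarrow> real \<Rightarrow> complex"
  rg1 :: "real \<Rightarrow> real \<Rightarrow> complex"

text \<open>The distributional data; the coefficient of the leading term is \<open>\<alpha> + \<mu>\<close>.\<close>

record problem_data =
  p\<alpha> :: real
  p\<mu> :: "(real \<times> real) measure"
  pb :: "(real \<times> real \<Rightarrow> real) \<Rightarrow> real"
  pq :: "(real \<Rightarrow> real) \<Rightarrow> real"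
  pf :: "(real \<times> real \<Rightarrow> complex) \<Rightarrow> complex"
  pu0 :: "(real \<Rightarrow> complex) \<Rightarrow> complex"
  pg0 :: "(real \<Rightarrow> complex) \<Rightarrow> complex"
  pg1 :: "(real \<Rightarrow> complex) \<Rightarrow> complex"

definition pa :: "real \<Rightarrow> problem_data \<Rightarrow> (real \<times> real \<Rightarrow> real) \<Rightarrow> real" where
  "pa T P \<phi> = dist_of_fun (QT T) (\<lambda>_. p\<alpha> P) \<phi> + dist_of_measure (p\<mu> P) \<phi>"

definition admissible_data :: "real \<Rightarrow> problem_data \<Rightarrow> bool" where
  "admissible_data T P \<longleftrightarrow>
     p\<alpha> P > 0 \<and> radon_measure_on (QT T) (p\<mu> P) \<and> emeasure (p\<mu> P) (QT T) < \<infinity> \<and>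
     distribution (QT T) (pb P) \<and> distribution (QT T) (pf P) \<and>
     distribution {0<..<1} (pq P) \<and> distribution {0<..<1} (pu0 P) \<and>
     distribution {0<..<T} (pg0 P) \<and> distribution {0<..<T} (pg1 P)"

definition R1 :: "real \<Rightarrow> problem_data \<Rightarrow> reg_family \<Rightarrow> bool" where
  "R1 T P R \<longleftrightarrow>
     regularisation (QT T) (W1inf (QT T)) (pa T P) (ra R) \<and>
     moderate_net (W1inf (QT T)) (ra R) \<and>
     (\<forall>\<epsilon>\<in>{0<..1}. AE z in lebesgue_on (QT T). ra R \<epsilon> z \<ge> p\<alpha> P)"

definition R2 :: "real \<Rightarrow> problem_data \<Rightarrow> reg_family \<Rightarrow> bool" where
  "R2 T P R \<longleftrightarrow>
     regularisation (QT T) (bochnerQ Linf T (W1inf {0<..<1})) (pb P) (rb R) \<and>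
     moderate_net (bochnerQ Linf T (W1inf {0<..<1})) (rb R) \<and>
     (\<exists>C>0. \<forall>\<epsilon>\<in>{0<..1}. \<exists>b'. has_wderiv (QT T) (0, 1) (rb R \<epsilon>) b' \<and> b' \<in> carr (Linf (QT T)) \<and>
        nrm (Linf (QT T)) b' \<le> C * (1 + \<bar>ln \<epsilon>\<bar>))"

definition R3 :: "problem_data \<Rightarrow> reg_family \<Rightarrow> bool" where
  "R3 P R \<longleftrightarrow>
     regularisation {0<..<1} (Linf {0<..<1}) (pq P) (rq R) \<and>
     moderate_net (Linf {0<..<1}) (rq R) \<and>
     (\<exists>C>0. \<forall>\<epsilon>\<in>{0<..1}. nrm (Linf {0<..<1}) (\<lambda>x. max (- rq R \<epsilon> x) 0) \<le> C * (1 + \<bar>ln \<epsilon>\<bar>))"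

definition R4 :: "real \<Rightarrow> problem_data \<Rightarrow> reg_family \<Rightarrow> bool" where
  "R4 T P R \<longleftrightarrow>
     regularisation (QT T) (L2 (QT T)) (pf P) (rf R) \<and> moderate_net (L2 (QT T)) (rf R) \<and>
     regularisation {0<..<1} (H1 {0<..<1}) (pu0 P) (ru0 R) \<and> moderate_net (H1 {0<..<1}) (ru0 R) \<and>
     regularisation {0<..<T} (H1 {0<..<T}) (pg0 P) (rg0 R) \<and> moderate_net (H1 {0<..<T}) (rg0 R) \<and>
     regularisation {0<..<T} (H1 {0<..<T}) (pg1 P) (rg1 R) \<and> moderate_net (H1 {0<..<T}) (rg1 R)"

definition R5 :: "real \<Rightarrow> reg_family \<Rightarrow> bool" where
  "R5 T R \<longleftrightarrow> (\<forall>\<epsilon>\<in>{0<..1}.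
     (\<exists>c. has_cont_value 0 1 (ru0 R \<epsilon>) 0 c \<and> has_cont_value 0 T (rg0 R \<epsilon>) 0 c) \<and>
     (\<exists>c. has_cont_value 0 1 (ru0 R \<epsilon>) 1 c \<and> has_cont_value 0 T (rg1 R \<epsilon>) 0 c))"

definition regularising_family :: "real \<Rightarrow> problem_data \<Rightarrow> reg_family \<Rightarrow> bool" where
  "regularising_family T P R \<longleftrightarrow> R1 T P R \<and> R2 T P R \<and> R3 P R \<and> R4 T P R \<and> R5 T R"

definition weak_solution ::
  "real \<Rightarrow> (real \<times> real \<Rightarrow> real) \<Rightarrow> (real \<times> real \<Rightarrow> real) \<Rightarrow> (real \<Rightarrow> real) \<Rightarrow> (real \<times> real \<Rightarrow> complex) \<Rightarrow>
     (real \<Rightarrow> complex) \<Rightarrow> (real \<Rightarrow> complex) \<Rightarrow> (real \<Rightarrow> complex) \<Rightarrow> (real \<times> real \<Rightarrow> complex) \<Rightarrow> bool" where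
  "weak_solution T a b q f u0 g0 g1 u \<longleftrightarrow>
     u \<in> carr (bochnerQ L2 T (H1 {0<..<1})) \<and>
     (\<lambda>(t, x). u (t, x) - ((1 - of_real x) * g0 t + of_real x * g1 t))
        \<in> carr (bochnerQ L2 T (H10 {0<..<1})) \<and>
     has_initial_value T u u0 \<and>
     (\<exists>u\<^sub>t \<in> carr (bochner L2 T (Hm1 {0<..<1})). has_time_deriv T u u\<^sub>t \<and>
        (\<forall>\<phi>\<in>carr (H10 {0<..<1}). AE t in lebesgue_on {0<..<T}.
           u\<^sub>t t \<phi>
           + (\<integral>x. of_real (a (t, x)) * wderiv {0<..<1} 1 (curry u t) x * cnj (wderiv {0<..<1} 1 \<phi> x)
                \<partial>lebesgue_on {0<..<1})
           + (\<integral>x. of_real (b (t, x)) * wderiv {0<..<1} 1 (curry u t) x * cnj (\<phi> x) \<partial>lebesgue_on {0<..<1})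
           + (\<integral>x. of_real (q x) * u (t, x) * cnj (\<phi> x) \<partial>lebesgue_on {0<..<1})
           = (\<integral>x. f (t, x) * cnj (\<phi> x) \<partial>lebesgue_on {0<..<1})))"

definition unique_weak_solution ::
  "real \<Rightarrow> (real \<times> real \<Rightarrow> real) \<Rightarrow> (real \<times> real \<Rightarrow> real) \<Rightarrow> (real \<Rightarrow> real) \<Rightarrow> (real \<times> real \<Rightarrow> complex) \<Rightarrow>
     (real \<Rightarrow> complex) \<Rightarrow> (real \<Rightarrow> complex) \<Rightarrow> (real \<Rightarrow> complex) \<Rightarrow> (real \<times> real \<Rightarrow> complex) \<Rightarrow> bool" where
  "unique_weak_solution T a b q f u0 g0 g1 u \<longleftrightarrow>
     weak_solution T a b q f u0 g0 g1 u \<and>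
     (\<forall>v. weak_solution T a b q f u0 g0 g1 v \<longrightarrow> (AE z in lebesgue_on (QT T). v z = u z))"

definition very_weak_solution ::
  "real \<Rightarrow> problem_data \<Rightarrow> reg_family \<Rightarrow> (real \<Rightarrow> real \<times> real \<Rightarrow> complex) \<Rightarrow> bool" where
  "very_weak_solution T P R u \<longleftrightarrow>
     regularising_family T P R \<and>
     (\<forall>\<epsilon>\<in>{0<..1}. unique_weak_solution T (ra R \<epsilon>) (rb R \<epsilon>) (rq R \<epsilon>) (rf R \<epsilon>)
        (ru0 R \<epsilon>) (rg0 R \<epsilon>) (rg1 R \<epsilon>) (u \<epsilon>)) \<and>
     moderate_net (sol_space T) u"

end

theory Submission
  imports Defs
begin

text \<open>Put \<open>w = u\<^sub>\<epsilon> - u'\<^sub>\<epsilon>\<close> and let \<open>\<psi>\<close> be the interpolation in \<open>x\<close> of the differences of the boundary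
  data. By \<open>H\<^sup>2\<close>-regularity both equations hold almost everywhere, so \<open>V = w - \<psi>\<close> solves the equation
  of \<open>u\<^sub>\<epsilon>\<close> with homogeneous boundary values and a right-hand side that is a sum of products of
  negligible differences with moderate quantities. Testing with \<open>V\<close> and \<open>V\<^sub>x\<^sub>x\<close> gives energy estimates.
  Their constants are polynomial in the norms of the coefficients and in \<open>1 / \<alpha>\<close>, except for a
  Gronwall factor that is exponential only in the bounds on \<open>\<partial>\<^sub>x b\<^sub>\<epsilon>\<close> and on the negative part of \<open>q\<^sub>\<epsilon>\<close>. As these
  grow logarithmically, the factor is a power of \<open>1 / \<epsilon>\<close>, and moderate times negligible is negligible.\<close>

text \<open>For V with V_t in L^2 and V in L^2(H^2) a chain rule for ||V_x||^2 in time is not at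
  hand. The second estimate therefore pairs V_xx with backward difference quotients of V: convexity
  bounds the pairing by a difference of values of ||V_x||^2 / 2 that telescopes after integration,
  and the quotients are Steklov averages of V_t, which converge to V_t in L^2. To reach back before
  time 0, V is extended by its initial value; this stays in H^1_0 because the data are compatible at
  the corners.

  Space is one-dimensional, so slices have absolutely continuous representatives, and integration by
  parts and boundary values can be taken literally on them. The weak formulation holds for almost
  every t with a null set that depends on the test function; countable families of test functions
  remove this dependence.

  The Gronwall exponent stays logarithmic because b V_x is tested with V through the derivative of
  |V|^2 / 2, which costs b_x alone, while only the negative part of q can act against the energy.
  All bounds are homogeneous in the data, hence the difference is at most one moderate factor times
  one negligible number.\<close>

abbreviation leb :: "'a::euclidean_space set \<Rightarrow> 'a measure" where
  "leb S \<equiv> lebesgue_on S"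

section \<open>Lebesgue measure on product sets\<close>

lemma AE_lebesgue_on_iff:
  assumes "S \<in> sets borel"
  shows "(AE x in leb S. P x) \<longleftrightarrow> (AE x in lborel. x \<in> S \<longrightarrow> P x)"
  using assms by (simp add: AE_restrict_space_iff AE_completion_iff)

text \<open>A Borel representative is the bridge from the completed measure in \<open>leb\<close> to
  product statements about \<open>lborel\<close>. It is found coordinate by coordinate, and the
  finitely many exceptional null sets are united.\<close>

lemma borel_representative:
  fixes f :: "'a::euclidean_space \<Rightarrow> 'b::euclidean_space"
  assumes S: "S \<in> sets borel" and f: "f \<in> borel_measurable (leb S)"
  obtains g where "g \<in> borel_measurable borel" "AE x in leb S. f x = g x"
proof -
  define h where "h = (\<lambda>x. if x \<in> S then f x else 0)"
  have h: "h \<in> borel_measurable lebesgue"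
    unfolding h_def using f S by (subst borel_measurable_if) auto
  have "\<exists>g. g \<in> borel_measurable borel \<and> (AE x in lborel. h x \<bullet> b = g x)" for b
    using completion_ex_borel_measurable_real[of "\<lambda>x. h x \<bullet> b" lborel] h by auto
  then obtain g where g: "\<And>b. g b \<in> borel_measurable borel" "\<And>b. AE x in lborel. h x \<bullet> b = g b x"
    by metis
  show thesis
  proof
    show "(\<lambda>x. \<Sum>b\<in>Basis. g b x *\<^sub>R b) \<in> borel_measurable borel"
      using g(1) by measurable
    have "AE x in lborel. \<forall>b\<in>Basis. h x \<bullet> b = g b x"
      using g(2) by (simp add: AE_finite_all)
    then show "AE x in leb S. f x = (\<Sum>b\<in>Basis. g b x *\<^sub>R b)"
      unfolding AE_lebesgue_on_iff[OF S]
    proof eventually_elim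
      case (elim x)
      then have "h x = (\<Sum>b\<in>Basis. g b x *\<^sub>R b)"
        by (metis (mono_tags, lifting) euclidean_representation sum.cong)
      then show ?case unfolding h_def by metis
    qed
  qed
qed

text \<open>Completeness of Lebesgue measure: a change on a null set keeps measurability.\<close>

lemma borel_measurable_lebesgue_on_AE:
  fixes f g :: "'a::euclidean_space \<Rightarrow> 'b::euclidean_space"
  assumes S: "S \<in> sets borel" and f: "f \<in> borel_measurable (leb S)"
    and ae: "AE x in leb S. f x = g x"
  shows "g \<in> borel_measurable (leb S)"
proof -
  have "(\<lambda>x. if x \<in> S then f x else 0) \<in> borel_measurable lebesgue"
    using f S by (subst borel_measurable_if) auto
  moreover have "AE x in lebesgue. (if x \<in> S then f x else 0) = (if x \<in> S then g x else 0)"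
    using ae S by (auto simp: AE_restrict_space_iff elim!: eventually_mono)
  ultimately have "(\<lambda>x. if x \<in> S then g x else 0) \<in> borel_measurable lebesgue"
    by (rule borel_measurable_AE)
  then show ?thesis
    using S by (subst (asm) borel_measurable_if) auto
qed

lemma borel_measurable_lebesgue_onI:
  "f \<in> borel_measurable borel \<Longrightarrow> f \<in> borel_measurable (leb S)"
  by (intro measurable_restrict_space1 measurable_completion) simp

lemma lebesgue_on_borel:
  fixes g :: "'a::euclidean_space \<Rightarrow> 'b::euclidean_space"
  assumes S: "S \<in> sets borel" and g: "g \<in> borel_measurable borel"
  shows integrable_lebesgue_on_borel:
      "integrable (leb S) g \<longleftrightarrow> integrable lborel (\<lambda>x. indicator S x *\<^sub>R g x)"
    and integral_lebesgue_on_borel: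
      "integral\<^sup>L (leb S) g = (\<integral>x. indicator S x *\<^sub>R g x \<partial>lborel)"
proof -
  have m: "(\<lambda>x. indicator S x *\<^sub>R g x) \<in> borel_measurable lborel" using S g by measurable
  show "integrable (leb S) g \<longleftrightarrow> integrable lborel (\<lambda>x. indicator S x *\<^sub>R g x)"
    using S m by (simp add: integrable_restrict_space integrable_completion)
  show "integral\<^sup>L (leb S) g = (\<integral>x. indicator S x *\<^sub>R g x \<partial>lborel)"
    using S m by (simp add: integral_restrict_space integral_completion)
qed

lemma nn_integral_lebesgue_on_borel:
  assumes "S \<in> sets borel" "g \<in> borel_measurable borel"
  shows "(\<integral>\<^sup>+x. g x \<partial>leb S) = (\<integral>\<^sup>+x. g x * indicator S x \<partial>lborel)"
  using assms by (simp add: nn_integral_restrict_space nn_integral_completion)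

lemma AE_lebesgue_on_slice:
  assumes A: "A \<in> sets borel" and B: "B \<in> sets borel"
    and ae: "AE z in leb (A \<times> B). P z"
  shows "AE t in leb A. AE x in leb B. P (t, x)"
proof -
  have "AE z in lborel \<Otimes>\<^sub>M lborel. z \<in> A \<times> B \<longrightarrow> P z"
    unfolding lborel_prod using ae A B by (simp add: AE_lebesgue_on_iff borel_Times)
  then have "AE t in lborel. AE x in lborel. (t, x) \<in> A \<times> B \<longrightarrow> P (t, x)"
    by (rule lborel_pair.AE_pair)
  then have "AE t in lborel. t \<in> A \<longrightarrow> (AE x in lborel. x \<in> B \<longrightarrow> P (t, x))"
    by (rule eventually_mono) (auto elim: eventually_mono)
  then show ?thesis by (simp add: AE_lebesgue_on_iff A B)
qed

lemma AE_lebesgue_on_swap: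
  assumes A: "A \<in> sets borel" and B: "B \<in> sets borel"
    and ae: "AE z in leb (A \<times> B). P z"
  shows "AE z in leb (B \<times> A). P (snd z, fst z)"
proof -
  have "AE z in lborel \<Otimes>\<^sub>M lborel. z \<in> A \<times> B \<longrightarrow> P z"
    unfolding lborel_prod using ae A B by (simp add: AE_lebesgue_on_iff borel_Times)
  \<comment> \<open>\<open>P\<close> need not describe a measurable set, so it is traded for the
    complement of a measurable null set before the measure is pushed forward under the exchange of
    coordinates.\<close>
  then obtain N where N: "N \<in> null_sets (lborel \<Otimes>\<^sub>M lborel)" "\<And>z. z \<notin> N \<Longrightarrow> z \<in> A \<times> B \<longrightarrow> P z"
    by (erule_tac AE_E3) (auto simp: space_pair_measure)
  have "AE z in distr (lborel \<Otimes>\<^sub>M lborel) (lborel \<Otimes>\<^sub>M lborel) (\<lambda>(x, y). (y, x)). z \<notin> N"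
    using N(1) AE_not_in lborel_pair.distr_pair_swap by metis
  then have "AE z in lborel \<Otimes>\<^sub>M lborel. (snd z, fst z) \<notin> N"
  proof (subst (asm) AE_distr_iff)
    have "space (lborel \<Otimes>\<^sub>M lborel) - N \<in> sets (lborel \<Otimes>\<^sub>M lborel)"
      by (intro sets.compl_sets null_setsD2 N(1))
    then show "{x \<in> space (lborel \<Otimes>\<^sub>M lborel). x \<notin> N} \<in> sets (lborel \<Otimes>\<^sub>M lborel)"
      by (simp only: set_diff_eq)
  qed (auto simp: case_prod_beta')
  then have "AE z in lborel \<Otimes>\<^sub>M lborel. z \<in> B \<times> A \<longrightarrow> P (snd z, fst z)"
    by (rule eventually_mono) (use N(2) in auto)
  then show ?thesis unfolding lborel_prod using A B by (simp add: AE_lebesgue_on_iff borel_Times)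
qed

lemma AE_lebesgue_on_slice':
  assumes A: "A \<in> sets borel" and B: "B \<in> sets borel"
    and ae: "AE z in leb (A \<times> B). P z"
  shows "AE x in leb B. AE t in leb A. P (t, x)"
  using AE_lebesgue_on_slice[OF B A AE_lebesgue_on_swap[OF A B ae]] by simp

lemma measurable_lebesgue_on_slice:
  fixes f :: "'a::euclidean_space \<times> 'b::euclidean_space \<Rightarrow> 'k::euclidean_space"
  assumes A: "A \<in> sets borel" and B: "B \<in> sets borel"
    and f: "f \<in> borel_measurable (leb (A \<times> B))"
  shows "AE t in leb A. (\<lambda>x. f (t, x)) \<in> borel_measurable (leb B)"
proof -
  have AB: "A \<times> B \<in> sets borel" using A B by (rule borel_Times)
  obtain g where g[measurable]: "g \<in> borel_measurable borel" and "AE z in leb (A \<times> B). f z = g z"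
    using borel_representative[OF AB f] by blast
  from AE_lebesgue_on_slice[OF A B this(2)] show ?thesis
  proof eventually_elim
    case (elim t)
    have "(\<lambda>x. g (t, x)) \<in> borel_measurable (leb B)"
      by (rule borel_measurable_lebesgue_onI) measurable
    then show ?case
      by (rule borel_measurable_lebesgue_on_AE[OF B]) (use elim in \<open>auto elim: eventually_mono\<close>)
  qed
qed

text \<open>Fubini is applied to a Borel representative \<open>g\<close> of \<open>f\<close>.
  Slicing the exceptional null set shows that for almost every \<open>t\<close> the slices of
  \<open>f\<close> and \<open>g\<close> agree almost everywhere, so that integrability and integrals
  pass back from \<open>g\<close> to \<open>f\<close>, which is measurable only for the completed
  measure.\<close>

lemma Fubini_lebesgue_on:
  fixes f :: "'a::euclidean_space \<times> 'b::euclidean_space \<Rightarrow> 'k::euclidean_space"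
  assumes A[measurable]: "A \<in> sets borel" and B[measurable]: "B \<in> sets borel"
    and f: "integrable (leb (A \<times> B)) f"
  shows AE_integrable_lebesgue_on_slice: "AE t in leb A. integrable (leb B) (\<lambda>x. f (t, x))" (is ?AE)
    and integrable_integral_lebesgue_on_slice:
      "integrable (leb A) (\<lambda>t. \<integral>x. f (t, x) \<partial>leb B)" (is ?int)
    and integral_lebesgue_on_slice:
      "(\<integral>t. \<integral>x. f (t, x) \<partial>leb B \<partial>leb A) = (\<integral>z. f z \<partial>leb (A \<times> B))" (is ?eq)
proof -
  have AB[measurable]: "A \<times> B \<in> sets borel" using A B by (rule borel_Times)
  obtain g where g[measurable]: "g \<in> borel_measurable borel" and ae: "AE z in leb (A \<times> B). f z = g z"
    using borel_representative[OF AB borel_measurable_integrable[OF f]] by blast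
  have gt: "(\<lambda>x. g (t, x)) \<in> borel_measurable borel" for t by measurable
  have gi: "integrable (leb (A \<times> B)) g"
    by (rule integrable_cong_AE_imp[OF f borel_measurable_lebesgue_onI[OF g]]) (use ae in \<open>auto elim: eventually_mono\<close>)
  define G where "G z = indicator (A \<times> B) z *\<^sub>R g z" for z
  have G: "integrable (lborel \<Otimes>\<^sub>M lborel) G"
    using gi unfolding G_def lborel_prod by (simp add: integrable_lebesgue_on_borel)
  have Gt: "G (t, x) = indicator A t *\<^sub>R (indicator B x *\<^sub>R g (t, x))" for t x
    by (auto simp: G_def indicator_def)
  have ae1: "AE t in leb A. AE x in leb B. f (t, x) = g (t, x)"
    by (rule AE_lebesgue_on_slice[OF A B ae])
  have "AE t in lborel. integrable lborel (\<lambda>x. G (t, x))"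
    by (rule lborel_pair.AE_integrable_fst'[OF G])
  then have "AE t in leb A. integrable lborel (\<lambda>x. indicator B x *\<^sub>R g (t, x))"
    unfolding AE_lebesgue_on_iff[OF A] by eventually_elim (auto simp: Gt)
  then have aeg: "AE t in leb A. integrable (leb B) (\<lambda>x. g (t, x))"
    by eventually_elim (simp add: integrable_lebesgue_on_borel[OF B gt])
  show ?AE
    using aeg ae1
  proof eventually_elim
    case (elim t)
    have "(\<lambda>x. f (t, x)) \<in> borel_measurable (leb B)"
      by (rule borel_measurable_lebesgue_on_AE[OF B borel_measurable_lebesgue_onI[OF gt]])
        (use elim in \<open>auto elim: eventually_mono\<close>)
    then show ?case
      using integrable_cong_AE[of "\<lambda>x. f (t, x)" "leb B" "\<lambda>x. g (t, x)"] elim gt borel_measurable_lebesgue_onI by blast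
  qed
  have int_eq: "AE t in leb A. (\<integral>x. g (t, x) \<partial>leb B) = (\<integral>x. f (t, x) \<partial>leb B)"
    using ae1
  proof eventually_elim
    case (elim t)
    have "(\<lambda>x. f (t, x)) \<in> borel_measurable (leb B)"
      by (rule borel_measurable_lebesgue_on_AE[OF B borel_measurable_lebesgue_onI[OF gt]])
        (use elim in \<open>auto elim: eventually_mono\<close>)
    then show ?case
      by (intro integral_cong_AE borel_measurable_lebesgue_onI[OF gt]) (use elim in \<open>auto elim: eventually_mono\<close>)
  qed
  have gB: "(\<integral>x. g (t, x) \<partial>leb B) = (\<integral>x. indicator B x *\<^sub>R g (t, x) \<partial>lborel)" for t
    by (rule integral_lebesgue_on_borel[OF B gt])
  have mg: "(\<lambda>t. \<integral>x. g (t, x) \<partial>leb B) \<in> borel_measurable borel"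
    unfolding gB by measurable
  have GB: "(\<integral>x. G (t, x) \<partial>lborel) = indicator A t *\<^sub>R (\<integral>x. g (t, x) \<partial>leb B)" for t
    by (cases "t \<in> A") (simp_all add: Gt gB)
  have ig: "integrable (leb A) (\<lambda>t. \<integral>x. g (t, x) \<partial>leb B)"
    using lborel_pair.integrable_fst'[OF G] by (simp add: GB integrable_lebesgue_on_borel[OF A mg])
  have mf: "(\<lambda>t. \<integral>x. f (t, x) \<partial>leb B) \<in> borel_measurable (leb A)"
    by (rule borel_measurable_lebesgue_on_AE[OF A borel_measurable_lebesgue_onI[OF mg] int_eq])
  show ?int
    using integrable_cong_AE[OF borel_measurable_lebesgue_onI[OF mg] mf int_eq] ig by blast
  have "(\<integral>t. \<integral>x. f (t, x) \<partial>leb B \<partial>leb A) = (\<integral>t. \<integral>x. g (t, x) \<partial>leb B \<partial>leb A)"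
    by (rule integral_cong_AE[OF mf borel_measurable_lebesgue_onI[OF mg]])
      (use int_eq in \<open>auto elim: eventually_mono\<close>)
  also have "\<dots> = (\<integral>t. \<integral>x. G (t, x) \<partial>lborel \<partial>lborel)"
    by (simp add: GB integral_lebesgue_on_borel[OF A mg])
  also have "\<dots> = integral\<^sup>L (lborel \<Otimes>\<^sub>M lborel) G"
    by (rule lborel_pair.integral_fst'[OF G])
  also have "\<dots> = (\<integral>z. g z \<partial>leb (A \<times> B))"
    by (simp add: G_def[abs_def] lborel_prod integral_lebesgue_on_borel)
  also have "\<dots> = (\<integral>z. f z \<partial>leb (A \<times> B))"
    by (rule integral_cong_AE[OF borel_measurable_lebesgue_onI[OF g] borel_measurable_integrable[OF f]])
      (use ae in \<open>auto elim: eventually_mono\<close>)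
  finally show ?eq .
qed

text \<open>The nonnegative integral of the norm of a Borel representative may be computed
  iteratively without any finiteness; \<open>i\<close> and \<open>ii\<close> then identify the
  iterated integral as a finite number.\<close>

lemma Tonelli_lebesgue_on:
  fixes f :: "'a::euclidean_space \<times> 'b::euclidean_space \<Rightarrow> 'k::euclidean_space"
  assumes A[measurable]: "A \<in> sets borel" and B[measurable]: "B \<in> sets borel"
    and f: "f \<in> borel_measurable (leb (A \<times> B))"
    and i: "AE t in leb A. integrable (leb B) (\<lambda>x. f (t, x))"
    and ii: "integrable (leb A) (\<lambda>t. \<integral>x. norm (f (t, x)) \<partial>leb B)"
  shows "integrable (leb (A \<times> B)) f"
proof -
  have AB[measurable]: "A \<times> B \<in> sets borel" using A B by (rule borel_Times)
  obtain g where g[measurable]: "g \<in> borel_measurable borel" and ae: "AE z in leb (A \<times> B). f z = g z"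
    using borel_representative[OF AB f] by blast
  have gt: "(\<lambda>x. g (t, x)) \<in> borel_measurable borel" for t by measurable
  have "(\<integral>\<^sup>+z. norm (f z) \<partial>leb (A \<times> B)) = (\<integral>\<^sup>+z. norm (g z) \<partial>leb (A \<times> B))"
    by (rule nn_integral_cong_AE) (use ae in \<open>auto elim: eventually_mono\<close>)
  also have "\<dots> = (\<integral>\<^sup>+z. ennreal (norm (g z)) * indicator (A \<times> B) z \<partial>(lborel \<Otimes>\<^sub>M lborel))"
    unfolding lborel_prod by (rule nn_integral_lebesgue_on_borel) measurable
  also have "\<dots> = (\<integral>\<^sup>+t. \<integral>\<^sup>+x. ennreal (norm (g (t, x))) * indicator (A \<times> B) (t, x) \<partial>lborel \<partial>lborel)"
    by (rule lborel.nn_integral_fst[symmetric]) (unfold lborel_prod, measurable)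
  also have "\<dots> = (\<integral>\<^sup>+t. (\<integral>\<^sup>+x. ennreal (norm (g (t, x))) * indicator B x \<partial>lborel) * indicator A t \<partial>lborel)"
    by (rule nn_integral_cong) (auto simp: indicator_def)
  also have "\<dots> = (\<integral>\<^sup>+t. \<integral>\<^sup>+x. ennreal (norm (g (t, x))) * indicator B x \<partial>lborel \<partial>leb A)"
    by (rule nn_integral_lebesgue_on_borel[symmetric]) auto
  also have "\<dots> = (\<integral>\<^sup>+t. ennreal (\<integral>x. norm (f (t, x)) \<partial>leb B) \<partial>leb A)"
  proof (rule nn_integral_cong_AE)
    show "AE t in leb A. (\<integral>\<^sup>+x. ennreal (norm (g (t, x))) * indicator B x \<partial>lborel) =
             ennreal (\<integral>x. norm (f (t, x)) \<partial>leb B)"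
      using i AE_lebesgue_on_slice[OF A B ae]
    proof eventually_elim
      case (elim t)
      have "(\<integral>\<^sup>+x. ennreal (norm (g (t, x))) * indicator B x \<partial>lborel) = (\<integral>\<^sup>+x. ennreal (norm (g (t, x))) \<partial>leb B)"
        by (rule nn_integral_lebesgue_on_borel[symmetric]) auto
      also have "\<dots> = (\<integral>\<^sup>+x. ennreal (norm (f (t, x))) \<partial>leb B)"
        by (rule nn_integral_cong_AE) (use elim in \<open>auto elim: eventually_mono\<close>)
      also have "\<dots> = ennreal (\<integral>x. norm (f (t, x)) \<partial>leb B)"
        using elim by (intro nn_integral_eq_integral) auto
      finally show ?case .
    qed
  qed
  also have "\<dots> = ennreal (\<integral>t. \<integral>x. norm (f (t, x)) \<partial>leb B \<partial>leb A)"
    using ii by (intro nn_integral_eq_integral) auto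
  finally show ?thesis
    using f by (simp add: integrable_iff_bounded)
qed

lemma measurable_lebesgue_on_swap:
  fixes f :: "'a::euclidean_space \<times> 'b::euclidean_space \<Rightarrow> 'k::euclidean_space"
  assumes A[measurable]: "A \<in> sets borel" and B[measurable]: "B \<in> sets borel"
    and f: "f \<in> borel_measurable (leb (A \<times> B))"
  shows "(\<lambda>z. f (snd z, fst z)) \<in> borel_measurable (leb (B \<times> A))"
proof -
  have AB[measurable]: "A \<times> B \<in> sets borel" "B \<times> A \<in> sets borel" using A B by (auto intro: borel_Times)
  obtain g where g[measurable]: "g \<in> borel_measurable borel" and ae: "AE z in leb (A \<times> B). f z = g z"
    using borel_representative[OF AB(1) f] by blast
  have "(\<lambda>z::'b\<times>'a. g (snd z, fst z)) \<in> borel_measurable borel"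
    unfolding borel_prod[symmetric] by measurable
  then show ?thesis
    by (intro borel_measurable_lebesgue_on_AE[OF AB(2) borel_measurable_lebesgue_onI])
      (use AE_lebesgue_on_swap[OF A B ae] in \<open>auto elim: eventually_mono\<close>)
qed

lemma lebesgue_on_swap:
  fixes f :: "'a::euclidean_space \<times> 'b::euclidean_space \<Rightarrow> 'k::euclidean_space"
  assumes A[measurable]: "A \<in> sets borel" and B[measurable]: "B \<in> sets borel"
    and f: "integrable (leb (A \<times> B)) f"
  shows integrable_lebesgue_on_swap: "integrable (leb (B \<times> A)) (\<lambda>z. f (snd z, fst z))"
    and integral_lebesgue_on_swap: "(\<integral>z. f (snd z, fst z) \<partial>leb (B \<times> A)) = (\<integral>z. f z \<partial>leb (A \<times> B))"
proof -
  have AB[measurable]: "A \<times> B \<in> sets borel" "B \<times> A \<in> sets borel" using A B by (auto intro: borel_Times)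
  obtain g where g[measurable]: "g \<in> borel_measurable borel" and ae: "AE z in leb (A \<times> B). f z = g z"
    using borel_representative[OF AB(1) borel_measurable_integrable[OF f]] by blast
  have gs[measurable]: "(\<lambda>z::'b\<times>'a. g (snd z, fst z)) \<in> borel_measurable borel"
    unfolding borel_prod[symmetric] by measurable
  have fs: "(\<lambda>z. f (snd z, fst z)) \<in> borel_measurable (leb (B \<times> A))"
    by (rule measurable_lebesgue_on_swap) (use f in auto)
  note aes = AE_lebesgue_on_swap[OF A B ae]
  have gi: "integrable (leb (A \<times> B)) g"
    by (rule integrable_cong_AE_imp[OF f borel_measurable_lebesgue_onI[OF g]]) (use ae in \<open>auto elim: eventually_mono\<close>)
  define G where "G z = indicator (A \<times> B) z *\<^sub>R g z" for z
  have G: "integrable (lborel \<Otimes>\<^sub>M lborel) G"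
    using gi unfolding G_def lborel_prod by (simp add: integrable_lebesgue_on_borel)
  have sw: "(\<lambda>z. indicator (B \<times> A) z *\<^sub>R g (snd z, fst z)) = (\<lambda>(x, y). G (y, x))"
    by (auto simp: G_def indicator_def)
  have "integrable (lborel \<Otimes>\<^sub>M lborel) (\<lambda>(x, y). G (y, x))"
    by (rule lborel_pair.integrable_product_swap[OF G])
  then have "integrable (leb (B \<times> A)) (\<lambda>z. g (snd z, fst z))"
    by (simp add: integrable_lebesgue_on_borel sw lborel_prod)
  then show "integrable (leb (B \<times> A)) (\<lambda>z. f (snd z, fst z))"
    by (subst integrable_cong_AE[OF fs borel_measurable_lebesgue_onI[OF gs] aes])
  have "(\<integral>z. f (snd z, fst z) \<partial>leb (B \<times> A)) = (\<integral>z. g (snd z, fst z) \<partial>leb (B \<times> A))"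
    by (rule integral_cong_AE[OF fs borel_measurable_lebesgue_onI[OF gs] aes])
  also have "\<dots> = (\<integral>z. (\<lambda>(x, y). G (y, x)) z \<partial>(lborel \<Otimes>\<^sub>M lborel))"
    by (simp add: integral_lebesgue_on_borel sw lborel_prod)
  also have "\<dots> = integral\<^sup>L (lborel \<Otimes>\<^sub>M lborel) G"
    by (rule lborel_pair.integral_product_swap) (use G in auto)
  also have "\<dots> = (\<integral>z. g z \<partial>leb (A \<times> B))"
    by (simp add: G_def[abs_def] lborel_prod integral_lebesgue_on_borel)
  also have "\<dots> = (\<integral>z. f z \<partial>leb (A \<times> B))"
    by (rule integral_cong_AE[OF borel_measurable_lebesgue_onI[OF g] borel_measurable_integrable[OF f]])
      (use ae in \<open>auto elim: eventually_mono\<close>)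
  finally show "(\<integral>z. f (snd z, fst z) \<partial>leb (B \<times> A)) = (\<integral>z. f z \<partial>leb (A \<times> B))" .
qed

section \<open>Bump functions\<close>

text \<open>Differentiability \<open>n\<close> times is encoded through some derivative function at
  each stage, so that closure under sums, products and affine substitution is an induction on
  \<open>n\<close> in which no higher derivative has to be named.\<close>

primrec times_diff :: "nat \<Rightarrow> (real \<Rightarrow> real) \<Rightarrow> bool" where
  "times_diff 0 f \<longleftrightarrow> True"
| "times_diff (Suc n) f \<longleftrightarrow> (\<exists>f'. (\<forall>x. (f has_real_derivative f' x) (at x)) \<and> times_diff n f')"

definition smooth_real :: "(real \<Rightarrow> real) \<Rightarrow> bool" where
  "smooth_real f \<longleftrightarrow> (\<forall>n. times_diff n f)"

lemma times_diff_SucD: "times_diff (Suc n) f \<Longrightarrow> times_diff n f"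
  by (induction n arbitrary: f) auto

lemma times_diff_const: "times_diff n (\<lambda>x. c)"
  by (induction n arbitrary: c) (auto intro!: exI[of _ "\<lambda>x. 0"])

lemma times_diff_add: "times_diff n f \<Longrightarrow> times_diff n g \<Longrightarrow> times_diff n (\<lambda>x. f x + g x)"
proof (induction n arbitrary: f g)
  case (Suc n)
  then obtain f' g' where "\<forall>x. (f has_real_derivative f' x) (at x)" "times_diff n f'"
    "\<forall>x. (g has_real_derivative g' x) (at x)" "times_diff n g'" by auto
  then show ?case
    using Suc.IH by (auto intro!: exI[of _ "\<lambda>x. f' x + g' x"] DERIV_add)
qed auto

lemma times_diff_mult: "times_diff n f \<Longrightarrow> times_diff n g \<Longrightarrow> times_diff n (\<lambda>x. f x * g x)"
proof (induction n arbitrary: f g)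
  case (Suc n)
  then obtain f' g' where *: "\<forall>x. (f has_real_derivative f' x) (at x)" "times_diff n f'"
    "\<forall>x. (g has_real_derivative g' x) (at x)" "times_diff n g'" by auto
  moreover have "times_diff n (\<lambda>x. f' x * g x + g' x * f x)"
    by (intro times_diff_add Suc.IH * times_diff_SucD[OF Suc.prems(1)] times_diff_SucD[OF Suc.prems(2)])
  ultimately show ?case
    by (auto intro!: exI[of _ "\<lambda>x. f' x * g x + g' x * f x"] DERIV_mult)
qed auto

lemma times_diff_affine: "times_diff n f \<Longrightarrow> times_diff n (\<lambda>x. f (c * x + d))"
proof (induction n arbitrary: f)
  case (Suc n)
  then obtain f' where *: "\<forall>x. (f has_real_derivative f' x) (at x)" "times_diff n f'" by auto
  have "((\<lambda>x. f (c * x + d)) has_real_derivative f' (c * x + d) * c) (at x)" for x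
    by (rule DERIV_chain2[OF *(1)[rule_format]]) (auto intro!: derivative_eq_intros)
  moreover have "times_diff n (\<lambda>x. f' (c * x + d) * c)"
    by (intro times_diff_mult times_diff_const Suc.IH *)
  ultimately show ?case by (auto intro!: exI[of _ "\<lambda>x. f' (c * x + d) * c"])
qed auto

lemma smooth_real_const [simp]: "smooth_real (\<lambda>x. c)"
  by (simp add: smooth_real_def times_diff_const)

lemma smooth_real_add: "smooth_real f \<Longrightarrow> smooth_real g \<Longrightarrow> smooth_real (\<lambda>x. f x + g x)"
  by (simp add: smooth_real_def times_diff_add)

lemma smooth_real_mult: "smooth_real f \<Longrightarrow> smooth_real g \<Longrightarrow> smooth_real (\<lambda>x. f x * g x)"
  by (simp add: smooth_real_def times_diff_mult)

lemma smooth_real_affine: "smooth_real f \<Longrightarrow> smooth_real (\<lambda>x. f (c * x + d))"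
  by (simp add: smooth_real_def times_diff_affine)

lemma smooth_real_diff: "smooth_real f \<Longrightarrow> smooth_real g \<Longrightarrow> smooth_real (\<lambda>x. f x - g x)"
  using smooth_real_add[OF _ smooth_real_mult[OF smooth_real_const[of "-1"]], of f g] by simp

lemma smooth_real_power: "smooth_real f \<Longrightarrow> smooth_real (\<lambda>x. f x ^ n)"
  by (induction n) (auto intro: smooth_real_mult)

lemma smooth_real_antideriv:
  "smooth_real f \<Longrightarrow> (\<And>x. (F has_real_derivative f x) (at x)) \<Longrightarrow> smooth_real F"
  unfolding smooth_real_def
proof
  fix n assume "\<forall>n. times_diff n f" "\<And>x. (F has_real_derivative f x) (at x)"
  then show "times_diff n F" by (cases n) auto
qed

lemma smooth_real_deriv:
  assumes "smooth_real f"
  shows "(f has_real_derivative deriv f x) (at x)" "smooth_real (deriv f)"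
proof -
  have *: "\<exists>f'. (\<forall>x. (f has_real_derivative f' x) (at x)) \<and> times_diff n f'" for n
    using assms unfolding smooth_real_def by (auto dest: spec[of _ "Suc n"])
  then show "(f has_real_derivative deriv f x) (at x)"
    by (metis DERIV_imp_deriv)
  have "times_diff n (deriv f)" for n
  proof -
    obtain f' where f': "\<forall>x. (f has_real_derivative f' x) (at x)" "times_diff n f'"
      using * by blast
    then have "deriv f = f'" by (auto intro!: DERIV_imp_deriv)
    with f' show ?thesis by simp
  qed
  then show "smooth_real (deriv f)" by (simp add: smooth_real_def)
qed

lemma smooth_real_continuous: "smooth_real f \<Longrightarrow> continuous_on A f"
  by (meson DERIV_isCont continuous_at_imp_continuous_on smooth_real_deriv(1))

lemma smooth_real_measurable: "smooth_real f \<Longrightarrow> f \<in> borel_measurable borel"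
  by (intro borel_measurable_continuous_onI smooth_real_continuous)

text \<open>The family p(1/x) exp(-1/x), extended by 0, is closed under differentiation: the
  derivative belongs to the polynomial X^2 (p - p'). Smoothness of every member, in particular of
  exp(-1/x) for p = 1, follows by induction.\<close>

definition flat_exp :: "real poly \<Rightarrow> real \<Rightarrow> real" where
  "flat_exp p x = (if x > 0 then poly p (1 / x) * exp (- (1 / x)) else 0)"

lemma poly_times_exp_tendsto_0: "((\<lambda>y::real. poly p y * exp (- y)) \<longlongrightarrow> 0) at_top"
proof -
  have "((\<lambda>y::real. \<Sum>i\<le>degree p. coeff p i * (y ^ i / exp y)) \<longlongrightarrow> (\<Sum>i\<le>degree p. coeff p i * 0)) at_top"
    by (intro tendsto_intros tendsto_power_div_exp_0)
  also have "(\<lambda>y::real. \<Sum>i\<le>degree p. coeff p i * (y ^ i / exp y)) = (\<lambda>y. poly p y * exp (- y))"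
    by (auto simp: poly_altdef sum_divide_distrib exp_minus field_simps)
  finally show ?thesis by simp
qed

lemma flat_exp_has_derivative:
  "(flat_exp p has_real_derivative flat_exp ([:0, 0, 1:] * (p - pderiv p)) x) (at x)"
proof -
  consider "x < 0" | "x = 0" | "x > 0" by linarith
  then show ?thesis
  proof cases
    case 1
    have "((\<lambda>x. 0) has_real_derivative 0) (at x)" by simp
    then have "(flat_exp p has_real_derivative 0) (at x)"
      by (rule has_field_derivative_transform_within_open[of _ _ _ "{..<0}"]) (use 1 in \<open>auto simp: flat_exp_def\<close>)
    then show ?thesis using 1 by (simp add: flat_exp_def)
  next
    case 3
    have "((\<lambda>x. poly p (1 / x) * exp (- (1 / x))) has_real_derivative
             poly ([:0, 0, 1:] * (p - pderiv p)) (1 / x) * exp (- (1 / x))) (at x)"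
      using 3 by (auto intro!: derivative_eq_intros simp: field_simps power2_eq_square)
    then have "(flat_exp p has_real_derivative poly ([:0, 0, 1:] * (p - pderiv p)) (1 / x) * exp (- (1 / x))) (at x)"
      by (rule has_field_derivative_transform_within_open[of _ _ _ "{0<..}"])
        (use 3 in \<open>auto simp: flat_exp_def\<close>)
    then show ?thesis using 3 by (simp add: flat_exp_def)
  next
    case 2
    \<comment> \<open>To the right of 0 the difference quotient is of the same form, with the
      polynomial X p in place of p.\<close>
    have "((\<lambda>h. poly ([:0, 1:] * p) (inverse h) * exp (- inverse h)) \<longlongrightarrow> 0) (at_right 0)"
      by (rule filterlim_compose[OF poly_times_exp_tendsto_0 filterlim_inverse_at_top_right])
    then have "((\<lambda>h. flat_exp p h / h) \<longlongrightarrow> 0) (at_right 0)"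
      by (rule Lim_transform_eventually)
        (auto simp: eventually_at_right_less flat_exp_def field_simps intro!: eventually_mono[OF eventually_at_right_less])
    moreover have "((\<lambda>h. flat_exp p h / h) \<longlongrightarrow> 0) (at_left 0)"
      by (rule tendsto_eventually) (auto simp: eventually_at flat_exp_def intro!: exI[of _ 1])
    ultimately have "((\<lambda>h. flat_exp p h / h) \<longlongrightarrow> 0) (at 0)"
      by (simp add: filterlim_split_at)
    then show ?thesis using 2 by (simp add: has_field_derivative_iff) (simp add: flat_exp_def)
  qed
qed

lemma smooth_flat_exp: "smooth_real (flat_exp p)"
proof -
  have "times_diff n (flat_exp p)" for n
  proof (induction n arbitrary: p)
    case (Suc n)
    then show ?case using flat_exp_has_derivative by auto
  qed simp
  then show ?thesis by (simp add: smooth_real_def)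
qed

text \<open>As \<open>n \<rightarrow> \<infinity>\<close>, the bump functions increase to the indicator function of the interval.\<close>

definition bump :: "real \<Rightarrow> real \<Rightarrow> nat \<Rightarrow> real \<Rightarrow> real" where
  "bump r s n x = 1 - (1 - flat_exp 1 (x - r) * flat_exp 1 (s - x)) ^ n"

lemma flat_exp_1: "0 \<le> flat_exp 1 x" "flat_exp 1 x < 1" "0 < x \<Longrightarrow> 0 < flat_exp 1 x" "x \<le> 0 \<Longrightarrow> flat_exp 1 x = 0"
  by (auto simp: flat_exp_def)

lemma flat_exp_prod:
  "0 \<le> flat_exp 1 a * flat_exp 1 b" "flat_exp 1 a * flat_exp 1 b < 1"
proof -
  show "0 \<le> flat_exp 1 a * flat_exp 1 b" by (intro mult_nonneg_nonneg flat_exp_1)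
  have "flat_exp 1 a * flat_exp 1 b \<le> flat_exp 1 a"
    by (intro mult_left_le flat_exp_1(1) less_imp_le[OF flat_exp_1(2)])
  then show "flat_exp 1 a * flat_exp 1 b < 1" using flat_exp_1(2)[of a] by linarith
qed

lemma smooth_bump: "smooth_real (bump r s n)"
proof -
  have "smooth_real (\<lambda>x. flat_exp 1 (1 * x + (- r)))" "smooth_real (\<lambda>x. flat_exp 1 ((-1) * x + s))"
    by (intro smooth_real_affine smooth_flat_exp)+
  then have "smooth_real (\<lambda>x. 1 - (1 - flat_exp 1 (1 * x + (- r)) * flat_exp 1 ((-1) * x + s)) ^ n)"
    by (intro smooth_real_diff smooth_real_const smooth_real_power smooth_real_mult)
  then show ?thesis by (simp add: bump_def[abs_def] algebra_simps)
qed

lemma bump_range: "0 \<le> bump r s n x" "bump r s n x \<le> 1"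
  using flat_exp_prod[of "x - r" "s - x"] by (auto simp: bump_def power_le_one)

lemma bump_outside: "x \<notin> {r<..<s} \<Longrightarrow> bump r s n x = 0"
  by (auto simp: bump_def flat_exp_1 not_less)

lemma bump_pos: "x \<in> {r<..<s} \<Longrightarrow> 0 < n \<Longrightarrow> 0 < bump r s n x"
  using flat_exp_prod(2)[of "x - r" "s - x"] flat_exp_1(3)[of "x - r"] flat_exp_1(3)[of "s - x"]
  by (auto simp: bump_def power_Suc_less_one intro!: power_less_one_iff[THEN iffD2])

text \<open>Inside the interval the product of the two flat exponentials lies strictly between 0 and
  1, so the power in \<open>bump\<close> decays geometrically.\<close>

lemma bump_tendsto: "(\<lambda>n. bump r s n x) \<longlonglongrightarrow> indicator {r<..<s} x"
proof (cases "x \<in> {r<..<s}")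
  case True
  have "(\<lambda>n. 1 - (1 - flat_exp 1 (x - r) * flat_exp 1 (s - x)) ^ n) \<longlonglongrightarrow> 1 - 0"
    using True flat_exp_prod[of "x - r" "s - x"] flat_exp_1(3)[of "x - r"] flat_exp_1(3)[of "s - x"]
    by (intro tendsto_intros LIMSEQ_realpow_zero) auto
  with True show ?thesis by (simp add: bump_def)
qed (simp add: bump_outside)

text \<open>Real-valued functions, embedded by \<open>of_real\<close>, serve as test functions for
  both scalar fields. The support is recorded by a closed interval strictly inside
  \<open>{l<..<u}\<close>, which makes closure under \<open>deriv\<close> immediate.\<close>

definition ctest :: "real \<Rightarrow> real \<Rightarrow> (real \<Rightarrow> real) set" where
  "ctest l u = {f. smooth_real f \<and> (\<exists>r s. l < r \<and> s < u \<and> (\<forall>x. x \<notin> {r..s} \<longrightarrow> f x = 0))}"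

lemma ctest_smooth: "f \<in> ctest l u \<Longrightarrow> smooth_real f"
  by (simp add: ctest_def)

lemma bump_ctest: "l < r \<Longrightarrow> s < u \<Longrightarrow> bump r s n \<in> ctest l u"
  unfolding ctest_def using smooth_bump
  by (intro CollectI conjI exI[of _ r] exI[of _ s] allI impI bump_outside) auto

lemma deriv_eq_0_outside:
  fixes f :: "real \<Rightarrow> real"
  assumes "\<forall>x. x \<notin> {r..s} \<longrightarrow> f x = 0" "x \<notin> {r..s}" shows "deriv f x = 0"
proof -
  have "((\<lambda>x. 0) has_real_derivative 0) (at x)" by simp
  then have "(f has_real_derivative 0) (at x)"
    by (rule has_field_derivative_transform_within_open[of _ _ _ "- {r..s}"]) (use assms in auto)
  then show ?thesis by (rule DERIV_imp_deriv)
qed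

lemma ctest_deriv: "f \<in> ctest l u \<Longrightarrow> deriv f \<in> ctest l u"
  unfolding ctest_def using smooth_real_deriv(2) deriv_eq_0_outside by blast

lemma ctest_bounded: 
  assumes "f \<in> ctest l u" shows "bounded (range f)"
proof -
  obtain r s where rs: "\<forall>x. x \<notin> {r..s} \<longrightarrow> f x = 0" "smooth_real f" using assms by (auto simp: ctest_def)
  have "bounded (f ` {r..s})"
    by (intro compact_imp_bounded compact_continuous_image smooth_real_continuous rs) auto
  then have "bounded (insert 0 (f ` {r..s}))" by simp
  then show ?thesis by (rule bounded_subset) (use rs in blast)
qed

section \<open>Embedded functions and tensor products as test functions\<close>

lemma frechet_derivative_of_real:
  assumes "(f has_real_derivative f') (at x)"
  shows "(\<lambda>x. of_real (f x) :: 'k::real_normed_field) differentiable (at x)"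
    "frechet_derivative (\<lambda>x. of_real (f x) :: 'k) (at x) 1 = of_real f'"
proof -
  have "((\<lambda>x. of_real (f x) :: 'k) has_derivative (\<lambda>h. of_real (f' * h))) (at x)"
    using assms by (intro has_derivative_of_real) (simp add: has_field_derivative_def)
  then show "(\<lambda>x. of_real (f x) :: 'k) differentiable (at x)"
    "frechet_derivative (\<lambda>x. of_real (f x) :: 'k) (at x) 1 = of_real f'"
    by (auto simp: differentiable_def frechet_derivative_at[symmetric])
qed

lemma partials_of_real:
  "smooth_real f \<Longrightarrow> partials [1] (\<lambda>x. of_real (f x) :: 'k::real_normed_field) = (\<lambda>x. of_real (deriv f x))"
  by (auto simp: frechet_derivative_of_real(2)[OF smooth_real_deriv(1)])

lemma smooth_fun_of_real:
  assumes f: "smooth_real f"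
  shows "smooth_fun (\<lambda>x. of_real (f x) :: 'k::real_normed_field)"
proof -
  have *: "set is \<subseteq> {1} \<Longrightarrow> \<exists>g. smooth_real g \<and> partials is (\<lambda>x. of_real (f x) :: 'k) = (\<lambda>x. of_real (g x))" for "is" :: "real list"
  proof (induction "is")
    case Nil then show ?case using f by auto
  next
    case (Cons i "is")
    then obtain g where g: "smooth_real g" "partials is (\<lambda>x. of_real (f x) :: 'k) = (\<lambda>x. of_real (g x))" by auto
    then show ?case using Cons.prems smooth_real_deriv[OF g(1)]
      by (auto intro!: exI[of _ "deriv g"] simp: frechet_derivative_of_real(2))
  qed
  show ?thesis unfolding smooth_fun_def
  proof (intro allI impI)
    fix "is" :: "real list" and x :: real assume "set is \<subseteq> Basis"
    then obtain g where g: "smooth_real g" "partials is (\<lambda>x. of_real (f x) :: 'k) = (\<lambda>x. of_real (g x))"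
      using * by auto
    show "partials is (\<lambda>x. of_real (f x) :: 'k) differentiable (at x)"
      unfolding g(2) by (rule frechet_derivative_of_real(1)[OF smooth_real_deriv(1)[OF g(1)]])
  qed
qed

lemma test_funs_of_real:
  assumes "f \<in> ctest l u"
  shows "(\<lambda>x. of_real (f x) :: 'k::real_normed_field) \<in> test_funs {l<..<u}"
proof -
  obtain r s where rs: "l < r" "s < u" "\<forall>x. x \<notin> {r..s} \<longrightarrow> f x = 0" "smooth_real f" using assms by (auto simp: ctest_def)
  have "supp (\<lambda>x. of_real (f x) :: 'k) \<subseteq> {r..s}"
    unfolding supp_def by (rule closure_minimal) (use rs in auto)
  moreover have "compact (supp (\<lambda>x. of_real (f x) :: 'k))"
    using calculation compact_Icc[of r s] unfolding supp_def
    by (meson bounded_subset closed_closure compact_eq_bounded_closed)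
  ultimately show ?thesis using smooth_fun_of_real[OF rs(4)] rs(1,2) by (force simp: test_funs_def)
qed

lemma frechet_derivative_tensor:
  assumes f: "(f has_real_derivative f') (at (fst z))" and g: "(g has_real_derivative g') (at (snd z))"
  shows "(\<lambda>z. of_real (f (fst z) * g (snd z)) :: 'k::real_normed_field) differentiable (at z)"
    "frechet_derivative (\<lambda>z. of_real (f (fst z) * g (snd z)) :: 'k) (at z) (1, 0) = of_real (f' * g (snd z))"
    "frechet_derivative (\<lambda>z. of_real (f (fst z) * g (snd z)) :: 'k) (at z) (0, 1) = of_real (f (fst z) * g')"
proof -
  have 1: "((\<lambda>z. f (fst z)) has_derivative (\<lambda>h. f' * fst h)) (at z)"
    by (rule has_derivative_compose[OF has_derivative_fst[OF has_derivative_ident] f[unfolded has_field_derivative_def]])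
  have 2: "((\<lambda>z. g (snd z)) has_derivative (\<lambda>h. g' * snd h)) (at z)"
    by (rule has_derivative_compose[OF has_derivative_snd[OF has_derivative_ident] g[unfolded has_field_derivative_def]])
  have "((\<lambda>z. of_real (f (fst z) * g (snd z)) :: 'k) has_derivative
          (\<lambda>h. of_real (f (fst z) * (g' * snd h) + (f' * fst h) * g (snd z)))) (at z)"
    by (intro has_derivative_of_real has_derivative_mult 1 2)
  note d = this frechet_derivative_at[OF this, symmetric]
  show "(\<lambda>z. of_real (f (fst z) * g (snd z)) :: 'k::real_normed_field) differentiable (at z)"
    "frechet_derivative (\<lambda>z. of_real (f (fst z) * g (snd z)) :: 'k) (at z) (1, 0) = of_real (f' * g (snd z))"
    "frechet_derivative (\<lambda>z. of_real (f (fst z) * g (snd z)) :: 'k) (at z) (0, 1) = of_real (f (fst z) * g')"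
    using d by (auto simp: differentiable_def)
qed

lemma partials_tensor:
  assumes "smooth_real f" "smooth_real g"
  shows "partials [(1, 0)] (\<lambda>z. of_real (f (fst z) * g (snd z)) :: 'k::real_normed_field) = (\<lambda>z. of_real (deriv f (fst z) * g (snd z)))"
    "partials [(0, 1)] (\<lambda>z. of_real (f (fst z) * g (snd z)) :: 'k::real_normed_field) = (\<lambda>z. of_real (f (fst z) * deriv g (snd z)))"
  using frechet_derivative_tensor(2,3)[OF smooth_real_deriv(1)[OF assms(1)] smooth_real_deriv(1)[OF assms(2)], where 'k='k] by auto

lemma Basis_real_prod: "(Basis :: (real \<times> real) set) = {(1, 0), (0, 1)}"
  by (auto simp: Basis_prod_def)

text \<open>Each partial derivative of a product f(t) g(x) is again such a product, so the induction
  on the list of directions only ever meets smooth factors.\<close>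

lemma smooth_fun_tensor:
  assumes f: "smooth_real f" and g: "smooth_real g"
  shows "smooth_fun (\<lambda>z. of_real (f (fst z) * g (snd z)) :: 'k::real_normed_field)" (is "smooth_fun ?F")
proof -
  have *: "set is \<subseteq> Basis \<Longrightarrow> \<exists>f1 g1. smooth_real f1 \<and> smooth_real g1 \<and> partials is ?F = (\<lambda>z. of_real (f1 (fst z) * g1 (snd z)))" for "is" :: "(real \<times> real) list"
  proof (induction "is")
    case Nil then show ?case using f g by auto
  next
    case (Cons i "is")
    then obtain f1 g1 where 1: "smooth_real f1" "smooth_real g1" "partials is ?F = (\<lambda>z. of_real (f1 (fst z) * g1 (snd z)))" by auto
    have *: "partials (i # is) ?F = partials [i] (\<lambda>z. of_real (f1 (fst z) * g1 (snd z)) :: 'k)" using 1(3) by simp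
    have "i = (1, 0) \<or> i = (0, 1)" using Cons.prems by (auto simp: Basis_real_prod)
    then show ?case
    proof
      assume "i = (1, 0)"
      then show ?thesis
        unfolding * using partials_tensor(1)[OF 1(1,2), where 'k='k] 1(2) smooth_real_deriv(2)[OF 1(1)]
        by (intro exI[of _ "deriv f1"] exI[of _ g1] conjI) simp_all
    next
      assume "i = (0, 1)"
      then show ?thesis
        unfolding * using partials_tensor(2)[OF 1(1,2), where 'k='k] 1(1) smooth_real_deriv(2)[OF 1(2)]
        by (intro exI[of _ f1] exI[of _ "deriv g1"] conjI) simp_all
    qed
  qed
  show ?thesis unfolding smooth_fun_def
  proof (intro allI impI)
    fix "is" :: "(real \<times> real) list" and x assume "set is \<subseteq> Basis"
    then obtain f1 g1 where 1: "smooth_real f1" "smooth_real g1" "partials is ?F = (\<lambda>z. of_real (f1 (fst z) * g1 (snd z)))"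
      using * by blast
    show "partials is ?F differentiable (at x)"
      unfolding 1(3) by (rule frechet_derivative_tensor(1)[OF smooth_real_deriv(1)[OF 1(1)] smooth_real_deriv(1)[OF 1(2)]])
  qed
qed

lemma test_funs_tensor:
  assumes "f \<in> ctest l u" "g \<in> ctest l' u'"
  shows "(\<lambda>z. of_real (f (fst z) * g (snd z)) :: 'k::real_normed_field) \<in> test_funs ({l<..<u} \<times> {l'<..<u'})" (is "?F \<in> _")
proof -
  obtain r s where rs: "l < r" "s < u" "\<forall>x. x \<notin> {r..s} \<longrightarrow> f x = 0" "smooth_real f" using assms(1) by (auto simp: ctest_def)
  obtain r' s' where rs': "l' < r'" "s' < u'" "\<forall>x. x \<notin> {r'..s'} \<longrightarrow> g x = 0" "smooth_real g" using assms(2) by (auto simp: ctest_def)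
  have "supp ?F \<subseteq> {r..s} \<times> {r'..s'}"
    unfolding supp_def by (rule closure_minimal) (use rs rs' in \<open>auto intro: closed_Times\<close>)
  moreover have "compact (supp ?F)"
    using calculation compact_Times[OF compact_Icc[of r s] compact_Icc[of r' s']] unfolding supp_def
    by (meson bounded_subset closed_closure compact_eq_bounded_closed)
  ultimately show ?thesis using smooth_fun_tensor[OF rs(4) rs'(4)] rs(1,2) rs'(1,2) by (force simp: test_funs_def)
qed

section \<open>Absolutely continuous functions\<close>

lemma lebesgue_on_subset_indicator:
  fixes f :: "'a::euclidean_space \<Rightarrow> 'k::euclidean_space"
  assumes "A \<subseteq> S" "A \<in> sets borel" "S \<in> sets borel"
  shows integrable_lebesgue_on_subset_indicator:
      "integrable (leb S) (\<lambda>x. indicator A x *\<^sub>R f x) \<longleftrightarrow> integrable (leb A) f"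
    and integral_lebesgue_on_subset_indicator:
      "(\<integral>x. indicator A x *\<^sub>R f x \<partial>leb S) = (\<integral>x. f x \<partial>leb A)"
proof -
  have "(\<lambda>x. indicator S x *\<^sub>R (indicator A x *\<^sub>R f x)) = (\<lambda>x. indicator A x *\<^sub>R f x)"
    using assms(1) by (intro ext) (auto split: split_indicator)
  with assms(2,3) show "integrable (leb S) (\<lambda>x. indicator A x *\<^sub>R f x) \<longleftrightarrow> integrable (leb A) f"
    "(\<integral>x. indicator A x *\<^sub>R f x \<partial>leb S) = (\<integral>x. f x \<partial>leb A)"
    by (simp_all add: integrable_restrict_space integral_restrict_space del: scaleR_scaleR)
qed

lemma integrable_lebesgue_on_subset:
  fixes f :: "'a::euclidean_space \<Rightarrow> 'k::euclidean_space"
  assumes "integrable (leb S) f" "A \<subseteq> S" "A \<in> sets borel" "S \<in> sets borel"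
  shows "integrable (leb A) f"
  using integrable_mult_indicator[of A "leb S" f] assms
  by (simp add: integrable_lebesgue_on_subset_indicator[symmetric, OF assms(2-4)] sets_restrict_space_iff)

lemma AE_lebesgue_on_subset:
  assumes "AE x in leb S. P x" "A \<subseteq> S" "A \<in> sets borel" "S \<in> sets borel"
  shows "AE x in leb A. P x"
  using assms by (auto simp: AE_lebesgue_on_iff elim!: eventually_mono)

lemma AE_lborel_real_singleton: "AE x in lborel. x \<noteq> (a::real)"
  using AE_lborel_singleton by auto

lemma integral_lebesgue_on_cong_AE_set:
  fixes f :: "real \<Rightarrow> 'k::euclidean_space"
  assumes "A \<in> sets borel" "S \<in> sets borel" "AE x in lborel. x \<in> A \<longleftrightarrow> x \<in> S"
  shows "integrable (leb A) f \<longleftrightarrow> integrable (leb S) f"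
    "integral\<^sup>L (leb A) f = integral\<^sup>L (leb S) f"
proof -
  have ae: "AE x in lebesgue. indicator A x *\<^sub>R f x = indicator S x *\<^sub>R f x"
    using assms(3) unfolding AE_completion_iff by eventually_elim (auto simp: indicator_def)
  have ae': "AE x in lebesgue. indicator S x *\<^sub>R f x = indicator A x *\<^sub>R f x"
    using ae by (auto elim: eventually_mono)
  have m: "(\<lambda>x. indicator A x *\<^sub>R f x) \<in> borel_measurable lebesgue \<longleftrightarrow> (\<lambda>x. indicator S x *\<^sub>R f x) \<in> borel_measurable lebesgue"
    using borel_measurable_AE[OF _ ae] borel_measurable_AE[OF _ ae'] by blast
  have i: "integrable lebesgue (\<lambda>x. indicator A x *\<^sub>R f x) \<longleftrightarrow> integrable lebesgue (\<lambda>x. indicator S x *\<^sub>R f x)"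
    using m integrable_cong_AE_imp[OF _ _ ae] integrable_cong_AE_imp[OF _ _ ae'] borel_measurable_integrable by blast
  show "integrable (leb A) f \<longleftrightarrow> integrable (leb S) f"
    using i assms(1,2) by (simp add: integrable_restrict_space)
  have "integral\<^sup>L lebesgue (\<lambda>x. indicator A x *\<^sub>R f x) = integral\<^sup>L lebesgue (\<lambda>x. indicator S x *\<^sub>R f x)"
  proof (cases "(\<lambda>x. indicator A x *\<^sub>R f x) \<in> borel_measurable lebesgue")
    case True
    then show ?thesis using m ae by (intro integral_cong_AE) auto
  next
    \<comment> \<open>Here neither function is integrable, and both integrals have the default value
      0.\<close>
    case False
    then show ?thesis using m i by (metis borel_measurable_integrable not_integrable_integral_eq)
  qed
  then show "integral\<^sup>L (leb A) f = integral\<^sup>L (leb S) f"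
    using assms(1,2) by (simp add: integral_restrict_space)
qed

text \<open>Half-lines are closed under intersection and generate the Borel sets, so vanishing
  integrals spread to all Borel sets, and these determine \<open>G\<close> almost
  everywhere.\<close>

lemma AE_zero_of_halflines:
  fixes G :: "real \<Rightarrow> 'k::euclidean_space"
  assumes G: "integrable lborel G" and z: "\<And>a. (\<integral>x. indicator {..<a} x *\<^sub>R G x \<partial>lborel) = 0"
  shows "AE x in lborel. G x = 0"
proof -
  \<comment> \<open>The induction step for complements needs the total integral, which is a limit of
    integrals over half-lines.\<close>
  have tot: "(\<integral>x. G x \<partial>lborel) = 0"
  proof -
    have "(\<lambda>n::nat. \<integral>x. indicator {..<real n} x *\<^sub>R G x \<partial>lborel) \<longlonglongrightarrow> (\<integral>x. G x \<partial>lborel)"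
    proof (rule integral_dominated_convergence)
      show "integrable lborel (\<lambda>x. norm (G x))" using G by simp
      show "AE x in lborel. (\<lambda>n. indicator {..<real n} x *\<^sub>R G x) \<longlonglongrightarrow> G x"
      proof (rule AE_I2)
        fix x :: real
        obtain N :: nat where "x < real N" using reals_Archimedean2 by blast
        then have "\<forall>\<^sub>F n in sequentially. G x = indicator {..<real n} x *\<^sub>R G x"
          by (auto simp: eventually_sequentially intro!: exI[of _ N])
        then show "(\<lambda>n. indicator {..<real n} x *\<^sub>R G x) \<longlonglongrightarrow> G x"
          by (rule Lim_transform_eventually[OF tendsto_const])
      qed
    qed (use G in \<open>auto simp: indicator_def\<close>)
    then show ?thesis by (simp add: z LIMSEQ_const_iff)
  qed
  have "(\<integral>x. indicator A x *\<^sub>R G x \<partial>lborel) = 0" if "A \<in> sets borel" for A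
  proof -
    have st: "Int_stable (range (\<lambda>a::real. {..<a}))" 
    proof (clarsimp simp: Int_stable_def)
      fix a b :: real
      have "{..<a} \<inter> {..<b} = {..<min a b}" by auto
      then show "{..<a} \<inter> {..<b} \<in> range lessThan" by simp
    qed
    have "A \<in> sigma_sets UNIV (range (\<lambda>a::real. {..<a}))"
      using that by (simp add: borel_Iio)
    moreover have "range (\<lambda>a::real. {..<a}) \<subseteq> Pow UNIV" by simp
    ultimately have "A \<in> sigma_sets UNIV (range (\<lambda>a::real. {..<a}))" "range (\<lambda>a::real. {..<a}) \<subseteq> Pow UNIV" by auto
    from st this(2,1) show ?thesis
    proof (induction rule: sigma_sets_induct_disjoint)
      case (basic A) then show ?case using z by auto
    next
      case (compl A)
      then have A: "A \<in> sets borel" by (simp add: borel_Iio)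
      have "indicator (UNIV - A) x *\<^sub>R G x = G x - indicator A x *\<^sub>R G x" for x by (auto simp: indicator_def)
      then show ?case using compl A G tot by (simp add: integrable_mult_indicator)
    next
      case (union A)
      then have A: "\<And>i. A i \<in> sets lborel" by (auto simp: borel_Iio)
      have "set_lebesgue_integral lborel (\<Union>i. A i) G = (\<Sum>i. set_lebesgue_integral lborel (A i) G)"
        by (rule lebesgue_integral_countable_add)
          (use A union(1) G in \<open>auto simp: disjoint_family_on_def set_integrable_def intro!: integrable_mult_indicator\<close>)
      then show ?case using union by (simp add: set_lebesgue_integral_def)
    qed auto
  qed
  then show ?thesis by (intro sigma_finite_measure.density_zero[OF lborel.sigma_finite_measure_axioms G]) (auto simp: set_lebesgue_integral_def)
qed

text \<open>Rational endpoints keep the family countable: an identity that holds, for each single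
  member, at almost every parameter then holds at almost every parameter for all members at
  once.\<close>

definition bumps :: "real \<Rightarrow> real \<Rightarrow> (real \<Rightarrow> real) set" where
  "bumps l u = {bump r s n | r s n. r \<in> \<rat> \<and> s \<in> \<rat> \<and> l < r \<and> r < s \<and> s < u}"

lemma countable_bumps: "countable (bumps l u)"
proof -
  have "bumps l u \<subseteq> (\<lambda>(r, s, n). bump r s n) ` (\<rat> \<times> \<rat> \<times> UNIV)"
  proof
    fix f assume "f \<in> bumps l u"
    then obtain r s n where "f = bump r s n" "r \<in> \<rat>" "s \<in> \<rat>" by (auto simp: bumps_def)
    then show "f \<in> (\<lambda>(r, s, n). bump r s n) ` (\<rat> \<times> \<rat> \<times> UNIV)"
      by (intro image_eqI[of _ _ "(r, s, n)"]) auto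
  qed
  then show ?thesis by (rule countable_subset) (intro countable_image countable_SIGMA countable_rat, auto)
qed

lemma bumps_ctest: "f \<in> bumps l u \<Longrightarrow> f \<in> ctest l u"
  by (auto simp: bumps_def intro: bump_ctest)

lemma bumps_mono: "l \<le> l' \<Longrightarrow> u' \<le> u \<Longrightarrow> bumps l' u' \<subseteq> bumps l u"
  unfolding bumps_def by auto (metis order.strict_trans1 order.strict_trans2)

lemma bounded_times_integrable:
  fixes f :: "'a \<Rightarrow> 'k::euclidean_space"
  assumes f: "integrable M f" and h: "h \<in> borel_measurable M" and b: "\<And>x. \<bar>h x\<bar> \<le> C"
  shows "integrable M (\<lambda>x. h x *\<^sub>R f x)"
proof (rule Bochner_Integration.integrable_bound)
  show "integrable M (\<lambda>x. C *\<^sub>R f x)" using f by simp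
  have "0 \<le> C" using b[of undefined] by linarith
  then show "AE x in M. norm (h x *\<^sub>R f x) \<le> norm (C *\<^sub>R f x)"
    using b by (auto intro!: mult_right_mono)
qed (use f h in auto)

lemma ctest_times_integrable:
  fixes f :: "real \<Rightarrow> 'k::euclidean_space"
  assumes \<phi>: "\<phi> \<in> ctest l u" and f: "integrable (leb S) f"
  shows "integrable (leb S) (\<lambda>x. \<phi> x *\<^sub>R f x)"
proof -
  obtain C where "\<And>x. \<bar>\<phi> x\<bar> \<le> C" using ctest_bounded[OF \<phi>] by (auto simp: bounded_iff)
  then show ?thesis
    by (intro bounded_times_integrable[OF f] borel_measurable_lebesgue_onI smooth_real_measurable ctest_smooth[OF \<phi>])
qed

text \<open>The countable family already suffices. Dominated convergence turns bumps into indicators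
  of intervals with rational endpoints, these exhaust any subinterval, and the criterion with
  half-lines applies to the extension by 0.\<close>

lemma fundamental_lemma:
  fixes f :: "real \<Rightarrow> 'k::euclidean_space"
  assumes f: "integrable (leb {l<..<u}) f"
    and z: "\<And>\<eta>. \<eta> \<in> bumps l u \<Longrightarrow> (\<integral>x. \<eta> x *\<^sub>R f x \<partial>leb {l<..<u}) = 0"
  shows "AE x in leb {l<..<u}. f x = 0"
proof -
  let ?M = "leb {l<..<u}"
  have rat: "(\<integral>x. f x \<partial>leb {r<..<s}) = 0" if rs: "r \<in> \<rat>" "s \<in> \<rat>" "l < r" "r < s" "s < u" for r s
  proof -
    have "(\<lambda>n. \<integral>x. bump r s n x *\<^sub>R f x \<partial>?M) \<longlonglongrightarrow> (\<integral>x. indicator {r<..<s} x *\<^sub>R f x \<partial>?M)"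
    proof (rule integral_dominated_convergence)
      show "integrable ?M (\<lambda>x. norm (f x))" using f by simp
      show "(\<lambda>x. indicator {r<..<s} x *\<^sub>R f x) \<in> borel_measurable ?M"
        using f by (intro borel_measurable_scaleR borel_measurable_lebesgue_onI[OF borel_measurable_indicator]) auto
      show "AE x in ?M. (\<lambda>n. bump r s n x *\<^sub>R f x) \<longlonglongrightarrow> indicator {r<..<s} x *\<^sub>R f x"
        by (intro AE_I2 tendsto_scaleR bump_tendsto tendsto_const)
      show "(\<lambda>x. bump r s n x *\<^sub>R f x) \<in> borel_measurable ?M" for n
        using f by (intro borel_measurable_scaleR borel_measurable_lebesgue_onI[OF smooth_real_measurable[OF smooth_bump]]) auto
      show "AE x in ?M. norm (bump r s n x *\<^sub>R f x) \<le> norm (f x)" for n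
        using bump_range[of r s n] by (intro AE_I2) (auto intro!: mult_left_le_one_le)
    qed
    moreover have "(\<integral>x. bump r s n x *\<^sub>R f x \<partial>?M) = 0" for n
      using rs by (intro z) (auto simp: bumps_def)
    ultimately have "(\<integral>x. indicator {r<..<s} x *\<^sub>R f x \<partial>?M) = 0" by (simp add: LIMSEQ_const_iff)
    then show ?thesis using rs by (subst (asm) integral_lebesgue_on_subset_indicator) auto
  qed
  have sub: "(\<integral>x. f x \<partial>leb {a<..<b}) = 0" if ab: "l \<le> a" "a < b" "b \<le> u" for a b
  proof -
    \<comment> \<open>The points \<open>r n\<close> stay in the left half of the interval and the
      points \<open>s n\<close> below in the right half, which guarantees \<open>r n < s n\<close>;
      the distance 1 / (n + 1) to the endpoints makes them converge.\<close>
    have "\<exists>r. r \<in> \<rat> \<and> a < r \<and> r < min (a + (b - a)/2) (a + 1 / Suc n)" for n :: nat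
    proof -
      have "a < min (a + (b - a)/2) (a + 1 / Suc n)" using ab by simp
      from Rats_dense_in_real[OF this] show ?thesis by blast
    qed
    then obtain r where r: "\<And>n::nat. r n \<in> \<rat>" "\<And>n. a < r n" "\<And>n. r n < min (a + (b - a)/2) (a + 1 / Suc n)"
      by metis
    have "\<exists>r. r \<in> \<rat> \<and> max (a + (b - a)/2) (b - 1 / Suc n) < r \<and> r < b" for n :: nat
    proof -
      have "max (a + (b - a)/2) (b - 1 / Suc n) < b" using ab by (simp add: field_simps)
      from Rats_dense_in_real[OF this] show ?thesis by blast
    qed
    then obtain s where s: "\<And>n::nat. s n \<in> \<rat>" "\<And>n. max (a + (b - a)/2) (b - 1 / Suc n) < s n" "\<And>n. s n < b"
      by metis
    let ?N = "leb {a<..<b}"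
    have fN: "integrable ?N f" by (rule integrable_lebesgue_on_subset[OF f]) (use ab in auto)
    have "(\<lambda>n. \<integral>x. indicator {r n<..<s n} x *\<^sub>R f x \<partial>?N) \<longlonglongrightarrow> (\<integral>x. f x \<partial>?N)"
    proof (rule integral_dominated_convergence)
      show "integrable ?N (\<lambda>x. norm (f x))" using fN by simp
      show "(\<lambda>x. indicator {r n<..<s n} x *\<^sub>R f x) \<in> borel_measurable ?N" for n
        using fN by (intro borel_measurable_scaleR borel_measurable_lebesgue_onI[OF borel_measurable_indicator]) auto
      show "AE x in ?N. norm (indicator {r n<..<s n} x *\<^sub>R f x) \<le> norm (f x)" for n
        by (intro AE_I2) (auto simp: indicator_def)
      show "AE x in ?N. (\<lambda>n. indicator {r n<..<s n} x *\<^sub>R f x) \<longlonglongrightarrow> f x"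
      proof (rule AE_I2)
        fix x assume "x \<in> space ?N"
        then have x: "a < x" "x < b" by auto
        have "\<forall>\<^sub>F n in sequentially. 1 / real (Suc n) < min (x - a) (b - x)"
          using LIMSEQ_inverse_real_of_nat x
          by (intro order_tendstoD(2)[where y=0]) (auto simp: inverse_eq_divide)
        then have "\<forall>\<^sub>F n in sequentially. f x = indicator {r n<..<s n} x *\<^sub>R f x"
        proof eventually_elim
          case (elim n)
          then show ?case using r(3)[of n] s(2)[of n] by (auto simp: indicator_def)
        qed
        then show "(\<lambda>n. indicator {r n<..<s n} x *\<^sub>R f x) \<longlonglongrightarrow> f x"
          by (rule Lim_transform_eventually[OF tendsto_const])
      qed
    qed (use fN in auto)
    moreover have "(\<integral>x. indicator {r n<..<s n} x *\<^sub>R f x \<partial>?N) = 0" for n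
    proof -
      have "r n < s n" using r(3)[of n] s(2)[of n] by auto
      then have "(\<integral>x. f x \<partial>leb {r n<..<s n}) = 0"
        using ab r(2)[of n] s(3)[of n] by (intro rat r(1) s(1)) auto
      then show ?thesis
        using r(2)[of n] s(3)[of n] by (subst integral_lebesgue_on_subset_indicator) auto
    qed
    ultimately show ?thesis by (simp add: LIMSEQ_const_iff)
  qed
  obtain g where g[measurable]: "g \<in> borel_measurable borel" and ae: "AE x in ?M. f x = g x"
    using borel_representative[OF _ borel_measurable_integrable[OF f]] by auto
  have gi: "integrable ?M g"
    by (rule integrable_cong_AE_imp[OF f borel_measurable_lebesgue_onI[OF g]]) (use ae in \<open>auto elim: eventually_mono\<close>)
  have "AE x in lborel. indicator {l<..<u} x *\<^sub>R g x = 0"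
  proof (rule AE_zero_of_halflines)
    show "integrable lborel (\<lambda>x. indicator {l<..<u} x *\<^sub>R g x)"
      using gi by (simp add: integrable_lebesgue_on_borel)
    fix a
    have "(\<integral>x. indicator {..<a} x *\<^sub>R (indicator {l<..<u} x *\<^sub>R g x) \<partial>lborel) = (\<integral>x. indicator {l<..<min a u} x *\<^sub>R g x \<partial>lborel)"
      by (intro Bochner_Integration.integral_cong) (auto simp: indicator_def)
    also have "\<dots> = (\<integral>x. g x \<partial>leb {l<..<min a u})"
      by (rule integral_lebesgue_on_borel[symmetric]) auto
    also have "\<dots> = (\<integral>x. f x \<partial>leb {l<..<min a u})"
    proof (rule integral_cong_AE)
      show "g \<in> borel_measurable (leb {l<..<min a u})" by (rule borel_measurable_lebesgue_onI[OF g])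
      show "f \<in> borel_measurable (leb {l<..<min a u})"
        by (intro borel_measurable_integrable integrable_lebesgue_on_subset[OF f]) auto
      have "AE x in leb {l<..<min a u}. f x = g x" by (rule AE_lebesgue_on_subset[OF ae]) auto
      then show "AE x in leb {l<..<min a u}. g x = f x" by (rule eventually_mono) simp
    qed
    also have "\<dots> = 0"
    proof (cases "l < min a u")
      case False
      then have "{l<..<min a u} = {}" by auto
      then show ?thesis by (simp only: integral_lebesgue_on_empty)
    qed (intro sub, auto)
    finally show "(\<integral>x. indicator {..<a} x *\<^sub>R (indicator {l<..<u} x *\<^sub>R g x) \<partial>lborel) = 0" .
  qed
  then have "AE x in ?M. g x = 0"
    by (auto simp: AE_lebesgue_on_iff elim!: eventually_mono)
  with ae show ?thesis by eventually_elim simp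
qed

text \<open>Absolute continuity on [l, u] in integral form, as a relation that carries the
  derivative along. \<open>F\<close> is constrained at every point of the closed interval, so that
  boundary values are literal, while \<open>f\<close> matters only up to null sets.\<close>

definition ac :: "real \<Rightarrow> real \<Rightarrow> (real \<Rightarrow> 'k::euclidean_space) \<Rightarrow> (real \<Rightarrow> 'k) \<Rightarrow> bool" where
  "ac l u F f \<longleftrightarrow> integrable (leb {l<..<u}) f \<and>
     (\<forall>x\<in>{l..u}. F x = F l + (\<integral>y. f y \<partial>leb {l<..<x}))"

lemma ac_integrable: "ac l u F f \<Longrightarrow> integrable (leb {l<..<u}) f"
  unfolding ac_def by (rule conjunct1)

lemma ac_eq: "ac l u F f \<Longrightarrow> x \<in> {l..u} \<Longrightarrow> F x = F l + (\<integral>y. f y \<partial>leb {l<..<x})"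
  unfolding ac_def by (drule conjunct2) (rule bspec)

lemma acI:
  assumes "integrable (leb {l<..<u}) f"
    and "\<And>x. l \<le> x \<Longrightarrow> x \<le> u \<Longrightarrow> F x = F l + (\<integral>y. f y \<partial>leb {l<..<x})"
  shows "ac l u F f"
  unfolding ac_def by (intro conjI ballI assms) auto

lemma ac_restrict:
  assumes "ac l u F f" "x \<le> u" shows "ac l x F f"
proof (rule acI)
  show "integrable (leb {l<..<x}) f"
    by (rule integrable_lebesgue_on_subset[OF ac_integrable[OF assms(1)]]) (use assms(2) in auto)
qed (rule ac_eq[OF assms(1)], use assms(2) in auto)

lemma ac_indefinite_integral:
  "integrable (leb {l<..<u}) f \<Longrightarrow> ac l u (\<lambda>x. c + (\<integral>y. f y \<partial>leb {l<..<x})) f"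
  unfolding ac_def by auto

lemma ac_const: "ac l u (\<lambda>x. c) (\<lambda>x. 0)"
  by (simp add: ac_def)

lemma ac_add: "ac l u F f \<Longrightarrow> ac l u G g \<Longrightarrow> ac l u (\<lambda>x. F x + G x) (\<lambda>x. f x + g x)"
proof -
  assume a: "ac l u F f" "ac l u G g"
  show ?thesis unfolding ac_def
  proof (intro conjI ballI)
    fix x assume x: "x \<in> {l..u}"
    then have "ac l x F f" "ac l x G g" using a ac_restrict by auto
    then show "F x + G x = F l + G l + (\<integral>y. f y + g y \<partial>leb {l<..<x})"
      using ac_eq[OF a(1) x] ac_eq[OF a(2) x] by (simp add: ac_integrable)
  qed (use a in \<open>auto simp: ac_integrable\<close>)
qed

lemma ac_linear: "bounded_linear L \<Longrightarrow> ac l u F f \<Longrightarrow> ac l u (\<lambda>x. L (F x)) (\<lambda>x. L (f x))"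
proof -
  assume a: "bounded_linear L" "ac l u F f"
  interpret bounded_linear L by fact
  show ?thesis unfolding ac_def
  proof (intro conjI ballI)
    fix x assume x: "x \<in> {l..u}"
    then have "ac l x F f" using a ac_restrict by auto
    then show "L (F x) = L (F l) + (\<integral>y. L (f y) \<partial>leb {l<..<x})"
      using ac_eq[OF a(2) x] by (simp add: integral_bounded_linear[OF a(1) ac_integrable] add)
  qed (use a in \<open>auto simp: ac_integrable integrable_bounded_linear\<close>)
qed

lemma ac_uminus: "ac l u F f \<Longrightarrow> ac l u (\<lambda>x. - F x) (\<lambda>x. - f x)"
  by (rule ac_linear[OF bounded_linear_minus[OF bounded_linear_ident]])

lemma ac_diff: "ac l u F f \<Longrightarrow> ac l u G g \<Longrightarrow> ac l u (\<lambda>x. F x - G x) (\<lambda>x. f x - g x)"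
  using ac_add[OF _ ac_uminus] by fastforce

lemma ac_cong_AE:
  assumes a: "ac l u F f" and g: "g \<in> borel_measurable (leb {l<..<u})"
    and ae: "AE x in leb {l<..<u}. f x = g x"
  shows "ac l u F g"
  unfolding ac_def
proof (intro conjI ballI)
  show gi: "integrable (leb {l<..<u}) g"
    by (rule integrable_cong_AE_imp[OF ac_integrable[OF a] g]) (use ae in \<open>auto elim: eventually_mono\<close>)
  fix x assume x: "x \<in> {l..u}"
  have "(\<integral>y. f y \<partial>leb {l<..<x}) = (\<integral>y. g y \<partial>leb {l<..<x})"
    using x by (intro integral_cong_AE AE_lebesgue_on_subset[OF ae] borel_measurable_integrable
         integrable_lebesgue_on_subset[OF gi] integrable_lebesgue_on_subset[OF ac_integrable[OF a]]) auto
  then show "F x = F l + (\<integral>y. g y \<partial>leb {l<..<x})" using ac_eq[OF a x] by simp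
qed

section \<open>The product rule\<close>

lemma finite_lebesgue_on_Ioo: "finite_measure (leb {l<..<u::real})"
  by (intro finite_measure_lebesgue_on bounded_set_imp_lmeasurable) auto

lemma sigma_finite_lebesgue_on_Ioo: "sigma_finite_measure (leb {l<..<u::real})"
  using finite_lebesgue_on_Ioo finite_measure.axioms by blast

text \<open>The strict and the non-strict cut differ by one point; each is used once, because the
  square is split into the triangles y < x and x \<le> y.\<close>

lemma indefinite_integral_indicator:
  fixes f :: "real \<Rightarrow> 'k::euclidean_space"
  assumes "y \<in> {l<..<u}"
  shows "(\<integral>x. f x \<partial>leb {l<..<y}) = (\<integral>x. indicator {..<y} x *\<^sub>R f x \<partial>leb {l<..<u})"
    "(\<integral>x. f x \<partial>leb {l<..<y}) = (\<integral>x. indicator {..y} x *\<^sub>R f x \<partial>leb {l<..<u})"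
proof -
  have "(\<integral>x. indicator {..<y} x *\<^sub>R f x \<partial>leb {l<..<u}) = (\<integral>x. indicator {l<..<y} x *\<^sub>R f x \<partial>leb {l<..<u})"
    by (intro Bochner_Integration.integral_cong) (auto simp: indicator_def)
  then show "(\<integral>x. f x \<partial>leb {l<..<y}) = (\<integral>x. indicator {..<y} x *\<^sub>R f x \<partial>leb {l<..<u})"
    using assms by (subst (asm) (2) integral_lebesgue_on_subset_indicator) auto
  have "(\<integral>x. indicator {..y} x *\<^sub>R f x \<partial>leb {l<..<u}) = (\<integral>x. indicator {l<..y} x *\<^sub>R f x \<partial>leb {l<..<u})"
    by (intro Bochner_Integration.integral_cong) (auto simp: indicator_def)
  also have "\<dots> = (\<integral>x. f x \<partial>leb {l<..y})"
    using assms by (subst integral_lebesgue_on_subset_indicator) auto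
  also have "\<dots> = (\<integral>x. f x \<partial>leb {l<..<y})"
    by (rule integral_lebesgue_on_cong_AE_set) (auto intro: eventually_mono[OF AE_lborel_real_singleton[of y]])
  finally show "(\<integral>x. f x \<partial>leb {l<..<y}) = (\<integral>x. indicator {..y} x *\<^sub>R f x \<partial>leb {l<..<u})" by simp
qed

text \<open>Fubini's theorem on the two triangles of the square.\<close>

lemma ac_product_endpoints:
  fixes f :: "real \<Rightarrow> 'a::euclidean_space" and g :: "real \<Rightarrow> 'b::euclidean_space"
    and B :: "'a \<Rightarrow> 'b \<Rightarrow> 'c::euclidean_space"
  assumes B: "bounded_bilinear B" and f: "integrable (leb {l<..<u}) f" and g: "integrable (leb {l<..<u}) g"
  defines "F \<equiv> \<lambda>x. \<integral>y. f y \<partial>leb {l<..<x}" and "G \<equiv> \<lambda>x. \<integral>y. g y \<partial>leb {l<..<x}"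
  shows "integrable (leb {l<..<u}) (\<lambda>x. B (f x) (G x))"
    "integrable (leb {l<..<u}) (\<lambda>x. B (F x) (g x))"
    "B (F u) (G u) = (\<integral>x. B (f x) (G x) \<partial>leb {l<..<u}) + (\<integral>x. B (F x) (g x) \<partial>leb {l<..<u})"
proof -
  let ?M = "leb {l<..<u}"
  interpret B: bounded_bilinear B by fact
  interpret pair_sigma_finite ?M ?M
    by (intro pair_sigma_finite.intro sigma_finite_lebesgue_on_Ioo)
  obtain K where K: "\<And>a b. norm (B a b) \<le> norm a * norm b * K" using B.bounded by blast
  have [measurable]: "f \<in> borel_measurable ?M" "g \<in> borel_measurable ?M" using f g by auto
  have idm[measurable]: "(\<lambda>x. x) \<in> borel_measurable ?M" by (rule borel_measurable_lebesgue_onI) auto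
  have Bm[measurable]: "(\<lambda>z. B (fst z) (snd z)) \<in> borel_measurable (borel \<Otimes>\<^sub>M borel)"
    unfolding borel_prod by (intro borel_measurable_continuous_onI) (auto intro!: continuous_intros B.continuous_on)
  have Bfg[measurable]: "(\<lambda>z. B (f (fst z)) (g (snd z))) \<in> borel_measurable (?M \<Otimes>\<^sub>M ?M)"
  proof -
    have "(\<lambda>z. (f (fst z), g (snd z))) \<in> (?M \<Otimes>\<^sub>M ?M) \<rightarrow>\<^sub>M borel \<Otimes>\<^sub>M borel" by measurable
    from measurable_comp[OF this Bm] show ?thesis by (simp add: comp_def)
  qed
  have int: "integrable (?M \<Otimes>\<^sub>M ?M) (\<lambda>z. B (f (fst z)) (g (snd z)))"
  proof (rule Bochner_Integration.integrable_bound)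
    show "integrable (?M \<Otimes>\<^sub>M ?M) (\<lambda>z. K * (norm (f (fst z)) * norm (g (snd z))))"
    proof (rule integrable_mult_right, rule Fubini_integrable)
      show "integrable ?M (\<lambda>x. \<integral>y. norm (norm (f (fst (x, y))) * norm (g (snd (x, y)))) \<partial>?M)"
        using f g by (simp add: abs_mult)
    qed (use g in auto)
    show "AE z in ?M \<Otimes>\<^sub>M ?M. norm (B (f (fst z)) (g (snd z))) \<le> norm (K * (norm (f (fst z)) * norm (g (snd z))))"
      using K by (intro AE_I2) (metis abs_ge_self mult.commute order_trans real_norm_def)
  qed (rule Bfg)
  \<comment> \<open>The integral over the whole square is \<open>B (F u) (G u)\<close>. On the
    triangle \<open>L\<close> integration over the second variable produces \<open>G x\<close>; on
    \<open>U\<close> integration over the first one produces \<open>F y\<close>.\<close>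
  define L where "L = (\<lambda>z. indicator {z. snd z < fst z} z *\<^sub>R B (f (fst z)) (g (snd z)))"
  define U where "U = (\<lambda>z. indicator {z. fst z \<le> snd z} z *\<^sub>R B (f (fst z)) (g (snd z)))"
  have "{z \<in> space (?M \<Otimes>\<^sub>M ?M). snd z < fst z} \<in> sets (?M \<Otimes>\<^sub>M ?M)" "{z \<in> space (?M \<Otimes>\<^sub>M ?M). fst z \<le> snd z} \<in> sets (?M \<Otimes>\<^sub>M ?M)"
    by measurable
  note tri = this
  have L: "integrable (?M \<Otimes>\<^sub>M ?M) L"
    using integrable_mult_indicator[OF tri(1) int]
    by (rule Bochner_Integration.integrable_cong[THEN iffD1, rotated 2]) (auto simp: L_def indicator_def)
  have U: "integrable (?M \<Otimes>\<^sub>M ?M) U"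
    using integrable_mult_indicator[OF tri(2) int]
    by (rule Bochner_Integration.integrable_cong[THEN iffD1, rotated 2]) (auto simp: U_def indicator_def)
  have Li: "(\<integral>y. L (x, y) \<partial>?M) = B (f x) (G x)" if "x \<in> space ?M" for x
  proof -
    have "L (x, y) = B (f x) (indicator {..<x} y *\<^sub>R g y)" for y by (auto simp: L_def indicator_def B.zero_right)
    then have "(\<integral>y. L (x, y) \<partial>?M) = (\<integral>y. B (f x) (indicator {..<x} y *\<^sub>R g y) \<partial>?M)" by simp
    also have "\<dots> = B (f x) (\<integral>y. indicator {..<x} y *\<^sub>R g y \<partial>?M)"
      by (intro integral_bounded_linear B.bounded_linear_right bounded_times_integrable[OF g, of _ 1] borel_measurable_lebesgue_onI) (auto simp: indicator_def)
    also have "(\<integral>y. indicator {..<x} y *\<^sub>R g y \<partial>?M) = G x"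
      unfolding G_def using that by (intro indefinite_integral_indicator(1)[symmetric]) auto
    finally show ?thesis .
  qed
  have Ui: "(\<integral>x. U (x, y) \<partial>?M) = B (F y) (g y)" if "y \<in> space ?M" for y
  proof -
    have "U (x, y) = B (indicator {..y} x *\<^sub>R f x) (g y)" for x by (auto simp: U_def indicator_def B.zero_left)
    then have "(\<integral>x. U (x, y) \<partial>?M) = (\<integral>x. B (indicator {..y} x *\<^sub>R f x) (g y) \<partial>?M)" by simp
    also have "\<dots> = B (\<integral>x. indicator {..y} x *\<^sub>R f x \<partial>?M) (g y)"
      by (intro integral_bounded_linear[of "\<lambda>a. B a (g y)"] B.bounded_linear_left bounded_times_integrable[OF f, of _ 1] borel_measurable_lebesgue_onI) (auto simp: indicator_def)
    also have "(\<integral>x. indicator {..y} x *\<^sub>R f x \<partial>?M) = F y"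
      unfolding F_def using that by (intro indefinite_integral_indicator(2)[symmetric]) auto
    finally show ?thesis .
  qed
  show 1: "integrable ?M (\<lambda>x. B (f x) (G x))"
    using integrable_fst'[OF L] by (rule Bochner_Integration.integrable_cong[THEN iffD1, rotated 2]) (use Li in auto)
  have U': "integrable (?M \<Otimes>\<^sub>M ?M) (case_prod (\<lambda>x y. U (x, y)))" using U by simp
  show 2: "integrable ?M (\<lambda>x. B (F x) (g x))"
    using integrable_snd[OF U'] by (rule Bochner_Integration.integrable_cong[THEN iffD1, rotated 2]) (use Ui in auto)
  have "B (F u) (G u) = (\<integral>x. B (f x) (G u) \<partial>?M)"
    unfolding F_def by (rule integral_bounded_linear[OF B.bounded_linear_left f, symmetric])
  also have "\<dots> = (\<integral>x. \<integral>y. B (f x) (g y) \<partial>?M \<partial>?M)"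
    unfolding G_def by (subst integral_bounded_linear[OF B.bounded_linear_right g]) simp
  also have "\<dots> = integral\<^sup>L (?M \<Otimes>\<^sub>M ?M) (\<lambda>z. B (f (fst z)) (g (snd z)))"
    using integral_fst'[OF int] by simp
  also have "\<dots> = integral\<^sup>L (?M \<Otimes>\<^sub>M ?M) (\<lambda>z. L z + U z)"
    by (intro Bochner_Integration.integral_cong) (auto simp: L_def U_def indicator_def)
  also have "\<dots> = integral\<^sup>L (?M \<Otimes>\<^sub>M ?M) L + integral\<^sup>L (?M \<Otimes>\<^sub>M ?M) U"
    by (rule Bochner_Integration.integral_add[OF L U])
  also have "integral\<^sup>L (?M \<Otimes>\<^sub>M ?M) L = (\<integral>x. B (f x) (G x) \<partial>?M)"
    unfolding integral_fst'[OF L, symmetric] by (rule Bochner_Integration.integral_cong) (use Li in auto)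
  also have "integral\<^sup>L (?M \<Otimes>\<^sub>M ?M) U = (\<integral>x. B (F x) (g x) \<partial>?M)"
    using integral_snd[OF U'] Bochner_Integration.integral_cong[OF refl Ui, of ?M] by simp
  finally show "B (F u) (G u) = (\<integral>x. B (f x) (G x) \<partial>?M) + (\<integral>x. B (F x) (g x) \<partial>?M)" .
qed

text \<open>A product rule for all bilinear operations at once: multiplication, scalar
  multiplication and the inner product are all integrated by parts later. Splitting off the values
  at \<open>l\<close> reduces it to primitives that vanish there.\<close>

lemma ac_bilinear:
  fixes f :: "real \<Rightarrow> 'a::euclidean_space" and g :: "real \<Rightarrow> 'b::euclidean_space"
    and B :: "'a \<Rightarrow> 'b \<Rightarrow> 'c::euclidean_space"
  assumes B: "bounded_bilinear B" and F: "ac l u F f" and G: "ac l u G g"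
  shows "ac l u (\<lambda>x. B (F x) (G x)) (\<lambda>x. B (f x) (G x) + B (F x) (g x))"
proof -
  interpret B: bounded_bilinear B by fact
  have *: "integrable (leb {l<..<x}) (\<lambda>x. B (f x) (G x) + B (F x) (g x)) \<and>
      B (F x) (G x) = B (F l) (G l) + (\<integral>y. B (f y) (G y) + B (F y) (g y) \<partial>leb {l<..<x})"
    if x: "x \<in> {l..u}" for x
  proof -
    let ?M = "leb {l<..<x}"
    have Fx: "ac l x F f" "ac l x G g" using F G x ac_restrict by auto
    note fg = ac_integrable[OF Fx(1)] ac_integrable[OF Fx(2)]
    note P = ac_product_endpoints[OF B fg]
    let ?F = "\<lambda>x. \<integral>y. f y \<partial>leb {l<..<x}" and ?G = "\<lambda>x. \<integral>y. g y \<partial>leb {l<..<x}"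
    have e: "B (f y) (G y) + B (F y) (g y) = (B (f y) (?G y) + B (F l) (g y)) + (B (f y) (G l) + B (?F y) (g y))"
      if "y \<in> space ?M" for y
      using that x ac_eq[OF F, of y] ac_eq[OF G, of y] by (simp add: B.add_left B.add_right)
    have i: "integrable ?M (\<lambda>y. B (f y) (G l))" "integrable ?M (\<lambda>y. B (F l) (g y))"
      using integrable_bounded_linear[OF B.bounded_linear_left fg(1)] integrable_bounded_linear[OF B.bounded_linear_right fg(2)] by auto
    have "integrable ?M (\<lambda>x. B (f x) (G x) + B (F x) (g x))"
      by (subst Bochner_Integration.integrable_cong[OF refl e]) (use P i in auto)
    moreover have "(\<integral>y. B (f y) (G y) + B (F y) (g y) \<partial>?M) = B (?F x) (?G x) + B (F l) (?G x) + B (?F x) (G l)"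
    proof -
      have "(\<integral>y. B (f y) (G y) + B (F y) (g y) \<partial>?M) =
          (\<integral>y. (B (f y) (?G y) + B (F l) (g y)) + (B (f y) (G l) + B (?F y) (g y)) \<partial>?M)"
        by (rule Bochner_Integration.integral_cong[OF refl e])
      also have "\<dots> = ((\<integral>y. B (f y) (?G y) \<partial>?M) + (\<integral>y. B (F l) (g y) \<partial>?M)) + ((\<integral>y. B (f y) (G l) \<partial>?M) + (\<integral>y. B (?F y) (g y) \<partial>?M))"
        using P(1,2) i by (simp only: Bochner_Integration.integral_add Bochner_Integration.integrable_add)
      also have "(\<integral>y. B (f y) (G l) \<partial>?M) = B (?F x) (G l)"
        by (rule integral_bounded_linear[OF B.bounded_linear_left fg(1)])
      also have "(\<integral>y. B (F l) (g y) \<partial>?M) = B (F l) (?G x)"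
        by (rule integral_bounded_linear[OF B.bounded_linear_right fg(2)])
      finally show ?thesis using P(3) by simp
    qed
    moreover have "B (F x) (G x) = B (F l) (G l) + (B (?F x) (?G x) + B (F l) (?G x) + B (?F x) (G l))"
      by (subst ac_eq[OF F x], subst ac_eq[OF G x]) (simp only: B.add_left B.add_right add_ac)
    ultimately show ?thesis by metis
  qed
  show ?thesis
  proof (cases "l \<le> u")
    case True
    show ?thesis
    proof (rule acI)
      show "integrable (leb {l<..<u}) (\<lambda>x. B (f x) (G x) + B (F x) (g x))"
        using *[of u] True by auto
    qed (rule conjunct2[OF *], simp)
  next
    case False
    then have "{l<..<u} = {}" "{l..u} = {}" by auto
    then show ?thesis by (simp add: ac_def)
  qed
qed

text \<open>The fundamental theorem for the gauge integral on the closed interval, transferred to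
  the Lebesgue integral on the open one.\<close>

lemma ac_C1:
  fixes F :: "real \<Rightarrow> 'k::euclidean_space"
  assumes F: "\<And>x. (F has_vector_derivative f x) (at x)" and f: "continuous_on UNIV f"
  shows "ac l u F f"
proof (rule acI)
  have i: "integrable (leb {l<..<x}) f" for x
    by (rule integrable_lebesgue_on_subset[of "{l..x}"])
      (auto intro: continuous_imp_integrable_real continuous_on_subset[OF f])
  show "integrable (leb {l<..<u}) f" by (rule i)
  fix x assume x: "l \<le> x" "x \<le> u"
  have "(f has_integral (F x - F l)) {l..x}"
    by (rule fundamental_theorem_of_calculus[OF x(1)]) (use F has_vector_derivative_at_within in blast)
  moreover have "(f has_integral (\<integral>y. f y \<partial>leb {l<..<x})) {l<..<x}"
    by (rule has_integral_integral_lebesgue_on[OF i]) auto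
  then have "(f has_integral (\<integral>y. f y \<partial>leb {l<..<x})) {l..x}"
    using has_integral_open_interval[of f _ l x] by simp
  ultimately have "F x - F l = (\<integral>y. f y \<partial>leb {l<..<x})" by (rule has_integral_unique)
  then show "F x = F l + (\<integral>y. f y \<partial>leb {l<..<x})" by (simp add: algebra_simps)
qed

lemma smooth_real_ac: "smooth_real f \<Longrightarrow> ac l u f (deriv f)"
  by (intro ac_C1 smooth_real_continuous smooth_real_deriv)
    (simp add: has_real_derivative_iff_has_vector_derivative[symmetric] smooth_real_deriv(1))

section \<open>Primitives of bumps and the lemma of du Bois-Reymond\<close>

lemma ac_test_by_parts:
  fixes F :: "real \<Rightarrow> 'k::euclidean_space"
  assumes \<phi>: "\<phi> \<in> ctest l u" and lu: "l < u" and F: "ac l u F f"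
  shows "integrable (leb {l<..<u}) (\<lambda>x. deriv \<phi> x *\<^sub>R F x)"
    "(\<integral>x. deriv \<phi> x *\<^sub>R F x \<partial>leb {l<..<u}) = - (\<integral>x. \<phi> x *\<^sub>R f x \<partial>leb {l<..<u})"
proof -
  let ?M = "leb {l<..<u}"
  have A: "ac l u (\<lambda>x. \<phi> x *\<^sub>R F x) (\<lambda>x. deriv \<phi> x *\<^sub>R F x + \<phi> x *\<^sub>R f x)"
    by (rule ac_bilinear[OF bounded_bilinear_scaleR smooth_real_ac[OF ctest_smooth[OF \<phi>]] F])
  have i: "integrable ?M (\<lambda>x. \<phi> x *\<^sub>R f x)" by (rule ctest_times_integrable[OF \<phi> ac_integrable[OF F]])
  show i2: "integrable ?M (\<lambda>x. deriv \<phi> x *\<^sub>R F x)"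
    using Bochner_Integration.integrable_diff[OF ac_integrable[OF A] i] by simp
  have "\<phi> l = 0" "\<phi> u = 0" using \<phi> by (auto simp: ctest_def)
  then have "(\<integral>x. deriv \<phi> x *\<^sub>R F x + \<phi> x *\<^sub>R f x \<partial>?M) = 0" using ac_eq[OF A, of u] lu by simp
  then show "(\<integral>x. deriv \<phi> x *\<^sub>R F x \<partial>?M) = - (\<integral>x. \<phi> x *\<^sub>R f x \<partial>?M)"
    using i i2 by (simp add: add_eq_0_iff2)
qed

text \<open>A primitive on the whole line, unlike an integral from \<open>l\<close>, which is
  controlled only to the right of \<open>l\<close>. For l < u the number
  \<open>antideriv l \<eta> u\<close> is the total mass of \<open>\<eta>\<close> on (l, u).\<close>

definition antideriv :: "real \<Rightarrow> (real \<Rightarrow> real) \<Rightarrow> real \<Rightarrow> real" where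
  "antideriv l \<eta> = (SOME F. F l = 0 \<and> (\<forall>x. (F has_real_derivative \<eta> x) (at x)))"

lemma antideriv:
  assumes "smooth_real \<eta>"
  shows "antideriv l \<eta> l = 0" "(antideriv l \<eta> has_real_derivative \<eta> x) (at x)"
proof -
  have "\<exists>F. \<forall>x :: real. -\<infinity> < ereal x \<longrightarrow> x < \<infinity> \<longrightarrow> (F has_vector_derivative \<eta> x) (at x)"
    by (rule einterval_antiderivative) (auto intro!: DERIV_isCont smooth_real_deriv assms)
  then obtain F where F: "\<And>x. (F has_real_derivative \<eta> x) (at x)"
    by (auto simp: has_real_derivative_iff_has_vector_derivative)
  have "\<exists>F. F l = 0 \<and> (\<forall>x. (F has_real_derivative \<eta> x) (at x))"
    by (rule exI[of _ "\<lambda>x. F x - F l"]) (auto intro!: derivative_eq_intros F)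
  from someI_ex[OF this]
  show "antideriv l \<eta> l = 0" "(antideriv l \<eta> has_real_derivative \<eta> x) (at x)"
    unfolding antideriv_def by blast+
qed

lemma antideriv_eq_integral:
  assumes "smooth_real \<eta>" "l \<le> x" shows "antideriv l \<eta> x = (\<integral>x. \<eta> x \<partial>leb {l<..<x})"
proof -
  have "ac l x (antideriv l \<eta>) \<eta>"
    by (rule ac_C1) (use antideriv[OF assms(1)] smooth_real_continuous[OF assms(1)] in \<open>auto simp: has_real_derivative_iff_has_vector_derivative\<close>)
  from ac_eq[OF this, of x] show ?thesis using assms antideriv(1)[OF assms(1)] by simp
qed

text \<open>A primitive is constant where the bump vanishes. This keeps the supports of the
  functions in \<open>prims\<close> inside (l, u), and the positive mass supplies a bump to
  normalise with.\<close>

lemma antideriv_bump: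
  assumes "l < r" "r < s"
  shows "x \<le> r \<Longrightarrow> antideriv l (bump r s n) x = 0"
    and "s \<le> x \<Longrightarrow> antideriv l (bump r s n) x = antideriv l (bump r s n) s"
    and "0 < n \<Longrightarrow> 0 < antideriv l (bump r s n) s"
proof -
  let ?F = "antideriv l (bump r s n)"
  note d = antideriv(2)[OF smooth_bump, of l r s n]
  have c: "continuous_on S ?F" for S using d DERIV_isCont continuous_at_imp_continuous_on by blast
  have e: "?F x = ?F y" if "x \<le> y" "\<And>z. x < z \<Longrightarrow> z < y \<Longrightarrow> z \<notin> {r<..<s}" for x y
  proof (cases "x = y")
    case False
    then show ?thesis using that
    proof (intro DERIV_isconst_end[of x y ?F, symmetric] c)
      fix z assume "x < z" "z < y"
      then show "(?F has_real_derivative 0) (at z)" using that(2)[of z] by (intro d[THEN DERIV_cong] bump_outside)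
    qed auto
  qed simp
  show *: "?F x = 0" if "x \<le> r" for x
    using e[of x l] e[of l x] antideriv(1)[OF smooth_bump, of l r s n] that assms by (cases "x \<le> l") auto
  show "s \<le> x \<Longrightarrow> ?F x = ?F s" using e[of s x] by auto
  assume n: "0 < n"
  have "?F r < ?F s"
    by (rule DERIV_pos_imp_increasing_open[OF assms(2) _ c]) (use d bump_pos[OF _ n] in \<open>fastforce\<close>)
  then show "0 < ?F s" using *[of r] by simp
qed

text \<open>The primitives of linear combinations of two bump functions with vanishing integral form a
  countable set of test functions that suffices to recognise weak derivatives.\<close>

definition prims :: "real \<Rightarrow> real \<Rightarrow> (real \<Rightarrow> real) set" where
  "prims l u = (\<lambda>(\<eta>, \<eta>') x. antideriv l \<eta>' u * antideriv l \<eta> x - antideriv l \<eta> u * antideriv l \<eta>' x) ` (bumps l u \<times> bumps l u)"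

lemma countable_prims: "countable (prims l u)"
  unfolding prims_def by (intro countable_image countable_SIGMA countable_bumps)

lemma prims_deriv:
  assumes "\<phi> = (\<lambda>x. antideriv l \<eta>' u * antideriv l \<eta> x - antideriv l \<eta> u * antideriv l \<eta>' x)" "smooth_real \<eta>" "smooth_real \<eta>'"
  shows "smooth_real \<phi>" "deriv \<phi> x = antideriv l \<eta>' u * \<eta> x - antideriv l \<eta> u * \<eta>' x"
proof -
  have d: "(\<phi> has_real_derivative antideriv l \<eta>' u * \<eta> x - antideriv l \<eta> u * \<eta>' x) (at x)" for x
    unfolding assms(1) by (intro DERIV_diff DERIV_cmult antideriv assms)
  show "smooth_real \<phi>"
    by (rule smooth_real_antideriv[OF _ d]) (intro smooth_real_diff smooth_real_mult smooth_real_const assms)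
  show "deriv \<phi> x = antideriv l \<eta>' u * \<eta> x - antideriv l \<eta> u * \<eta>' x"
    by (rule DERIV_imp_deriv[OF d])
qed

lemma prims_ctest:
  assumes "\<phi> \<in> prims l u" shows "\<phi> \<in> ctest l u"
proof -
  from assms obtain r s n r' s' n' where
    \<phi>: "\<phi> = (\<lambda>x. antideriv l (bump r' s' n') u * antideriv l (bump r s n) x - antideriv l (bump r s n) u * antideriv l (bump r' s' n') x)"
    and o: "l < r" "r < s" "s < u" "l < r'" "r' < s'" "s' < u"
    by (auto simp: prims_def bumps_def)
  have "\<phi> x = 0" if "x \<notin> {min r r'..max s s'}" for x
  proof -
    have "x \<le> r \<and> x \<le> r' \<or> s \<le> x \<and> s' \<le> x"
      using that unfolding atLeastAtMost_iff by linarith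
    then consider "x \<le> r" "x \<le> r'" | "s \<le> x" "s' \<le> x" by blast
    then show ?thesis
    proof cases
      case 1
      then show ?thesis using o by (simp add: \<phi> antideriv_bump(1))
    next
      case 2
      then show ?thesis using o antideriv_bump(2)[of l r s x n] antideriv_bump(2)[of l r s u n]
          antideriv_bump(2)[of l r' s' x n'] antideriv_bump(2)[of l r' s' u n'] by (simp add: \<phi>)
    qed
  qed
  then show ?thesis
    unfolding ctest_def using prims_deriv(1)[OF \<phi> smooth_bump smooth_bump] o
    by (intro CollectI conjI exI[of _ "min r r'"] exI[of _ "max s s'"]) auto
qed

lemma ex_bump_pos:
  assumes "l < u" obtains \<eta> where "\<eta> \<in> bumps l u" "0 < antideriv l \<eta> u"
proof -
  obtain r where r: "r \<in> \<rat>" "l < r" "r < u" using Rats_dense_in_real[OF assms] by blast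
  obtain s where s: "s \<in> \<rat>" "r < s" "s < u" using Rats_dense_in_real[OF r(3)] by blast
  have "bump r s 1 \<in> bumps l u" using r s by (auto simp: bumps_def)
  moreover have "0 < antideriv l (bump r s 1) u"
    using antideriv_bump(3)[OF r(2) s(2), of 1] antideriv_bump(2)[OF r(2) s(2), of u 1] s by simp
  ultimately show thesis by (rule that)
qed

text \<open>With one bump \<open>\<eta>0\<close> of positive mass fixed, each \<open>\<eta>\<close>
  minus a suitable multiple of it has mean zero and is, up to a factor, the derivative of a member
  of \<open>prims\<close>. The constant is written as the mean of \<open>w\<close>, so that it
  depends measurably on a parameter when \<open>w\<close> is a slice.\<close>

lemma du_Bois_Reymond:
  fixes w :: "real \<Rightarrow> 'k::euclidean_space"
  assumes lu: "l < u" and w: "integrable (leb {l<..<u}) w"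
    and z: "\<And>\<phi>. \<phi> \<in> prims l u \<Longrightarrow> (\<integral>x. deriv \<phi> x *\<^sub>R w x \<partial>leb {l<..<u}) = 0"
  shows "AE x in leb {l<..<u}. w x = (1 / (u - l)) *\<^sub>R (\<integral>x. w x \<partial>leb {l<..<u})"
proof -
  let ?M = "leb {l<..<u}"
  interpret M: finite_measure ?M by (rule finite_lebesgue_on_Ioo)
  obtain \<eta>0 where \<eta>0: "\<eta>0 \<in> bumps l u" "0 < antideriv l \<eta>0 u" using ex_bump_pos[OF lu] .
  \<comment> \<open>The value that a constant \<open>w\<close> must have, read off by testing with
    \<open>\<eta>0\<close>.\<close>
  define c where "c = (1 / antideriv l \<eta>0 u) *\<^sub>R (\<integral>x. \<eta>0 x *\<^sub>R w x \<partial>?M)"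
  have ae: "AE x in ?M. w x - c = 0"
  proof (rule fundamental_lemma)
    show "integrable ?M (\<lambda>x. w x - c)" using w by auto
    fix \<eta> assume \<eta>: "\<eta> \<in> bumps l u"
    have s: "smooth_real \<eta>" "smooth_real \<eta>0" using \<eta> \<eta>0 by (auto simp: bumps_def smooth_bump)
    define \<phi> where "\<phi> = (\<lambda>x. antideriv l \<eta>0 u * antideriv l \<eta> x - antideriv l \<eta> u * antideriv l \<eta>0 x)"
    have "\<phi> \<in> prims l u" unfolding prims_def \<phi>_def using \<eta> \<eta>0 by (intro image_eqI[of _ _ "(\<eta>, \<eta>0)"]) auto
    from z[OF this] have "(\<integral>x. antideriv l \<eta>0 u *\<^sub>R (\<eta> x *\<^sub>R w x) - antideriv l \<eta> u *\<^sub>R (\<eta>0 x *\<^sub>R w x) \<partial>?M) = 0"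
      by (simp add: prims_deriv(2)[OF \<phi>_def s] scaleR_diff_left)
    then have e: "antideriv l \<eta>0 u *\<^sub>R (\<integral>x. \<eta> x *\<^sub>R w x \<partial>?M) = antideriv l \<eta> u *\<^sub>R (\<integral>x. \<eta>0 x *\<^sub>R w x \<partial>?M)"
      using ctest_times_integrable[OF bumps_ctest[OF \<eta>] w] ctest_times_integrable[OF bumps_ctest[OF \<eta>0(1)] w]
      by (simp del: scaleR_scaleR)
    have "(\<integral>x. \<eta> x *\<^sub>R w x \<partial>?M) = (1 / antideriv l \<eta>0 u) *\<^sub>R (antideriv l \<eta>0 u *\<^sub>R (\<integral>x. \<eta> x *\<^sub>R w x \<partial>?M))"
      using \<eta>0 by simp
    also have "\<dots> = antideriv l \<eta> u *\<^sub>R c" unfolding e c_def by simp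
    also have "antideriv l \<eta> u *\<^sub>R c = (\<integral>x. \<eta> x *\<^sub>R c \<partial>?M)"
      using lu antideriv_eq_integral[OF s(1), of l u] ctest_times_integrable[OF bumps_ctest[OF \<eta>], of "{l<..<u}" "\<lambda>x. 1 :: real"] by simp
    finally show "(\<integral>x. \<eta> x *\<^sub>R (w x - c) \<partial>?M) = 0"
      using ctest_times_integrable[OF bumps_ctest[OF \<eta>] w] ctest_times_integrable[OF bumps_ctest[OF \<eta>], of "{l<..<u}" "\<lambda>x. c"]
      by (simp add: scaleR_diff_right)
  qed
  have "(\<integral>x. w x \<partial>?M) = (\<integral>x. c \<partial>?M)"
    using w ae by (intro integral_cong_AE) (auto elim: eventually_mono)
  also have "\<dots> = (u - l) *\<^sub>R c" using lu by (simp add: measure_restrict_space)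
  finally show ?thesis using ae lu by (auto elim: eventually_mono)
qed

text \<open>Subtracting the primitive \<open>S\<close> of \<open>v\<close> leaves a function with
  vanishing weak derivative, to which the lemma of du Bois-Reymond applies.\<close>

lemma weak_derivative_ac:
  fixes w v :: "real \<Rightarrow> 'k::euclidean_space"
  assumes lu: "l < u" and w: "integrable (leb {l<..<u}) w" and v: "integrable (leb {l<..<u}) v"
    and z: "\<And>\<phi>. \<phi> \<in> prims l u \<Longrightarrow> (\<integral>x. deriv \<phi> x *\<^sub>R w x \<partial>leb {l<..<u}) = - (\<integral>x. \<phi> x *\<^sub>R v x \<partial>leb {l<..<u})"
  defines "S \<equiv> \<lambda>x. \<integral>y. v y \<partial>leb {l<..<x}"
  shows "AE x in leb {l<..<u}. w x = (1 / (u - l)) *\<^sub>R (\<integral>x. w x - S x \<partial>leb {l<..<u}) + S x"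
proof -
  let ?M = "leb {l<..<u}"
  have S: "ac l u S v" using ac_indefinite_integral[OF v, of 0] by (simp add: S_def)
  have Si: "integrable ?M S"
    using ac_product_endpoints(1)[OF bounded_bilinear_scaleR, of l u "\<lambda>x. 1" v] v finite_lebesgue_on_Ioo[of l u]
    by (simp add: S_def finite_measure.integrable_const)
  have "AE x in ?M. w x - S x = (1 / (u - l)) *\<^sub>R (\<integral>x. w x - S x \<partial>?M)"
  proof (rule du_Bois_Reymond[OF lu])
    show "integrable ?M (\<lambda>x. w x - S x)" using w Si by auto
    fix \<phi> assume \<phi>: "\<phi> \<in> prims l u"
    note c = prims_ctest[OF \<phi>]
    show "(\<integral>x. deriv \<phi> x *\<^sub>R (w x - S x) \<partial>?M) = 0"
      using z[OF \<phi>] ac_test_by_parts[OF c lu S] ctest_times_integrable[OF ctest_deriv[OF c] w]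
      by (simp add: scaleR_diff_right)
  qed
  then show ?thesis by (auto elim: eventually_mono simp: algebra_simps)
qed

section \<open>Weak derivatives on rectangles\<close>

lemma tensor_times_integrable:
  fixes k :: "real \<times> real \<Rightarrow> 'k::euclidean_space"
  assumes k: "integrable (leb S) k" and h: "h1 \<in> ctest a b" "h2 \<in> ctest l r"
  shows "integrable (leb S) (\<lambda>z. (h1 (fst z) * h2 (snd z)) *\<^sub>R k z)"
proof -
  obtain C1 where C1: "\<And>x. \<bar>h1 x\<bar> \<le> C1" using ctest_bounded[OF h(1)] by (auto simp: bounded_iff)
  obtain C2 where C2: "\<And>x. \<bar>h2 x\<bar> \<le> C2" using ctest_bounded[OF h(2)] by (auto simp: bounded_iff)
  have [measurable]: "h1 \<in> borel_measurable borel" "h2 \<in> borel_measurable borel"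
    using h smooth_real_measurable ctest_smooth by blast+
  show ?thesis
  proof (rule bounded_times_integrable[OF k borel_measurable_lebesgue_onI])
    show "(\<lambda>z. h1 (fst z) * h2 (snd z)) \<in> borel_measurable borel"
      unfolding borel_prod[symmetric] by measurable
    show "\<bar>h1 (fst z) * h2 (snd z)\<bar> \<le> C1 * C2" for z
      using mult_mono'[OF C1[of "fst z"] C2[of "snd z"]] by (simp add: abs_mult)
  qed
qed

text \<open>For each fixed \<open>\<phi>\<close> the fundamental lemma in the first variable removes
  the factor \<open>\<theta>\<close>. As \<open>prims\<close> is countable, one null set of
  \<open>t\<close> serves all \<open>\<phi>\<close>, and the one-dimensional result applies on the
  remaining slices.\<close>

lemma slice_weak_derivative:
  fixes f g :: "real \<times> real \<Rightarrow> 'k::euclidean_space"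
  assumes lr: "l < r" and f: "integrable (leb ({a<..<b} \<times> {l<..<r})) f"
    and g: "integrable (leb ({a<..<b} \<times> {l<..<r})) g"
    and w: "\<And>\<theta> \<phi>. \<theta> \<in> bumps a b \<Longrightarrow> \<phi> \<in> prims l r \<Longrightarrow>
        (\<integral>z. (\<theta> (fst z) * deriv \<phi> (snd z)) *\<^sub>R f z \<partial>leb ({a<..<b} \<times> {l<..<r})) =
        - (\<integral>z. (\<theta> (fst z) * \<phi> (snd z)) *\<^sub>R g z \<partial>leb ({a<..<b} \<times> {l<..<r}))"
  defines "S \<equiv> \<lambda>t x. \<integral>y. g (t, y) \<partial>leb {l<..<x}"
  shows "AE t in leb {a<..<b}. AE x in leb {l<..<r}.
    f (t, x) = (1 / (r - l)) *\<^sub>R (\<integral>x. f (t, x) - S t x \<partial>leb {l<..<r}) + S t x"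
proof -
  let ?A = "leb {a<..<b}" and ?B = "leb {l<..<r}" and ?M = "leb ({a<..<b} \<times> {l<..<r})"
  note i = tensor_times_integrable[of "{a<..<b} \<times> {l<..<r}"]
  have sl: "AE t in ?A. (\<integral>x. deriv \<phi> x *\<^sub>R f (t, x) \<partial>?B) + (\<integral>x. \<phi> x *\<^sub>R g (t, x) \<partial>?B) = 0"
    if \<phi>: "\<phi> \<in> prims l r" for \<phi>
  proof (rule fundamental_lemma)
    note c = prims_ctest[OF \<phi>]
    have int: "integrable ?A (\<lambda>t. (\<integral>x. h x *\<^sub>R k (t, x) \<partial>?B))"
      if h: "h \<in> ctest l r" and k: "integrable ?M k" for h and k :: "real \<times> real \<Rightarrow> 'k"
    proof -
      obtain C where C: "\<And>x. \<bar>h x\<bar> \<le> C" using ctest_bounded[OF h] by (auto simp: bounded_iff)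
      have [measurable]: "h \<in> borel_measurable borel" using h smooth_real_measurable ctest_smooth by blast
      have "(\<lambda>z :: real \<times> real. h (snd z)) \<in> borel_measurable borel"
      unfolding borel_prod[symmetric] by measurable
      then have "integrable ?M (\<lambda>z. h (snd z) *\<^sub>R k z)"
        using C by (intro bounded_times_integrable[OF k borel_measurable_lebesgue_onI])
      from integrable_integral_lebesgue_on_slice[OF _ _ this] show ?thesis by simp
    qed
    note I = int[OF ctest_deriv[OF c] f] int[OF c g]
    show "integrable ?A (\<lambda>t. (\<integral>x. deriv \<phi> x *\<^sub>R f (t, x) \<partial>?B) + (\<integral>x. \<phi> x *\<^sub>R g (t, x) \<partial>?B))"
      using I by (rule Bochner_Integration.integrable_add)
    fix \<theta> assume \<theta>: "\<theta> \<in> bumps a b"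
    note c' = bumps_ctest[OF \<theta>]
    have e: "(\<integral>t. \<theta> t *\<^sub>R (\<integral>x. h x *\<^sub>R k (t, x) \<partial>?B) \<partial>?A) = (\<integral>z. (\<theta> (fst z) * h (snd z)) *\<^sub>R k z \<partial>?M)"
      if "h \<in> ctest l r" "integrable ?M k" for h and k :: "real \<times> real \<Rightarrow> 'k"
    proof -
      have "(\<integral>t. \<theta> t *\<^sub>R (\<integral>x. h x *\<^sub>R k (t, x) \<partial>?B) \<partial>?A) = (\<integral>t. \<integral>x. (\<theta> t * h x) *\<^sub>R k (t, x) \<partial>?B \<partial>?A)"
        by (simp flip: scaleR_scaleR)
      then show ?thesis
        using integral_lebesgue_on_slice[OF _ _ i[OF that(2) c' that(1)]] by simp
    qed
    show "(\<integral>t. \<theta> t *\<^sub>R ((\<integral>x. deriv \<phi> x *\<^sub>R f (t, x) \<partial>?B) + (\<integral>x. \<phi> x *\<^sub>R g (t, x) \<partial>?B)) \<partial>?A) = 0"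
      using ctest_times_integrable[OF c' I(1)] ctest_times_integrable[OF c' I(2)] e[OF ctest_deriv[OF c] f] e[OF c g] w[OF \<theta> \<phi>]
      by (simp add: scaleR_add_right)
  qed
  have "AE t in ?A. \<forall>\<phi>\<in>prims l r. (\<integral>x. deriv \<phi> x *\<^sub>R f (t, x) \<partial>?B) + (\<integral>x. \<phi> x *\<^sub>R g (t, x) \<partial>?B) = 0"
    using sl by (simp add: AE_ball_countable[OF countable_prims])
  moreover have "AE t in ?A. integrable ?B (\<lambda>x. f (t, x))" "AE t in ?A. integrable ?B (\<lambda>x. g (t, x))"
    using AE_integrable_lebesgue_on_slice[OF _ _ f] AE_integrable_lebesgue_on_slice[OF _ _ g] by auto
  ultimately show ?thesis
  proof eventually_elim
    case (elim t)
    show ?case unfolding S_def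
      by (rule weak_derivative_ac[OF lr elim(2,3)]) (use elim(1) in \<open>simp add: add_eq_0_iff2\<close>)
  qed
qed

lemma mult_of_real_scaleR: "(x :: 'k::real_normed_field) * of_real c = c *\<^sub>R x"
  by (simp add: scaleR_conv_of_real mult.commute)

lemma has_wderiv_tensor:
  fixes f g :: "real \<times> real \<Rightarrow> 'k::{real_normed_field, euclidean_space}"
  assumes "\<theta> \<in> ctest a b" "\<phi> \<in> ctest l r"
  shows "has_wderiv ({a<..<b} \<times> {l<..<r}) (0, 1) f g \<Longrightarrow>
        (\<integral>z. (\<theta> (fst z) * deriv \<phi> (snd z)) *\<^sub>R f z \<partial>leb ({a<..<b} \<times> {l<..<r})) =
        - (\<integral>z. (\<theta> (fst z) * \<phi> (snd z)) *\<^sub>R g z \<partial>leb ({a<..<b} \<times> {l<..<r}))"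
    "has_wderiv ({a<..<b} \<times> {l<..<r}) (1, 0) f g \<Longrightarrow>
        (\<integral>z. (deriv \<theta> (fst z) * \<phi> (snd z)) *\<^sub>R f z \<partial>leb ({a<..<b} \<times> {l<..<r})) =
        - (\<integral>z. (\<theta> (fst z) * \<phi> (snd z)) *\<^sub>R g z \<partial>leb ({a<..<b} \<times> {l<..<r}))"
proof -
  note t = test_funs_tensor[OF assms, where 'k='k] and p = partials_tensor[OF ctest_smooth ctest_smooth, OF assms, where 'k='k]
  show "(\<integral>z. (\<theta> (fst z) * deriv \<phi> (snd z)) *\<^sub>R f z \<partial>leb ({a<..<b} \<times> {l<..<r})) =
        - (\<integral>z. (\<theta> (fst z) * \<phi> (snd z)) *\<^sub>R g z \<partial>leb ({a<..<b} \<times> {l<..<r}))"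
    if "has_wderiv ({a<..<b} \<times> {l<..<r}) (0, 1) f g"
    using that t unfolding has_wderiv_def p mult_of_real_scaleR[symmetric]
    by (auto simp only: p dest!: bspec[where x="\<lambda>z. of_real (\<theta> (fst z) * \<phi> (snd z))"])
  show "(\<integral>z. (deriv \<theta> (fst z) * \<phi> (snd z)) *\<^sub>R f z \<partial>leb ({a<..<b} \<times> {l<..<r})) =
        - (\<integral>z. (\<theta> (fst z) * \<phi> (snd z)) *\<^sub>R g z \<partial>leb ({a<..<b} \<times> {l<..<r}))"
    if "has_wderiv ({a<..<b} \<times> {l<..<r}) (1, 0) f g"
    using that t unfolding has_wderiv_def p mult_of_real_scaleR[symmetric]
    by (auto simp only: p dest!: bspec[where x="\<lambda>z. of_real (\<theta> (fst z) * \<phi> (snd z))"])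
qed

lemma has_wderiv_slice_x:
  fixes f g :: "real \<times> real \<Rightarrow> 'k::{real_normed_field, euclidean_space}"
  assumes lr: "l < r" and f: "integrable (leb ({a<..<b} \<times> {l<..<r})) f"
    and g: "integrable (leb ({a<..<b} \<times> {l<..<r})) g"
    and w: "has_wderiv ({a<..<b} \<times> {l<..<r}) (0, 1) f g"
  defines "S \<equiv> \<lambda>t x. \<integral>y. g (t, y) \<partial>leb {l<..<x}"
  shows "AE t in leb {a<..<b}. AE x in leb {l<..<r}.
    f (t, x) = (1 / (r - l)) *\<^sub>R (\<integral>x. f (t, x) - S t x \<partial>leb {l<..<r}) + S t x"
  unfolding S_def
  by (rule slice_weak_derivative[OF lr f g]) (intro has_wderiv_tensor(1) bumps_ctest prims_ctest w)

lemma has_wderiv_slice_t: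
  fixes f g :: "real \<times> real \<Rightarrow> 'k::{real_normed_field, euclidean_space}"
  assumes ab: "a < b" and f: "integrable (leb ({a<..<b} \<times> {l<..<r})) f"
    and g: "integrable (leb ({a<..<b} \<times> {l<..<r})) g"
    and w: "has_wderiv ({a<..<b} \<times> {l<..<r}) (1, 0) f g"
  defines "S \<equiv> \<lambda>x t. \<integral>s. g (s, x) \<partial>leb {a<..<t}"
  shows "AE x in leb {l<..<r}. AE t in leb {a<..<b}.
    f (t, x) = (1 / (b - a)) *\<^sub>R (\<integral>t. f (t, x) - S x t \<partial>leb {a<..<b}) + S x t"
proof -
  let ?M = "leb ({a<..<b} \<times> {l<..<r})" and ?N = "leb ({l<..<r} \<times> {a<..<b})"
  have e: "(\<integral>z. h (snd z, fst z) *\<^sub>R k (snd z, fst z) \<partial>?N) = (\<integral>z. h z *\<^sub>R k z \<partial>?M)"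
    if "integrable ?M (\<lambda>z. h z *\<^sub>R k z)" for h and k :: "real \<times> real \<Rightarrow> 'k"
    using integral_lebesgue_on_swap[OF _ _ that] by simp
  note i = tensor_times_integrable[of "{a<..<b} \<times> {l<..<r}"]
  have "AE x in leb {l<..<r}. AE t in leb {a<..<b}.
      (\<lambda>z. f (snd z, fst z)) (x, t) = (1 / (b - a)) *\<^sub>R (\<integral>t. (\<lambda>z. f (snd z, fst z)) (x, t) - (\<integral>s. (\<lambda>z. g (snd z, fst z)) (x, s) \<partial>leb {a<..<t}) \<partial>leb {a<..<b})
        + (\<integral>s. (\<lambda>z. g (snd z, fst z)) (x, s) \<partial>leb {a<..<t})"
  proof (rule slice_weak_derivative[OF ab])
    show "integrable ?N (\<lambda>z. f (snd z, fst z))" "integrable ?N (\<lambda>z. g (snd z, fst z))"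
      using f g by (auto intro!: integrable_lebesgue_on_swap)
    fix \<theta> \<phi> assume "\<theta> \<in> bumps l r" "\<phi> \<in> prims a b"
    then have c: "\<theta> \<in> ctest l r" "\<phi> \<in> ctest a b" by (auto intro: bumps_ctest prims_ctest)
    show "(\<integral>z. (\<theta> (fst z) * deriv \<phi> (snd z)) *\<^sub>R f (snd z, fst z) \<partial>?N) = - (\<integral>z. (\<theta> (fst z) * \<phi> (snd z)) *\<^sub>R g (snd z, fst z) \<partial>?N)"
      using has_wderiv_tensor(2)[OF c(2,1) w] e[OF i[OF f ctest_deriv[OF c(2)] c(1)]] e[OF i[OF g c(2,1)]]
      by (simp add: mult.commute)
  qed
  then show ?thesis by (simp add: S_def)
qed

text \<open>The one-dimensional lemma is used in the first variable for each \<open>\<eta>\<close>,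
  and then in the second one for almost every \<open>t\<close>; integrating the norm of
  \<open>f\<close> turns the result on slices into one on the rectangle.\<close>

lemma fundamental_lemma_rectangle:
  fixes f :: "real \<times> real \<Rightarrow> 'k::euclidean_space"
  assumes f: "integrable (leb ({a<..<b} \<times> {l<..<r})) f"
    and z: "\<And>\<theta> \<eta>. \<theta> \<in> bumps a b \<Longrightarrow> \<eta> \<in> bumps l r \<Longrightarrow>
      (\<integral>z. (\<theta> (fst z) * \<eta> (snd z)) *\<^sub>R f z \<partial>leb ({a<..<b} \<times> {l<..<r})) = 0"
  shows "AE z in leb ({a<..<b} \<times> {l<..<r}). f z = 0"
proof -
  let ?A = "leb {a<..<b}" and ?B = "leb {l<..<r}" and ?M = "leb ({a<..<b} \<times> {l<..<r})"
  have sl: "AE t in ?A. (\<integral>x. \<eta> x *\<^sub>R f (t, x) \<partial>?B) = 0" if \<eta>: "\<eta> \<in> bumps l r" for \<eta>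
  proof (rule fundamental_lemma)
    note c = bumps_ctest[OF \<eta>]
    obtain C where C: "\<And>x. \<bar>\<eta> x\<bar> \<le> C" using ctest_bounded[OF c] by (auto simp: bounded_iff)
    have [measurable]: "\<eta> \<in> borel_measurable borel" using c smooth_real_measurable ctest_smooth by blast
    have "(\<lambda>z :: real \<times> real. \<eta> (snd z)) \<in> borel_measurable borel"
      unfolding borel_prod[symmetric] by measurable
    then have i: "integrable ?M (\<lambda>z. \<eta> (snd z) *\<^sub>R f z)"
      using C by (intro bounded_times_integrable[OF f borel_measurable_lebesgue_onI])
    from integrable_integral_lebesgue_on_slice[OF _ _ this]
    show "integrable ?A (\<lambda>t. \<integral>x. \<eta> x *\<^sub>R f (t, x) \<partial>?B)" by simp
    fix \<theta> assume \<theta>: "\<theta> \<in> bumps a b"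
    note c' = bumps_ctest[OF \<theta>]
    obtain C' where C': "\<And>x. \<bar>\<theta> x\<bar> \<le> C'" using ctest_bounded[OF c'] by (auto simp: bounded_iff)
    have [measurable]: "\<theta> \<in> borel_measurable borel" using c' smooth_real_measurable ctest_smooth by blast
    have "(\<lambda>z :: real \<times> real. \<theta> (fst z)) \<in> borel_measurable borel"
      unfolding borel_prod[symmetric] by measurable
    then have i': "integrable ?M (\<lambda>z. \<theta> (fst z) *\<^sub>R (\<eta> (snd z) *\<^sub>R f z))"
      using C' by (intro bounded_times_integrable[OF i borel_measurable_lebesgue_onI])
    show "(\<integral>t. \<theta> t *\<^sub>R (\<integral>x. \<eta> x *\<^sub>R f (t, x) \<partial>?B) \<partial>?A) = 0"
    proof -
      have "(\<integral>z. \<theta> (fst z) *\<^sub>R (\<eta> (snd z) *\<^sub>R f z) \<partial>?M) = 0" using z[OF \<theta> \<eta>] by simp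
      then show ?thesis using integral_lebesgue_on_slice[OF _ _ i'] by (simp del: scaleR_scaleR)
    qed
  qed
  have "AE t in ?A. \<forall>\<eta>\<in>bumps l r. (\<integral>x. \<eta> x *\<^sub>R f (t, x) \<partial>?B) = 0"
    using sl by (simp add: AE_ball_countable[OF countable_bumps])
  moreover have "AE t in ?A. integrable ?B (\<lambda>x. f (t, x))"
    using AE_integrable_lebesgue_on_slice[OF _ _ f] by auto
  ultimately have "AE t in ?A. AE x in ?B. f (t, x) = 0"
    by eventually_elim (auto intro: fundamental_lemma)
  then have ae: "AE t in ?A. (\<integral>x. norm (f (t, x)) \<partial>?B) = 0"
    by eventually_elim (auto intro: integral_eq_zero_AE)
  have "(\<integral>z. norm (f z) \<partial>?M) = (\<integral>t. \<integral>x. norm (f (t, x)) \<partial>?B \<partial>?A)"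
    using f by (intro integral_lebesgue_on_slice[symmetric]) auto
  also have "\<dots> = 0" by (rule integral_eq_zero_AE[OF ae])
  finally have "AE z in ?M. norm (f z) = 0"
    using f by (subst (asm) integral_nonneg_eq_0_iff_AE) auto
  then show ?thesis by simp
qed

section \<open>Uniqueness of weak derivatives\<close>

lemma locally_integrable_on_box:
  fixes f :: "'a::euclidean_space \<Rightarrow> 'k::{real_normed_field, euclidean_space}"
  assumes "locally_integrable \<Omega> f" "B \<subseteq> K" "K \<subseteq> \<Omega>" "compact K" "B \<in> sets borel"
  shows "integrable (leb B) f"
proof (rule integrable_lebesgue_on_subset)
  show "integrable (leb K) f" using assms(1,3,4) by (simp add: locally_integrable_def)
qed (use assms in \<open>simp_all add: borel_compact\<close>)

text \<open>Weak derivatives are only locally integrable, so they are compared on intervals whose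
  closure lies inside; countably many rational ones exhaust the open interval.\<close>

lemma AE_Ioo_exhaust:
  fixes l u :: real
  assumes "\<And>p q. p \<in> \<rat> \<Longrightarrow> q \<in> \<rat> \<Longrightarrow> l < p \<Longrightarrow> p < q \<Longrightarrow> q < u \<Longrightarrow> AE x in lborel. x \<in> {p<..<q} \<longrightarrow> P x"
  shows "AE x in leb {l<..<u}. P x"
proof -
  have "AE x in lborel. \<forall>z\<in>\<rat> \<times> \<rat>. l < fst z \<and> fst z < snd z \<and> snd z < u \<longrightarrow> x \<in> {fst z<..<snd z} \<longrightarrow> P x"
  proof (subst AE_ball_countable, intro countable_SIGMA countable_rat, intro ballI)
    fix z :: "real \<times> real" assume z: "z \<in> \<rat> \<times> \<rat>"
    show "AE x in lborel. l < fst z \<and> fst z < snd z \<and> snd z < u \<longrightarrow> x \<in> {fst z<..<snd z} \<longrightarrow> P x"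
    proof (cases "l < fst z \<and> fst z < snd z \<and> snd z < u")
      case True
      then have "AE x in lborel. x \<in> {fst z<..<snd z} \<longrightarrow> P x" using z by (intro assms) (auto simp: mem_Times_iff)
      then show ?thesis by (rule eventually_mono) simp
    next
      case False
      then show ?thesis by (intro AE_I2) blast
    qed
  qed
  then show ?thesis
    unfolding AE_lebesgue_on_iff[OF borel_open[OF open_greaterThanLessThan]]
  proof (rule eventually_mono)
    fix x assume elim: "\<forall>z\<in>\<rat> \<times> \<rat>. l < fst z \<and> fst z < snd z \<and> snd z < u \<longrightarrow> x \<in> {fst z<..<snd z} \<longrightarrow> P x"
    show "x \<in> {l<..<u} \<longrightarrow> P x"
    proof
      assume x: "x \<in> {l<..<u}"
      obtain p where p: "p \<in> \<rat>" "l < p" "p < x" using Rats_dense_in_real[of l x] x by auto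
      obtain q where q: "q \<in> \<rat>" "x < q" "q < u" using Rats_dense_in_real[of x u] x by auto
      show "P x" using elim[rule_format, of "(p, q)"] p q by auto
    qed
  qed
qed

lemma has_wderiv_unique:
  fixes f :: "real \<Rightarrow> 'k::{real_normed_field, euclidean_space}"
  assumes g: "has_wderiv {l<..<u} 1 f g" and g': "has_wderiv {l<..<u} 1 f g'"
  shows "AE x in leb {l<..<u}. g x = g' x"
proof (rule AE_Ioo_exhaust)
  fix p q assume pq: "p \<in> \<rat>" "q \<in> \<rat>" "l < p" "p < q" "q < u"
  have i: "integrable (leb {p<..<q}) g" "integrable (leb {p<..<q}) g'"
    using g g' pq unfolding has_wderiv_def by (auto intro!: locally_integrable_on_box[of "{l<..<u}" _ _ "{p..q}"])
  have "AE x in leb {p<..<q}. g x - g' x = 0"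
  proof (rule fundamental_lemma)
    show "integrable (leb {p<..<q}) (\<lambda>x. g x - g' x)" using i by auto
    fix \<eta> assume \<eta>: "\<eta> \<in> bumps p q"
    have e: "(\<integral>x. h x * of_real (\<eta> x) \<partial>leb {l<..<u}) = (\<integral>x. \<eta> x *\<^sub>R h x \<partial>leb {p<..<q})" for h :: "real \<Rightarrow> 'k"
    proof -
      have "h x * of_real (\<eta> x) = indicator {p<..<q} x *\<^sub>R (\<eta> x *\<^sub>R h x)" for x
      proof (cases "x \<in> {p<..<q}")
        case False
        then have "\<eta> x = 0" using \<eta> by (auto simp: bumps_def bump_outside)
        then show ?thesis by simp
      qed (simp add: mult_of_real_scaleR)
      then have "(\<integral>x. h x * of_real (\<eta> x) \<partial>leb {l<..<u}) = (\<integral>x. indicator {p<..<q} x *\<^sub>R (\<eta> x *\<^sub>R h x) \<partial>leb {l<..<u})"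
        by (intro Bochner_Integration.integral_cong refl)
      also have "\<dots> = (\<integral>x. \<eta> x *\<^sub>R h x \<partial>leb {p<..<q})"
        by (rule integral_lebesgue_on_subset_indicator) (use pq in auto)
      finally show ?thesis .
    qed
    have "\<eta> \<in> ctest l u" using bumps_mono[of l p q u] pq \<eta> by (auto intro: bumps_ctest)
    then have "(\<lambda>x. of_real (\<eta> x) :: 'k) \<in> test_funs {l<..<u}" by (rule test_funs_of_real)
    note t = this
    have "(\<integral>x. g x * of_real (\<eta> x) \<partial>leb {l<..<u}) = (\<integral>x. g' x * of_real (\<eta> x) \<partial>leb {l<..<u})"
      using g g' unfolding has_wderiv_def by (auto dest!: bspec[OF _ t])
    then show "(\<integral>x. \<eta> x *\<^sub>R (g x - g' x) \<partial>leb {p<..<q}) = 0"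
      unfolding e using ctest_times_integrable[OF bumps_ctest[OF \<eta>] i(1)] ctest_times_integrable[OF bumps_ctest[OF \<eta>] i(2)]
      by (simp add: scaleR_diff_right)
  qed
  then show "AE x in lborel. x \<in> {p<..<q} \<longrightarrow> g x = g' x" by (simp add: AE_lebesgue_on_iff)
qed

text \<open>As on an interval: comparison on boxes with closure inside, tested with products of
  bumps, and exhaustion by rational boxes. It makes the choice in \<open>wderiv\<close> harmless on
  \<open>QT T\<close>.\<close>

lemma has_wderiv_unique_rectangle:
  fixes f :: "real \<times> real \<Rightarrow> 'k::{real_normed_field, euclidean_space}"
  assumes g: "has_wderiv ({a<..<b} \<times> {l<..<r}) i f g" and g': "has_wderiv ({a<..<b} \<times> {l<..<r}) i f g'"
  shows "AE z in leb ({a<..<b} \<times> {l<..<r}). g z = g' z"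
proof -
  let ?\<Omega> = "{a<..<b} \<times> {l<..<r}"
  have box: "AE z in lborel. z \<in> {p<..<q} \<times> {p'<..<q'} \<longrightarrow> g z = g' z"
    if pq: "a < p" "p < q" "q < b" "l < p'" "p' < q'" "q' < r" for p q p' q'
  proof -
    let ?B = "{p<..<q} \<times> {p'<..<q'}"
    have i: "integrable (leb ?B) g" "integrable (leb ?B) g'"
      using g g' pq unfolding has_wderiv_def
      by (auto intro!: locally_integrable_on_box[of ?\<Omega> _ _ "{p..q} \<times> {p'..q'}"] compact_Times borel_Times)
    have "AE z in leb ?B. g z - g' z = 0"
    proof (rule fundamental_lemma_rectangle)
      show "integrable (leb ?B) (\<lambda>z. g z - g' z)" using i by auto
      fix \<theta> \<eta> assume \<theta>: "\<theta> \<in> bumps p q" and \<eta>: "\<eta> \<in> bumps p' q'"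
      have e: "(\<integral>z. h z * of_real (\<theta> (fst z) * \<eta> (snd z)) \<partial>leb ?\<Omega>) = (\<integral>z. (\<theta> (fst z) * \<eta> (snd z)) *\<^sub>R h z \<partial>leb ?B)" for h :: "real \<times> real \<Rightarrow> 'k"
      proof -
        have "h z * of_real (\<theta> (fst z) * \<eta> (snd z)) = indicator ?B z *\<^sub>R ((\<theta> (fst z) * \<eta> (snd z)) *\<^sub>R h z)" for z
        proof -
          have "fst z \<notin> {p<..<q} \<Longrightarrow> \<theta> (fst z) = 0" "snd z \<notin> {p'<..<q'} \<Longrightarrow> \<eta> (snd z) = 0"
            using \<theta> \<eta> by (auto simp: bumps_def bump_outside)
          then show ?thesis unfolding mult_of_real_scaleR by (cases "z \<in> ?B") (auto simp: mem_Times_iff)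
        qed
        then have "(\<integral>z. h z * of_real (\<theta> (fst z) * \<eta> (snd z)) \<partial>leb ?\<Omega>) =
            (\<integral>z. indicator ?B z *\<^sub>R ((\<theta> (fst z) * \<eta> (snd z)) *\<^sub>R h z) \<partial>leb ?\<Omega>)"
          by (intro Bochner_Integration.integral_cong refl)
        also have "\<dots> = (\<integral>z. (\<theta> (fst z) * \<eta> (snd z)) *\<^sub>R h z \<partial>leb ?B)"
          by (rule integral_lebesgue_on_subset_indicator) (use pq in \<open>auto simp: borel_Times\<close>)
        finally show ?thesis .
      qed
      have c: "\<theta> \<in> ctest a b" "\<eta> \<in> ctest l r"
        using bumps_mono[of a p q b] bumps_mono[of l p' q' r] pq \<theta> \<eta> by (auto intro: bumps_ctest)
      note t = test_funs_tensor[OF this, where 'k='k]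
      have eq: "(\<integral>z. g z * of_real (\<theta> (fst z) * \<eta> (snd z)) \<partial>leb ?\<Omega>) = (\<integral>z. g' z * of_real (\<theta> (fst z) * \<eta> (snd z)) \<partial>leb ?\<Omega>)"
        using g g' t unfolding has_wderiv_def by (auto dest!: bspec[OF _ t])
      have m: "(\<lambda>z. \<theta> (fst z) * \<eta> (snd z)) \<in> borel_measurable borel"
      proof -
        have [measurable]: "\<theta> \<in> borel_measurable borel" "\<eta> \<in> borel_measurable borel"
          using c smooth_real_measurable ctest_smooth by blast+
        show ?thesis unfolding borel_prod[symmetric] by measurable
      qed
      have bd: "\<bar>\<theta> (fst z) * \<eta> (snd z)\<bar> \<le> 1" for z
        using \<theta> \<eta> bump_range by (auto simp: bumps_def abs_mult mult_le_one)
      have "integrable (leb ?B) (\<lambda>z. (\<theta> (fst z) * \<eta> (snd z)) *\<^sub>R g z)" "integrable (leb ?B) (\<lambda>z. (\<theta> (fst z) * \<eta> (snd z)) *\<^sub>R g' z)"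
        by (rule bounded_times_integrable[OF _ borel_measurable_lebesgue_onI[OF m] bd], rule i)+
      with eq show "(\<integral>z. (\<theta> (fst z) * \<eta> (snd z)) *\<^sub>R (g z - g' z) \<partial>leb ?B) = 0"
        unfolding e by (simp add: scaleR_diff_right)
    qed
    then show ?thesis by (simp add: AE_lebesgue_on_iff borel_Times)
  qed
  have "countable ((\<rat> \<times> \<rat>) \<times> (\<rat> \<times> \<rat>) :: ((real \<times> real) \<times> (real \<times> real)) set)" by (intro countable_SIGMA countable_rat)
  then have "AE z in lborel. \<forall>((p, q), (p', q'))\<in>(\<rat> \<times> \<rat>) \<times> (\<rat> \<times> \<rat>). a < p \<and> p < q \<and> q < b \<and> l < p' \<and> p' < q' \<and> q' < r \<longrightarrow>
      z \<in> {p<..<q} \<times> {p'<..<q'} \<longrightarrow> g z = g' z"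
    using box by (subst AE_ball_countable) auto
  then have "AE z in lborel. z \<in> ?\<Omega> \<longrightarrow> g z = g' z"
  proof eventually_elim
    case (elim z)
    show ?case
    proof
      assume z: "z \<in> ?\<Omega>"
      then have z': "a < fst z" "fst z < b" "l < snd z" "snd z < r" by (auto simp: mem_Times_iff)
      obtain p where p: "p \<in> \<rat>" "a < p" "p < fst z" using Rats_dense_in_real[OF z'(1)] by auto
      obtain q where q: "q \<in> \<rat>" "fst z < q" "q < b" using Rats_dense_in_real[OF z'(2)] by auto
      obtain p' where p': "p' \<in> \<rat>" "l < p'" "p' < snd z" using Rats_dense_in_real[OF z'(3)] by auto
      obtain q' where q': "q' \<in> \<rat>" "snd z < q'" "q' < r" using Rats_dense_in_real[OF z'(4)] by auto
      show "g z = g' z"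
        using bspec[OF elim, of "((p, q), (p', q'))"] p q p' q' by (auto simp: mem_Times_iff)
    qed
  qed
  then show ?thesis by (simp add: AE_lebesgue_on_iff borel_Times)
qed

section \<open>Function spaces\<close>

lemma L2_iff: "u \<in> carr (L2 \<Omega>) \<longleftrightarrow> u \<in> borel_measurable (leb \<Omega>) \<and> integrable (leb \<Omega>) (\<lambda>x. (norm (u x))\<^sup>2)"
  by (simp add: L2_def)

lemma L2_measurable: "u \<in> carr (L2 \<Omega>) \<Longrightarrow> u \<in> borel_measurable (leb \<Omega>)"
  by (simp add: L2_iff)

lemma L2_nrm: "nrm (L2 \<Omega>) u = sqrt (\<integral>x. (norm (u x))\<^sup>2 \<partial>leb \<Omega>)"
  by (simp add: L2_def)

lemma L2_nrm_sq: "(nrm (L2 \<Omega>) u)\<^sup>2 = (\<integral>x. (norm (u x))\<^sup>2 \<partial>leb \<Omega>)"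
  by (simp add: L2_nrm)

lemma L2_nrm_nonneg [simp]: "0 \<le> nrm (L2 \<Omega>) u"
  by (simp add: L2_nrm)

lemma norm_add_squared: "(norm (a + b))\<^sup>2 \<le> 2 * (norm a)\<^sup>2 + 2 * (norm (b :: 'a::real_normed_vector))\<^sup>2"
proof -
  have "(norm (a + b))\<^sup>2 \<le> (norm a + norm b)\<^sup>2" by (intro power_mono norm_triangle_ineq) auto
  also have "\<dots> \<le> 2 * (norm a)\<^sup>2 + 2 * (norm b)\<^sup>2" using sum_squares_bound[of "norm a" "norm b"] by (simp add: power2_sum)
  finally show ?thesis .
qed

lemma L2_bound:
  assumes "u \<in> carr (L2 \<Omega>)" "v \<in> borel_measurable (leb \<Omega>)" "AE x in leb \<Omega>. norm (v x) \<le> C * norm (u x)"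
  shows "v \<in> carr (L2 \<Omega>)"
proof -
  have "integrable (leb \<Omega>) (\<lambda>x. (norm (v x))\<^sup>2)"
  proof (rule Bochner_Integration.integrable_bound)
    show "integrable (leb \<Omega>) (\<lambda>x. C\<^sup>2 * (norm (u x))\<^sup>2)" using assms(1) by (simp add: L2_iff)
    show "AE x in leb \<Omega>. norm ((norm (v x))\<^sup>2) \<le> norm (C\<^sup>2 * (norm (u x))\<^sup>2)"
      using assms(3) by eventually_elim (simp add: power_mult_distrib[symmetric] power_mono)
  qed (use assms in simp)
  then show ?thesis using assms(2) by (simp add: L2_iff)
qed

lemma L2_add: "u \<in> carr (L2 \<Omega>) \<Longrightarrow> v \<in> carr (L2 \<Omega>) \<Longrightarrow> (\<lambda>x. u x + v x) \<in> carr (L2 \<Omega>)"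
proof -
  assume u: "u \<in> carr (L2 \<Omega>)" and v: "v \<in> carr (L2 \<Omega>)"
  have m: "(\<lambda>x. u x + v x) \<in> borel_measurable (leb \<Omega>)"
    using u v by (intro borel_measurable_add L2_measurable)
  have "integrable (leb \<Omega>) (\<lambda>x. (norm (u x + v x))\<^sup>2)"
  proof (rule Bochner_Integration.integrable_bound)
    show "integrable (leb \<Omega>) (\<lambda>x. 2 * (norm (u x))\<^sup>2 + 2 * (norm (v x))\<^sup>2)"
      using u v by (simp add: L2_iff)
    show "AE x in leb \<Omega>. norm ((norm (u x + v x))\<^sup>2) \<le> norm (2 * (norm (u x))\<^sup>2 + 2 * (norm (v x))\<^sup>2)"
      using norm_add_squared by (intro AE_I2) auto
  qed (use m in simp)
  with m show ?thesis by (simp add: L2_iff)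
qed

lemma L2_cmult: "u \<in> carr (L2 \<Omega>) \<Longrightarrow> (\<lambda>x. c * u x) \<in> carr (L2 \<Omega>)"
  by (rule L2_bound[of u _ _ "norm c"]) (auto simp: L2_iff norm_mult)

lemma L2_diff: "u \<in> carr (L2 \<Omega>) \<Longrightarrow> v \<in> carr (L2 \<Omega>) \<Longrightarrow> (\<lambda>x. u x - v x) \<in> carr (L2 \<Omega>)"
  using L2_add[OF _ L2_cmult[of v \<Omega> "-1"]] by simp

lemma L2_cong_AE:
  assumes "u \<in> carr (L2 \<Omega>)" "\<Omega> \<in> sets borel" "AE x in leb \<Omega>. u x = v x"
  shows "v \<in> carr (L2 \<Omega>)" "nrm (L2 \<Omega>) v = nrm (L2 \<Omega>) u"
proof -
  have v: "v \<in> borel_measurable (leb \<Omega>)"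
    by (rule borel_measurable_lebesgue_on_AE[OF assms(2) L2_measurable[OF assms(1)] assms(3)])
  show "v \<in> carr (L2 \<Omega>)"
    by (rule L2_bound[OF assms(1) v, of 1]) (use assms(3) in \<open>auto elim: eventually_mono\<close>)
  show "nrm (L2 \<Omega>) v = nrm (L2 \<Omega>) u"
    unfolding L2_nrm real_sqrt_eq_iff
    by (rule integral_cong_AE) (use v L2_measurable[OF assms(1)] assms(3) in \<open>auto elim: eventually_mono\<close>)
qed

lemma L2_Cauchy_Schwarz:
  assumes u: "u \<in> carr (L2 \<Omega>)" and v: "v \<in> carr (L2 \<Omega>)"
  shows "integrable (leb \<Omega>) (\<lambda>x. norm (u x) * norm (v x))"
    "(\<integral>x. norm (u x) * norm (v x) \<partial>leb \<Omega>) \<le> nrm (L2 \<Omega>) u * nrm (L2 \<Omega>) v"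
proof -
  let ?M = "leb \<Omega>"
  have [measurable]: "u \<in> borel_measurable ?M" "v \<in> borel_measurable ?M" using u v by (auto simp: L2_iff)
  show i: "integrable ?M (\<lambda>x. norm (u x) * norm (v x))"
  proof (rule Bochner_Integration.integrable_bound)
    show "integrable ?M (\<lambda>x. (norm (u x))\<^sup>2 + (norm (v x))\<^sup>2)" using u v by (simp add: L2_iff)
    have "norm a * norm b \<le> (norm a)\<^sup>2 + (norm b)\<^sup>2" for a :: 'b and b :: 'c
      using sum_squares_bound[of "norm a" "norm b"] mult_nonneg_nonneg[OF norm_ge_zero[of a] norm_ge_zero[of b]] by linarith
    then show "AE x in ?M. norm (norm (u x) * norm (v x)) \<le> norm ((norm (u x))\<^sup>2 + (norm (v x))\<^sup>2)" by auto
  qed simp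
  have e: "(\<integral>\<^sup>+x. ennreal (norm (w x)) ^ 2 \<partial>?M) = ennreal ((nrm (L2 \<Omega>) w)\<^sup>2)" if "w \<in> carr (L2 \<Omega>)" for w :: "_ \<Rightarrow> 'd::{real_normed_field, euclidean_space}"
    unfolding L2_nrm_sq using that by (simp add: ennreal_power L2_iff nn_integral_eq_integral)
  have "(\<integral>\<^sup>+x. ennreal (norm (u x)) * ennreal (norm (v x)) \<partial>?M)\<^sup>2 \<le> (\<integral>\<^sup>+x. ennreal (norm (u x)) ^ 2 \<partial>?M) * (\<integral>\<^sup>+x. ennreal (norm (v x)) ^ 2 \<partial>?M)"
    by (rule Cauchy_Schwarz_nn_integral) auto
  also have "\<dots> = ennreal ((nrm (L2 \<Omega>) u * nrm (L2 \<Omega>) v)\<^sup>2)"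
    unfolding e[OF u] e[OF v] by (simp add: ennreal_mult' power_mult_distrib)
  also have "(\<integral>\<^sup>+x. ennreal (norm (u x)) * ennreal (norm (v x)) \<partial>?M) = ennreal (\<integral>x. norm (u x) * norm (v x) \<partial>?M)"
    using i by (simp add: ennreal_mult'[symmetric] nn_integral_eq_integral)
  finally have "(\<integral>x. norm (u x) * norm (v x) \<partial>?M)\<^sup>2 \<le> (nrm (L2 \<Omega>) u * nrm (L2 \<Omega>) v)\<^sup>2"
    by (simp add: ennreal_power)
  then show "(\<integral>x. norm (u x) * norm (v x) \<partial>?M) \<le> nrm (L2 \<Omega>) u * nrm (L2 \<Omega>) v"
    by (rule power2_le_imp_le) simp
qed

lemma L2_triangle:
  assumes u: "u \<in> carr (L2 \<Omega>)" and v: "v \<in> carr (L2 \<Omega>)"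
  shows "nrm (L2 \<Omega>) (\<lambda>x. u x + v x) \<le> nrm (L2 \<Omega>) u + nrm (L2 \<Omega>) v"
    "nrm (L2 \<Omega>) (\<lambda>x. u x - v x) \<le> nrm (L2 \<Omega>) u + nrm (L2 \<Omega>) v"
proof -
  let ?M = "leb \<Omega>"
  have *: "nrm (L2 \<Omega>) w \<le> nrm (L2 \<Omega>) u + nrm (L2 \<Omega>) v"
    if w: "w \<in> carr (L2 \<Omega>)" and le: "\<And>x. norm (w x) \<le> norm (u x) + norm (v x)" for w
  proof -
    have "(nrm (L2 \<Omega>) w)\<^sup>2 \<le> (\<integral>x. (norm (u x))\<^sup>2 + 2 * (norm (u x) * norm (v x)) + (norm (v x))\<^sup>2 \<partial>?M)"
      unfolding L2_nrm_sq
    proof (rule integral_mono)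
      show "integrable ?M (\<lambda>x. (norm (u x))\<^sup>2 + 2 * (norm (u x) * norm (v x)) + (norm (v x))\<^sup>2)"
        using u v L2_Cauchy_Schwarz(1)[OF u v] by (auto simp: L2_iff)
      have "(norm (w x))\<^sup>2 \<le> (norm (u x) + norm (v x))\<^sup>2" for x using le[of x] by (intro power_mono) auto
      then show "(norm (w x))\<^sup>2 \<le> (norm (u x))\<^sup>2 + 2 * (norm (u x) * norm (v x)) + (norm (v x))\<^sup>2" for x
        by (simp add: power2_sum algebra_simps)
    qed (use w in \<open>simp add: L2_iff\<close>)
    also have "\<dots> = (nrm (L2 \<Omega>) u)\<^sup>2 + 2 * (\<integral>x. norm (u x) * norm (v x) \<partial>?M) + (nrm (L2 \<Omega>) v)\<^sup>2"
      unfolding L2_nrm_sq using u v L2_Cauchy_Schwarz(1)[OF u v] by (simp add: L2_iff)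
    also have "\<dots> \<le> (nrm (L2 \<Omega>) u + nrm (L2 \<Omega>) v)\<^sup>2"
      using L2_Cauchy_Schwarz(2)[OF u v] by (simp add: power2_sum)
    finally show ?thesis by (rule power2_le_imp_le) simp
  qed
  show "nrm (L2 \<Omega>) (\<lambda>x. u x + v x) \<le> nrm (L2 \<Omega>) u + nrm (L2 \<Omega>) v"
    by (rule *[OF L2_add[OF u v]]) (rule norm_triangle_ineq)
  show "nrm (L2 \<Omega>) (\<lambda>x. u x - v x) \<le> nrm (L2 \<Omega>) u + nrm (L2 \<Omega>) v"
    by (rule *[OF L2_diff[OF u v]]) (rule norm_triangle_ineq4)
qed

lemma L2_imp_integrable:
  assumes "u \<in> carr (L2 \<Omega>)" "finite_measure (leb \<Omega>)"
  shows "integrable (leb \<Omega>) u"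
proof -
  interpret finite_measure "leb \<Omega>" by fact
  show ?thesis
  proof (rule Bochner_Integration.integrable_bound)
    show "integrable (leb \<Omega>) (\<lambda>x. 1 + (norm (u x))\<^sup>2)" using assms(1) by (simp add: L2_iff)
    have "norm a \<le> 1 + (norm a)\<^sup>2" for a :: 'b
      using sum_squares_bound[of "norm a" 1] norm_ge_zero[of a] unfolding power_one mult_1_right by linarith
    then show "AE x in leb \<Omega>. norm (u x) \<le> norm (1 + (norm (u x))\<^sup>2)" by auto
  qed (rule L2_measurable[OF assms(1)])
qed

text \<open>On representatives \<open>nrm\<close> is only a seminorm. Symmetry under exchange of the
  arguments stands in for homogeneity, and nonnegativity is asked for outside the carrier too, since
  a Bochner norm evaluates \<open>nrm\<close> at every time.\<close>

definition seminormed :: "('a \<Rightarrow> 'b::ab_group_add) fspace \<Rightarrow> bool" where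
  "seminormed X \<longleftrightarrow> (\<forall>u\<in>carr X. \<forall>v\<in>carr X. u - v \<in> carr X \<and>
     nrm X (u - v) \<le> nrm X u + nrm X v \<and> nrm X (u - v) = nrm X (v - u)) \<and> (\<forall>u. 0 \<le> nrm X u)"

lemma seminormed_reverse:
  assumes X: "seminormed X" and u: "u \<in> carr X" and v: "v \<in> carr X"
  shows "\<bar>nrm X u - nrm X v\<bar> \<le> nrm X (u - v)"
proof -
  have "u = v - (v - u)" "v = u - (u - v)" by (auto simp: fun_eq_iff)
  then have "nrm X u \<le> nrm X v + nrm X (v - u)" "nrm X v \<le> nrm X u + nrm X (u - v)" "nrm X (u - v) = nrm X (v - u)"
    using X u v unfolding seminormed_def by metis+
  then show ?thesis by linarith
qed

lemma seminormed_L2: "seminormed (L2 \<Omega> :: ('a::euclidean_space \<Rightarrow> 'k::{real_normed_field, euclidean_space}) fspace)"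
  unfolding seminormed_def
proof (intro conjI ballI allI)
  fix u v :: "'a \<Rightarrow> 'k" assume uv: "u \<in> carr (L2 \<Omega>)" "v \<in> carr (L2 \<Omega>)"
  show "u - v \<in> carr (L2 \<Omega>)" using L2_diff[OF uv] by (simp add: fun_diff_def)
  show "nrm (L2 \<Omega>) (u - v) \<le> nrm (L2 \<Omega>) u + nrm (L2 \<Omega>) v" using L2_triangle(2)[OF uv] by (simp add: fun_diff_def)
  show "nrm (L2 \<Omega>) (u - v) = nrm (L2 \<Omega>) (v - u)" by (simp add: L2_nrm norm_minus_commute)
qed simp

section \<open>Weak derivatives under differences and changes on null sets\<close>

lemma integrable_times_test:
  fixes u :: "'a::euclidean_space \<Rightarrow> 'k::{real_normed_field, euclidean_space}"
  assumes u: "locally_integrable \<Omega> u" and \<Omega>: "\<Omega> \<in> sets borel" and K: "compact K" "K \<subseteq> \<Omega>"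
    and h: "continuous_on UNIV h" "\<And>x. x \<notin> K \<Longrightarrow> h x = 0"
  shows "integrable (leb \<Omega>) (\<lambda>x. u x * h x)"
proof -
  have "bounded (h ` K)" by (intro compact_imp_bounded compact_continuous_image continuous_on_subset[OF h(1)] K) auto
  then obtain C where C: "\<And>x. x \<in> K \<Longrightarrow> norm (h x) \<le> C" by (auto simp: bounded_iff)
  have uK: "integrable (leb K) u" using u K by (simp add: locally_integrable_def)
  have "integrable (leb K) (\<lambda>x. u x * h x)"
  proof (rule Bochner_Integration.integrable_bound)
    show "integrable (leb K) (\<lambda>x. C * norm (u x))" using uK by simp
    show "(\<lambda>x. u x * h x) \<in> borel_measurable (leb K)"
      using uK by (intro borel_measurable_times borel_measurable_integrable[OF uK] borel_measurable_lebesgue_onI borel_measurable_continuous_onI h(1))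
    show "AE x in leb K. norm (u x * h x) \<le> norm (C * norm (u x))"
    proof (rule AE_I2)
      fix x assume "x \<in> space (leb K)"
      then have "norm (h x) \<le> C" using C by simp
      then have "norm (u x) * norm (h x) \<le> norm (u x) * \<bar>C\<bar>" by (intro mult_left_mono) auto
      then show "norm (u x * h x) \<le> norm (C * norm (u x))" by (simp add: norm_mult mult.commute abs_mult)
    qed
  qed
  then have "integrable (leb \<Omega>) (\<lambda>x. indicator K x *\<^sub>R (u x * h x))"
    using K \<Omega> by (subst integrable_lebesgue_on_subset_indicator) (auto simp: borel_compact)
  moreover have "(\<lambda>x. indicator K x *\<^sub>R (u x * h x)) = (\<lambda>x. u x * h x)" using h(2) by (auto simp: indicator_def)
  ultimately show ?thesis by simp
qed

lemma test_funs_continuous: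
  assumes "\<phi> \<in> test_funs \<Omega>" "i \<in> Basis"
  shows "continuous_on UNIV \<phi>" "continuous_on UNIV (partials [i] \<phi>)"
    "x \<notin> supp \<phi> \<Longrightarrow> \<phi> x = 0" "x \<notin> supp \<phi> \<Longrightarrow> partials [i] \<phi> x = 0"
proof -
  have s: "smooth_fun \<phi>" using assms by (simp add: test_funs_def)
  have "partials [] \<phi> differentiable (at x)" "partials [i] \<phi> differentiable (at x)" for x
    using s[unfolded smooth_fun_def, rule_format, of "[]"] s[unfolded smooth_fun_def, rule_format, of "[i]"] assms(2)
    by (simp_all only: list.set empty_subsetI insert_subset simp_thms)
  then show "continuous_on UNIV \<phi>" "continuous_on UNIV (partials [i] \<phi>)"
    by (auto intro!: continuous_at_imp_continuous_on differentiable_imp_continuous_within)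
  have z: "\<phi> y = 0" if "y \<notin> supp \<phi>" for y
    using that subsetD[OF closure_subset, of y "{x. \<phi> x \<noteq> 0}"] unfolding supp_def by blast
  then show "x \<notin> supp \<phi> \<Longrightarrow> \<phi> x = 0" .
  assume x: "x \<notin> supp \<phi>"
  have "((\<lambda>x. 0) has_derivative (\<lambda>h. 0)) (at x)" by simp
  then have "(\<phi> has_derivative (\<lambda>h. 0)) (at x)"
  proof (rule has_derivative_transform_within_open)
    show "open (- supp \<phi>)" unfolding supp_def by (rule open_Compl[OF closed_closure])
    show "x \<in> - supp \<phi>" using x by simp
    show "0 = \<phi> y" if "y \<in> - supp \<phi>" for y using z[of y] that by simp
  qed
  then have "frechet_derivative \<phi> (at x) = (\<lambda>h. 0)" by (rule frechet_derivative_at[symmetric])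
  then show "partials [i] \<phi> x = 0" by simp
qed

lemma has_wderiv_integrable:
  assumes "has_wderiv \<Omega> i u v" "\<Omega> \<in> sets borel" "\<phi> \<in> test_funs \<Omega>" "i \<in> Basis"
  shows "integrable (leb \<Omega>) (\<lambda>x. u x * partials [i] \<phi> x)" "integrable (leb \<Omega>) (\<lambda>x. v x * \<phi> x)"
proof -
  have K: "compact (supp \<phi>)" "supp \<phi> \<subseteq> \<Omega>" using assms(3) by (auto simp: test_funs_def)
  have l: "locally_integrable \<Omega> u" "locally_integrable \<Omega> v" using assms(1) by (auto simp: has_wderiv_def)
  show "integrable (leb \<Omega>) (\<lambda>x. u x * partials [i] \<phi> x)"
    by (rule integrable_times_test[OF l(1) assms(2) K]) (rule test_funs_continuous[OF assms(3,4)], rule test_funs_continuous(4)[OF assms(3,4)])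
  show "integrable (leb \<Omega>) (\<lambda>x. v x * \<phi> x)"
    by (rule integrable_times_test[OF l(2) assms(2) K]) (rule test_funs_continuous[OF assms(3,4)], rule test_funs_continuous(3)[OF assms(3,4)])
qed

lemma has_wderiv_diff:
  assumes 1: "has_wderiv \<Omega> i u v" and 2: "has_wderiv \<Omega> i u' v'" and \<Omega>: "\<Omega> \<in> sets borel" "i \<in> Basis"
  shows "has_wderiv \<Omega> i (\<lambda>x. u x - u' x) (\<lambda>x. v x - v' x)"
  unfolding has_wderiv_def
proof (intro conjI ballI)
  show "locally_integrable \<Omega> (\<lambda>x. u x - u' x)" "locally_integrable \<Omega> (\<lambda>x. v x - v' x)"
    using 1 2 by (auto simp: has_wderiv_def locally_integrable_def)
  fix \<phi> :: "'a \<Rightarrow> 'b" assume \<phi>: "\<phi> \<in> test_funs \<Omega>"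
  have e: "(\<integral>x. u x * partials [i] \<phi> x \<partial>leb \<Omega>) = - (\<integral>x. v x * \<phi> x \<partial>leb \<Omega>)"
    "(\<integral>x. u' x * partials [i] \<phi> x \<partial>leb \<Omega>) = - (\<integral>x. v' x * \<phi> x \<partial>leb \<Omega>)"
    using 1 2 \<phi> by (auto simp: has_wderiv_def)
  show "(\<integral>x. (u x - u' x) * partials [i] \<phi> x \<partial>leb \<Omega>) = - (\<integral>x. (v x - v' x) * \<phi> x \<partial>leb \<Omega>)"
    unfolding left_diff_distrib
    using has_wderiv_integrable[OF 1 \<Omega>(1) \<phi> \<Omega>(2)] has_wderiv_integrable[OF 2 \<Omega>(1) \<phi> \<Omega>(2)] e
    by (simp del: partials.simps)
qed

lemma locally_integrable_cong_AE:
  fixes u u' :: "'a::euclidean_space \<Rightarrow> 'k::{real_normed_field, euclidean_space}"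
  assumes "locally_integrable \<Omega> u" "AE x in leb \<Omega>. u x = u' x" "\<Omega> \<in> sets borel"
  shows "locally_integrable \<Omega> u'"
  unfolding locally_integrable_def
proof (intro allI impI)
  fix K assume K: "compact K \<and> K \<subseteq> \<Omega>"
  then have Kb: "K \<in> sets borel" by (simp add: borel_compact)
  have u: "integrable (leb K) u" using assms(1) K by (simp add: locally_integrable_def)
  have ae: "AE x in leb K. u x = u' x" using AE_lebesgue_on_subset[OF assms(2) _ Kb assms(3)] K by auto
  show "integrable (leb K) u'"
    by (rule integrable_cong_AE_imp[OF u borel_measurable_lebesgue_on_AE[OF Kb borel_measurable_integrable[OF u] ae]])
      (use ae in \<open>auto elim: eventually_mono\<close>)
qed

text \<open>No measurability enters: by completeness either both functions are measurable or neither
  is, and in the latter case both integrals have the default value 0.\<close>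

lemma integral_lebesgue_on_cong_AE:
  fixes f g :: "'a::euclidean_space \<Rightarrow> 'k::euclidean_space"
  assumes \<Omega>: "\<Omega> \<in> sets borel" and ae: "AE x in leb \<Omega>. f x = g x"
  shows "integral\<^sup>L (leb \<Omega>) f = integral\<^sup>L (leb \<Omega>) g"
    "integrable (leb \<Omega>) f \<longleftrightarrow> integrable (leb \<Omega>) g"
proof -
  have ae': "AE x in leb \<Omega>. g x = f x" using ae by (auto elim: eventually_mono)
  have m: "f \<in> borel_measurable (leb \<Omega>) \<longleftrightarrow> g \<in> borel_measurable (leb \<Omega>)"
    using borel_measurable_lebesgue_on_AE[OF \<Omega> _ ae] borel_measurable_lebesgue_on_AE[OF \<Omega> _ ae'] by blast
  show i: "integrable (leb \<Omega>) f \<longleftrightarrow> integrable (leb \<Omega>) g"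
    using m integrable_cong_AE_imp[OF _ _ ae] integrable_cong_AE_imp[OF _ _ ae'] borel_measurable_integrable by blast
  show "integral\<^sup>L (leb \<Omega>) f = integral\<^sup>L (leb \<Omega>) g"
  proof (cases "f \<in> borel_measurable (leb \<Omega>)")
    case True
    then show ?thesis using m ae by (intro integral_cong_AE) auto
  next
    case False
    then show ?thesis using m i by (metis borel_measurable_integrable not_integrable_integral_eq)
  qed
qed

lemma has_wderiv_cong_AE:
  assumes 1: "has_wderiv \<Omega> i u v" and \<Omega>: "\<Omega> \<in> sets borel"
    and u: "AE x in leb \<Omega>. u x = u' x" and v: "AE x in leb \<Omega>. v x = v' x"
  shows "has_wderiv \<Omega> i u' v'"
  unfolding has_wderiv_def
proof (intro conjI ballI)
  show "locally_integrable \<Omega> u'" "locally_integrable \<Omega> v'"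
    using 1 locally_integrable_cong_AE[OF _ u \<Omega>] locally_integrable_cong_AE[OF _ v \<Omega>] by (auto simp: has_wderiv_def)
  fix \<phi> :: "'a \<Rightarrow> 'b" assume \<phi>: "\<phi> \<in> test_funs \<Omega>"
  have "(\<integral>x. u' x * partials [i] \<phi> x \<partial>leb \<Omega>) = (\<integral>x. u x * partials [i] \<phi> x \<partial>leb \<Omega>)"
    by (rule integral_lebesgue_on_cong_AE[OF \<Omega>]) (use u in \<open>auto elim: eventually_mono\<close>)
  also have "\<dots> = - (\<integral>x. v x * \<phi> x \<partial>leb \<Omega>)" using 1 \<phi> by (auto simp: has_wderiv_def)
  also have "(\<integral>x. v x * \<phi> x \<partial>leb \<Omega>) = (\<integral>x. v' x * \<phi> x \<partial>leb \<Omega>)"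
    by (rule integral_lebesgue_on_cong_AE[OF \<Omega>]) (use v in \<open>auto elim: eventually_mono\<close>)
  finally show "(\<integral>x. u' x * partials [i] \<phi> x \<partial>leb \<Omega>) = - (\<integral>x. v' x * \<phi> x \<partial>leb \<Omega>)" .
qed

lemma has_wderiv_wderiv: "has_wderiv \<Omega> i u v \<Longrightarrow> has_wderiv \<Omega> i u (wderiv \<Omega> i u)"
  unfolding wderiv_def by (rule someI[of "has_wderiv \<Omega> i u"])

lemma wderiv_eq:
  fixes f g :: "real \<Rightarrow> 'k::{real_normed_field, euclidean_space}"
  assumes "has_wderiv {l<..<u} 1 f g"
  shows "AE x in leb {l<..<u}. wderiv {l<..<u} 1 f x = g x"
  by (rule has_wderiv_unique[OF has_wderiv_wderiv[OF assms] assms])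

section \<open>Sobolev spaces on an interval\<close>

lemma H1_iff: "u \<in> carr (H1 {l<..<r::real}) \<longleftrightarrow> u \<in> carr (L2 {l<..<r}) \<and> (\<exists>v\<in>carr (L2 {l<..<r}). has_wderiv {l<..<r} 1 u v)"
  by (simp add: H1_def)

lemma H1_nrm: "nrm (H1 {l<..<r::real}) u = sqrt ((nrm (L2 {l<..<r}) u)\<^sup>2 + (nrm (L2 {l<..<r}) (wderiv {l<..<r} 1 u))\<^sup>2)"
  by (simp add: H1_def)

lemma H1_wderiv:
  assumes "u \<in> carr (H1 {l<..<r::real})"
  shows "u \<in> carr (L2 {l<..<r})" "has_wderiv {l<..<r} 1 u (wderiv {l<..<r} 1 u)" "wderiv {l<..<r} 1 u \<in> carr (L2 {l<..<r})"
proof -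
  obtain v where v: "v \<in> carr (L2 {l<..<r})" "has_wderiv {l<..<r} 1 u v" and u: "u \<in> carr (L2 {l<..<r})"
    using assms by (auto simp: H1_iff)
  show "u \<in> carr (L2 {l<..<r})" by fact
  show "has_wderiv {l<..<r} 1 u (wderiv {l<..<r} 1 u)" by (rule has_wderiv_wderiv[OF v(2)])
  show "wderiv {l<..<r} 1 u \<in> carr (L2 {l<..<r})"
    by (rule L2_cong_AE(1)[OF v(1)]) (use wderiv_eq[OF v(2)] in \<open>auto elim: eventually_mono\<close>)
qed

lemma H1I: "u \<in> carr (L2 {l<..<r::real}) \<Longrightarrow> has_wderiv {l<..<r} 1 u v \<Longrightarrow> v \<in> carr (L2 {l<..<r}) \<Longrightarrow> u \<in> carr (H1 {l<..<r})"
  by (auto simp: H1_iff)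

lemma H1_diff:
  assumes u: "u \<in> carr (H1 {l<..<r::real})" and v: "v \<in> carr (H1 {l<..<r})"
  shows "u - v \<in> carr (H1 {l<..<r})"
    "AE x in leb {l<..<r}. wderiv {l<..<r} 1 (u - v) x = wderiv {l<..<r} 1 u x - wderiv {l<..<r} 1 v x"
proof -
  have "has_wderiv {l<..<r} 1 (u - v) (\<lambda>x. wderiv {l<..<r} 1 u x - wderiv {l<..<r} 1 v x)"
    using has_wderiv_diff[OF H1_wderiv(2)[OF u] H1_wderiv(2)[OF v]] by (simp add: fun_diff_def)
  then show "u - v \<in> carr (H1 {l<..<r})"
    "AE x in leb {l<..<r}. wderiv {l<..<r} 1 (u - v) x = wderiv {l<..<r} 1 u x - wderiv {l<..<r} 1 v x"
    using L2_diff[OF H1_wderiv(1)[OF u] H1_wderiv(1)[OF v]] L2_diff[OF H1_wderiv(3)[OF u] H1_wderiv(3)[OF v]]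
    by (auto intro: H1I wderiv_eq simp: fun_diff_def)
qed

text \<open>The triangle inequality of the plane, which lifts that of the components to the norms of
  \<open>H1\<close> and \<open>H2\<close>.\<close>

lemma sqrt_sum_squares_mono:
  assumes "0 \<le> a" "0 \<le> b" "a \<le> a1 + a2" "b \<le> b1 + b2"
  shows "sqrt (a\<^sup>2 + b\<^sup>2) \<le> sqrt (a1\<^sup>2 + b1\<^sup>2) + sqrt (a2\<^sup>2 + b2\<^sup>2)"
proof -
  have "sqrt (a\<^sup>2 + b\<^sup>2) \<le> sqrt ((a1 + a2)\<^sup>2 + (b1 + b2)\<^sup>2)"
    using assms by (intro real_sqrt_le_mono add_mono power_mono)
  also have "\<dots> \<le> sqrt (a1\<^sup>2 + b1\<^sup>2) + sqrt (a2\<^sup>2 + b2\<^sup>2)" by (rule real_sqrt_sum_squares_triangle_ineq)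
  finally show ?thesis .
qed

lemma seminormed_H1: "seminormed (H1 {l<..<r::real} :: (real \<Rightarrow> 'k::{real_normed_field, euclidean_space}) fspace)"
  unfolding seminormed_def
proof (intro conjI ballI allI)
  fix u v :: "real \<Rightarrow> 'k" assume u: "u \<in> carr (H1 {l<..<r})" and v: "v \<in> carr (H1 {l<..<r})"
  let ?I = "{l<..<r}"
  let ?D = "\<lambda>u v x. wderiv ?I 1 u x - wderiv ?I 1 v x"
  show "u - v \<in> carr (H1 ?I)" by (rule H1_diff[OF u v])
  have d: "nrm (L2 ?I) (wderiv ?I 1 (u - v)) = nrm (L2 ?I) (?D u v)" if "u \<in> carr (H1 ?I)" "v \<in> carr (H1 ?I)" for u v :: "real \<Rightarrow> 'k"
    by (rule L2_cong_AE(2)) (use H1_diff[OF that] L2_diff[OF H1_wderiv(3)[OF that(1)] H1_wderiv(3)[OF that(2)]] in \<open>auto elim: eventually_mono\<close>)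
  show "nrm (H1 ?I) (u - v) \<le> nrm (H1 ?I) u + nrm (H1 ?I) v"
    unfolding H1_nrm d[OF u v]
    by (intro sqrt_sum_squares_mono L2_triangle H1_wderiv u v L2_nrm_nonneg)
      (use L2_triangle(2)[OF H1_wderiv(1)[OF u] H1_wderiv(1)[OF v]] in \<open>simp add: fun_diff_def\<close>)
  show "nrm (H1 ?I) (u - v) = nrm (H1 ?I) (v - u)"
    unfolding H1_nrm d[OF u v] d[OF v u] by (simp add: L2_nrm norm_minus_commute)
qed (simp add: H1_nrm)

lemma H1_cong_AE:
  assumes u: "u \<in> carr (H1 {l<..<r::real})" and ae: "AE x in leb {l<..<r}. u x = v x"
  shows "v \<in> carr (H1 {l<..<r})" "AE x in leb {l<..<r}. wderiv {l<..<r} 1 v x = wderiv {l<..<r} 1 u x"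
    "nrm (H1 {l<..<r}) v = nrm (H1 {l<..<r}) u"
proof -
  have w: "has_wderiv {l<..<r} 1 v (wderiv {l<..<r} 1 u)"
    by (rule has_wderiv_cong_AE[OF H1_wderiv(2)[OF u] _ ae]) auto
  show v: "v \<in> carr (H1 {l<..<r})"
    by (rule H1I[OF L2_cong_AE(1)[OF H1_wderiv(1)[OF u] _ ae] w H1_wderiv(3)[OF u]]) auto
  show e: "AE x in leb {l<..<r}. wderiv {l<..<r} 1 v x = wderiv {l<..<r} 1 u x"
    by (rule wderiv_eq[OF w])
  have "nrm (L2 {l<..<r}) v = nrm (L2 {l<..<r}) u" by (rule L2_cong_AE(2)[OF H1_wderiv(1)[OF u] _ ae]) auto
  moreover have "nrm (L2 {l<..<r}) (wderiv {l<..<r} 1 u) = nrm (L2 {l<..<r}) (wderiv {l<..<r} 1 v)"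
    by (rule L2_cong_AE(2)[OF H1_wderiv(3)[OF v] _ e]) auto
  ultimately show "nrm (H1 {l<..<r}) v = nrm (H1 {l<..<r}) u" by (simp add: H1_nrm)
qed

lemma H2_nrm: "nrm (H2 {l<..<r::real}) u = sqrt ((nrm (L2 {l<..<r}) u)\<^sup>2 + (nrm (H1 {l<..<r}) (wderiv {l<..<r} 1 u))\<^sup>2)"
  by (simp add: H2_def)

lemma H2_wderiv:
  assumes "u \<in> carr (H2 {l<..<r::real})"
  shows "u \<in> carr (H1 {l<..<r})" "wderiv {l<..<r} 1 u \<in> carr (H1 {l<..<r})"
proof -
  obtain v where v: "v \<in> carr (H1 {l<..<r})" "has_wderiv {l<..<r} 1 u v" and u: "u \<in> carr (L2 {l<..<r})"
    using assms by (auto simp: H2_def)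
  show "u \<in> carr (H1 {l<..<r})" by (rule H1I[OF u v(2) H1_wderiv(1)[OF v(1)]])
  show "wderiv {l<..<r} 1 u \<in> carr (H1 {l<..<r})"
    by (rule H1_cong_AE(1)[OF v(1)]) (use wderiv_eq[OF v(2)] in \<open>auto elim: eventually_mono\<close>)
qed

lemma H2_diff:
  assumes u: "u \<in> carr (H2 {l<..<r::real})" and v: "v \<in> carr (H2 {l<..<r})"
  shows "u - v \<in> carr (H2 {l<..<r})"
proof -
  have "has_wderiv {l<..<r} 1 (u - v) (wderiv {l<..<r} 1 u - wderiv {l<..<r} 1 v)"
    using has_wderiv_diff[OF H1_wderiv(2)[OF H2_wderiv(1)[OF u]] H1_wderiv(2)[OF H2_wderiv(1)[OF v]]] by (simp add: fun_diff_def)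
  moreover have "wderiv {l<..<r} 1 u - wderiv {l<..<r} 1 v \<in> carr (H1 {l<..<r})"
    by (rule H1_diff[OF H2_wderiv(2)[OF u] H2_wderiv(2)[OF v]])
  moreover have "u - v \<in> carr (L2 {l<..<r})"
    by (rule H1_wderiv(1)[OF H1_diff(1)[OF H2_wderiv(1)[OF u] H2_wderiv(1)[OF v]]])
  ultimately show ?thesis by (auto simp: H2_def)
qed

lemma seminormed_H2: "seminormed (H2 {l<..<r::real} :: (real \<Rightarrow> 'k::{real_normed_field, euclidean_space}) fspace)"
  unfolding seminormed_def
proof (intro conjI ballI allI)
  fix u v :: "real \<Rightarrow> 'k" assume u: "u \<in> carr (H2 {l<..<r})" and v: "v \<in> carr (H2 {l<..<r})"
  let ?I = "{l<..<r}"
  show "u - v \<in> carr (H2 ?I)" by (rule H2_diff[OF u v])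
  have d: "nrm (H1 ?I) (wderiv ?I 1 (u - v)) = nrm (H1 ?I) (wderiv ?I 1 u - wderiv ?I 1 v)" if "u \<in> carr (H2 ?I)" "v \<in> carr (H2 ?I)" for u v :: "real \<Rightarrow> 'k"
    by (rule H1_cong_AE(3)[OF H1_diff(1)[OF H2_wderiv(2)[OF that(1)] H2_wderiv(2)[OF that(2)]]])
      (use H1_diff(2)[OF H2_wderiv(1)[OF that(1)] H2_wderiv(1)[OF that(2)]] in \<open>auto elim: eventually_mono\<close>)
  have n: "seminormed (L2 ?I :: (real \<Rightarrow> 'k) fspace)" "seminormed (H1 ?I :: (real \<Rightarrow> 'k) fspace)" by (rule seminormed_L2 seminormed_H1)+
  note uv = H1_wderiv(1)[OF H2_wderiv(1)[OF u]] H1_wderiv(1)[OF H2_wderiv(1)[OF v]] H2_wderiv(2)[OF u] H2_wderiv(2)[OF v]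
  show "nrm (H2 ?I) (u - v) \<le> nrm (H2 ?I) u + nrm (H2 ?I) v"
    unfolding H2_nrm d[OF u v]
    by (intro sqrt_sum_squares_mono) (use n uv in \<open>auto simp: seminormed_def\<close>)
  show "nrm (H2 ?I) (u - v) = nrm (H2 ?I) (v - u)"
    using n uv unfolding H2_nrm d[OF u v] d[OF v u] by (auto simp: seminormed_def)
qed (simp add: H2_nrm)

section \<open>Bochner measurability\<close>

lemma strongly_measurable_diff:
  fixes X :: "('a \<Rightarrow> 'b::ab_group_add) fspace"
  assumes X: "seminormed X" and U: "strongly_measurable T X U" "AE t in leb {0<..<T}. U t \<in> carr X"
    and V: "strongly_measurable T X V" "AE t in leb {0<..<T}. V t \<in> carr X"
  shows "strongly_measurable T X (\<lambda>t. U t - V t)"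
proof -
  let ?M = "leb {0<..<T}"
  obtain s where s: "\<And>n. simple_function ?M (s n)" "\<And>n t. t \<in> {0<..<T} \<Longrightarrow> s n t \<in> carr X" "AE t in ?M. (\<lambda>n. nrm X (s n t - U t)) \<longlonglongrightarrow> 0"
    using U(1) unfolding strongly_measurable_def by blast
  obtain r where r: "\<And>n. simple_function ?M (r n)" "\<And>n t. t \<in> {0<..<T} \<Longrightarrow> r n t \<in> carr X" "AE t in ?M. (\<lambda>n. nrm X (r n t - V t)) \<longlonglongrightarrow> 0"
    using V(1) unfolding strongly_measurable_def by blast
  have "AE t in ?M. (\<lambda>n. nrm X ((s n t - r n t) - (U t - V t))) \<longlonglongrightarrow> 0"
    using s(3) r(3) U(2) V(2) AE_space
  proof eventually_elim
    case (elim t)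
    then have t: "t \<in> {0<..<T}" by simp
    show ?case
    proof (rule tendsto_sandwich[OF _ _ tendsto_const])
      show "\<forall>\<^sub>F n in sequentially. 0 \<le> nrm X ((s n t - r n t) - (U t - V t))" using X by (auto simp: seminormed_def)
      show "\<forall>\<^sub>F n in sequentially. nrm X ((s n t - r n t) - (U t - V t)) \<le> nrm X (s n t - U t) + nrm X (r n t - V t)"
      proof (rule always_eventually, rule allI)
        fix n
        have "(s n t - r n t) - (U t - V t) = (s n t - U t) - (r n t - V t)" by (auto simp: fun_eq_iff)
        then show "nrm X ((s n t - r n t) - (U t - V t)) \<le> nrm X (s n t - U t) + nrm X (r n t - V t)"
          using X s(2)[OF t] r(2)[OF t] elim(3,4) unfolding seminormed_def by metis
      qed
      show "(\<lambda>n. nrm X (s n t - U t) + nrm X (r n t - V t)) \<longlonglongrightarrow> 0"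
        using tendsto_add[OF elim(1,2)] by simp
    qed
  qed
  moreover have "simple_function ?M (\<lambda>t. s n t - r n t)" for n
    by (rule simple_function_compose2[OF s(1) r(1)])
  moreover have "s n t - r n t \<in> carr X" if "t \<in> {0<..<T}" for n t
    using X s(2) r(2) that unfolding seminormed_def by blast
  ultimately show ?thesis unfolding strongly_measurable_def by (intro exI[of _ "\<lambda>n t. s n t - r n t"]) blast
qed

text \<open>By the reverse triangle inequality the norms of the simple approximations converge
  almost everywhere to the norm of the limit.\<close>

lemma strongly_measurable_nrm:
  fixes X :: "('a \<Rightarrow> 'b::ab_group_add) fspace"
  assumes X: "seminormed X" and U: "strongly_measurable T X U" "AE t in leb {0<..<T}. U t \<in> carr X"
  shows "(\<lambda>t. nrm X (U t)) \<in> borel_measurable (leb {0<..<T})"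
proof -
  let ?M = "leb {0<..<T}"
  obtain s where s: "\<And>n. simple_function ?M (s n)" "\<And>n t. t \<in> {0<..<T} \<Longrightarrow> s n t \<in> carr X" "AE t in ?M. (\<lambda>n. nrm X (s n t - U t)) \<longlonglongrightarrow> 0"
    using U(1) unfolding strongly_measurable_def by blast
  have "AE t in ?M. lim (\<lambda>n. nrm X (s n t)) = nrm X (U t)"
    using s(3) U(2) AE_space
  proof eventually_elim
    case (elim t)
    then have t: "t \<in> {0<..<T}" by simp
    have "(\<lambda>n. nrm X (s n t) - nrm X (U t)) \<longlonglongrightarrow> 0"
      by (rule Lim_null_comparison[OF _ elim(1)])
        (use seminormed_reverse[OF X s(2)[OF t] elim(2)] in \<open>auto intro!: always_eventually\<close>)
    then show ?case by (intro limI) (simp add: LIM_zero_iff)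
  qed
  moreover have "(\<lambda>t. lim (\<lambda>n. nrm X (s n t))) \<in> borel_measurable ?M"
    by (intro borel_measurable_lim_metric borel_measurable_simple_function simple_function_compose1[OF s(1), of "nrm X"])
  ultimately show ?thesis by (intro borel_measurable_lebesgue_on_AE[where g="\<lambda>t. nrm X (U t)"]) auto
qed

lemma bochner_L2_iff:
  "U \<in> carr (bochner L2 T X) \<longleftrightarrow> strongly_measurable T X U \<and> (AE t in leb {0<..<T}. U t \<in> carr X) \<and> (\<lambda>t. nrm X (U t)) \<in> carr (L2 {0<..<T})"
  by (simp add: bochner_def)

lemma bochner_L2_diff:
  fixes X :: "('a \<Rightarrow> 'b::ab_group_add) fspace"
  assumes X: "seminormed X" and U: "U \<in> carr (bochner L2 T X)" and V: "V \<in> carr (bochner L2 T X)"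
  shows "(\<lambda>t. U t - V t) \<in> carr (bochner L2 T X)"
proof -
  let ?M = "leb {0<..<T}"
  have s: "strongly_measurable T X (\<lambda>t. U t - V t)"
    using U V by (intro strongly_measurable_diff[OF X]) (auto simp: bochner_L2_iff)
  have c: "AE t in ?M. U t - V t \<in> carr X"
  proof -
    have "AE t in ?M. U t \<in> carr X" "AE t in ?M. V t \<in> carr X" using U V by (auto simp: bochner_L2_iff)
    then show ?thesis by eventually_elim (use X in \<open>auto simp: seminormed_def\<close>)
  qed
  have "(\<lambda>t. nrm X (U t - V t)) \<in> carr (L2 {0<..<T})"
  proof (rule L2_bound[of "\<lambda>t. nrm X (U t) + nrm X (V t)" _ _ 1])
    show "(\<lambda>t. nrm X (U t) + nrm X (V t)) \<in> carr (L2 {0<..<T})" using U V by (intro L2_add) (auto simp: bochner_L2_iff)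
    show "(\<lambda>t. nrm X (U t - V t)) \<in> borel_measurable ?M" by (rule strongly_measurable_nrm[OF X s c])
    have "AE t in ?M. U t \<in> carr X" "AE t in ?M. V t \<in> carr X" using U V by (auto simp: bochner_L2_iff)
    then show "AE t in ?M. norm (nrm X (U t - V t)) \<le> 1 * norm (nrm X (U t) + nrm X (V t))"
      by eventually_elim (use X in \<open>auto simp: seminormed_def\<close>)
  qed
  with s c show ?thesis by (simp add: bochner_L2_iff)
qed

text \<open>The continuous representative of a Sobolev function in one dimension is a constant plus
  the primitive of its weak derivative; real test functions from \<open>prims\<close> detect it over
  either field.\<close>

lemma has_wderiv_ac:
  fixes w v :: "real \<Rightarrow> 'k::{real_normed_field, euclidean_space}"
  assumes lu: "l < u" and w: "integrable (leb {l<..<u}) w" and v: "integrable (leb {l<..<u}) v"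
    and d: "has_wderiv {l<..<u} 1 w v"
  obtains W where "ac l u W v" "AE x in leb {l<..<u}. w x = W x"
proof -
  have "(\<integral>x. deriv \<phi> x *\<^sub>R w x \<partial>leb {l<..<u}) = - (\<integral>x. \<phi> x *\<^sub>R v x \<partial>leb {l<..<u})" if "\<phi> \<in> prims l u" for \<phi>
  proof -
    note c = prims_ctest[OF that]
    have "(\<integral>x. w x * partials [1] (\<lambda>x. of_real (\<phi> x)) x \<partial>leb {l<..<u}) = - (\<integral>x. v x * of_real (\<phi> x) \<partial>leb {l<..<u})"
      using d test_funs_of_real[OF c, where 'k='k] unfolding has_wderiv_def by blast
    then show ?thesis by (simp only: partials_of_real[OF ctest_smooth[OF c]] mult_of_real_scaleR)
  qed
  from weak_derivative_ac[OF lu w v this] ac_indefinite_integral[OF v] show thesis by (blast intro: that)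
qed

lemma H1_ac:
  assumes lu: "l < u" and w: "w \<in> carr (H1 {l<..<u})"
  obtains W where "ac l u W (wderiv {l<..<u} 1 w)" "AE x in leb {l<..<u}. w x = W x"
  by (rule has_wderiv_ac[OF lu _ _ H1_wderiv(2)[OF w]])
    (use H1_wderiv[OF w] finite_lebesgue_on_Ioo in \<open>auto intro: L2_imp_integrable\<close>)

section \<open>Sup bounds, traces and boundary values\<close>

lemma ac_continuous:
  assumes F: "ac l u F f" shows "continuous_on {l..u} F"
proof -
  have f: "integrable (leb {l<..<u}) f" by (rule ac_integrable[OF F])
  then have "f integrable_on {l..u}"
    unfolding integrable_on_open_interval_real[symmetric] by (rule integrable_on_lebesgue_on) auto
  from indefinite_integral_continuous_1[OF this]
  have c: "continuous_on {l..u} (\<lambda>x. F l + integral {l..x} f)" by (intro continuous_intros)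
  have "F x = F l + integral {l..x} f" if x: "x \<in> {l..u}" for x
  proof -
    have fx: "integrable (leb {l<..<x}) f" by (rule ac_integrable[OF ac_restrict[OF F]]) (use x in auto)
    then have "integral\<^sup>L (leb {l<..<x}) f = integral {l..x} f"
      by (simp add: lebesgue_integral_eq_integral integral_open_interval_real)
    then show ?thesis using ac_eq[OF F x] by simp
  qed
  from continuous_on_eq[OF c this[symmetric]] show ?thesis .
qed

lemma ac_bounded: "ac l u F f \<Longrightarrow> bounded (F ` {l..u})"
  by (intro compact_imp_bounded compact_continuous_image ac_continuous) auto

lemma ac_measurable:
  assumes "ac l u F f" shows "F \<in> borel_measurable (leb {l<..<u})"
  by (rule continuous_imp_measurable_on_sets_lebesgue[OF continuous_on_subset[OF ac_continuous[OF assms]]]) auto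

lemma bounded_measurable_L2:
  fixes F :: "'a::euclidean_space \<Rightarrow> 'k::{real_normed_field, euclidean_space}"
  assumes "finite_measure (leb \<Omega>)" "F \<in> borel_measurable (leb \<Omega>)" "AE x in leb \<Omega>. norm (F x) \<le> C"
  shows "F \<in> carr (L2 \<Omega>)"
proof (rule L2_bound[of "\<lambda>x. 1 :: real"])
  interpret finite_measure "leb \<Omega>" by fact
  show "(\<lambda>x. 1 :: real) \<in> carr (L2 \<Omega>)" by (simp add: L2_iff)
qed (use assms in auto)

lemma ac_L2:
  fixes F :: "real \<Rightarrow> 'k::{real_normed_field, euclidean_space}"
  assumes "ac l u F f" shows "F \<in> carr (L2 {l<..<u})"
proof -
  obtain C where "\<forall>y\<in>F ` {l..u}. norm y \<le> C" using ac_bounded[OF assms] unfolding bounded_iff by blast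
  then show ?thesis
    by (intro bounded_measurable_L2[OF finite_lebesgue_on_Ioo ac_measurable[OF assms]]) (auto intro!: AE_I2)
qed

lemma ac_self_integrable:
  fixes F :: "real \<Rightarrow> 'k::{real_normed_field, euclidean_space}"
  shows "ac l u F f \<Longrightarrow> integrable (leb {l<..<u}) F"
  by (intro L2_imp_integrable ac_L2 finite_lebesgue_on_Ioo)

lemma ac_oscillation:
  assumes F: "ac l u F f" and x: "x \<in> {l..u}" and y: "y \<in> {l..u}"
  shows "norm (F x - F y) \<le> (\<integral>z. norm (f z) \<partial>leb {l<..<u})"
proof -
  let ?M = "leb {l<..<u}"
  have f: "integrable ?M f" by (rule ac_integrable[OF F])
  have e: "F x = F l + (\<integral>z. indicator {l<..<x} z *\<^sub>R f z \<partial>?M)" if "x \<in> {l..u}" for x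
    by (subst integral_lebesgue_on_subset_indicator) (use that ac_eq[OF F that] in auto)
  have i: "integrable ?M (\<lambda>z. indicator {l<..<x} z *\<^sub>R f z)" for x
    by (rule bounded_times_integrable[OF f, of _ 1]) (auto intro: borel_measurable_lebesgue_onI simp: indicator_def)
  have "F x - F y = (\<integral>z. indicator {l<..<x} z *\<^sub>R f z - indicator {l<..<y} z *\<^sub>R f z \<partial>?M)"
    using e[OF x] e[OF y] i by simp
  also have "norm \<dots> \<le> (\<integral>z. norm (indicator {l<..<x} z *\<^sub>R f z - indicator {l<..<y} z *\<^sub>R f z) \<partial>?M)"
    by (rule integral_norm_bound)
  also have "\<dots> \<le> (\<integral>z. norm (f z) \<partial>?M)"
    by (rule integral_mono) (use i f in \<open>auto simp: indicator_def\<close>)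
  finally show ?thesis .
qed

text \<open>The oscillation bound compares \<open>F x\<close> with \<open>F y\<close> for every
  \<open>y\<close>; it is averaged over \<open>y\<close>.\<close>

lemma ac_sup_bound:
  fixes F :: "real \<Rightarrow> 'k::{real_normed_field, euclidean_space}"
  assumes F: "ac l u F f" and x: "x \<in> {l..u}" and lu: "l < u"
  shows "(u - l) * norm (F x) \<le> (\<integral>z. norm (F z) \<partial>leb {l<..<u}) + (u - l) * (\<integral>z. norm (f z) \<partial>leb {l<..<u})"
proof -
  let ?M = "leb {l<..<u}"
  interpret finite_measure ?M by (rule finite_lebesgue_on_Ioo)
  have m: "measure ?M (space ?M) = u - l" using lu by (simp add: measure_restrict_space)
  have "(u - l) * norm (F x) = (\<integral>y. norm (F x) \<partial>?M)" using m by simp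
  also have "\<dots> \<le> (\<integral>y. norm (F y) + (\<integral>z. norm (f z) \<partial>?M) \<partial>?M)"
  proof (rule integral_mono)
    fix y assume "y \<in> space ?M"
    then have "norm (F x - F y) \<le> (\<integral>z. norm (f z) \<partial>?M)" by (intro ac_oscillation[OF F x]) auto
    then show "norm (F x) \<le> norm (F y) + (\<integral>z. norm (f z) \<partial>?M)" using norm_triangle_sub[of "F x" "F y"] by linarith
  qed (use ac_self_integrable[OF F] in auto)
  also have "\<dots> = (\<integral>y. norm (F y) \<partial>?M) + (u - l) * (\<integral>z. norm (f z) \<partial>?M)"
    using ac_self_integrable[OF F] m by simp
  finally show ?thesis .
qed

lemma L2_integral_bound:
  fixes f :: "real \<Rightarrow> 'k::{real_normed_field, euclidean_space}"
  assumes "f \<in> carr (L2 {l<..<u})" "l \<le> u"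
  shows "(\<integral>z. norm (f z) \<partial>leb {l<..<u}) \<le> sqrt (u - l) * nrm (L2 {l<..<u}) f"
proof -
  let ?M = "leb {l<..<u}"
  interpret finite_measure ?M by (rule finite_lebesgue_on_Ioo)
  have "(\<lambda>x. 1 :: real) \<in> carr (L2 {l<..<u})" by (simp add: L2_iff)
  from L2_Cauchy_Schwarz(2)[OF this assms(1)] show ?thesis using assms(2) by (simp add: L2_nrm measure_restrict_space)
qed

lemma norm_integral_squared_le:
  fixes f :: "real \<Rightarrow> 'k::{real_normed_field, euclidean_space}"
  assumes "f \<in> carr (L2 {l<..<u})" "l \<le> u"
  shows "(norm (\<integral>z. f z \<partial>leb {l<..<u}))\<^sup>2 \<le> (u - l) * (\<integral>z. (norm (f z))\<^sup>2 \<partial>leb {l<..<u})"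
proof -
  have "norm (\<integral>z. f z \<partial>leb {l<..<u}) \<le> sqrt (u - l) * nrm (L2 {l<..<u}) f"
    using integral_norm_bound[of "leb {l<..<u}" f] L2_integral_bound[OF assms] by linarith
  then have "(norm (\<integral>z. f z \<partial>leb {l<..<u}))\<^sup>2 \<le> (sqrt (u - l) * nrm (L2 {l<..<u}) f)\<^sup>2"
    by (rule power_mono) simp
  then show ?thesis using assms(2) by (simp add: power_mult_distrib L2_nrm_sq)
qed

text \<open>Cauchy-Schwarz on both integrals of the previous bound. On (0, T) the two coefficients
  add up to the constant \<open>CT\<close> of the trace estimate.\<close>

lemma ac_sup_bound_L2:
  fixes F :: "real \<Rightarrow> 'k::{real_normed_field, euclidean_space}"
  assumes F: "ac l u F f" and f: "f \<in> carr (L2 {l<..<u})" and x: "x \<in> {l..u}" and lu: "l < u"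
  shows "norm (F x) \<le> (1 / sqrt (u - l)) * nrm (L2 {l<..<u}) F + sqrt (u - l) * nrm (L2 {l<..<u}) f"
proof -
  define r where "r = sqrt (u - l)"
  have r: "r * r = u - l" "r > 0" using lu by (auto simp: r_def)
  let ?N = "nrm (L2 {l<..<u}) F" and ?M = "nrm (L2 {l<..<u}) f"
  have "r * r * norm (F x) \<le> (\<integral>z. norm (F z) \<partial>leb {l<..<u}) + r * r * (\<integral>z. norm (f z) \<partial>leb {l<..<u})"
    unfolding r(1) by (rule ac_sup_bound[OF F x lu])
  also have "\<dots> \<le> r * ?N + r * r * (r * ?M)"
    unfolding r_def using lu by (intro add_mono mult_left_mono L2_integral_bound ac_L2[OF F] f) auto
  finally have "r * (r * norm (F x)) \<le> r * (?N + r * (r * ?M))" by (simp add: algebra_simps)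
  then have "r * norm (F x) \<le> ?N + r * (r * ?M)" using r(2) by (simp only: mult_le_cancel_left_pos)
  then have "norm (F x) \<le> (?N + r * (r * ?M)) / r" using r(2) by (simp add: pos_le_divide_eq mult.commute)
  also have "\<dots> = (1 / r) * ?N + r * ?M" using r(2) by (simp add: add_divide_distrib)
  finally show ?thesis unfolding r_def .
qed

lemma test_funs_ac:
  fixes \<phi> :: "real \<Rightarrow> 'k::{real_normed_field, euclidean_space}"
  assumes \<phi>: "\<phi> \<in> test_funs {l<..<u}"
  shows "ac l u \<phi> (partials [1] \<phi>)" "\<phi> l = 0" "\<phi> u = 0"
proof -
  show "\<phi> l = 0" "\<phi> u = 0"
    using \<phi> by (auto simp: test_funs_def intro!: test_funs_continuous(3)[OF \<phi>, of 1])
  have s: "smooth_fun \<phi>" using \<phi> by (simp add: test_funs_def)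
  have "partials [] \<phi> differentiable (at x)" for x
    using s[unfolded smooth_fun_def, rule_format, of "[]"] by simp
  then have d: "\<phi> differentiable (at x)" for x by simp
  have "(\<phi> has_vector_derivative partials [1] \<phi> x) (at x)" for x
  proof -
    have D: "(\<phi> has_derivative frechet_derivative \<phi> (at x)) (at x)"
      using d frechet_derivative_works by blast
    have "frechet_derivative \<phi> (at x) = (\<lambda>h. h *\<^sub>R frechet_derivative \<phi> (at x) 1)"
    proof
      fix h
      show "frechet_derivative \<phi> (at x) h = h *\<^sub>R frechet_derivative \<phi> (at x) 1"
        using linear_scale[OF has_derivative_linear[OF D], of h 1] by simp
    qed
    with D show ?thesis by (simp add: has_vector_derivative_def)
  qed
  then show "ac l u \<phi> (partials [1] \<phi>)"
    by (rule ac_C1) (rule test_funs_continuous(2)[OF \<phi>], simp)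
qed

text \<open>The product rule for \<open>F\<close> times a test function; the boundary terms vanish
  with the test function.\<close>

lemma ac_imp_has_wderiv:
  fixes F :: "real \<Rightarrow> 'k::{real_normed_field, euclidean_space}"
  assumes F: "ac l u F f" and lu: "l < u"
  shows "has_wderiv {l<..<u} 1 F f"
  unfolding has_wderiv_def
proof (intro conjI ballI)
  show "locally_integrable {l<..<u} F" "locally_integrable {l<..<u} f"
    using integrable_lebesgue_on_subset[OF ac_self_integrable[OF F]] integrable_lebesgue_on_subset[OF ac_integrable[OF F]]
    by (auto simp: locally_integrable_def borel_compact)
  fix \<psi> :: "real \<Rightarrow> 'k" assume \<psi>: "\<psi> \<in> test_funs {l<..<u}"
  note a = test_funs_ac[OF \<psi>]
  let ?M = "leb {l<..<u}"
  have A: "ac l u (\<lambda>x. F x * \<psi> x) (\<lambda>x. f x * \<psi> x + F x * partials [1] \<psi> x)"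
    by (rule ac_bilinear[OF bounded_bilinear_mult F a(1)])
  have l: "locally_integrable {l<..<u} f" by fact
  have i: "integrable ?M (\<lambda>x. f x * \<psi> x)"
    by (rule integrable_times_test[OF l, of "supp \<psi>"])
      (use \<psi> test_funs_continuous[OF \<psi>, of 1] in \<open>auto simp: test_funs_def simp del: partials.simps\<close>)
  have i2: "integrable ?M (\<lambda>x. F x * partials [1] \<psi> x)"
    using Bochner_Integration.integrable_diff[OF ac_integrable[OF A] i] by simp
  have "(\<integral>x. f x * \<psi> x + F x * partials [1] \<psi> x \<partial>?M) = 0"
    using ac_eq[OF A, of u] lu a by simp
  then show "(\<integral>x. F x * partials [1] \<psi> x \<partial>?M) = - (\<integral>x. f x * \<psi> x \<partial>?M)"
    using i i2 by (simp add: add_eq_0_iff2 del: partials.simps)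
qed

lemma test_funs_H10:
  fixes \<phi> :: "real \<Rightarrow> 'k::{real_normed_field, euclidean_space}"
  assumes \<phi>: "\<phi> \<in> test_funs {l<..<u}" and lu: "l < u"
  shows "\<phi> \<in> carr (H1 {l<..<u})" "\<phi> \<in> carr (H10 {l<..<u})"
    "AE x in leb {l<..<u}. wderiv {l<..<u} 1 \<phi> x = partials [1] \<phi> x"
proof -
  note a = test_funs_ac[OF \<phi>]
  have w: "has_wderiv {l<..<u} 1 \<phi> (partials [1] \<phi>)" by (rule ac_imp_has_wderiv[OF a(1) lu])
  show "AE x in leb {l<..<u}. wderiv {l<..<u} 1 \<phi> x = partials [1] \<phi> x" by (rule wderiv_eq[OF w])
  have c: "continuous_on UNIV (partials [1] \<phi>)" by (rule test_funs_continuous(2)[OF \<phi>]) simp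
  have "bounded (partials [1] \<phi> ` {l..u})" by (intro compact_imp_bounded compact_continuous_image continuous_on_subset[OF c]) auto
  then obtain C where "\<forall>y\<in>partials [1] \<phi> ` {l..u}. norm y \<le> C" unfolding bounded_iff by blast
  then have "partials [1] \<phi> \<in> carr (L2 {l<..<u})"
    by (intro bounded_measurable_L2[OF finite_lebesgue_on_Ioo, of _ _ _ C] borel_measurable_lebesgue_onI borel_measurable_continuous_onI c)
      (auto intro!: AE_I2 simp del: partials.simps)
  then show h: "\<phi> \<in> carr (H1 {l<..<u})" by (rule H1I[OF ac_L2[OF a(1)] w])
  \<comment> \<open>The approximating sequence is constant, but \<open>wderiv\<close> is a choice:
    the derivative of \<open>\<phi> - \<phi>\<close> is known to vanish only almost everywhere, so
    its norm has to be argued to be 0.\<close>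
  have z: "has_wderiv {l<..<u} 1 (\<phi> - \<phi>) (\<lambda>x. 0)"
    using has_wderiv_diff[OF w w] by (simp add: fun_diff_def)
  have "nrm (L2 {l<..<u}) (\<lambda>x. 0 :: 'k) = nrm (L2 {l<..<u}) (wderiv {l<..<u} 1 (\<phi> - \<phi>))"
  proof (rule L2_cong_AE(2))
    show "wderiv {l<..<u} 1 (\<phi> - \<phi>) \<in> carr (L2 {l<..<u})"
      by (rule H1_wderiv(3)[OF H1_diff(1)[OF h h]])
  qed (use wderiv_eq[OF z] in auto)
  then have "nrm (H1 {l<..<u}) (\<phi> - \<phi>) = 0"
    unfolding H1_nrm by (simp add: L2_nrm)
  then show "\<phi> \<in> carr (H10 {l<..<u})"
    using h \<phi> by (auto simp: H10_def intro!: exI[of _ "\<lambda>n. \<phi>"])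
qed

text \<open>Evaluation at an end is continuous in the \<open>H1\<close> norm by the sup bound, and
  the approximating test functions vanish at both ends.\<close>

lemma H10_ac:
  fixes w :: "real \<Rightarrow> 'k::{real_normed_field, euclidean_space}"
  assumes lu: "l < u" and w: "w \<in> carr (H10 {l<..<u})"
  obtains W where "ac l u W (wderiv {l<..<u} 1 w)" "AE x in leb {l<..<u}. w x = W x" "W l = 0" "W u = 0"
proof -
  let ?I = "{l<..<u}"
  have h: "w \<in> carr (H1 ?I)" using w by (simp add: H10_def)
  obtain \<phi> where \<phi>: "\<And>n. \<phi> n \<in> test_funs ?I" and lim: "(\<lambda>n::nat. nrm (H1 ?I) (w - \<phi> n)) \<longlonglongrightarrow> 0"
    using w by (auto simp: H10_def)
  obtain W where W: "ac l u W (wderiv ?I 1 w)" "AE x in leb ?I. w x = W x" by (rule H1_ac[OF lu h])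
  have bd: "norm (W x) \<le> (1 / sqrt (u - l) + sqrt (u - l)) * nrm (H1 ?I) (w - \<phi> n)" if x: "x \<in> {l, u}" for x n
  proof -
    have p1: "\<phi> n \<in> carr (H1 ?I)" by (rule test_funs_H10[OF \<phi> lu])
    have A: "ac l u (\<lambda>x. W x - \<phi> n x) (\<lambda>x. wderiv ?I 1 w x - partials [1] (\<phi> n) x)"
      by (rule ac_diff[OF W(1) test_funs_ac(1)[OF \<phi>]])
    note d = H1_diff[OF h p1]
    have ae: "AE x in leb ?I. wderiv ?I 1 (w - \<phi> n) x = wderiv ?I 1 w x - partials [1] (\<phi> n) x"
      using d(2) test_funs_H10(3)[OF \<phi>[of n] lu] by eventually_elim (simp del: partials.simps)
    have ae': "AE x in leb ?I. (w - \<phi> n) x = W x - \<phi> n x" using W(2) by eventually_elim simp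
    have f: "(\<lambda>x. wderiv ?I 1 w x - partials [1] (\<phi> n) x) \<in> carr (L2 ?I)"
      by (rule L2_cong_AE(1)[OF H1_wderiv(3)[OF d(1)] _ ae]) auto
    have n1: "nrm (L2 ?I) (\<lambda>x. wderiv ?I 1 w x - partials [1] (\<phi> n) x) = nrm (L2 ?I) (wderiv ?I 1 (w - \<phi> n))"
      by (rule L2_cong_AE(2)[OF H1_wderiv(3)[OF d(1)] _ ae]) auto
    have n2: "nrm (L2 ?I) (\<lambda>x. W x - \<phi> n x) = nrm (L2 ?I) (w - \<phi> n)"
      by (rule L2_cong_AE(2)[OF H1_wderiv(1)[OF d(1)] _ ae']) auto
    have le: "nrm (L2 ?I) (w - \<phi> n) \<le> nrm (H1 ?I) (w - \<phi> n)" "nrm (L2 ?I) (wderiv ?I 1 (w - \<phi> n)) \<le> nrm (H1 ?I) (w - \<phi> n)"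
      unfolding H1_nrm by (auto intro!: real_le_rsqrt)
    have "norm (W x) = norm (W x - \<phi> n x)" using x test_funs_ac(2,3)[OF \<phi>[of n]] by auto
    also have "\<dots> \<le> (1 / sqrt (u - l)) * nrm (L2 ?I) (w - \<phi> n) + sqrt (u - l) * nrm (L2 ?I) (wderiv ?I 1 (w - \<phi> n))"
      using ac_sup_bound_L2[OF A f _ lu, of x] x lu unfolding n1 n2 by auto
    also have "\<dots> \<le> (1 / sqrt (u - l)) * nrm (H1 ?I) (w - \<phi> n) + sqrt (u - l) * nrm (H1 ?I) (w - \<phi> n)"
      using le lu by (intro add_mono mult_left_mono) auto
    finally show ?thesis by (simp add: distrib_right)
  qed
  have "W x = 0" if x: "x \<in> {l, u}" for x
  proof -
    have "(\<lambda>n. (1 / sqrt (u - l) + sqrt (u - l)) * nrm (H1 ?I) (w - \<phi> n)) \<longlonglongrightarrow> (1 / sqrt (u - l) + sqrt (u - l)) * 0"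
      by (intro tendsto_intros lim)
    from LIMSEQ_le_const[OF this, of "norm (W x)"] bd[OF x] show ?thesis by auto
  qed
  then have "W l = 0" "W u = 0" by blast+
  with W show thesis by (rule that)
qed

section \<open>Initial values\<close>

text \<open>Measurability of the set is what permits the return from iterated null sets to a null
  set of the product; the variables change their order on the way.\<close>

lemma AE_lebesgue_on_commute:
  fixes P :: "'a::euclidean_space \<times> 'b::euclidean_space \<Rightarrow> bool"
  assumes A[measurable]: "A \<in> sets borel" and B[measurable]: "B \<in> sets borel" and P: "{z. P z} \<in> sets borel"
    and ae: "AE x in leb B. AE t in leb A. P (t, x)"
  shows "AE z in leb (A \<times> B). P z"
proof -
  have [measurable]: "Measurable.pred (borel \<Otimes>\<^sub>M borel) P"
    using P by (simp add: pred_def borel_prod)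
  have "AE x in lborel. AE t in lborel. x \<in> B \<longrightarrow> t \<in> A \<longrightarrow> P (t, x)"
    using ae unfolding AE_lebesgue_on_iff[OF A] AE_lebesgue_on_iff[OF B]
    by (rule eventually_mono) (auto elim: eventually_mono)
  then have "AE x in lborel. AE t in lborel. fst (x, t) \<in> B \<longrightarrow> snd (x, t) \<in> A \<longrightarrow> P (snd (x, t), fst (x, t))"
    by simp
  then have "AE z in lborel \<Otimes>\<^sub>M lborel. fst z \<in> B \<longrightarrow> snd z \<in> A \<longrightarrow> P (snd z, fst z)"
    by (intro lborel_pair.AE_pair_measure) measurable
  then have "AE z in leb (B \<times> A). P (snd z, fst z)"
    unfolding AE_lebesgue_on_iff[OF borel_Times[OF B A]] lborel_prod
    by (rule eventually_mono) (auto simp: mem_Times_iff)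
  from AE_lebesgue_on_swap[OF B A this] show ?thesis by simp
qed

text \<open>Selects good times arbitrarily close to 0: an interval of positive length is not a null
  set.\<close>

lemma AE_Ioo_ex:
  fixes T :: real
  assumes "AE t in leb {0<..<T}. P t" "0 < d" "d \<le> T"
  obtains t where "0 < t" "t < d" "P t"
proof -
  have "AE t in leb {0<..<d}. P t"
    by (rule AE_lebesgue_on_subset[OF assms(1)]) (use assms in auto)
  with AE_space have "AE t in leb {0<..<d}. t \<in> {0<..<d} \<and> P t" by eventually_elim simp
  moreover have "emeasure (leb {0<..<d}) (space (leb {0<..<d})) \<noteq> 0"
    using assms(2) by (simp add: emeasure_restrict_space)
  then have "ae_filter (leb {0<..<d}) \<noteq> bot" by (simp add: ae_filter_eq_bot_iff)
  ultimately have "\<exists>t. t \<in> {0<..<d} \<and> P t" by (intro eventually_happens'[of "ae_filter (leb {0<..<d})"])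
  then show thesis using that by auto
qed

lemma borel_rectangle [simp]: "{a<..<b::real} \<times> {l<..<u::real} \<in> sets borel"
  by (intro borel_open open_Times) auto

lemma finite_lebesgue_on_rectangle: "finite_measure (leb ({a<..<b::real} \<times> {l<..<u::real}))"
proof (intro finite_measure_lebesgue_on bounded_set_imp_lmeasurable bounded_Times)
  show "{a<..<b} \<times> {l<..<u} \<in> sets lebesgue" by (rule sets_completionI_sets) simp
qed auto

text \<open>The variable domain of integration is moved into the integrand, where joint
  measurability applies.\<close>

lemma primitive_measurable:
  fixes P :: "real \<times> real \<Rightarrow> 'k::euclidean_space"
  assumes [measurable]: "P \<in> borel_measurable borel"
  shows "(\<lambda>z. \<integral>s. P (s, snd z) \<partial>leb {0<..<fst z}) \<in> borel_measurable borel"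
proof -
  have P[measurable]: "P \<in> borel_measurable (borel \<Otimes>\<^sub>M borel)" using assms by (simp add: borel_prod)
  have e: "(\<integral>s. P (s, x) \<partial>leb {0<..<t}) = (\<integral>s. (if 0 < s \<and> s < t then P (s, x) else 0) \<partial>lborel)" for t x
    by (subst integral_lebesgue_on_borel) (auto intro!: Bochner_Integration.integral_cong simp: indicator_def)
  have "(\<lambda>z. \<integral>s. (if 0 < s \<and> s < fst z then P (s, snd z) else 0) \<partial>lborel) \<in> borel_measurable (borel \<Otimes>\<^sub>M borel)"
    by measurable
  then show ?thesis unfolding e borel_prod .
qed

text \<open>The initial value fixes the constant of integration in the representation of almost every
  slice as a primitive of its time derivative.\<close>

lemma initial_value_primitive:
  fixes u v :: "real \<times> real \<Rightarrow> complex"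
  assumes T: "0 < T" and u: "u \<in> carr (L2 (QT T))" and v: "v \<in> carr (L2 (QT T))"
    and d: "has_wderiv (QT T) (1, 0) u v" and iv: "has_initial_value T u h"
  shows "AE x in leb {0<..<1}. AE t in leb {0<..<T}. u (t, x) = h x + (\<integral>s. v (s, x) \<partial>leb {0<..<t})"
    and "h \<in> carr (L2 {0<..<1})"
proof -
  let ?J = "leb {0<..<T}" and ?I = "leb {0<..<1::real}" and ?Q = "leb (QT T)"
  note fQ = finite_lebesgue_on_rectangle[of 0 T 0 1]
  have ui: "integrable ?Q u" and vi: "integrable ?Q v" using u v fQ by (auto intro: L2_imp_integrable)
  obtain u1 where u1[measurable]: "u1 \<in> borel_measurable borel" and ae_u: "AE z in ?Q. u z = u1 z"
    using borel_representative[OF _ L2_measurable[OF u]] by auto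
  obtain v1 where v1[measurable]: "v1 \<in> borel_measurable borel" and ae_v: "AE z in ?Q. v z = v1 z"
    using borel_representative[OF _ L2_measurable[OF v]] by auto
  \<comment> \<open>Borel representatives are used throughout, because the identity u = c + S must
    describe a Borel subset of the plane when the order of the variables is exchanged below.\<close>
  define S where "S x t = (\<integral>s. v1 (s, x) \<partial>leb {0<..<t})" for x t :: real
  define c where "c x = (1 / (T - 0)) *\<^sub>R (\<integral>t. u1 (t, x) - S x t \<partial>?J)" for x :: real
  have u1p[measurable]: "u1 \<in> borel_measurable (borel \<Otimes>\<^sub>M borel)" by (simp add: borel_prod)
  have Sm: "(\<lambda>z. S (snd z) (fst z)) \<in> borel_measurable borel"
    unfolding S_def using primitive_measurable[OF v1] by simp
  have Sp: "(\<lambda>z. S (fst z) (snd z)) \<in> borel_measurable (borel \<Otimes>\<^sub>M borel)"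
  proof -
    have "(\<lambda>z. S (snd z) (fst z)) \<in> borel_measurable (borel \<Otimes>\<^sub>M borel)" using Sm by (simp add: borel_prod)
    from measurable_comp[OF measurable_pair_swap' this] show ?thesis by (simp add: comp_def case_prod_beta')
  qed
  have cm: "c \<in> borel_measurable borel"
  proof -
    have m: "(\<lambda>z. indicator {0<..<T} (snd z) *\<^sub>R (u1 (snd z, fst z) - S (fst z) (snd z))) \<in> borel_measurable (borel \<Otimes>\<^sub>M lborel)"
      using Sp by measurable
    have "(\<lambda>x. \<integral>t. indicator {0<..<T} t *\<^sub>R (u1 (t, x) - S x t) \<partial>lborel) \<in> borel_measurable borel"
      using lborel.borel_measurable_lebesgue_integral[of "\<lambda>x t. indicator {0<..<T} t *\<^sub>R (u1 (t, x) - S x t)" borel] m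
      by (simp add: case_prod_beta')
    moreover have "(\<integral>t. u1 (t, x) - S x t \<partial>?J) = (\<integral>t. indicator {0<..<T} t *\<^sub>R (u1 (t, x) - S x t) \<partial>lborel)" for x
    proof (rule integral_lebesgue_on_borel)
      have "(\<lambda>t. (x, t)) \<in> borel \<rightarrow>\<^sub>M (borel \<Otimes>\<^sub>M borel)" by measurable
      from measurable_comp[OF this Sp] show "(\<lambda>t. u1 (t, x) - S x t) \<in> borel_measurable borel"
        by (intro borel_measurable_diff) (auto simp: comp_def)
    qed auto
    ultimately show ?thesis unfolding c_def by simp
  qed
  have S_eq: "AE x in ?I. \<forall>t\<in>{0..T}. S x t = (\<integral>s. v (s, x) \<partial>leb {0<..<t})"
    using AE_lebesgue_on_slice'[OF _ _ ae_v]
  proof (rule eventually_mono[rotated 2])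
    fix x assume ae: "AE t in ?J. v (t, x) = v1 (t, x)"
    show "\<forall>t\<in>{0..T}. S x t = (\<integral>s. v (s, x) \<partial>leb {0<..<t})"
    proof
      fix t assume t: "t \<in> {0..T}"
      have "AE s in leb {0<..<t}. v (s, x) = v1 (s, x)" by (rule AE_lebesgue_on_subset[OF ae]) (use t in auto)
      then show "S x t = (\<integral>s. v (s, x) \<partial>leb {0<..<t})"
        unfolding S_def by (intro integral_lebesgue_on_cong_AE) (auto elim: eventually_mono)
    qed
  qed auto
  have rep: "AE x in ?I. AE t in ?J. u1 (t, x) = c x + S x t"
    using has_wderiv_slice_t[OF T ui vi d] S_eq AE_lebesgue_on_slice'[OF _ _ ae_u, simplified]
  proof eventually_elim
    case (elim x)
    have "AE t in ?J. u (t, x) - (\<integral>s. v (s, x) \<partial>leb {0<..<t}) = u1 (t, x) - S x t"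
      using elim(3) AE_space by eventually_elim (use elim(2) in auto)
    then have e: "(\<integral>t. u (t, x) - (\<integral>s. v (s, x) \<partial>leb {0<..<t}) \<partial>?J) = (\<integral>t. u1 (t, x) - S x t \<partial>?J)"
      by (intro integral_lebesgue_on_cong_AE) auto
    show ?case
      using elim(1,3) AE_space by eventually_elim (use elim(2) e in \<open>auto simp: c_def\<close>)
  qed
  \<comment> \<open>The representation holds for almost every \<open>x\<close> and then almost every
    \<open>t\<close>. Continuity at time 0 needs it for fixed \<open>t\<close>, so the order is
    exchanged.\<close>
  have "{z. u1 z = c (snd z) + S (snd z) (fst z)} \<in> sets borel"
  proof -
    have "(\<lambda>z. u1 z - (c (snd z) + S (snd z) (fst z))) \<in> borel_measurable borel"
      using Sm cm unfolding borel_prod[symmetric] by measurable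
    from measurable_sets[OF this, of "{0}"] show ?thesis by (simp add: vimage_def)
  qed
  from AE_lebesgue_on_commute[OF _ _ this, of "{0<..<T}" "{0<..<1}"] rep
  have "AE z in ?Q. u1 z = c (snd z) + S (snd z) (fst z)" by simp
  from AE_lebesgue_on_slice[OF _ _ this] have rep': "AE t in ?J. AE x in ?I. u1 (t, x) = c x + S x t" by simp
  obtain W where W: "\<And>t. t \<in> {0..T} \<Longrightarrow> W t \<in> carr (L2 {0<..<1})"
    "\<And>s. s \<in> {0..T} \<Longrightarrow> ((\<lambda>t. nrm (L2 {0<..<1}) (W t - W s)) \<longlongrightarrow> 0) (at s within {0..T})"
    "AE t in ?J. AE x in ?I. W t x = u (t, x)" "AE x in ?I. W 0 x = h x"
    using iv unfolding has_initial_value_def by blast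
  have W0: "W 0 \<in> carr (L2 {0<..<1})" using W(1) T by simp
  show h: "h \<in> carr (L2 {0<..<1})" by (rule L2_cong_AE(1)[OF W0 _ W(4)]) simp
  have good: "AE t in ?J. AE x in ?I. c x = W t x - S x t"
    using rep' W(3) AE_lebesgue_on_slice[OF _ _ ae_u, simplified]
  proof eventually_elim
    case (elim t)
    then show ?case by eventually_elim simp
  qed
  define N where "N = (\<integral>z. (norm (v z))\<^sup>2 \<partial>?Q)"
  have vv: "integrable ?Q (\<lambda>z. (norm (v z))\<^sup>2)" using v by (simp add: L2_iff)
  have vvs: "integrable (leb ({0<..<1} \<times> {0<..<T})) (\<lambda>z. (norm (v (snd z, fst z)))\<^sup>2)"
    using integrable_lebesgue_on_swap[OF _ _ vv] by simp
  \<comment> \<open>Cauchy-Schwarz in time: the primitive is of order sqrt t in L^2(0,1).\<close>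
  have Sb: "(\<lambda>x. S x t) \<in> carr (L2 {0<..<1})" "(nrm (L2 {0<..<1}) (\<lambda>x. S x t))\<^sup>2 \<le> t * N" if t: "t \<in> {0..T}" for t
  proof -
    have "(\<lambda>x. (x, t)) \<in> borel \<rightarrow>\<^sub>M (borel \<Otimes>\<^sub>M borel)" by measurable
    from measurable_comp[OF this Sp] have m: "(\<lambda>x. S x t) \<in> borel_measurable borel" by (simp add: comp_def)
    note iv = integrable_integral_lebesgue_on_slice[OF _ _ vvs, simplified]
    have vs: "AE x in ?I. (\<lambda>s. v (s, x)) \<in> borel_measurable ?J"
      using measurable_lebesgue_on_slice[OF _ _ measurable_lebesgue_on_swap[OF _ _ L2_measurable[OF v]], simplified] by simp
    have b: "AE x in ?I. (norm (S x t))\<^sup>2 \<le> t * (\<integral>s. (norm (v (s, x)))\<^sup>2 \<partial>?J)"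
      using S_eq AE_integrable_lebesgue_on_slice[OF _ _ vvs, simplified] vs
    proof eventually_elim
      case (elim x)
      have vL: "(\<lambda>s. v (s, x)) \<in> carr (L2 {0<..<T})" using elim by (simp add: L2_iff)
      have sub: "{0<..<t} \<subseteq> {0<..<T}" using t by auto
      have it: "integrable (leb {0<..<t}) (\<lambda>s. (norm (v (s, x)))\<^sup>2)"
        by (rule integrable_lebesgue_on_subset[OF _ sub]) (use elim in auto)
      have "integrable ?J (\<lambda>s. v (s, x))" by (rule L2_imp_integrable[OF vL finite_lebesgue_on_Ioo])
      then have "integrable (leb {0<..<t}) (\<lambda>s. v (s, x))" by (rule integrable_lebesgue_on_subset[OF _ sub]) auto
      with it have vt: "(\<lambda>s. v (s, x)) \<in> carr (L2 {0<..<t})" by (simp add: L2_iff borel_measurable_integrable)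
      have "(norm (S x t))\<^sup>2 \<le> (t - 0) * (\<integral>s. (norm (v (s, x)))\<^sup>2 \<partial>leb {0<..<t})"
        using elim(1)[rule_format, OF t] norm_integral_squared_le[OF vt] t by simp
      also have "(\<integral>s. (norm (v (s, x)))\<^sup>2 \<partial>leb {0<..<t}) = (\<integral>s. indicator {0<..<t} s *\<^sub>R (norm (v (s, x)))\<^sup>2 \<partial>?J)"
        by (rule integral_lebesgue_on_subset_indicator[symmetric]) (use sub in auto)
      also have "\<dots> \<le> (\<integral>s. (norm (v (s, x)))\<^sup>2 \<partial>?J)"
        using elim(2) integrable_lebesgue_on_subset_indicator[OF sub, of "\<lambda>s. (norm (v (s, x)))\<^sup>2"] it
        by (intro integral_mono) (auto simp: indicator_def)
      finally show ?case using t by (simp add: mult_left_mono)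
    qed
    have i2: "integrable ?I (\<lambda>x. (norm (S x t))\<^sup>2)"
    proof (rule Bochner_Integration.integrable_bound)
      show "integrable ?I (\<lambda>x. t * (\<integral>s. (norm (v (s, x)))\<^sup>2 \<partial>?J))" using iv by simp
      show "AE x in ?I. norm ((norm (S x t))\<^sup>2) \<le> norm (t * (\<integral>s. (norm (v (s, x)))\<^sup>2 \<partial>?J))"
        using b by eventually_elim simp
    qed (use borel_measurable_lebesgue_onI[OF m] in simp)
    then show "(\<lambda>x. S x t) \<in> carr (L2 {0<..<1})" using borel_measurable_lebesgue_onI[OF m] by (simp add: L2_iff)
    have "(nrm (L2 {0<..<1}) (\<lambda>x. S x t))\<^sup>2 \<le> (\<integral>x. t * (\<integral>s. (norm (v (s, x)))\<^sup>2 \<partial>?J) \<partial>?I)"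
      unfolding L2_nrm_sq by (rule integral_mono_AE[OF i2 _ b]) (use iv in simp)
    also have "\<dots> = t * N"
      using integral_lebesgue_on_slice[OF _ _ vvs] integral_lebesgue_on_swap[OF _ _ vv] by (simp add: N_def)
    finally show "(nrm (L2 {0<..<1}) (\<lambda>x. S x t))\<^sup>2 \<le> t * N" .
  qed
  \<comment> \<open>At a good time c - h is the difference of W t - W 0 and the primitive S at
    \<open>t\<close>; both tend to 0 in L^2 as \<open>t\<close> does.\<close>
  have ch: "(\<lambda>x. c x - h x) \<in> carr (L2 {0<..<1})"
    and bound: "nrm (L2 {0<..<1}) (\<lambda>x. c x - h x) \<le> nrm (L2 {0<..<1}) (W t - W 0) + sqrt (t * N)"
    if t: "0 < t" "t < T" and ae: "AE x in ?I. c x = W t x - S x t" for t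
  proof -
    have tt: "t \<in> {0..T}" using t by simp
    have dW: "(\<lambda>x. W t x - W 0 x) \<in> carr (L2 {0<..<1})" by (rule L2_diff[OF W(1)[OF tt] W0])
    have e: "AE x in ?I. (W t x - W 0 x) - S x t = c x - h x" using ae W(4) by eventually_elim simp
    show "(\<lambda>x. c x - h x) \<in> carr (L2 {0<..<1})"
      by (rule L2_cong_AE(1)[OF L2_diff[OF dW Sb(1)[OF tt]] _ e]) simp
    have "nrm (L2 {0<..<1}) (\<lambda>x. c x - h x) = nrm (L2 {0<..<1}) (\<lambda>x. (W t x - W 0 x) - S x t)"
      by (rule L2_cong_AE(2)[OF L2_diff[OF dW Sb(1)[OF tt]] _ e]) simp
    also have "\<dots> \<le> nrm (L2 {0<..<1}) (\<lambda>x. W t x - W 0 x) + nrm (L2 {0<..<1}) (\<lambda>x. S x t)"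
      by (rule L2_triangle(2)[OF dW Sb(1)[OF tt]])
    also have "nrm (L2 {0<..<1}) (\<lambda>x. S x t) \<le> sqrt (t * N)" by (rule real_le_rsqrt[OF Sb(2)[OF tt]])
    finally show "nrm (L2 {0<..<1}) (\<lambda>x. c x - h x) \<le> nrm (L2 {0<..<1}) (W t - W 0) + sqrt (t * N)"
      by (simp add: fun_diff_def)
  qed
  have "\<exists>t. 0 < t \<and> t < min T (1 / Suc n) \<and> (AE x in ?I. c x = W t x - S x t)" for n
  proof -
    have "0 < min T (1 / Suc n)" "min T (1 / Suc n) \<le> T" using T by auto
    from AE_Ioo_ex[OF good this] show ?thesis by blast
  qed
  then obtain t where t: "\<And>n. 0 < t n" "\<And>n. t n < min T (1 / Suc n)" "\<And>n. AE x in ?I. c x = W (t n) x - S x (t n)"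
    by metis
  have t0: "t \<longlonglongrightarrow> 0"
  proof (rule tendsto_sandwich[OF _ _ tendsto_const])
    show "(\<lambda>n. 1 / real (Suc n)) \<longlonglongrightarrow> 0" using LIMSEQ_inverse_real_of_nat by (simp add: inverse_eq_divide)
    show "\<forall>\<^sub>F n in sequentially. t n \<le> 1 / real (Suc n)" using t(2) by (auto intro!: always_eventually less_imp_le)
  qed (use t(1) in \<open>auto intro!: always_eventually less_imp_le\<close>)
  have "(\<lambda>n. nrm (L2 {0<..<1}) (W (t n) - W 0) + sqrt (t n * N)) \<longlonglongrightarrow> 0 + sqrt (0 * N)"
  proof (intro tendsto_add tendsto_real_sqrt tendsto_mult t0 tendsto_const)
    have "filterlim t (at 0 within {0..T}) sequentially"
      using t0 t(1,2) T by (auto simp: filterlim_at intro!: always_eventually less_imp_le) (metis less_irrefl)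
    then show "(\<lambda>n. nrm (L2 {0<..<1}) (W (t n) - W 0)) \<longlonglongrightarrow> 0"
      using filterlim_compose[OF W(2)[of 0]] T by simp
  qed
  moreover have "nrm (L2 {0<..<1}) (\<lambda>x. c x - h x) \<le> nrm (L2 {0<..<1}) (W (t n) - W 0) + sqrt (t n * N)" for n
    using bound[OF t(1) _ t(3), of n] t(2)[of n] by simp
  ultimately have "nrm (L2 {0<..<1}) (\<lambda>x. c x - h x) \<le> 0"
    using LIMSEQ_le_const by fastforce
  then have "nrm (L2 {0<..<1}) (\<lambda>x. c x - h x) = 0" by (rule antisym) simp
  then have "(\<integral>x. (norm (c x - h x))\<^sup>2 \<partial>?I) = 0" by (simp add: L2_nrm)
  moreover have "integrable ?I (\<lambda>x. (norm (c x - h x))\<^sup>2)" using ch[OF t(1) _ t(3), of 0] t(2)[of 0] by (simp add: L2_iff)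
  ultimately have "AE x in ?I. c x = h x" by (subst (asm) integral_nonneg_eq_0_iff_AE) auto
  then show "AE x in ?I. AE t in ?J. u (t, x) = h x + (\<integral>s. v (s, x) \<partial>leb {0<..<t})"
    using rep S_eq AE_lebesgue_on_slice'[OF _ _ ae_u, simplified]
  proof eventually_elim
    case (elim x)
    show ?case using elim(2,4) AE_space by eventually_elim (use elim(1,3) in auto)
  qed
qed

section \<open>Steklov averages\<close>

text \<open>Average over the past interval (t - h, t) in the first variable only: backward averages
  have the sign that the convexity inequality requires. The integral runs over the whole line, so it
  is applied to functions extended by 0 outside Q_T.\<close>

definition steklov :: "real \<Rightarrow> (real \<times> real \<Rightarrow> complex) \<Rightarrow> real \<times> real \<Rightarrow> complex" where
  "steklov h F z = (1 / h) *\<^sub>R (\<integral>r. indicator {fst z - h<..<fst z} r *\<^sub>R F (r, snd z) \<partial>lborel)"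

lemma steklov_measurable:
  assumes "F \<in> borel_measurable borel" shows "steklov h F \<in> borel_measurable borel"
proof -
  have [measurable]: "F \<in> borel_measurable (borel \<Otimes>\<^sub>M borel)" using assms by (simp add: borel_prod)
  have "(\<lambda>z. \<integral>r. (if fst z - h < r \<and> r < fst z then F (r, snd z) else 0) \<partial>lborel) \<in> borel_measurable (borel \<Otimes>\<^sub>M borel)"
    by measurable
  moreover have "(\<integral>r. indicator {fst z - h<..<fst z} r *\<^sub>R F (r, snd z) \<partial>lborel) =
      (\<integral>r. (if fst z - h < r \<and> r < fst z then F (r, snd z) else 0) \<partial>lborel)" for z
    by (intro Bochner_Integration.integral_cong) (auto simp: indicator_def)
  ultimately show ?thesis unfolding steklov_def[abs_def] by (simp add: borel_prod)
qed

lemma steklov_pointwise: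
  assumes h: "0 < h" and F[measurable]: "F \<in> borel_measurable borel"
  shows "ennreal ((norm (steklov h F (s, x)))\<^sup>2) \<le> ennreal (1 / h) * (\<integral>\<^sup>+r. indicator {s - h<..<s} r * ennreal ((norm (F (r, x)))\<^sup>2) \<partial>lborel)"
proof (cases "integrable lborel (\<lambda>r. indicator {s - h<..<s} r *\<^sub>R F (r, x))")
  case True
  have [measurable]: "F \<in> borel_measurable (borel \<Otimes>\<^sub>M borel)" by (simp add: borel_prod)
  let ?f = "\<lambda>r. indicator {s - h<..<s} r * ennreal (norm (F (r, x)))"
  have "ennreal (norm (\<integral>r. indicator {s - h<..<s} r *\<^sub>R F (r, x) \<partial>lborel)) \<le> (\<integral>\<^sup>+r. norm (indicator {s - h<..<s} r *\<^sub>R F (r, x)) \<partial>lborel)"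
    by (rule integral_norm_bound_ennreal[OF True])
  \<comment> \<open>Writing the integrand as the indicator times itself lets Cauchy-Schwarz yield a
    factor \<open>h\<close>, which against 1 / h^2 leaves 1 / h.\<close>
  also have "\<dots> = (\<integral>\<^sup>+r. indicator {s - h<..<s} r * ?f r \<partial>lborel)"
    by (intro nn_integral_cong) (auto simp: indicator_def)
  finally have "(ennreal (norm (\<integral>r. indicator {s - h<..<s} r *\<^sub>R F (r, x) \<partial>lborel)))\<^sup>2 \<le> (\<integral>\<^sup>+r. indicator {s - h<..<s} r * ?f r \<partial>lborel)\<^sup>2"
    by (rule power_mono) simp
  also have "\<dots> \<le> (\<integral>\<^sup>+r. indicator {s - h<..<s} r ^ 2 \<partial>lborel) * (\<integral>\<^sup>+r. ?f r ^ 2 \<partial>lborel)"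
    by (rule Cauchy_Schwarz_nn_integral) measurable
  also have "(\<integral>\<^sup>+r. indicator {s - h<..<s} r ^ 2 \<partial>lborel) = (\<integral>\<^sup>+r. indicator {s - h<..<s} r \<partial>lborel)"
    by (intro nn_integral_cong) (auto simp: indicator_def)
  also have "\<dots> = ennreal h" using h by simp
  also have "(\<integral>\<^sup>+r. ?f r ^ 2 \<partial>lborel) = (\<integral>\<^sup>+r. indicator {s - h<..<s} r * ennreal ((norm (F (r, x)))\<^sup>2) \<partial>lborel)"
    by (intro nn_integral_cong) (auto simp: indicator_def ennreal_power)
  finally have *: "ennreal ((norm (\<integral>r. indicator {s - h<..<s} r *\<^sub>R F (r, x) \<partial>lborel))\<^sup>2) \<le> ennreal h * (\<integral>\<^sup>+r. indicator {s - h<..<s} r * ennreal ((norm (F (r, x)))\<^sup>2) \<partial>lborel)"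
    by (simp add: ennreal_power)
  have "ennreal ((norm (steklov h F (s, x)))\<^sup>2) = ennreal ((1 / h)\<^sup>2) * ennreal ((norm (\<integral>r. indicator {s - h<..<s} r *\<^sub>R F (r, x) \<partial>lborel))\<^sup>2)"
    by (simp add: steklov_def power_mult_distrib power_divide ennreal_mult'[symmetric])
  also have "\<dots> \<le> ennreal ((1 / h)\<^sup>2) * (ennreal h * (\<integral>\<^sup>+r. indicator {s - h<..<s} r * ennreal ((norm (F (r, x)))\<^sup>2) \<partial>lborel))"
    by (rule mult_left_mono[OF *]) simp
  also have "\<dots> = ennreal (1 / h) * (\<integral>\<^sup>+r. indicator {s - h<..<s} r * ennreal ((norm (F (r, x)))\<^sup>2) \<partial>lborel)"
    using h by (simp add: mult.assoc[symmetric] ennreal_mult'[symmetric] power2_eq_square)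
  finally show ?thesis .
next
  \<comment> \<open>The average then has the default value 0.\<close>
  case False
  then show ?thesis by (simp add: steklov_def not_integrable_integral_eq)
qed

text \<open>A time \<open>r\<close> contributes to the averages at the times in (r, r + h), an
  interval of length \<open>h\<close>. Tonelli exchanges the integrals, and this length cancels the
  factor 1 / h.\<close>

lemma steklov_contraction:
  assumes h: "0 < h" and F[measurable]: "F \<in> borel_measurable borel"
  shows "(\<integral>\<^sup>+z. ennreal ((norm (steklov h F z))\<^sup>2) \<partial>lborel) \<le> (\<integral>\<^sup>+z. ennreal ((norm (F z))\<^sup>2) \<partial>lborel)"
proof -
  have [measurable]: "F \<in> borel_measurable (borel \<Otimes>\<^sub>M borel)" by (simp add: borel_prod)
  have [measurable]: "steklov h F \<in> borel_measurable (borel \<Otimes>\<^sub>M borel)" using steklov_measurable[OF F] by (simp add: borel_prod)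
  let ?k = "\<lambda>s r x. (if s - h < r \<and> r < s then 1 else 0) * ennreal ((norm (F (r, x)))\<^sup>2)"
  have "(\<integral>\<^sup>+z. ennreal ((norm (steklov h F z))\<^sup>2) \<partial>(lborel \<Otimes>\<^sub>M lborel)) = (\<integral>\<^sup>+x. \<integral>\<^sup>+s. ennreal ((norm (steklov h F (s, x)))\<^sup>2) \<partial>lborel \<partial>lborel)"
    by (rule lborel_pair.nn_integral_snd[symmetric]) measurable
  also have "\<dots> \<le> (\<integral>\<^sup>+x. \<integral>\<^sup>+s. ennreal (1 / h) * (\<integral>\<^sup>+r. ?k s r x \<partial>lborel) \<partial>lborel \<partial>lborel)"
  proof (intro nn_integral_mono)
    fix x s :: real
    have "ennreal ((norm (steklov h F (s, x)))\<^sup>2) \<le> ennreal (1 / h) * (\<integral>\<^sup>+r. indicator {s - h<..<s} r * ennreal ((norm (F (r, x)))\<^sup>2) \<partial>lborel)"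
      by (rule steklov_pointwise[OF h F])
    also have "(\<integral>\<^sup>+r. indicator {s - h<..<s} r * ennreal ((norm (F (r, x)))\<^sup>2) \<partial>lborel) = (\<integral>\<^sup>+r. ?k s r x \<partial>lborel)"
      by (intro nn_integral_cong) (auto simp: indicator_def)
    finally show "ennreal ((norm (steklov h F (s, x)))\<^sup>2) \<le> ennreal (1 / h) * (\<integral>\<^sup>+r. ?k s r x \<partial>lborel)" .
  qed
  also have "\<dots> = (\<integral>\<^sup>+x. ennreal (1 / h) * (\<integral>\<^sup>+s. \<integral>\<^sup>+r. ?k s r x \<partial>lborel \<partial>lborel) \<partial>lborel)"
    by (intro nn_integral_cong nn_integral_cmult) measurable
  also have "\<dots> = (\<integral>\<^sup>+x. ennreal (1 / h) * (\<integral>\<^sup>+r. \<integral>\<^sup>+s. ?k s r x \<partial>lborel \<partial>lborel) \<partial>lborel)"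
  proof (rule nn_integral_cong, rule arg_cong[where f="\<lambda>c. ennreal (1 / h) * c"])
    fix x :: real
    have "(\<lambda>(s, r). ?k s r x) \<in> borel_measurable (lborel \<Otimes>\<^sub>M lborel)" by measurable
    from lborel_pair.Fubini'[OF this] show "(\<integral>\<^sup>+s. \<integral>\<^sup>+r. ?k s r x \<partial>lborel \<partial>lborel) = (\<integral>\<^sup>+r. \<integral>\<^sup>+s. ?k s r x \<partial>lborel \<partial>lborel)"
      by simp
  qed
  also have "\<dots> = (\<integral>\<^sup>+x. ennreal (1 / h) * (\<integral>\<^sup>+r. ennreal h * ennreal ((norm (F (r, x)))\<^sup>2) \<partial>lborel) \<partial>lborel)"
  proof (rule nn_integral_cong, rule arg_cong[where f="\<lambda>c. ennreal (1 / h) * c"], rule nn_integral_cong)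
    fix x r :: real
    have "(\<integral>\<^sup>+s. ?k s r x \<partial>lborel) = (\<integral>\<^sup>+s. ennreal ((norm (F (r, x)))\<^sup>2) * indicator {r<..<r + h} s \<partial>lborel)"
      by (intro nn_integral_cong) (auto simp: indicator_def)
    also have "\<dots> = ennreal ((norm (F (r, x)))\<^sup>2) * emeasure lborel {r<..<r + h}"
      by (rule nn_integral_cmult_indicator) simp
    finally show "(\<integral>\<^sup>+s. ?k s r x \<partial>lborel) = ennreal h * ennreal ((norm (F (r, x)))\<^sup>2)"
      using h by (simp add: mult.commute)
  qed
  also have "\<dots> = (\<integral>\<^sup>+x. \<integral>\<^sup>+r. ennreal ((norm (F (r, x)))\<^sup>2) \<partial>lborel \<partial>lborel)"
  proof (rule nn_integral_cong)
    fix x :: real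
    have "(\<integral>\<^sup>+r. ennreal h * ennreal ((norm (F (r, x)))\<^sup>2) \<partial>lborel) = ennreal h * (\<integral>\<^sup>+r. ennreal ((norm (F (r, x)))\<^sup>2) \<partial>lborel)"
      by (rule nn_integral_cmult) measurable
    moreover have "ennreal (1 / h) * ennreal h = 1" using h by (simp add: ennreal_mult'[symmetric])
    ultimately show "ennreal (1 / h) * (\<integral>\<^sup>+r. ennreal h * ennreal ((norm (F (r, x)))\<^sup>2) \<partial>lborel) = (\<integral>\<^sup>+r. ennreal ((norm (F (r, x)))\<^sup>2) \<partial>lborel)"
      by (simp add: mult.assoc[symmetric])
  qed
  also have "\<dots> = (\<integral>\<^sup>+z. ennreal ((norm (F z))\<^sup>2) \<partial>(lborel \<Otimes>\<^sub>M lborel))"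
    by (rule lborel_pair.nn_integral_snd) measurable
  finally show ?thesis by (simp add: lborel_prod)
qed

text \<open>Once \<open>h n\<close> is smaller than \<open>s\<close>, the averaging interval stays
  in positive times and the cut-off at 0 is invisible; the rest is continuity of \<open>g\<close> at
  the point.\<close>

lemma steklov_continuous_tendsto:
  assumes g: "continuous_on UNIV g" and s: "0 < s" and h: "h \<longlonglongrightarrow> 0" "\<And>n. 0 < h n"
  shows "(\<lambda>n. steklov (h n) (\<lambda>z. indicator {0<..} (fst z) *\<^sub>R g z) (s, x)) \<longlonglongrightarrow> g (s, x)"
proof (rule LIMSEQ_I)
  fix e :: real assume e: "0 < e"
  have "continuous_on UNIV (\<lambda>r. g (r, x))"
    by (rule continuous_on_compose2[OF g]) (auto intro!: continuous_intros)
  then obtain d where d: "d > 0" "\<And>r. dist r s < d \<Longrightarrow> dist (g (r, x)) (g (s, x)) < e / 2"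
    using e unfolding continuous_on_iff by (metis UNIV_I half_gt_zero)
  have gm: "(\<lambda>r. g (r, x)) \<in> borel_measurable borel" by (intro borel_measurable_continuous_onI) fact
  have "\<forall>\<^sub>F n in sequentially. h n < min d s" using d s by (intro order_tendstoD[OF h(1)]) auto
  then obtain N where N: "\<And>n. n \<ge> N \<Longrightarrow> h n < min d s" by (auto simp: eventually_sequentially)
  show "\<exists>N. \<forall>n\<ge>N. norm (steklov (h n) (\<lambda>z. indicator {0<..} (fst z) *\<^sub>R g z) (s, x) - g (s, x)) < e"
  proof (intro exI allI impI)
    fix n assume "N \<le> n"
    then have hn: "h n < d" "h n < s" "0 < h n" using N h(2) by auto
    let ?M = "leb {s - h n<..<s}"
    interpret M: finite_measure ?M by (rule finite_lebesgue_on_Ioo)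
    have gi: "integrable ?M (\<lambda>r. g (r, x))"
    proof (rule M.integrable_const_bound[of _ "norm (g (s, x)) + e"])
      show "AE r in ?M. norm (g (r, x)) \<le> norm (g (s, x)) + e"
      proof (rule AE_I2)
        fix r assume "r \<in> space ?M"
        then have "dist (g (r, x)) (g (s, x)) < e / 2" using hn by (intro d(2)) (auto simp: dist_real_def)
        then show "norm (g (r, x)) \<le> norm (g (s, x)) + e"
          using norm_triangle_sub[of "g (r, x)" "g (s, x)"] e by (simp add: dist_norm)
      qed
    qed (rule borel_measurable_lebesgue_onI[OF gm])
    have "(\<integral>r. indicator {s - h n<..<s} r *\<^sub>R (indicator {0<..} r *\<^sub>R g (r, x)) \<partial>lborel) = (\<integral>r. indicator {s - h n<..<s} r *\<^sub>R g (r, x) \<partial>lborel)"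
      using hn by (intro Bochner_Integration.integral_cong) (auto simp: indicator_def)
    also have "\<dots> = (\<integral>r. g (r, x) \<partial>?M)" by (rule integral_lebesgue_on_borel[symmetric, OF _ gm]) simp
    finally have "steklov (h n) (\<lambda>z. indicator {0<..} (fst z) *\<^sub>R g z) (s, x) = (1 / h n) *\<^sub>R (\<integral>r. g (r, x) \<partial>?M)"
      by (simp add: steklov_def)
    moreover have "Sigma_Algebra.measure ?M {s - h n<..<s} = h n" using hn by (simp add: measure_restrict_space)
    then have "g (s, x) = (1 / h n) *\<^sub>R (\<integral>r. g (s, x) \<partial>?M)" using hn by simp
    ultimately have "steklov (h n) (\<lambda>z. indicator {0<..} (fst z) *\<^sub>R g z) (s, x) - g (s, x) =
        (1 / h n) *\<^sub>R (\<integral>r. g (r, x) \<partial>?M) - (1 / h n) *\<^sub>R (\<integral>r. g (s, x) \<partial>?M)"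
      by (rule arg_cong2[where f="(-)"])
    also have "\<dots> = (1 / h n) *\<^sub>R (\<integral>r. g (r, x) - g (s, x) \<partial>?M)"
      using gi by (simp only: scaleR_diff_right[symmetric] Bochner_Integration.integral_diff M.integrable_const)
    also have "norm \<dots> \<le> (1 / h n) * (\<integral>r. norm (g (r, x) - g (s, x)) \<partial>?M)"
      using hn by (simp add: divide_right_mono)
    also have "\<dots> \<le> (1 / h n) * (\<integral>r. e / 2 \<partial>?M)"
    proof (intro mult_left_mono integral_mono)
      fix r assume "r \<in> space ?M"
      then have "dist (g (r, x)) (g (s, x)) < e / 2" using hn by (intro d(2)) (auto simp: dist_real_def)
      then show "norm (g (r, x) - g (s, x)) \<le> e / 2" by (simp add: dist_norm)
    qed (use gi hn in auto)
    also have "\<dots> < e" using hn e by (simp add: measure_restrict_space)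
    finally show "norm (steklov (h n) (\<lambda>z. indicator {0<..} (fst z) *\<^sub>R g z) (s, x) - g (s, x)) < e" .
  qed
qed

section \<open>Approximation by bounded continuous functions\<close>

lemma norm_add3_squared: "(norm (a + b + c))\<^sup>2 \<le> 3 * ((norm a)\<^sup>2 + (norm b)\<^sup>2 + (norm (c :: 'a::real_normed_vector))\<^sup>2)"
proof -
  have "(norm (a + b + c))\<^sup>2 \<le> (norm a + norm b + norm c)\<^sup>2"
    by (intro power_mono order_trans[OF norm_triangle_ineq] add_right_mono norm_triangle_ineq) auto
  also have "(x + y + z)\<^sup>2 \<le> 3 * (x\<^sup>2 + y\<^sup>2 + z\<^sup>2)" for x y z :: real
  proof -
    have "0 \<le> (x - y)\<^sup>2 + (x - z)\<^sup>2 + (y - z)\<^sup>2" by simp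
    then show ?thesis by (simp add: power2_eq_square algebra_simps)
  qed
  finally show ?thesis .
qed

text \<open>Radial projection onto the closed ball of radius \<open>M\<close>: a truncation that is
  continuous, so that truncated approximants remain continuous.\<close>

definition clamp_norm :: "real \<Rightarrow> complex \<Rightarrow> complex" where
  "clamp_norm M z = (M / max M (norm z)) *\<^sub>R z"

lemma clamp_norm:
  assumes "0 < M"
  shows "norm (clamp_norm M z) \<le> M" "norm (clamp_norm M z) \<le> norm z" "norm z \<le> M \<Longrightarrow> clamp_norm M z = z"
    "continuous_on S (clamp_norm M)"
proof -
  have m: "0 < max M (norm z)" for z :: complex using assms by simp
  show "norm (clamp_norm M z) \<le> M"
    using assms m[of z] mult_left_mono[OF max.cobounded2[of "norm z" M], of M] by (simp add: clamp_norm_def field_simps)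
  have "M / max M (norm z) \<le> 1" using assms m[of z] by simp
  then have "M / max M (norm z) * norm z \<le> 1 * norm z" by (rule mult_right_mono) simp
  then show "norm (clamp_norm M z) \<le> norm z" using assms by (simp add: clamp_norm_def)
  show "norm z \<le> M \<Longrightarrow> clamp_norm M z = z" using assms by (simp add: clamp_norm_def max_absorb1)
  show "continuous_on S (clamp_norm M)"
    unfolding clamp_norm_def[abs_def] by (intro continuous_intros) (use m in \<open>auto simp: less_imp_neq[symmetric]\<close>)
qed

lemma L2_tendsto_0:
  fixes F :: "nat \<Rightarrow> 'a::euclidean_space \<Rightarrow> complex"
  assumes F: "\<And>n. F n \<in> borel_measurable (leb \<Omega>)" and w: "integrable (leb \<Omega>) w"
    and b: "\<And>n. AE z in leb \<Omega>. (norm (F n z))\<^sup>2 \<le> w z" and l: "AE z in leb \<Omega>. (\<lambda>n. F n z) \<longlonglongrightarrow> 0"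
  shows "(\<lambda>n. \<integral>z. (norm (F n z))\<^sup>2 \<partial>leb \<Omega>) \<longlonglongrightarrow> 0" "\<And>n. F n \<in> carr (L2 \<Omega>)"
proof -
  have "(\<lambda>n. \<integral>z. (norm (F n z))\<^sup>2 \<partial>leb \<Omega>) \<longlonglongrightarrow> (\<integral>z. 0 \<partial>leb \<Omega>)"
  proof (rule integral_dominated_convergence[OF _ _ w])
    show "AE z in leb \<Omega>. (\<lambda>n. (norm (F n z))\<^sup>2) \<longlonglongrightarrow> 0"
      using l
    proof eventually_elim
      case (elim z)
      then have "(\<lambda>n. (norm (F n z))\<^sup>2) \<longlonglongrightarrow> 0\<^sup>2" by (intro tendsto_power tendsto_norm_zero)
      then show ?case by simp
    qed
  qed (use F b in auto)
  then show "(\<lambda>n. \<integral>z. (norm (F n z))\<^sup>2 \<partial>leb \<Omega>) \<longlonglongrightarrow> 0" by simp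
  fix n
  have "integrable (leb \<Omega>) (\<lambda>z. (norm (F n z))\<^sup>2)"
    by (rule Bochner_Integration.integrable_bound[OF w]) (use F[of n] b[of n] in \<open>auto elim!: eventually_mono\<close>)
  then show "F n \<in> carr (L2 \<Omega>)" using F by (simp add: L2_iff)
qed

text \<open>Truncation at a high level \<open>M\<close> changes \<open>P\<close> little in L^2. As
  \<open>P\<close> is an almost everywhere limit of continuous functions, truncating these at the
  same level gives uniformly bounded approximants, and dominated convergence applies on the finite
  measure space.\<close>

lemma L2_approx_bounded_continuous:
  fixes P :: "real \<times> real \<Rightarrow> complex"
  assumes P: "P \<in> carr (L2 (QT T))" and e: "0 < e"
  obtains g M where "continuous_on UNIV g" "\<And>z. norm (g z) \<le> M" "(\<lambda>z. P z - g z) \<in> carr (L2 (QT T))"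
    "(\<integral>z. (norm (P z - g z))\<^sup>2 \<partial>leb (QT T)) < e"
proof -
  let ?Q = "leb (QT T)"
  interpret Q: finite_measure ?Q by (rule finite_lebesgue_on_rectangle)
  have Pm[measurable]: "P \<in> borel_measurable ?Q" by (rule L2_measurable[OF P])
  have cm: "(\<lambda>z. clamp_norm M (h z)) \<in> borel_measurable ?Q" if "0 < M" "h \<in> borel_measurable ?Q" for M and h :: "real \<times> real \<Rightarrow> complex"
    using measurable_comp[OF that(2) borel_measurable_continuous_onI[OF clamp_norm(4)[OF that(1)]]] by (simp add: comp_def)
  have "(\<lambda>n. \<integral>z. (norm (P z - clamp_norm (Suc n) (P z)))\<^sup>2 \<partial>?Q) \<longlonglongrightarrow> 0"
  proof (rule L2_tendsto_0(1))
    show "integrable ?Q (\<lambda>z. 4 * (norm (P z))\<^sup>2)" using P by (simp add: L2_iff)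
    have "(norm (c - clamp_norm (Suc n) c))\<^sup>2 \<le> 4 * (norm c)\<^sup>2" for c n
    proof -
      have "norm (c - clamp_norm (Suc n) c) \<le> 2 * norm c"
        using norm_triangle_ineq4[of c "clamp_norm (Suc n) c"] clamp_norm(2)[of "Suc n" c] by simp
      then have "(norm (c - clamp_norm (Suc n) c))\<^sup>2 \<le> (2 * norm c)\<^sup>2" by (rule power_mono) simp
      then show ?thesis by (simp add: power_mult_distrib)
    qed
    then show "AE z in ?Q. (norm (P z - clamp_norm (Suc n) (P z)))\<^sup>2 \<le> 4 * (norm (P z))\<^sup>2" for n by auto
    have "(\<lambda>n. c - clamp_norm (Suc n) c) \<longlonglongrightarrow> 0" for c
    proof (rule tendsto_eventually)
      obtain N :: nat where "norm c < real N" using reals_Archimedean2 by blast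
      then show "\<forall>\<^sub>F n in sequentially. c - clamp_norm (Suc n) c = 0"
        by (auto simp: eventually_sequentially clamp_norm(3) intro!: exI[of _ N])
    qed
    then show "AE z in ?Q. (\<lambda>n. P z - clamp_norm (Suc n) (P z)) \<longlonglongrightarrow> 0" by auto
  qed (use cm[OF _ Pm] in auto)
  then have "\<forall>\<^sub>F n in sequentially. (\<integral>z. (norm (P z - clamp_norm (Suc n) (P z)))\<^sup>2 \<partial>?Q) < e / 4"
    by (rule order_tendstoD) (use e in simp)
  then obtain k where k: "(\<integral>z. (norm (P z - clamp_norm (Suc k) (P z)))\<^sup>2 \<partial>?Q) < e / 4"
    by (auto simp: eventually_sequentially)
  define M where "M = real (Suc k)"
  have M: "0 < M" by (simp add: M_def)
  have "P measurable_on QT T"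
    by (subst measurable_on_iff_borel_measurable) (auto simp: Pm)
  then obtain N g where Ng: "negligible N" "\<And>n::nat. continuous_on UNIV (g n)"
    "\<And>z. z \<notin> N \<Longrightarrow> (\<lambda>n. g n z) \<longlonglongrightarrow> (if z \<in> QT T then P z else 0)"
    unfolding measurable_on_def by blast
  let ?g = "\<lambda>n z. clamp_norm M (g n z)"
  have gc: "continuous_on UNIV (?g n)" for n
    by (rule continuous_on_compose2[OF clamp_norm(4)[OF M, of UNIV] Ng(2)]) auto
  have gm: "?g n \<in> borel_measurable ?Q" for n
    by (intro borel_measurable_lebesgue_onI borel_measurable_continuous_onI gc)
  have bd: "\<And>n. AE z in ?Q. (norm (clamp_norm M (P z) - ?g n z))\<^sup>2 \<le> 4 * M\<^sup>2"
  proof (rule AE_I2)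
    fix n z
    have "norm (clamp_norm M (P z) - ?g n z) \<le> 2 * M"
      using norm_triangle_ineq4[of "clamp_norm M (P z)" "?g n z"] clamp_norm(1)[OF M, of "P z"] clamp_norm(1)[OF M, of "g n z"] by linarith
    then have "(norm (clamp_norm M (P z) - ?g n z))\<^sup>2 \<le> (2 * M)\<^sup>2" by (rule power_mono) simp
    then show "(norm (clamp_norm M (P z) - ?g n z))\<^sup>2 \<le> 4 * M\<^sup>2" by (simp add: power_mult_distrib)
  qed
  have lim: "AE z in ?Q. (\<lambda>n. clamp_norm M (P z) - ?g n z) \<longlonglongrightarrow> 0"
  proof -
    have "AE z in lebesgue. z \<notin> N" using Ng(1) by (auto simp: negligible_iff_null_sets intro: AE_not_in)
    then have "AE z in ?Q. z \<notin> N" by (subst AE_restrict_space_iff) (auto elim: eventually_mono)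
    with AE_space show ?thesis
    proof eventually_elim
      case (elim z)
      then have "(\<lambda>n. g n z) \<longlonglongrightarrow> P z" using Ng(3)[of z] by simp
      moreover have "isCont (clamp_norm M) (P z)" using clamp_norm(4)[OF M, of UNIV] by (simp add: continuous_on_eq_continuous_at)
      ultimately have "(\<lambda>n. ?g n z) \<longlonglongrightarrow> clamp_norm M (P z)" by (rule isCont_tendsto_compose[rotated])
      from tendsto_diff[OF tendsto_const this, of "clamp_norm M (P z)"] show ?case by simp
    qed
  qed
  have dm: "(\<lambda>z. clamp_norm M (P z) - ?g n z) \<in> borel_measurable ?Q" for n
    using cm[OF M Pm] gm by simp
  have wi: "integrable ?Q (\<lambda>z. 4 * M\<^sup>2)" by simp
  have "(\<lambda>n. \<integral>z. (norm (clamp_norm M (P z) - ?g n z))\<^sup>2 \<partial>?Q) \<longlonglongrightarrow> 0" and dL: "\<And>n. (\<lambda>z. clamp_norm M (P z) - ?g n z) \<in> carr (L2 (QT T))"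
    using L2_tendsto_0[OF dm wi bd lim] by auto
  then have "\<forall>\<^sub>F n in sequentially. (\<integral>z. (norm (clamp_norm M (P z) - ?g n z))\<^sup>2 \<partial>?Q) < e / 4"
    by (intro order_tendstoD) (use e in auto)
  then obtain n where n: "(\<integral>z. (norm (clamp_norm M (P z) - ?g n z))\<^sup>2 \<partial>?Q) < e / 4"
    by (auto simp: eventually_sequentially)
  have pL: "(\<lambda>z. P z - clamp_norm M (P z)) \<in> carr (L2 (QT T))"
  proof (rule L2_bound[OF P, of _ 2])
    show "AE z in ?Q. norm (P z - clamp_norm M (P z)) \<le> 2 * norm (P z)"
    proof (rule AE_I2)
      fix z show "norm (P z - clamp_norm M (P z)) \<le> 2 * norm (P z)"
        using norm_triangle_ineq4[of "P z" "clamp_norm M (P z)"] clamp_norm(2)[OF M, of "P z"] by linarith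
    qed
  qed (use cm[OF M Pm] in simp)
  show thesis
  proof (rule that[OF gc[of n] clamp_norm(1)[OF M]])
    show L: "(\<lambda>z. P z - ?g n z) \<in> carr (L2 (QT T))" using L2_add[OF pL dL[of n]] by simp
    have "(\<integral>z. (norm (P z - ?g n z))\<^sup>2 \<partial>?Q) \<le> (\<integral>z. 2 * (norm (P z - clamp_norm M (P z)))\<^sup>2 + 2 * (norm (clamp_norm M (P z) - ?g n z))\<^sup>2 \<partial>?Q)"
    proof (rule integral_mono)
      show "integrable ?Q (\<lambda>z. 2 * (norm (P z - clamp_norm M (P z)))\<^sup>2 + 2 * (norm (clamp_norm M (P z) - ?g n z))\<^sup>2)"
        using pL dL[of n] by (simp add: L2_iff)
      show "(norm (P z - ?g n z))\<^sup>2 \<le> 2 * (norm (P z - clamp_norm M (P z)))\<^sup>2 + 2 * (norm (clamp_norm M (P z) - ?g n z))\<^sup>2" for z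
        using norm_add_squared[of "P z - clamp_norm M (P z)" "clamp_norm M (P z) - ?g n z"] by simp
    qed (use L in \<open>simp add: L2_iff\<close>)
    also have "\<dots> < e" using pL dL[of n] k n by (simp add: L2_iff M_def)
    finally show "(\<integral>z. (norm (P z - ?g n z))\<^sup>2 \<partial>?Q) < e" .
  qed
qed

lemma steklov_diff:
  assumes "integrable lborel (\<lambda>r. indicator {fst z - h<..<fst z} r *\<^sub>R F (r, snd z))" "integrable lborel (\<lambda>r. indicator {fst z - h<..<fst z} r *\<^sub>R G (r, snd z))"
  shows "steklov h (\<lambda>z. F z - G z) z = steklov h F z - steklov h G z"
  using assms by (simp add: steklov_def scaleR_diff_right)

lemma L2_norm_triangle3:
  fixes f g h :: "'a::euclidean_space \<Rightarrow> complex"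
  assumes "f \<in> carr (L2 \<Omega>)" "g \<in> carr (L2 \<Omega>)" "h \<in> carr (L2 \<Omega>)"
  shows "(\<integral>z. (norm (f z + g z + h z))\<^sup>2 \<partial>leb \<Omega>) \<le> 3 * ((\<integral>z. (norm (f z))\<^sup>2 \<partial>leb \<Omega>) + (\<integral>z. (norm (g z))\<^sup>2 \<partial>leb \<Omega>) + (\<integral>z. (norm (h z))\<^sup>2 \<partial>leb \<Omega>))"
proof -
  have "(\<integral>z. (norm (f z + g z + h z))\<^sup>2 \<partial>leb \<Omega>) \<le> (\<integral>z. 3 * ((norm (f z))\<^sup>2 + (norm (g z))\<^sup>2 + (norm (h z))\<^sup>2) \<partial>leb \<Omega>)"
    using assms L2_add[OF L2_add[OF assms(1,2)] assms(3)] by (intro integral_mono norm_add3_squared) (auto simp: L2_iff)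
  then show ?thesis using assms by (simp add: L2_iff)
qed

text \<open>A density argument: the error for \<open>P\<close> is split into P - g, the error for
  the continuous \<open>g\<close>, and the average of P - G. The first and the last part are small
  because averaging is a contraction, the middle one by dominated convergence.\<close>

lemma steklov_L2_tendsto:
  fixes P :: "real \<times> real \<Rightarrow> complex"
  assumes Pm[measurable]: "P \<in> borel_measurable borel" and P: "P \<in> carr (L2 (QT T))" and P0: "\<And>z. z \<notin> QT T \<Longrightarrow> P z = 0"
    and h: "h \<longlonglongrightarrow> 0" "\<And>n. 0 < h n"
  shows "(\<lambda>n. \<integral>z. (norm (P z - steklov (h n) P z))\<^sup>2 \<partial>leb (QT T)) \<longlonglongrightarrow> 0"
    "\<And>n. (\<lambda>z. P z - steklov (h n) P z) \<in> carr (L2 (QT T))"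
proof -
  let ?Q = "leb (QT T)"
  interpret Q: finite_measure ?Q by (rule finite_lebesgue_on_rectangle)
  have contr: "steklov (h n) F \<in> carr (L2 (QT T)) \<and> (\<integral>z. (norm (steklov (h n) F z))\<^sup>2 \<partial>?Q) \<le> (\<integral>z. (norm (F z))\<^sup>2 \<partial>?Q)"
    if F[measurable]: "F \<in> borel_measurable borel" and FL: "F \<in> carr (L2 (QT T))" and F0: "\<And>z. z \<notin> QT T \<Longrightarrow> F z = 0" for F n
  proof -
    have m: "steklov (h n) F \<in> borel_measurable ?Q" by (rule borel_measurable_lebesgue_onI[OF steklov_measurable[OF F]])
    have "(\<integral>\<^sup>+z. ennreal ((norm (steklov (h n) F z))\<^sup>2) \<partial>?Q) = (\<integral>\<^sup>+z. ennreal ((norm (steklov (h n) F z))\<^sup>2) * indicator (QT T) z \<partial>lborel)"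
      using steklov_measurable[OF F] by (intro nn_integral_lebesgue_on_borel) auto
    also have "\<dots> \<le> (\<integral>\<^sup>+z. ennreal ((norm (steklov (h n) F z))\<^sup>2) \<partial>lborel)"
      by (intro nn_integral_mono) (auto simp: indicator_def)
    also have "\<dots> \<le> (\<integral>\<^sup>+z. ennreal ((norm (F z))\<^sup>2) \<partial>lborel)" by (rule steklov_contraction[OF h(2) F])
    also have "\<dots> = (\<integral>\<^sup>+z. ennreal ((norm (F z))\<^sup>2) * indicator (QT T) z \<partial>lborel)"
      using F0 by (intro nn_integral_cong) (auto simp: indicator_def)
    also have "\<dots> = (\<integral>\<^sup>+z. ennreal ((norm (F z))\<^sup>2) \<partial>?Q)" by (intro nn_integral_lebesgue_on_borel[symmetric]) auto
    also have "\<dots> = ennreal (\<integral>z. (norm (F z))\<^sup>2 \<partial>?Q)" using FL by (intro nn_integral_eq_integral) (auto simp: L2_iff)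
    finally have le: "(\<integral>\<^sup>+z. ennreal ((norm (steklov (h n) F z))\<^sup>2) \<partial>?Q) \<le> ennreal (\<integral>z. (norm (F z))\<^sup>2 \<partial>?Q)" .
    then have i: "integrable ?Q (\<lambda>z. (norm (steklov (h n) F z))\<^sup>2)"
      using m by (intro integrableI_bounded) (auto simp: less_top[symmetric] top_unique)
    have "ennreal (\<integral>z. (norm (steklov (h n) F z))\<^sup>2 \<partial>?Q) \<le> ennreal (\<integral>z. (norm (F z))\<^sup>2 \<partial>?Q)"
      using le i by (subst (asm) nn_integral_eq_integral) auto
    with i m show ?thesis by (simp add: L2_iff ennreal_le_iff)
  qed
  show L: "(\<lambda>z. P z - steklov (h n) P z) \<in> carr (L2 (QT T))" for n
    by (rule L2_diff[OF P]) (use contr[OF Pm P P0] in blast)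
  show "(\<lambda>n. \<integral>z. (norm (P z - steklov (h n) P z))\<^sup>2 \<partial>?Q) \<longlonglongrightarrow> 0"
  proof (rule LIMSEQ_I)
    fix e :: real assume "0 < e"
    \<comment> \<open>The square of a sum of three terms costs a factor 3, so three errors below e /
      9 add up to less than e.\<close>
    then have e: "0 < e / 9" by simp
    obtain g M where g: "continuous_on UNIV g" "\<And>z. norm (g z) \<le> M" "(\<lambda>z. P z - g z) \<in> carr (L2 (QT T))"
      "(\<integral>z. (norm (P z - g z))\<^sup>2 \<partial>?Q) < e / 9"
      by (rule L2_approx_bounded_continuous[OF P e]) blast
    have [measurable]: "g \<in> borel_measurable borel" by (rule borel_measurable_continuous_onI[OF g(1)])
    define G where "G z = indicator (QT T) z *\<^sub>R g z" for z
    have G[measurable]: "G \<in> borel_measurable borel"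
      unfolding G_def[abs_def] by (intro borel_measurable_scaleR borel_measurable_indicator borel_rectangle borel_measurable_continuous_onI g(1))
    have Gp: "G \<in> borel_measurable (borel \<Otimes>\<^sub>M borel)" and Pp: "P \<in> borel_measurable (borel \<Otimes>\<^sub>M borel)"
      using G Pm by (simp_all add: borel_prod)
    have Gs: "(\<lambda>r. G (r, x)) \<in> borel_measurable borel" and Ps: "(\<lambda>r. P (r, x)) \<in> borel_measurable borel" for x
      using Gp Pp by measurable
    have M: "0 \<le> M" using g(2)[of undefined] norm_ge_zero order_trans by blast
    have Gi: "integrable lborel (\<lambda>r. indicator {s - h n<..<s} r *\<^sub>R G (r, x))" for s x n
    proof (rule Bochner_Integration.integrable_bound)
      show "integrable lborel (\<lambda>r. M * indicator {s - h n<..<s} r)"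
        using h(2)[of n] by (intro integrable_mult_right integrable_real_indicator) auto
      show "AE r in lborel. norm (indicator {s - h n<..<s} r *\<^sub>R G (r, x)) \<le> norm (M * indicator {s - h n<..<s} r)"
        using g(2) M by (auto simp: G_def indicator_def)
      show "(\<lambda>r. indicator {s - h n<..<s} r *\<^sub>R G (r, x)) \<in> borel_measurable lborel" using Gs by measurable
    qed
    have Gb: "norm (steklov (h n) G z) \<le> M" for n z
    proof -
      have "norm (\<integral>r. indicator {fst z - h n<..<fst z} r *\<^sub>R G (r, snd z) \<partial>lborel) \<le> (\<integral>r. norm (indicator {fst z - h n<..<fst z} r *\<^sub>R G (r, snd z)) \<partial>lborel)"
        by (rule integral_norm_bound)
      also have "\<dots> \<le> (\<integral>r. M * indicator {fst z - h n<..<fst z} r \<partial>lborel)"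
      proof (rule integral_mono)
        show "integrable lborel (\<lambda>r. norm (indicator {fst z - h n<..<fst z} r *\<^sub>R G (r, snd z)))" by (rule integrable_norm[OF Gi])
        show "integrable lborel (\<lambda>r. M * indicator {fst z - h n<..<fst z} r)"
          using h(2)[of n] by (intro integrable_mult_right integrable_real_indicator) auto
        show "norm (indicator {fst z - h n<..<fst z} r *\<^sub>R G (r, snd z)) \<le> M * indicator {fst z - h n<..<fst z} r" for r
          using g(2)[of "(r, snd z)"] M by (simp add: G_def indicator_def)
      qed
      also have "\<dots> = M * h n" using h(2)[of n] by simp
      finally show ?thesis using h(2)[of n] by (simp add: steklov_def divide_le_eq)
    qed
    have gG: "(\<lambda>n. \<integral>z. (norm (g z - steklov (h n) G z))\<^sup>2 \<partial>?Q) \<longlonglongrightarrow> 0" and gGL: "\<And>n. (\<lambda>z. g z - steklov (h n) G z) \<in> carr (L2 (QT T))"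
    proof -
      have m: "(\<lambda>z. g z - steklov (h n) G z) \<in> borel_measurable ?Q" for n
        using steklov_measurable[OF G] by (intro borel_measurable_lebesgue_onI) simp
      have w: "integrable ?Q (\<lambda>z. (2 * M)\<^sup>2)" by simp
      have b: "AE z in ?Q. (norm (g z - steklov (h n) G z))\<^sup>2 \<le> (2 * M)\<^sup>2" for n
      proof (intro AE_I2 power_mono)
        fix z show "norm (g z - steklov (h n) G z) \<le> 2 * M"
          using norm_triangle_ineq4[of "g z" "steklov (h n) G z"] g(2)[of z] Gb[of n z] by linarith
      qed simp
      have l: "AE z in ?Q. (\<lambda>n. g z - steklov (h n) G z) \<longlonglongrightarrow> 0"
      proof (rule AE_I2)
        fix z assume "z \<in> space ?Q"
        then obtain s x where z: "z = (s, x)" "0 < s" "s < T" "0 < x" "x < 1" by (cases z) auto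
        have "steklov (h n) G (s, x) = steklov (h n) (\<lambda>z. indicator {0<..} (fst z) *\<^sub>R g z) (s, x)" for n
        proof -
          have "(\<lambda>r. indicator {s - h n<..<s} r *\<^sub>R G (r, x)) = (\<lambda>r. indicator {s - h n<..<s} r *\<^sub>R (indicator {0<..} r *\<^sub>R g (r, x)))"
            using z by (auto simp: G_def indicator_def fun_eq_iff)
          then show ?thesis by (simp add: steklov_def)
        qed
        then have "(\<lambda>n. steklov (h n) G (s, x)) \<longlonglongrightarrow> g (s, x)"
          using steklov_continuous_tendsto[OF g(1) z(2) h] by simp
        from tendsto_diff[OF tendsto_const this, of "g (s, x)"] show "(\<lambda>n. g z - steklov (h n) G z) \<longlonglongrightarrow> 0" by (simp add: z)
      qed
      show "(\<lambda>n. \<integral>z. (norm (g z - steklov (h n) G z))\<^sup>2 \<partial>?Q) \<longlonglongrightarrow> 0" "\<And>n. (\<lambda>z. g z - steklov (h n) G z) \<in> carr (L2 (QT T))"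
        using L2_tendsto_0[OF m w b l] by auto
    qed
    have PG: "(\<lambda>z. P z - G z) \<in> carr (L2 (QT T))" and PGn: "(\<integral>z. (norm (P z - G z))\<^sup>2 \<partial>?Q) = (\<integral>z. (norm (P z - g z))\<^sup>2 \<partial>?Q)"
    proof -
      have ae: "AE z in ?Q. P z - g z = P z - G z" by (intro AE_I2) (auto simp: G_def)
      show "(\<lambda>z. P z - G z) \<in> carr (L2 (QT T))" by (rule L2_cong_AE(1)[OF g(3) _ ae]) simp
      have "nrm (L2 (QT T)) (\<lambda>z. P z - G z) = nrm (L2 (QT T)) (\<lambda>z. P z - g z)" by (rule L2_cong_AE(2)[OF g(3) _ ae]) simp
      then show "(\<integral>z. (norm (P z - G z))\<^sup>2 \<partial>?Q) = (\<integral>z. (norm (P z - g z))\<^sup>2 \<partial>?Q)" by (simp add: L2_nrm)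
    qed
    have dPG: "steklov (h n) (\<lambda>z. P z - G z) \<in> carr (L2 (QT T))" "(\<integral>z. (norm (steklov (h n) (\<lambda>z. P z - G z) z))\<^sup>2 \<partial>?Q) < e / 9" for n
    proof -
      have m: "(\<lambda>z. P z - G z) \<in> borel_measurable borel" by (rule borel_measurable_diff[OF Pm G])
      have "P z - G z = 0" if "z \<notin> QT T" for z using P0[OF that] that by (simp add: G_def)
      from contr[OF m PG this, of n]
      show "steklov (h n) (\<lambda>z. P z - G z) \<in> carr (L2 (QT T))" "(\<integral>z. (norm (steklov (h n) (\<lambda>z. P z - G z) z))\<^sup>2 \<partial>?Q) < e / 9"
        unfolding PGn using g(4) by linarith+
    qed
    \<comment> \<open>Averages are additive only where the slice of \<open>P\<close> is integrable
      in time, which holds for almost every \<open>x\<close>.\<close>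
    have Pi: "AE z in ?Q. \<forall>n. integrable lborel (\<lambda>r. indicator {fst z - h n<..<fst z} r *\<^sub>R P (r, snd z))"
    proof -
      have "integrable ?Q P" by (rule L2_imp_integrable[OF P Q.finite_measure_axioms])
      from integrable_lebesgue_on_swap[OF _ _ this] have i: "integrable (leb ({0<..<1} \<times> {0<..<T})) (\<lambda>z. P (snd z, fst z))" by simp
      have "AE x in leb {0<..<1}. integrable (leb {0<..<T}) (\<lambda>r. P (r, x))"
        using AE_integrable_lebesgue_on_slice[OF _ _ i] by simp
      then obtain N where N: "N \<in> null_sets lborel" "\<And>x. x \<notin> N \<Longrightarrow> x \<in> {0<..<1} \<longrightarrow> integrable (leb {0<..<T}) (\<lambda>r. P (r, x))"
        unfolding AE_lebesgue_on_iff[OF borel_open[OF open_greaterThanLessThan]] by (erule_tac AE_E3) auto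
      have "AE t in leb {0<..<T}. True" by simp
      have "AE z in ?Q. snd z \<notin> N"
      proof (rule AE_lebesgue_on_commute)
        show "AE x in leb {0<..<1}. AE t in leb {0<..<T}. snd (t, x) \<notin> N"
          unfolding AE_lebesgue_on_iff[OF borel_open[OF open_greaterThanLessThan]] using AE_not_in[OF N(1)] by eventually_elim simp
        have Nb: "N \<in> sets borel" using N(1) by auto
        have "(\<lambda>z :: real \<times> real. snd z) \<in> borel_measurable borel"
          by (intro borel_measurable_continuous_onI continuous_intros)
        from measurable_sets[OF this, of "- N"] Nb show "{z :: real \<times> real. snd z \<notin> N} \<in> sets borel"
          by (simp add: vimage_def)
      qed auto
      with AE_space show ?thesis
      proof eventually_elim
        case (elim z)
        then have "integrable (leb {0<..<T}) (\<lambda>r. P (r, snd z))" using N(2)[of "snd z"] by (auto simp: mem_Times_iff)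
        then have i: "integrable lborel (\<lambda>r. indicator {0<..<T} r *\<^sub>R P (r, snd z))"
          by (simp add: integrable_lebesgue_on_borel[OF _ Ps])
        have "(\<lambda>r. indicator {0<..<T} r *\<^sub>R P (r, snd z)) = (\<lambda>r. P (r, snd z))"
          using P0 by (auto simp: indicator_def fun_eq_iff)
        with i have "integrable lborel (\<lambda>r. P (r, snd z))" by simp
        then show ?case by (intro allI bounded_times_integrable[of lborel _ _ 1]) (auto simp: indicator_def)
      qed
    qed
    have est: "(\<integral>z. (norm (P z - steklov (h n) P z))\<^sup>2 \<partial>?Q) \<le> 3 * (e / 9 + (\<integral>z. (norm (g z - steklov (h n) G z))\<^sup>2 \<partial>?Q) + e / 9)" for n
    proof -
      have ae: "AE z in ?Q. (P z - g z) + (g z - steklov (h n) G z) + - steklov (h n) (\<lambda>z. P z - G z) z = P z - steklov (h n) P z"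
        using Pi
      proof eventually_elim
        case (elim z)
        have "steklov (h n) (\<lambda>z. P z - G z) z = steklov (h n) P z - steklov (h n) G z"
          by (rule steklov_diff) (use elim Gi in auto)
        then show ?case by simp
      qed
      have mneg: "(\<lambda>z. - steklov (h n) (\<lambda>z. P z - G z) z) \<in> carr (L2 (QT T))" using L2_cmult[OF dPG(1), of "-1" n] by simp
      have "(\<integral>z. (norm (P z - steklov (h n) P z))\<^sup>2 \<partial>?Q) = (\<integral>z. (norm ((P z - g z) + (g z - steklov (h n) G z) + - steklov (h n) (\<lambda>z. P z - G z) z))\<^sup>2 \<partial>?Q)"
      proof (rule integral_lebesgue_on_cong_AE)
        show "AE z in ?Q. (norm (P z - steklov (h n) P z))\<^sup>2 = (norm ((P z - g z) + (g z - steklov (h n) G z) + - steklov (h n) (\<lambda>z. P z - G z) z))\<^sup>2"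
          using ae by (rule eventually_mono) (simp only:)
      qed simp
      also have "\<dots> \<le> 3 * ((\<integral>z. (norm (P z - g z))\<^sup>2 \<partial>?Q) + (\<integral>z. (norm (g z - steklov (h n) G z))\<^sup>2 \<partial>?Q) + (\<integral>z. (norm (- steklov (h n) (\<lambda>z. P z - G z) z))\<^sup>2 \<partial>?Q))"
        by (rule L2_norm_triangle3[OF g(3) gGL mneg])
      also have "\<dots> \<le> 3 * (e / 9 + (\<integral>z. (norm (g z - steklov (h n) G z))\<^sup>2 \<partial>?Q) + e / 9)"
        using g(4) dPG(2)[of n] by (intro mult_left_mono add_mono) auto
      finally show ?thesis .
    qed
    have "\<forall>\<^sub>F n in sequentially. (\<integral>z. (norm (g z - steklov (h n) G z))\<^sup>2 \<partial>?Q) < e / 9"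
      using gG e by (intro order_tendstoD) auto
    then obtain N where N: "\<And>n. n \<ge> N \<Longrightarrow> (\<integral>z. (norm (g z - steklov (h n) G z))\<^sup>2 \<partial>?Q) < e / 9" by (auto simp: eventually_sequentially)
    show "\<exists>N. \<forall>n\<ge>N. norm ((\<integral>z. (norm (P z - steklov (h n) P z))\<^sup>2 \<partial>?Q) - 0) < e"
    proof (intro exI allI impI)
      fix n assume "N \<le> n"
      then have "(\<integral>z. (norm (P z - steklov (h n) P z))\<^sup>2 \<partial>?Q) < e" using est[of n] N[of n] by simp
      moreover have "0 \<le> (\<integral>z. (norm (P z - steklov (h n) P z))\<^sup>2 \<partial>?Q)" by simp
      ultimately show "norm ((\<integral>z. (norm (P z - steklov (h n) P z))\<^sup>2 \<partial>?Q) - 0) < e" by simp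
    qed
  qed
qed

lemma L2_inner:
  fixes f g :: "'a::euclidean_space \<Rightarrow> complex"
  assumes f: "f \<in> carr (L2 \<Omega>)" and g: "g \<in> carr (L2 \<Omega>)"
  shows "integrable (leb \<Omega>) (\<lambda>x. f x \<bullet> g x)"
    "\<bar>\<integral>x. f x \<bullet> g x \<partial>leb \<Omega>\<bar> \<le> nrm (L2 \<Omega>) f * nrm (L2 \<Omega>) g"
proof -
  show i: "integrable (leb \<Omega>) (\<lambda>x. f x \<bullet> g x)"
    by (rule Bochner_Integration.integrable_bound[OF L2_Cauchy_Schwarz(1)[OF f g]])
      (use L2_measurable[OF f] L2_measurable[OF g] in \<open>auto intro!: AE_I2 Cauchy_Schwarz_ineq2\<close>)
  have "\<bar>\<integral>x. f x \<bullet> g x \<partial>leb \<Omega>\<bar> \<le> (\<integral>x. \<bar>f x \<bullet> g x\<bar> \<partial>leb \<Omega>)"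
    using integral_norm_bound[of "leb \<Omega>" "\<lambda>x. f x \<bullet> g x"] by simp
  also have "\<dots> \<le> (\<integral>x. norm (f x) * norm (g x) \<partial>leb \<Omega>)"
    using i L2_Cauchy_Schwarz(1)[OF f g] by (intro integral_mono) (auto intro: Cauchy_Schwarz_ineq2)
  finally show "\<bar>\<integral>x. f x \<bullet> g x \<partial>leb \<Omega>\<bar> \<le> nrm (L2 \<Omega>) f * nrm (L2 \<Omega>) g"
    using L2_Cauchy_Schwarz(2)[OF f g] by linarith
qed

lemma L2_times_bounded:
  fixes f :: "'a::euclidean_space \<Rightarrow> complex"
  assumes f: "f \<in> carr (L2 \<Omega>)" and c: "c \<in> borel_measurable (leb \<Omega>)" and b: "AE x in leb \<Omega>. \<bar>c x\<bar> \<le> C" and C: "0 \<le> C"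
  shows "(\<lambda>x. c x *\<^sub>R f x) \<in> carr (L2 \<Omega>)" "nrm (L2 \<Omega>) (\<lambda>x. c x *\<^sub>R f x) \<le> C * nrm (L2 \<Omega>) f"
proof -
  show L: "(\<lambda>x. c x *\<^sub>R f x) \<in> carr (L2 \<Omega>)"
    by (rule L2_bound[OF f, of _ C]) (use c L2_measurable[OF f] b in \<open>auto elim!: eventually_mono intro: mult_right_mono\<close>)
  have "(nrm (L2 \<Omega>) (\<lambda>x. c x *\<^sub>R f x))\<^sup>2 \<le> (\<integral>x. C\<^sup>2 * (norm (f x))\<^sup>2 \<partial>leb \<Omega>)"
    unfolding L2_nrm_sq
  proof (rule integral_mono_AE)
    show "AE x in leb \<Omega>. (norm (c x *\<^sub>R f x))\<^sup>2 \<le> C\<^sup>2 * (norm (f x))\<^sup>2"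
      using b
    proof eventually_elim
      case (elim x)
      have "norm (c x *\<^sub>R f x) \<le> C * norm (f x)" using elim by (auto intro: mult_right_mono)
      then have "(norm (c x *\<^sub>R f x))\<^sup>2 \<le> (C * norm (f x))\<^sup>2" by (rule power_mono) simp
      then show ?case by (simp add: power_mult_distrib)
    qed
  qed (use f L in \<open>auto simp: L2_iff\<close>)
  also have "\<dots> = (C * nrm (L2 \<Omega>) f)\<^sup>2" by (simp add: L2_nrm_sq power_mult_distrib)
  finally show "nrm (L2 \<Omega>) (\<lambda>x. c x *\<^sub>R f x) \<le> C * nrm (L2 \<Omega>) f"
    by (rule power2_le_imp_le) (use C in simp)
qed

section \<open>Energy estimates\<close>

lemma ac_boundary_zero:
  assumes "ac l u F f" "F l = 0" "F u = 0" "l \<le> u" shows "(\<integral>x. f x \<partial>leb {l<..<u}) = 0"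
  using ac_eq[OF assms(1), of u] assms by simp

lemma L2_inner_self:
  fixes f :: "'a::euclidean_space \<Rightarrow> complex"
  shows "(\<integral>x. f x \<bullet> f x \<partial>leb \<Omega>) = (nrm (L2 \<Omega>) f)\<^sup>2"
  by (simp add: L2_nrm_sq power2_norm_eq_inner)

text \<open>The problem at one fixed time: \<open>y\<close> and \<open>z\<close> are v_x and v_xx,
  and \<open>p\<close> is the time derivative. The product \<open>\<bullet>\<close> used below is
  the real inner product of complex numbers, so that testing yields real parts directly.\<close>

locale spatial_problem =
  fixes v y z g p :: "real \<Rightarrow> complex" and a a' b b' q :: "real \<Rightarrow> real" and \<alpha> A A1 Bm B1 Q Qm :: real
  assumes v: "ac 0 1 v y" "v 0 = 0" "v 1 = 0" and y: "ac 0 1 y z" and z: "z \<in> carr (L2 {0<..<1})"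
    and a: "ac 0 1 a a'" and b: "ac 0 1 b b'" and q: "q \<in> borel_measurable (leb {0<..<1})"
    and g: "g \<in> carr (L2 {0<..<1})" and \<alpha>: "0 < \<alpha>"
    and bounds: "AE x in leb {0<..<1}. \<alpha> \<le> a x \<and> a x \<le> A \<and> \<bar>a' x\<bar> \<le> A1 \<and> \<bar>b x\<bar> \<le> Bm \<and> \<bar>b' x\<bar> \<le> B1 \<and> \<bar>q x\<bar> \<le> Q \<and> - q x \<le> Qm"
    and nonneg: "0 \<le> A" "0 \<le> A1" "0 \<le> Bm" "0 \<le> B1" "0 \<le> Q" "0 \<le> Qm"
    and p: "AE x in leb {0<..<1}. p x = a x *\<^sub>R z x + a' x *\<^sub>R y x - b x *\<^sub>R y x - q x *\<^sub>R v x + g x"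
begin

abbreviation "I \<equiv> {0<..<1::real}"
abbreviation "nI f \<equiv> nrm (L2 I) (f :: real \<Rightarrow> complex)"

definition "lower x = a' x *\<^sub>R y x - b x *\<^sub>R y x - q x *\<^sub>R v x + g x"

lemma pieces:
  "v \<in> carr (L2 I)" "y \<in> carr (L2 I)"
  "(\<lambda>x. a x *\<^sub>R z x) \<in> carr (L2 I)" "nI (\<lambda>x. a x *\<^sub>R z x) \<le> A * nI z"
  "(\<lambda>x. a x *\<^sub>R y x) \<in> carr (L2 I)"
  "(\<lambda>x. a' x *\<^sub>R y x) \<in> carr (L2 I)" "nI (\<lambda>x. a' x *\<^sub>R y x) \<le> A1 * nI y"
  "(\<lambda>x. b x *\<^sub>R y x) \<in> carr (L2 I)" "nI (\<lambda>x. b x *\<^sub>R y x) \<le> Bm * nI y"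
  "(\<lambda>x. b' x *\<^sub>R v x) \<in> carr (L2 I)" "nI (\<lambda>x. b' x *\<^sub>R v x) \<le> B1 * nI v"
  "(\<lambda>x. q x *\<^sub>R v x) \<in> carr (L2 I)" "nI (\<lambda>x. q x *\<^sub>R v x) \<le> Q * nI v"
proof -
  show vL: "v \<in> carr (L2 I)" and yL: "y \<in> carr (L2 I)" by (rule ac_L2[OF v(1)], rule ac_L2[OF y])
  have m: "a \<in> borel_measurable (leb I)" "a' \<in> borel_measurable (leb I)"
    "b \<in> borel_measurable (leb I)" "b' \<in> borel_measurable (leb I)"
    using ac_measurable[OF a] ac_measurable[OF b] ac_integrable[OF a] ac_integrable[OF b] by auto
  have B: "AE x in leb I. \<bar>a x\<bar> \<le> A" "AE x in leb I. \<bar>a' x\<bar> \<le> A1" "AE x in leb I. \<bar>b x\<bar> \<le> Bm"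
    "AE x in leb I. \<bar>b' x\<bar> \<le> B1" "AE x in leb I. \<bar>q x\<bar> \<le> Q"
    by (rule eventually_mono[OF bounds], use \<alpha> in auto)+
  show "(\<lambda>x. a x *\<^sub>R z x) \<in> carr (L2 I)" "nI (\<lambda>x. a x *\<^sub>R z x) \<le> A * nI z"
    by (rule L2_times_bounded[OF z m(1) B(1) nonneg(1)])+
  show "(\<lambda>x. a x *\<^sub>R y x) \<in> carr (L2 I)" by (rule L2_times_bounded[OF yL m(1) B(1) nonneg(1)])
  show "(\<lambda>x. a' x *\<^sub>R y x) \<in> carr (L2 I)" "nI (\<lambda>x. a' x *\<^sub>R y x) \<le> A1 * nI y"
    by (rule L2_times_bounded[OF yL m(2) B(2) nonneg(2)])+
  show "(\<lambda>x. b x *\<^sub>R y x) \<in> carr (L2 I)" "nI (\<lambda>x. b x *\<^sub>R y x) \<le> Bm * nI y"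
    by (rule L2_times_bounded[OF yL m(3) B(3) nonneg(3)])+
  show "(\<lambda>x. b' x *\<^sub>R v x) \<in> carr (L2 I)" "nI (\<lambda>x. b' x *\<^sub>R v x) \<le> B1 * nI v"
    by (rule L2_times_bounded[OF vL m(4) B(4) nonneg(4)])+
  show "(\<lambda>x. q x *\<^sub>R v x) \<in> carr (L2 I)" "nI (\<lambda>x. q x *\<^sub>R v x) \<le> Q * nI v"
    by (rule L2_times_bounded[OF vL q B(5) nonneg(5)])+
qed

lemma lower:
  "lower \<in> carr (L2 I)" "nI lower \<le> (A1 + Bm) * nI y + Q * nI v + nI g"
proof -
  note P = pieces
  have 1: "(\<lambda>x. a' x *\<^sub>R y x - b x *\<^sub>R y x) \<in> carr (L2 I)" by (rule L2_diff[OF P(6,8)])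
  have 2: "(\<lambda>x. a' x *\<^sub>R y x - b x *\<^sub>R y x - q x *\<^sub>R v x) \<in> carr (L2 I)" by (rule L2_diff[OF 1 P(12)])
  show "lower \<in> carr (L2 I)" unfolding lower_def[abs_def] by (rule L2_add[OF 2 g])
  show "nI lower \<le> (A1 + Bm) * nI y + Q * nI v + nI g"
    unfolding lower_def[abs_def]
    using L2_triangle(1)[OF 2 g] L2_triangle(2)[OF 1 P(12)] L2_triangle(2)[OF P(6,8)] P(7,9,13)
    by (simp add: distrib_right)
qed

lemma p_eq: "AE x in leb I. a x *\<^sub>R z x + lower x = p x"
  using p by eventually_elim (simp add: lower_def)

lemma p_L2: "p \<in> carr (L2 I)" "nI p \<le> A * nI z + ((A1 + Bm) * nI y + Q * nI v + nI g)"
proof -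
  have L: "(\<lambda>x. a x *\<^sub>R z x + lower x) \<in> carr (L2 I)" by (rule L2_add[OF pieces(3) lower(1)])
  show "p \<in> carr (L2 I)" by (rule L2_cong_AE(1)[OF L _ p_eq]) simp
  have "nI p = nI (\<lambda>x. a x *\<^sub>R z x + lower x)" by (rule L2_cong_AE(2)[OF L _ p_eq]) simp
  then show "nI p \<le> A * nI z + ((A1 + Bm) * nI y + Q * nI v + nI g)"
    using L2_triangle(1)[OF pieces(3) lower(1)] pieces(4) lower(2) by linarith
qed

text \<open>Testing with v_xx: ellipticity bounds the leading term from below, and
  \<open>lower\<close> collects everything else.\<close>

lemma inner_z: "\<alpha> * (nI z)\<^sup>2 \<le> (\<integral>x. p x \<bullet> z x \<partial>leb I) + ((A1 + Bm) * nI y + Q * nI v + nI g) * nI z"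
proof -
  have "(\<integral>x. p x \<bullet> z x \<partial>leb I) = (\<integral>x. (a x *\<^sub>R z x) \<bullet> z x + lower x \<bullet> z x \<partial>leb I)"
    by (rule integral_lebesgue_on_cong_AE, simp, rule eventually_mono[OF p_eq]) (simp only: inner_add_left[symmetric])
  also have "\<dots> = (\<integral>x. (a x *\<^sub>R z x) \<bullet> z x \<partial>leb I) + (\<integral>x. lower x \<bullet> z x \<partial>leb I)"
    by (intro Bochner_Integration.integral_add L2_inner(1) pieces lower z)
  finally have e: "(\<integral>x. p x \<bullet> z x \<partial>leb I) = (\<integral>x. (a x *\<^sub>R z x) \<bullet> z x \<partial>leb I) + (\<integral>x. lower x \<bullet> z x \<partial>leb I)" .
  have "\<alpha> * (nI z)\<^sup>2 = (\<integral>x. \<alpha> * (z x \<bullet> z x) \<partial>leb I)" by (simp add: L2_inner_self[symmetric])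
  also have "\<dots> \<le> (\<integral>x. (a x *\<^sub>R z x) \<bullet> z x \<partial>leb I)"
  proof (rule integral_mono_AE)
    show "integrable (leb I) (\<lambda>x. \<alpha> * (z x \<bullet> z x))" using L2_inner(1)[OF z z] by simp
    show "AE x in leb I. \<alpha> * (z x \<bullet> z x) \<le> (a x *\<^sub>R z x) \<bullet> z x"
      using bounds by eventually_elim (simp add: mult_right_mono)
  qed (rule L2_inner(1)[OF pieces(3) z])
  finally have 1: "\<alpha> * (nI z)\<^sup>2 \<le> (\<integral>x. (a x *\<^sub>R z x) \<bullet> z x \<partial>leb I)" .
  have "\<bar>\<integral>x. lower x \<bullet> z x \<partial>leb I\<bar> \<le> nI lower * nI z" by (rule L2_inner(2)[OF lower(1) z])
  also have "\<dots> \<le> ((A1 + Bm) * nI y + Q * nI v + nI g) * nI z" by (rule mult_right_mono[OF lower(2)]) simp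
  finally show ?thesis using 1 e by linarith
qed

text \<open>Testing with \<open>v\<close> must leave only constants of logarithmic growth in front
  of |v|^2, since they enter the Gronwall exponent; hence \<open>b\<close> is treated by parts and
  \<open>q\<close> through its negative part.\<close>

lemma inner_v: "(\<integral>x. p x \<bullet> v x \<partial>leb I) + \<alpha> * (nI y)\<^sup>2 \<le> (B1 / 2 + Qm) * (nI v)\<^sup>2 + nI g * nI v"
proof -
  note P = pieces
  have flux: "ac 0 1 (\<lambda>x. a x *\<^sub>R y x) (\<lambda>x. a' x *\<^sub>R y x + a x *\<^sub>R z x)"
    by (rule ac_bilinear[OF bounded_bilinear_scaleR a y])
  have "ac 0 1 (\<lambda>x. (a x *\<^sub>R y x) \<bullet> v x) (\<lambda>x. (a' x *\<^sub>R y x + a x *\<^sub>R z x) \<bullet> v x + (a x *\<^sub>R y x) \<bullet> y x)"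
    by (rule ac_bilinear[OF bounded_bilinear_inner flux v(1)])
  from ac_boundary_zero[OF this] have "(\<integral>x. (a' x *\<^sub>R y x + a x *\<^sub>R z x) \<bullet> v x + (a x *\<^sub>R y x) \<bullet> y x \<partial>leb I) = 0"
    using v by simp
  moreover have i1: "integrable (leb I) (\<lambda>x. (a' x *\<^sub>R y x + a x *\<^sub>R z x) \<bullet> v x)" "integrable (leb I) (\<lambda>x. (a x *\<^sub>R y x) \<bullet> y x)"
    by (intro L2_inner(1) L2_add P)+
  ultimately have fl: "(\<integral>x. (a' x *\<^sub>R y x + a x *\<^sub>R z x) \<bullet> v x \<partial>leb I) = - (\<integral>x. (a x *\<^sub>R y x) \<bullet> y x \<partial>leb I)"
    by (simp only: Bochner_Integration.integral_add)
  have "\<alpha> * (nI y)\<^sup>2 = (\<integral>x. \<alpha> * (y x \<bullet> y x) \<partial>leb I)" by (simp add: L2_inner_self[symmetric])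
  also have "\<dots> \<le> (\<integral>x. (a x *\<^sub>R y x) \<bullet> y x \<partial>leb I)"
  proof (rule integral_mono_AE)
    show "integrable (leb I) (\<lambda>x. \<alpha> * (y x \<bullet> y x))" using L2_inner(1)[OF P(2) P(2)] by simp
    show "AE x in leb I. \<alpha> * (y x \<bullet> y x) \<le> (a x *\<^sub>R y x) \<bullet> y x"
      using bounds by eventually_elim (simp add: mult_right_mono)
  qed (rule i1(2))
  finally have fl': "(\<integral>x. (a' x *\<^sub>R y x + a x *\<^sub>R z x) \<bullet> v x \<partial>leb I) \<le> - (\<alpha> * (nI y)\<^sup>2)" using fl by linarith
  \<comment> \<open>Twice the inner product of b v_x with \<open>v\<close> is \<open>b\<close> times
    the derivative of |v|^2, so integration by parts leaves b' |v|^2 without any derivative of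
    \<open>v\<close>.\<close>
  have "ac 0 1 (\<lambda>x. b x * (v x \<bullet> v x)) (\<lambda>x. b' x * (v x \<bullet> v x) + b x * (y x \<bullet> v x + v x \<bullet> y x))"
    by (rule ac_bilinear[OF bounded_bilinear_mult b ac_bilinear[OF bounded_bilinear_inner v(1) v(1)]])
  from ac_boundary_zero[OF this] have "(\<integral>x. b' x * (v x \<bullet> v x) + b x * (y x \<bullet> v x + v x \<bullet> y x) \<partial>leb I) = 0"
    using v by simp
  also have "(\<lambda>x. b' x * (v x \<bullet> v x) + b x * (y x \<bullet> v x + v x \<bullet> y x)) = (\<lambda>x. (b' x *\<^sub>R v x) \<bullet> v x + 2 * ((b x *\<^sub>R y x) \<bullet> v x))"
    by (simp add: inner_commute algebra_simps)
  finally have "(\<integral>x. (b' x *\<^sub>R v x) \<bullet> v x + 2 * ((b x *\<^sub>R y x) \<bullet> v x) \<partial>leb I) = 0" .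
  moreover have "integrable (leb I) (\<lambda>x. (b' x *\<^sub>R v x) \<bullet> v x)" "integrable (leb I) (\<lambda>x. 2 * ((b x *\<^sub>R y x) \<bullet> v x))"
    by (intro integrable_mult_right L2_inner(1) P)+
  ultimately have bt: "2 * (\<integral>x. (b x *\<^sub>R y x) \<bullet> v x \<partial>leb I) = - (\<integral>x. (b' x *\<^sub>R v x) \<bullet> v x \<partial>leb I)"
    by (simp only: Bochner_Integration.integral_add integral_mult_right_zero)
  have "\<bar>\<integral>x. (b' x *\<^sub>R v x) \<bullet> v x \<partial>leb I\<bar> \<le> nI (\<lambda>x. b' x *\<^sub>R v x) * nI v" by (intro L2_inner(2) P)
  also have "\<dots> \<le> (B1 * nI v) * nI v" by (rule mult_right_mono[OF P(11)]) simp
  finally have bt': "- (\<integral>x. (b x *\<^sub>R y x) \<bullet> v x \<partial>leb I) \<le> B1 / 2 * (nI v)\<^sup>2" using bt by (simp add: power2_eq_square)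
  have qt: "- (\<integral>x. (q x *\<^sub>R v x) \<bullet> v x \<partial>leb I) \<le> Qm * (nI v)\<^sup>2"
  proof -
    have "- (\<integral>x. (q x *\<^sub>R v x) \<bullet> v x \<partial>leb I) = (\<integral>x. - ((q x *\<^sub>R v x) \<bullet> v x) \<partial>leb I)" by simp
    also have "\<dots> \<le> (\<integral>x. Qm * (v x \<bullet> v x) \<partial>leb I)"
    proof (rule integral_mono_AE)
      show "integrable (leb I) (\<lambda>x. - ((q x *\<^sub>R v x) \<bullet> v x))" using L2_inner(1)[OF P(12) P(1)] by simp
      show "integrable (leb I) (\<lambda>x. Qm * (v x \<bullet> v x))" using L2_inner(1)[OF P(1) P(1)] by simp
      show "AE x in leb I. - ((q x *\<^sub>R v x) \<bullet> v x) \<le> Qm * (v x \<bullet> v x)"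
        using bounds
      proof eventually_elim
        case (elim x)
        then have "(- q x) * (v x \<bullet> v x) \<le> Qm * (v x \<bullet> v x)" by (intro mult_right_mono) auto
        then show ?case by simp
      qed
    qed
    also have "\<dots> = Qm * (nI v)\<^sup>2" by (simp add: L2_inner_self)
    finally show ?thesis .
  qed
  have gt: "(\<integral>x. g x \<bullet> v x \<partial>leb I) \<le> nI g * nI v" using L2_inner(2)[OF g P(1)] by linarith
  have "(\<integral>x. p x \<bullet> v x \<partial>leb I) = (\<integral>x. ((a' x *\<^sub>R y x + a x *\<^sub>R z x) \<bullet> v x - (b x *\<^sub>R y x) \<bullet> v x) - (q x *\<^sub>R v x) \<bullet> v x + g x \<bullet> v x \<partial>leb I)"
    by (rule integral_lebesgue_on_cong_AE) (use p in \<open>auto elim!: eventually_mono simp: inner_add_left inner_diff_left\<close>)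
  also have "\<dots> = ((\<integral>x. (a' x *\<^sub>R y x + a x *\<^sub>R z x) \<bullet> v x \<partial>leb I) - (\<integral>x. (b x *\<^sub>R y x) \<bullet> v x \<partial>leb I)) - (\<integral>x. (q x *\<^sub>R v x) \<bullet> v x \<partial>leb I) + (\<integral>x. g x \<bullet> v x \<partial>leb I)"
    using i1(1) L2_inner(1)[OF P(8) P(1)] L2_inner(1)[OF P(12) P(1)] L2_inner(1)[OF g P(1)]
    by (simp only: Bochner_Integration.integral_add Bochner_Integration.integral_diff Bochner_Integration.integrable_add Bochner_Integration.integrable_diff)
  finally show ?thesis using fl' bt' qt gt by (simp add: distrib_right)
qed

end

text \<open>\<open>d\<close> is a current state minus an earlier one, with derivatives
  \<open>y\<close> and \<open>yr\<close>. Integration by parts turns the pairing into the inner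
  product of yr - y with \<open>y\<close>, and Young's inequality gives a difference of squares that
  telescopes in time.\<close>

lemma convexity_inequality:
  fixes d y z yr :: "real \<Rightarrow> complex"
  assumes d: "ac 0 1 d (\<lambda>x. y x - yr x)" "d 0 = 0" "d 1 = 0" and y: "ac 0 1 y z" and z: "z \<in> carr (L2 {0<..<1})"
    and yr: "yr \<in> carr (L2 {0<..<1})"
  shows "(\<integral>x. d x \<bullet> z x \<partial>leb {0<..<1}) \<le> ((nrm (L2 {0<..<1}) yr)\<^sup>2 - (nrm (L2 {0<..<1}) y)\<^sup>2) / 2"
proof -
  let ?M = "leb {0<..<1::real}"
  have yL: "y \<in> carr (L2 {0<..<1})" and dL: "d \<in> carr (L2 {0<..<1})" by (rule ac_L2[OF y], rule ac_L2[OF d(1)])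
  have "ac 0 1 (\<lambda>x. d x \<bullet> y x) (\<lambda>x. (y x - yr x) \<bullet> y x + d x \<bullet> z x)"
    by (rule ac_bilinear[OF bounded_bilinear_inner d(1) y])
  from ac_boundary_zero[OF this] have "(\<integral>x. (y x - yr x) \<bullet> y x + d x \<bullet> z x \<partial>?M) = 0" using d by simp
  moreover have "integrable ?M (\<lambda>x. (y x - yr x) \<bullet> y x)" "integrable ?M (\<lambda>x. d x \<bullet> z x)"
    by (intro L2_inner(1) L2_diff yL yr dL z)+
  ultimately have "(\<integral>x. d x \<bullet> z x \<partial>?M) = - (\<integral>x. (y x - yr x) \<bullet> y x \<partial>?M)" by (simp only: Bochner_Integration.integral_add)
  also have "(\<integral>x. (y x - yr x) \<bullet> y x \<partial>?M) = (nrm (L2 {0<..<1}) y)\<^sup>2 - (\<integral>x. yr x \<bullet> y x \<partial>?M)"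
    using L2_inner(1)[OF yL yL] L2_inner(1)[OF yr yL] by (simp add: inner_diff_left L2_inner_self)
  also have "- ((nrm (L2 {0<..<1}) y)\<^sup>2 - (\<integral>x. yr x \<bullet> y x \<partial>?M)) \<le> - (nrm (L2 {0<..<1}) y)\<^sup>2 + nrm (L2 {0<..<1}) yr * nrm (L2 {0<..<1}) y"
    using L2_inner(2)[OF yr yL] by linarith
  also have "\<dots> \<le> ((nrm (L2 {0<..<1}) yr)\<^sup>2 - (nrm (L2 {0<..<1}) y)\<^sup>2) / 2"
    using sum_squares_bound[of "nrm (L2 {0<..<1}) yr" "nrm (L2 {0<..<1}) y"] by (simp add: field_simps)
  finally show ?thesis .
qed

text \<open>Only boundedness of \<open>y\<close> is used: the supremum \<open>M\<close> of \<open>y t * exp (- 2 K t)\<close> satisfies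
  \<open>M \<le> A + M / 2\<close>.\<close>

lemma Gronwall_bounded:
  fixes y :: "real \<Rightarrow> real"
  assumes T: "0 \<le> T" and K: "0 < K" and A: "0 \<le> A" and bd: "\<And>t. t \<in> {0..T} \<Longrightarrow> y t \<le> C" and pos: "\<And>t. t \<in> {0..T} \<Longrightarrow> 0 \<le> y t"
    and yi: "integrable (leb {0<..<T}) y"
    and ineq: "\<And>t. t \<in> {0..T} \<Longrightarrow> y t \<le> A + K * (\<integral>s. y s \<partial>leb {0<..<t})"
    and t: "t \<in> {0..T}"
  shows "y t \<le> 2 * A * exp (2 * K * t)"
proof -
  define S where "S = (\<lambda>t. y t * exp (- (2 * K * t))) ` {0..T}"
  have e1: "exp (- (2 * K * t)) \<le> 1" if "0 \<le> t" for t using that K by simp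
  have "bdd_above S"
    unfolding S_def
  proof (rule bdd_aboveI2)
    fix t assume t: "t \<in> {0..T}"
    have "y t * exp (- (2 * K * t)) \<le> y t * 1" using pos[OF t] e1 t by (intro mult_left_mono) auto
    then show "y t * exp (- (2 * K * t)) \<le> C" using bd[OF t] by simp
  qed
  define M where "M = Sup S"
  have M: "y t * exp (- (2 * K * t)) \<le> M" if "t \<in> {0..T}" for t
    unfolding M_def by (rule cSup_upper[OF _ \<open>bdd_above S\<close>]) (use that in \<open>auto simp: S_def\<close>)
  have M0: "0 \<le> M" using M[of 0] pos[of 0] T by auto
  have yM: "y t \<le> M * exp (2 * K * t)" if "t \<in> {0..T}" for t
    using M[OF that] by (simp add: exp_minus field_simps)
  \<comment> \<open>Inserting \<open>y s \<le> M * exp (2 * K * s)\<close> into the integral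
    inequality returns half of \<open>M\<close>, because the exponent is chosen as twice
    \<open>K\<close>.\<close>
  have "y t * exp (- (2 * K * t)) \<le> A + M / 2" if t: "t \<in> {0..T}" for t
  proof -
    have F: "ac 0 t (\<lambda>s. M / (2 * K) * exp (2 * K * s)) (\<lambda>s. M * exp (2 * K * s))"
    proof (rule ac_C1)
      show "((\<lambda>s. M / (2 * K) * exp (2 * K * s)) has_vector_derivative M * exp (2 * K * x)) (at x)" for x
        unfolding has_real_derivative_iff_has_vector_derivative[symmetric]
        using K by (auto intro!: derivative_eq_intros)
    qed (intro continuous_intros)
    have "(\<integral>s. y s \<partial>leb {0<..<t}) \<le> (\<integral>s. M * exp (2 * K * s) \<partial>leb {0<..<t})"
      using t by (intro integral_mono ac_integrable[OF F] integrable_lebesgue_on_subset[OF yi] yM) auto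
    also have "\<dots> = M / (2 * K) * exp (2 * K * t) - M / (2 * K)" using ac_eq[OF F, of t] t by simp
    also have "\<dots> \<le> M / (2 * K) * exp (2 * K * t)" using M0 K by simp
    finally have "K * (\<integral>s. y s \<partial>leb {0<..<t}) \<le> K * (M / (2 * K) * exp (2 * K * t))" using K by (intro mult_left_mono) auto
    then have "y t \<le> A + M / 2 * exp (2 * K * t)" using ineq[OF t] K by simp
    then have "y t * exp (- (2 * K * t)) \<le> (A + M / 2 * exp (2 * K * t)) * exp (- (2 * K * t))" by (rule mult_right_mono) simp
    also have "\<dots> = A * exp (- (2 * K * t)) + M / 2" by (simp add: distrib_right mult.assoc exp_add[symmetric])
    also have "\<dots> \<le> A * 1 + M / 2" using A e1[of t] t by (intro add_right_mono mult_left_mono) auto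
    finally show ?thesis by simp
  qed
  then have "M \<le> A + M / 2"
    unfolding M_def S_def using T by (intro cSup_least) auto
  then have "M \<le> 2 * A" by simp
  then show ?thesis using yM[OF t] by (smt (verit) exp_gt_zero mult_right_mono)
qed

text \<open>Translation invariance, used to speak about the earlier time s - h at almost every
  \<open>s\<close>.\<close>

lemma AE_lborel_shift:
  fixes h :: real
  assumes "AE s in lborel. P s" shows "AE s in lborel. P (s - h)"
proof -
  obtain N where N: "N \<in> null_sets lborel" "\<And>s. s \<notin> N \<Longrightarrow> P s" using assms by (auto elim!: AE_E3)
  have "AE s in distr lborel borel ((+) (- h)). s \<notin> N"
    unfolding lborel_distr_plus by (rule AE_not_in[OF N(1)])
  then have "AE s in lborel. - h + s \<notin> N"
  proof (subst (asm) AE_distr_iff)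
    have "UNIV - N \<in> sets borel" using N(1) by auto
    then show "{x \<in> space borel. x \<notin> N} \<in> sets borel" by (simp add: set_diff_eq)
  qed auto
  then show ?thesis by (rule eventually_mono) (use N(2) in \<open>simp add: algebra_simps\<close>)
qed

text \<open>\<open>p\<close>, \<open>X\<close> and \<open>Z\<close> are the derivatives \<open>V\<^sub>t\<close>, \<open>V\<^sub>x\<close> and \<open>V\<^sub>x\<^sub>x\<close>, and \<open>v0\<close> is the initial value.\<close>

locale parabolic_problem =
  fixes T \<alpha> A A1 Bm B1 Q Qm :: real and a a' b b' :: "real \<times> real \<Rightarrow> real" and q :: "real \<Rightarrow> real"
    and V p :: "real \<times> real \<Rightarrow> complex" and v0 v0' :: "real \<Rightarrow> complex"
    and X Z G :: "real \<Rightarrow> real \<Rightarrow> complex" and \<Gamma> :: "real \<Rightarrow> real"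
  assumes T: "0 < T" and \<alpha>: "0 < \<alpha>" and nonneg: "0 \<le> A" "0 \<le> A1" "0 \<le> Bm" "0 \<le> B1" "0 \<le> Q" "0 \<le> Qm"
    and V: "V \<in> carr (L2 (QT T))" and p: "p \<in> carr (L2 (QT T))"
    and V_rep: "AE x in leb {0<..<1}. AE t in leb {0<..<T}. V (t, x) = v0 x + (\<integral>s. p (s, x) \<partial>leb {0<..<t})"
    and v0: "ac 0 1 v0 v0'" "v0 0 = 0" "v0 1 = 0" "v0' \<in> carr (L2 {0<..<1})"
    and V_ac: "AE t in leb {0<..<T}. \<exists>v. ac 0 1 v (X t) \<and> v 0 = 0 \<and> v 1 = 0 \<and> (AE x in leb {0<..<1}. V (t, x) = v x)"
    and X_ac: "AE t in leb {0<..<T}. \<exists>y. ac 0 1 y (Z t) \<and> (AE x in leb {0<..<1}. X t x = y x)"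
    and Z_L2: "AE t in leb {0<..<T}. Z t \<in> carr (L2 {0<..<1})"
    and nX: "(\<lambda>t. nrm (L2 {0<..<1}) (X t)) \<in> carr (L2 {0<..<T})" and nZ: "(\<lambda>t. nrm (L2 {0<..<1}) (Z t)) \<in> carr (L2 {0<..<T})"
    and a_ac: "AE t in leb {0<..<T}. \<exists>c. ac 0 1 c (\<lambda>x. a' (t, x)) \<and> (AE x in leb {0<..<1}. a (t, x) = c x)"
    and b_ac: "AE t in leb {0<..<T}. \<exists>c. ac 0 1 c (\<lambda>x. b' (t, x)) \<and> (AE x in leb {0<..<1}. b (t, x) = c x)"
    and q: "q \<in> borel_measurable (leb {0<..<1})"
    and bounds: "AE t in leb {0<..<T}. AE x in leb {0<..<1}. \<alpha> \<le> a (t, x) \<and> a (t, x) \<le> A \<and> \<bar>a' (t, x)\<bar> \<le> A1 \<and>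
        \<bar>b (t, x)\<bar> \<le> Bm \<and> \<bar>b' (t, x)\<bar> \<le> B1 \<and> \<bar>q x\<bar> \<le> Q \<and> - q x \<le> Qm"
    and G: "AE t in leb {0<..<T}. G t \<in> carr (L2 {0<..<1}) \<and> nrm (L2 {0<..<1}) (G t) \<le> \<Gamma> t" and \<Gamma>: "\<Gamma> \<in> carr (L2 {0<..<T})"
    and equation: "AE t in leb {0<..<T}. AE x in leb {0<..<1}.
        p (t, x) = a (t, x) *\<^sub>R Z t x + a' (t, x) *\<^sub>R X t x - b (t, x) *\<^sub>R X t x - q x *\<^sub>R V (t, x) + G t x"
begin

abbreviation "I \<equiv> {0<..<1::real}"
abbreviation "J \<equiv> {0<..<T}"
abbreviation "nI f \<equiv> nrm (L2 I) (f :: real \<Rightarrow> complex)"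

text \<open>Absolutely continuous representatives are chosen for all slices at once; bounds and
  equation transfer, because each representative differs from its slice only on a null set.\<close>

lemma spatial:
  "AE t in leb J. \<exists>v y c d. spatial_problem v y (Z t) (G t) (\<lambda>x. p (t, x)) c (\<lambda>x. a' (t, x)) d (\<lambda>x. b' (t, x)) q \<alpha> A A1 Bm B1 Q Qm \<and>
     (AE x in leb I. V (t, x) = v x) \<and> (AE x in leb I. X t x = y x)"
  using V_ac X_ac Z_L2 a_ac b_ac bounds G equation
proof eventually_elim
  case (elim t)
  obtain v where v: "ac 0 1 v (X t)" "v 0 = 0" "v 1 = 0" and ae_v: "AE x in leb I. V (t, x) = v x" using elim(1) by blast
  obtain y where y: "ac 0 1 y (Z t)" and ae_y: "AE x in leb I. X t x = y x" using elim(2) by blast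
  obtain c where c: "ac 0 1 c (\<lambda>x. a' (t, x))" and ae_c: "AE x in leb I. a (t, x) = c x" using elim(4) by blast
  obtain d where d: "ac 0 1 d (\<lambda>x. b' (t, x))" and ae_d: "AE x in leb I. b (t, x) = d x" using elim(5) by blast
  have vy: "ac 0 1 v y" by (rule ac_cong_AE[OF v(1) ac_measurable[OF y] ae_y])
  have "spatial_problem v y (Z t) (G t) (\<lambda>x. p (t, x)) c (\<lambda>x. a' (t, x)) d (\<lambda>x. b' (t, x)) q \<alpha> A A1 Bm B1 Q Qm"
  proof
    show "AE x in leb {0<..<1}. \<alpha> \<le> c x \<and> c x \<le> A \<and> \<bar>a' (t, x)\<bar> \<le> A1 \<and> \<bar>d x\<bar> \<le> Bm \<and> \<bar>b' (t, x)\<bar> \<le> B1 \<and> \<bar>q x\<bar> \<le> Q \<and> - q x \<le> Qm"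
      using elim(6) ae_c ae_d by eventually_elim simp
    show "AE x in leb {0<..<1}. p (t, x) = c x *\<^sub>R Z t x + a' (t, x) *\<^sub>R y x - d x *\<^sub>R y x - q x *\<^sub>R v x + G t x"
      using elim(8) ae_v ae_y ae_c ae_d by eventually_elim simp
  qed (use vy v y elim(3,7) c d q \<alpha> nonneg in auto)
  with ae_v ae_y show ?case by blast
qed

text \<open>A Borel version of V_t that vanishes outside Q_T, so that its primitives in time and its
  averages over the whole line are Borel functions given at every point.\<close>

definition P :: "real \<times> real \<Rightarrow> complex" where
  "P = (SOME g. g \<in> borel_measurable borel \<and> (\<forall>z. z \<notin> QT T \<longrightarrow> g z = 0) \<and> (AE z in leb (QT T). p z = g z))"

lemma P: "P \<in> borel_measurable borel" "z \<notin> QT T \<Longrightarrow> P z = 0" "AE z in leb (QT T). p z = P z"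
proof -
  obtain g where g: "g \<in> borel_measurable borel" "AE z in leb (QT T). p z = g z"
    using borel_representative[OF borel_rectangle L2_measurable[OF p]] .
  have "(\<lambda>z. indicator (QT T) z *\<^sub>R g z) \<in> borel_measurable borel"
    by (intro borel_measurable_scaleR borel_measurable_indicator borel_rectangle g)
  moreover have "AE z in leb (QT T). p z = indicator (QT T) z *\<^sub>R g z"
    using g(2) AE_space by eventually_elim simp
  ultimately have "\<exists>g. g \<in> borel_measurable borel \<and> (\<forall>z. z \<notin> QT T \<longrightarrow> g z = 0) \<and> (AE z in leb (QT T). p z = g z)"
    by (intro exI[of _ "\<lambda>z. indicator (QT T) z *\<^sub>R g z"]) auto
  from someI_ex[OF this] show "P \<in> borel_measurable borel" "z \<notin> QT T \<Longrightarrow> P z = 0" "AE z in leb (QT T). p z = P z"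
    unfolding P_def by blast+
qed

lemma P_L2: "P \<in> carr (L2 (QT T))"
  by (rule L2_cong_AE(1)[OF p borel_rectangle P(3)])

definition "w0 x = indicator {0..1} x *\<^sub>R v0 x"

text \<open>The representative of \<open>V\<close> obtained by integrating V_t in time. For t \<le>
  0 the integral is over an empty interval, so this also extends \<open>V\<close> backwards by its
  initial value.\<close>

definition "Vb z = w0 (snd z) + (\<integral>s. P (s, snd z) \<partial>leb {0<..<fst z})"

lemma Vb_measurable: "Vb \<in> borel_measurable borel"
proof -
  have [measurable]: "w0 \<in> borel_measurable borel"
    unfolding w0_def[abs_def] by (rule borel_measurable_continuous_on_indicator[OF _ ac_continuous[OF v0(1)]]) simp
  have "(\<lambda>z :: real \<times> real. w0 (snd z)) \<in> borel_measurable borel"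
    unfolding borel_prod[symmetric] by measurable
  then show ?thesis unfolding Vb_def[abs_def] by (intro borel_measurable_add primitive_measurable P)
qed

lemma Vb_nonpos: "t \<le> 0 \<Longrightarrow> Vb (t, x) = w0 x"
  by (simp add: Vb_def)

lemma Vb_eq: "AE z in leb (QT T). V z = Vb z"
proof -
  obtain V1 where V1: "V1 \<in> borel_measurable borel" and ae: "AE z in leb (QT T). V z = V1 z"
    using borel_representative[OF borel_rectangle L2_measurable[OF V]] .
  have "AE x in leb I. AE t in leb J. V1 (t, x) = Vb (t, x)"
    using V_rep AE_lebesgue_on_slice'[OF _ _ ae, simplified] AE_lebesgue_on_slice'[OF _ _ P(3), simplified] AE_space
  proof eventually_elim
    case (elim x)
    have w: "w0 x = v0 x" using elim(4) by (simp add: w0_def)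
    show ?case
      using elim(1,2) AE_space
    proof eventually_elim
      case (elim t)
      have "AE s in leb {0<..<t}. p (s, x) = P (s, x)"
        by (rule AE_lebesgue_on_subset[OF \<open>AE t in leb J. p (t, x) = P (t, x)\<close>]) (use elim in auto)
      then have "(\<integral>s. p (s, x) \<partial>leb {0<..<t}) = (\<integral>s. P (s, x) \<partial>leb {0<..<t})"
        by (intro integral_lebesgue_on_cong_AE) auto
      then show ?case using elim w by (simp add: Vb_def)
    qed
  qed
  moreover have "{z. V1 z = Vb z} \<in> sets borel"
    using measurable_sets[OF borel_measurable_diff[OF V1 Vb_measurable], of "{0}"] by (simp add: vimage_def)
  ultimately have "AE z in leb (QT T). V1 z = Vb z" by (intro AE_lebesgue_on_commute) auto
  with ae show ?thesis by eventually_elim simp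
qed

lemma Vb_L2: "Vb \<in> carr (L2 (QT T))"
  by (rule L2_cong_AE(1)[OF V borel_rectangle Vb_eq])

lemma slice_measurable:
  assumes "F \<in> borel_measurable (borel :: (real \<times> real) measure)"
  shows "(\<lambda>t. F (t, x)) \<in> borel_measurable borel" "(\<lambda>x. F (t, x)) \<in> borel_measurable borel"
proof -
  have [measurable]: "F \<in> borel_measurable (borel \<Otimes>\<^sub>M borel)" using assms by (simp add: borel_prod)
  show "(\<lambda>t. F (t, x)) \<in> borel_measurable borel" "(\<lambda>x. F (t, x)) \<in> borel_measurable borel" by measurable
qed

lemma P_sq_swap: "integrable (leb (I \<times> J)) (\<lambda>z. (norm (P (snd z, fst z)))\<^sup>2)"
  using P_L2 by (intro integrable_lebesgue_on_swap) (auto simp: L2_iff)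

lemma P_slice_L2: "AE x in leb I. (\<lambda>s. P (s, x)) \<in> carr (L2 J)"
  using AE_integrable_lebesgue_on_slice[OF _ _ P_sq_swap, simplified]
  by (rule eventually_mono) (simp add: L2_iff borel_measurable_lebesgue_onI slice_measurable(1)[OF P(1)])

lemma Vb_ac:
  assumes "(\<lambda>s. P (s, x)) \<in> carr (L2 J)"
  shows "ac 0 T (\<lambda>t. Vb (t, x)) (\<lambda>s. P (s, x))"
  unfolding Vb_def using ac_indefinite_integral[OF L2_imp_integrable[OF assms finite_lebesgue_on_Ioo], of "w0 x"] by simp

text \<open>Crude but uniform in \<open>t\<close>: Gronwall's argument by suprema asks for
  boundedness beforehand.\<close>

lemma Vb_slice:
  assumes t: "t \<in> {0..T}"
  shows "(\<lambda>x. Vb (t, x)) \<in> carr (L2 I)"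
    "(nI (\<lambda>x. Vb (t, x)))\<^sup>2 \<le> 2 * (nI v0)\<^sup>2 + 2 * T * (\<integral>z. (norm (P z))\<^sup>2 \<partial>leb (QT T))"
proof -
  let ?W = "\<lambda>x. 2 * (norm (v0 x))\<^sup>2 + 2 * (T * (\<integral>s. (norm (P (s, x)))\<^sup>2 \<partial>leb J))"
  have v0L: "v0 \<in> carr (L2 I)" by (rule ac_L2[OF v0(1)])
  note iP = integrable_integral_lebesgue_on_slice[OF _ _ P_sq_swap, simplified]
  have W: "integrable (leb I) ?W" using v0L iP by (simp add: L2_iff)
  have b: "AE x in leb I. (norm (Vb (t, x)))\<^sup>2 \<le> ?W x"
    using P_slice_L2 AE_space
  proof eventually_elim
    case (elim x)
    have sub: "{0<..<t} \<subseteq> J" using t by auto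
    have "integrable (leb {0<..<t}) (\<lambda>s. (norm (P (s, x)))\<^sup>2)"
      by (rule integrable_lebesgue_on_subset[OF _ sub]) (use elim(1) in \<open>auto simp: L2_iff\<close>)
    then have L: "(\<lambda>s. P (s, x)) \<in> carr (L2 {0<..<t})" and i: "integrable (leb {0<..<t}) (\<lambda>s. (norm (P (s, x)))\<^sup>2)"
      by (auto simp: L2_iff borel_measurable_lebesgue_onI slice_measurable(1)[OF P(1)])
    have "(norm (\<integral>s. P (s, x) \<partial>leb {0<..<t}))\<^sup>2 \<le> (t - 0) * (\<integral>s. (norm (P (s, x)))\<^sup>2 \<partial>leb {0<..<t})"
      by (rule norm_integral_squared_le[OF L]) (use t in simp)
    also have "\<dots> \<le> T * (\<integral>s. (norm (P (s, x)))\<^sup>2 \<partial>leb J)"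
    proof (intro mult_mono)
      have "(\<integral>s. (norm (P (s, x)))\<^sup>2 \<partial>leb {0<..<t}) = (\<integral>s. indicator {0<..<t} s *\<^sub>R (norm (P (s, x)))\<^sup>2 \<partial>leb J)"
        by (rule integral_lebesgue_on_subset_indicator[symmetric]) (use sub in auto)
      also have "\<dots> \<le> (\<integral>s. (norm (P (s, x)))\<^sup>2 \<partial>leb J)"
        using elim(1) integrable_lebesgue_on_subset_indicator[OF sub, of "\<lambda>s. (norm (P (s, x)))\<^sup>2"] i
        by (intro integral_mono) (auto simp: L2_iff indicator_def)
      finally show "(\<integral>s. (norm (P (s, x)))\<^sup>2 \<partial>leb {0<..<t}) \<le> (\<integral>s. (norm (P (s, x)))\<^sup>2 \<partial>leb J)" .
    qed (use t T in auto)
    finally have "(norm (\<integral>s. P (s, x) \<partial>leb {0<..<t}))\<^sup>2 \<le> T * (\<integral>s. (norm (P (s, x)))\<^sup>2 \<partial>leb J)" .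
    moreover have "Vb (t, x) = v0 x + (\<integral>s. P (s, x) \<partial>leb {0<..<t})" using elim(2) by (simp add: Vb_def w0_def)
    ultimately show ?case using norm_add_squared[of "v0 x" "\<integral>s. P (s, x) \<partial>leb {0<..<t}"] by simp
  qed
  have m: "(\<lambda>x. Vb (t, x)) \<in> borel_measurable (leb I)"
    by (rule borel_measurable_lebesgue_onI[OF slice_measurable(2)[OF Vb_measurable]])
  have i: "integrable (leb I) (\<lambda>x. (norm (Vb (t, x)))\<^sup>2)"
    by (rule Bochner_Integration.integrable_bound[OF W]) (use m b in \<open>auto elim!: eventually_mono\<close>)
  with m show "(\<lambda>x. Vb (t, x)) \<in> carr (L2 I)" by (simp add: L2_iff)
  have "(nI (\<lambda>x. Vb (t, x)))\<^sup>2 \<le> (\<integral>x. ?W x \<partial>leb I)" unfolding L2_nrm_sq by (rule integral_mono_AE[OF i W b])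
  also have "\<dots> = 2 * (nI v0)\<^sup>2 + 2 * (T * (\<integral>x. \<integral>s. (norm (P (s, x)))\<^sup>2 \<partial>leb J \<partial>leb I))"
    using v0L iP by (simp add: L2_nrm_sq L2_iff)
  also have "(\<integral>x. \<integral>s. (norm (P (s, x)))\<^sup>2 \<partial>leb J \<partial>leb I) = (\<integral>z. (norm (P z))\<^sup>2 \<partial>leb (QT T))"
    using integral_lebesgue_on_slice[OF _ _ P_sq_swap] integral_lebesgue_on_swap[of J I "\<lambda>z. (norm (P z))\<^sup>2"] P_L2 by (simp add: L2_iff)
  finally show "(nI (\<lambda>x. Vb (t, x)))\<^sup>2 \<le> 2 * (nI v0)\<^sup>2 + 2 * T * (\<integral>z. (norm (P z))\<^sup>2 \<partial>leb (QT T))" by simp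
qed

section \<open>First energy estimate\<close>

definition "ysq t = (nI (\<lambda>x. Vb (t, x)))\<^sup>2"

lemma ysq_integrable: "integrable (leb J) ysq"
proof -
  have "integrable (leb (QT T)) (\<lambda>z. (norm (Vb z))\<^sup>2)" using Vb_L2 by (simp add: L2_iff)
  from integrable_integral_lebesgue_on_slice[OF _ _ this] show ?thesis unfolding ysq_def[abs_def] L2_nrm_sq by simp
qed

lemma ysq_eq: "AE t in leb J. ysq t = (nI (\<lambda>x. V (t, x)))\<^sup>2"
  using AE_lebesgue_on_slice[OF _ _ Vb_eq, simplified]
proof (rule eventually_mono)
  fix t assume "AE x in leb I. V (t, x) = Vb (t, x)"
  then show "ysq t = (nI (\<lambda>x. V (t, x)))\<^sup>2"
    unfolding ysq_def L2_nrm_sq by (intro integral_lebesgue_on_cong_AE) (auto elim!: eventually_mono)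
qed

text \<open>The chain rule is applied to |Vb (t, x)|^2 in \<open>t\<close> for almost every fixed
  \<open>x\<close> and integrated in \<open>x\<close> by Fubini, which avoids differentiating a
  function with values in L^2. As \<open>Vb\<close> is given at every point, the identity holds for
  every \<open>t\<close>, as the Gronwall argument requires.\<close>

lemma ysq_identity:
  assumes t: "t \<in> {0..T}"
  shows "integrable (leb J) (\<lambda>s. \<integral>x. P (s, x) \<bullet> Vb (s, x) \<partial>leb I)"
    "ysq t = (nI v0)\<^sup>2 + 2 * (\<integral>s. \<integral>x. P (s, x) \<bullet> Vb (s, x) \<partial>leb I \<partial>leb {0<..<t})"
proof -
  have PV: "integrable (leb (QT T)) (\<lambda>z. P z \<bullet> Vb z)" by (rule L2_inner(1)[OF P_L2 Vb_L2])
  from integrable_integral_lebesgue_on_slice[OF _ _ this]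
  show "integrable (leb J) (\<lambda>s. \<integral>x. P (s, x) \<bullet> Vb (s, x) \<partial>leb I)" by simp
  have sub: "{0<..<t} \<times> I \<subseteq> QT T" using t by auto
  have PVt: "integrable (leb ({0<..<t} \<times> I)) (\<lambda>z. P z \<bullet> Vb z)"
    by (rule integrable_lebesgue_on_subset[OF PV sub]) auto
  note PVs = integrable_lebesgue_on_swap[OF _ _ PVt, simplified]
  have id: "AE x in leb I. (norm (Vb (t, x)))\<^sup>2 = (norm (v0 x))\<^sup>2 + 2 * (\<integral>s. P (s, x) \<bullet> Vb (s, x) \<partial>leb {0<..<t})"
    using P_slice_L2 AE_space
  proof eventually_elim
    case (elim x)
    have "ac 0 T (\<lambda>t. Vb (t, x) \<bullet> Vb (t, x)) (\<lambda>t. P (t, x) \<bullet> Vb (t, x) + Vb (t, x) \<bullet> P (t, x))"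
      by (rule ac_bilinear[OF bounded_bilinear_inner Vb_ac[OF elim(1)] Vb_ac[OF elim(1)]])
    from ac_eq[OF this t] show ?case
      using elim(2) by (simp add: power2_norm_eq_inner inner_commute Vb_nonpos w0_def)
  qed
  have v0L: "v0 \<in> carr (L2 I)" by (rule ac_L2[OF v0(1)])
  have iI: "integrable (leb I) (\<lambda>x. \<integral>s. P (s, x) \<bullet> Vb (s, x) \<partial>leb {0<..<t})"
    using integrable_integral_lebesgue_on_slice[OF _ _ PVs] by simp
  have "ysq t = (\<integral>x. (norm (v0 x))\<^sup>2 + 2 * (\<integral>s. P (s, x) \<bullet> Vb (s, x) \<partial>leb {0<..<t}) \<partial>leb I)"
    unfolding ysq_def L2_nrm_sq by (rule integral_lebesgue_on_cong_AE[OF _ id]) simp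
  also have "\<dots> = (nI v0)\<^sup>2 + 2 * (\<integral>x. \<integral>s. P (s, x) \<bullet> Vb (s, x) \<partial>leb {0<..<t} \<partial>leb I)"
    using v0L iI by (simp add: L2_nrm_sq L2_iff)
  also have "(\<integral>x. \<integral>s. P (s, x) \<bullet> Vb (s, x) \<partial>leb {0<..<t} \<partial>leb I) = (\<integral>s. \<integral>x. P (s, x) \<bullet> Vb (s, x) \<partial>leb I \<partial>leb {0<..<t})"
    using integral_lebesgue_on_slice[OF _ _ PVs] integral_lebesgue_on_swap[OF _ _ PVt] integral_lebesgue_on_slice[OF _ _ PVt] by simp
  finally show "ysq t = (nI v0)\<^sup>2 + 2 * (\<integral>s. \<integral>x. P (s, x) \<bullet> Vb (s, x) \<partial>leb I \<partial>leb {0<..<t})" .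
qed

text \<open>Twice the coefficient B1 / 2 + Qm from testing with \<open>v\<close>, plus 1 from
  Young's inequality for the forcing.\<close>

definition "Kc = B1 + 2 * Qm + 1"
definition "D0 = (nI v0)\<^sup>2 + (\<integral>t. (\<Gamma> t)\<^sup>2 \<partial>leb J)"

lemma \<Gamma>_sq: "integrable (leb J) (\<lambda>t. (\<Gamma> t)\<^sup>2)" "0 \<le> (\<integral>t. (\<Gamma> t)\<^sup>2 \<partial>leb J)"
  using \<Gamma> by (auto simp: L2_iff)

lemma nX_sq: "integrable (leb J) (\<lambda>t. (nI (X t))\<^sup>2)" and nZ_sq: "integrable (leb J) (\<lambda>t. (nI (Z t))\<^sup>2)"
  using nX nZ by (auto simp: L2_iff)

lemma slice_eqs:
  "AE t in leb J. (AE x in leb I. V (t, x) = Vb (t, x)) \<and> (AE x in leb I. p (t, x) = P (t, x))"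
  using AE_lebesgue_on_slice[OF _ _ Vb_eq, simplified] AE_lebesgue_on_slice[OF _ _ P(3), simplified] by eventually_elim simp

text \<open>Twice the estimate \<open>inner_v\<close>, transferred from the chosen slices to
  \<open>P\<close> and \<open>Vb\<close>.\<close>

lemma dissipation:
  "AE t in leb J. 2 * (\<integral>x. P (t, x) \<bullet> Vb (t, x) \<partial>leb I) + 2 * \<alpha> * (nI (X t))\<^sup>2 \<le> Kc * ysq t + (\<Gamma> t)\<^sup>2"
  using spatial slice_eqs G
proof eventually_elim
  case (elim t)
  obtain v y c d where sp: "spatial_problem v y (Z t) (G t) (\<lambda>x. p (t, x)) c (\<lambda>x. a' (t, x)) d (\<lambda>x. b' (t, x)) q \<alpha> A A1 Bm B1 Q Qm"
    and ae_v: "AE x in leb I. V (t, x) = v x" and ae_y: "AE x in leb I. X t x = y x" using elim(1) by blast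
  interpret sp: spatial_problem v y "Z t" "G t" "\<lambda>x. p (t, x)" c "\<lambda>x. a' (t, x)" d "\<lambda>x. b' (t, x)" q \<alpha> A A1 Bm B1 Q Qm by (rule sp)
  have ae: "AE x in leb I. P (t, x) \<bullet> Vb (t, x) = p (t, x) \<bullet> v x"
    using ae_v conjunct1[OF elim(2)] conjunct2[OF elim(2)] by eventually_elim simp
  have e1: "(\<integral>x. P (t, x) \<bullet> Vb (t, x) \<partial>leb I) = (\<integral>x. p (t, x) \<bullet> v x \<partial>leb I)"
    by (rule integral_lebesgue_on_cong_AE[OF _ ae]) simp
  have ae2: "AE x in leb I. v x = Vb (t, x)" using ae_v conjunct1[OF elim(2)] by eventually_elim simp
  have e2: "ysq t = (nI v)\<^sup>2" unfolding ysq_def using L2_cong_AE(2)[OF sp.pieces(1) _ ae2] by simp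
  have ae3: "AE x in leb I. y x = X t x" using ae_y by (auto elim: eventually_mono)
  have e3: "nI (X t) = nI y" using L2_cong_AE(2)[OF sp.pieces(2) _ ae3] by simp
  have "nI (G t) * nI v \<le> \<Gamma> t * nI v" using elim(3) by (intro mult_right_mono) auto
  also have "2 * (\<Gamma> t * nI v) \<le> (\<Gamma> t)\<^sup>2 + (nI v)\<^sup>2" using sum_squares_bound[of "\<Gamma> t" "nI v"] by simp
  finally have "2 * (nI (G t) * nI v) \<le> (\<Gamma> t)\<^sup>2 + (nI v)\<^sup>2" by simp
  then show ?case using sp.inner_v unfolding e1 e2 e3 Kc_def by (simp add: algebra_simps)
qed

lemma energy_inequality:
  assumes t: "t \<in> {0..T}"
  shows "ysq t + 2 * \<alpha> * (\<integral>s. (nI (X s))\<^sup>2 \<partial>leb {0<..<t}) \<le> D0 + Kc * (\<integral>s. ysq s \<partial>leb {0<..<t})"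
proof -
  let ?f = "\<lambda>s. \<integral>x. P (s, x) \<bullet> Vb (s, x) \<partial>leb I"
  have sub: "{0<..<t} \<subseteq> J" using t by auto
  have i: "integrable (leb {0<..<t}) ?f" "integrable (leb {0<..<t}) (\<lambda>s. (nI (X s))\<^sup>2)"
    "integrable (leb {0<..<t}) ysq" "integrable (leb {0<..<t}) (\<lambda>s. (\<Gamma> s)\<^sup>2)"
    by (rule integrable_lebesgue_on_subset[OF _ sub], use ysq_identity(1)[OF t] nX_sq ysq_integrable \<Gamma>_sq in auto)+
  have "(\<integral>s. 2 * ?f s + 2 * \<alpha> * (nI (X s))\<^sup>2 \<partial>leb {0<..<t}) \<le> (\<integral>s. Kc * ysq s + (\<Gamma> s)\<^sup>2 \<partial>leb {0<..<t})"
    by (rule integral_mono_AE) (use i AE_lebesgue_on_subset[OF dissipation sub] in auto)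
  then have "2 * (\<integral>s. ?f s \<partial>leb {0<..<t}) + 2 * \<alpha> * (\<integral>s. (nI (X s))\<^sup>2 \<partial>leb {0<..<t})
      \<le> Kc * (\<integral>s. ysq s \<partial>leb {0<..<t}) + (\<integral>s. (\<Gamma> s)\<^sup>2 \<partial>leb {0<..<t})"
    using i by simp
  moreover have "(\<integral>s. (\<Gamma> s)\<^sup>2 \<partial>leb {0<..<t}) \<le> (\<integral>s. (\<Gamma> s)\<^sup>2 \<partial>leb J)"
  proof -
    have "(\<integral>s. (\<Gamma> s)\<^sup>2 \<partial>leb {0<..<t}) = (\<integral>s. indicator {0<..<t} s *\<^sub>R (\<Gamma> s)\<^sup>2 \<partial>leb J)"
      by (rule integral_lebesgue_on_subset_indicator[symmetric]) (use sub in auto)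
    also have "\<dots> \<le> (\<integral>s. (\<Gamma> s)\<^sup>2 \<partial>leb J)"
      using \<Gamma>_sq integrable_lebesgue_on_subset_indicator[OF sub, of "\<lambda>s. (\<Gamma> s)\<^sup>2"] i(4)
      by (intro integral_mono) (auto simp: indicator_def)
    finally show ?thesis .
  qed
  ultimately show ?thesis using ysq_identity(2)[OF t] by (simp add: D0_def)
qed

lemma Kc_pos: "0 < Kc" "0 \<le> D0"
  using nonneg \<Gamma>_sq by (auto simp: Kc_def D0_def)

lemma sup_bound:
  assumes t: "t \<in> {0..T}" shows "ysq t \<le> 2 * D0 * exp (2 * Kc * T)"
proof -
  have "ysq t \<le> 2 * D0 * exp (2 * Kc * t)"
  proof (rule Gronwall_bounded[OF less_imp_le[OF T] Kc_pos _ _ ysq_integrable _ t])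
    fix t assume t: "t \<in> {0..T}"
    show "ysq t \<le> 2 * (nI v0)\<^sup>2 + 2 * T * (\<integral>z. (norm (P z))\<^sup>2 \<partial>leb (QT T))"
      unfolding ysq_def by (rule Vb_slice(2)[OF t])
    show "0 \<le> ysq t" by (simp add: ysq_def)
    have "0 \<le> (\<integral>s. (nI (X s))\<^sup>2 \<partial>leb {0<..<t})" by simp
    then have "0 \<le> 2 * \<alpha> * (\<integral>s. (nI (X s))\<^sup>2 \<partial>leb {0<..<t})" using \<alpha> by (intro mult_nonneg_nonneg) auto
    then show "ysq t \<le> D0 + Kc * (\<integral>s. ysq s \<partial>leb {0<..<t})"
      using energy_inequality[OF t] by linarith
  qed
  also have "\<dots> \<le> 2 * D0 * exp (2 * Kc * T)"
    using Kc_pos t by (intro mult_left_mono) auto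
  finally show ?thesis .
qed

text \<open>The right-hand side of the energy inequality at time \<open>T\<close> with the Gronwall
  bound inserted; the bare \<open>D0\<close> is enlarged by the exponential to obtain one common
  factor.\<close>

definition "D1 = D0 * (1 + 2 * Kc * T) * exp (2 * Kc * T)"

lemma integral_ysq: "(\<integral>t. ysq t \<partial>leb J) \<le> 2 * T * D0 * exp (2 * Kc * T)"
proof -
  have "(\<integral>t. ysq t \<partial>leb J) \<le> (\<integral>t. 2 * D0 * exp (2 * Kc * T) \<partial>leb J)"
    using finite_measure.integrable_const[OF finite_lebesgue_on_Ioo[of 0 T]]
    by (intro integral_mono ysq_integrable sup_bound) auto
  also have "\<dots> = 2 * T * D0 * exp (2 * Kc * T)" using T by (simp add: measure_restrict_space)
  finally show ?thesis .
qed

lemma gradient_bound: "2 * \<alpha> * (\<integral>t. (nI (X t))\<^sup>2 \<partial>leb J) \<le> D1"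
proof -
  have "0 \<le> ysq T" by (simp add: ysq_def)
  then have "2 * \<alpha> * (\<integral>t. (nI (X t))\<^sup>2 \<partial>leb J) \<le> D0 + Kc * (\<integral>t. ysq t \<partial>leb J)"
    using energy_inequality[of T] T by simp
  also have "\<dots> \<le> D0 * exp (2 * Kc * T) + Kc * (2 * T * D0 * exp (2 * Kc * T))"
    using Kc_pos T integral_ysq by (intro add_mono mult_left_mono) (auto simp: mult_le_cancel_left1)
  also have "\<dots> = D1" by (simp add: D1_def algebra_simps)
  finally show ?thesis .
qed

end

section \<open>Second energy estimate\<close>

context parabolic_problem
begin

text \<open>Both sides are the integral of \<open>P\<close> over (s - h, s), divided by
  \<open>h\<close>. Negative times contribute to neither: \<open>P\<close> vanishes there and
  \<open>Vb\<close> is constant.\<close>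

lemma steklov_Vb:
  assumes x: "(\<lambda>s. P (s, x)) \<in> carr (L2 J)" and h: "0 < h"
  shows "steklov h P (s, x) = (1 / h) *\<^sub>R (Vb (s, x) - Vb (s - h, x))"
proof -
  have m: "(\<lambda>r. P (r, x)) \<in> borel_measurable borel" by (rule slice_measurable(1)[OF P(1)])
  have "integrable (leb J) (\<lambda>r. P (r, x))" by (rule L2_imp_integrable[OF x finite_lebesgue_on_Ioo])
  then have "integrable lborel (\<lambda>r. indicator J r *\<^sub>R P (r, x))" by (simp add: integrable_lebesgue_on_borel[OF _ m])
  moreover have "(\<lambda>r. indicator J r *\<^sub>R P (r, x)) = (\<lambda>r. P (r, x))"
    using P(2) by (auto simp: indicator_def fun_eq_iff)
  ultimately have i: "integrable lborel (\<lambda>r. P (r, x))" by simp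
  have ind: "integrable lborel (\<lambda>r. indicator B r *\<^sub>R P (r, x))" if "B \<in> sets borel" for B
    using that by (intro bounded_times_integrable[OF i, of _ 1]) (auto simp: indicator_def)
  have V: "Vb (t, x) = w0 x + (\<integral>r. indicator {0<..<t} r *\<^sub>R P (r, x) \<partial>lborel)" for t
    by (simp add: Vb_def integral_lebesgue_on_borel[OF _ m])
  have "Vb (s, x) - Vb (s - h, x) = (\<integral>r. indicator {0<..<s} r *\<^sub>R P (r, x) - indicator {0<..<s - h} r *\<^sub>R P (r, x) \<partial>lborel)"
    unfolding V by (subst Bochner_Integration.integral_diff) (auto intro: ind)
  also have "\<dots> = (\<integral>r. indicator {s - h<..<s} r *\<^sub>R P (r, x) \<partial>lborel)"
  proof (rule integral_cong_AE)
    \<comment> \<open>The intervals (0, s - h) and (s - h, s) together miss just the point s -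
      h.\<close>
    show "AE r in lborel. indicator {0<..<s} r *\<^sub>R P (r, x) - indicator {0<..<s - h} r *\<^sub>R P (r, x) = indicator {s - h<..<s} r *\<^sub>R P (r, x)"
      using AE_lborel_real_singleton[of "s - h"]
    proof eventually_elim
      case (elim r)
      show ?case
      proof (cases "0 < r")
        case True
        then show ?thesis using elim h by (auto simp: indicator_def)
      next
        case False
        then show ?thesis using P(2)[of "(r, x)"] by auto
      qed
    qed
  qed (use m in measurable)
  finally show ?thesis by (simp add: steklov_def)
qed

text \<open>Bounds the L^2 norm of the lower-order terms at time \<open>t\<close>, with the forcing
  replaced by its bound \<open>\<Gamma>\<close>.\<close>

definition "Hs t = (A1 + Bm) * nI (X t) + Q * sqrt (ysq t) + \<Gamma> t"

lemma Hs_L2: "Hs \<in> carr (L2 J)"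
  "(\<integral>t. (Hs t)\<^sup>2 \<partial>leb J) \<le> 3 * ((A1 + Bm)\<^sup>2 * (\<integral>t. (nI (X t))\<^sup>2 \<partial>leb J) + Q\<^sup>2 * (\<integral>t. ysq t \<partial>leb J) + (\<integral>t. (\<Gamma> t)\<^sup>2 \<partial>leb J))"
proof -
  have y0: "0 \<le> ysq t" for t by (simp add: ysq_def)
  have yL: "(\<lambda>t. sqrt (ysq t)) \<in> carr (L2 J)"
    using ysq_integrable y0 by (auto simp: L2_iff)
  show L: "Hs \<in> carr (L2 J)"
    unfolding Hs_def[abs_def] by (intro L2_add L2_cmult nX yL \<Gamma>)
  have "(\<integral>t. (Hs t)\<^sup>2 \<partial>leb J) \<le> (\<integral>t. 3 * ((A1 + Bm)\<^sup>2 * (nI (X t))\<^sup>2 + Q\<^sup>2 * ysq t + (\<Gamma> t)\<^sup>2) \<partial>leb J)"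
  proof (rule integral_mono)
    show "(Hs t)\<^sup>2 \<le> 3 * ((A1 + Bm)\<^sup>2 * (nI (X t))\<^sup>2 + Q\<^sup>2 * ysq t + (\<Gamma> t)\<^sup>2)" for t
      using norm_add3_squared[of "(A1 + Bm) * nI (X t)" "Q * sqrt (ysq t)" "\<Gamma> t"] y0[of t]
      by (simp add: Hs_def power_mult_distrib)
  qed (use L nX_sq ysq_integrable \<Gamma>_sq in \<open>auto simp: L2_iff\<close>)
  then show "(\<integral>t. (Hs t)\<^sup>2 \<partial>leb J) \<le> 3 * ((A1 + Bm)\<^sup>2 * (\<integral>t. (nI (X t))\<^sup>2 \<partial>leb J) + Q\<^sup>2 * (\<integral>t. ysq t \<partial>leb J) + (\<integral>t. (\<Gamma> t)\<^sup>2 \<partial>leb J))"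
    using nX_sq ysq_integrable \<Gamma>_sq by simp
qed

text \<open>The convexity inequality for \<open>v \<mapsto> \<parallel>v\<^sub>x\<parallel>\<^sup>2\<close> is applied to backward time differences of \<open>Vb\<close>, which
  is extended by its initial value to negative times; their quotients are Steklov averages of \<open>P\<close>.\<close>

lemma second_order_bound:
  "\<alpha> / 2 * (\<integral>t. (nI (Z t))\<^sup>2 \<partial>leb J) \<le> (\<integral>t. (Hs t)\<^sup>2 \<partial>leb J) / \<alpha> + (nI v0')\<^sup>2 / 2"
proof -
  define c0 where "c0 = (nI v0')\<^sup>2"
  have c0: "0 \<le> c0" by (simp add: c0_def)
  have mX: "(\<lambda>t. (nI (X t))\<^sup>2) \<in> borel_measurable (leb J)" using nX_sq by (rule borel_measurable_integrable)
  obtain Y1 where Y1: "Y1 \<in> borel_measurable borel" and ae_Y1: "AE t in leb J. (nI (X t))\<^sup>2 = Y1 t"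
    using borel_representative[OF _ mX] by auto
  \<comment> \<open>||V_x||^2 extended in time: backwards by its initial value, matching the
    extension of \<open>Vb\<close>, and by 0 from \<open>T\<close> on, a range that the shifted
    times s - h do not reach.\<close>
  define Yb where "Yb r = (if r \<le> 0 then c0 else if r < T then \<bar>Y1 r\<bar> else 0)" for r
  have Yb_nonneg: "0 \<le> Yb r" for r using c0 by (simp add: Yb_def)
  have Yb_m[measurable]: "Yb \<in> borel_measurable borel" using Y1 unfolding Yb_def[abs_def] by measurable
  have Yb_eq: "AE t in leb J. Yb t = (nI (X t))\<^sup>2"
    using ae_Y1 AE_space
  proof eventually_elim
    case (elim t)
    then have "Y1 t = (nI (X t))\<^sup>2" by simp
    then show ?case using elim(2) by (auto simp: Yb_def)
  qed
  \<comment> \<open>Times at which \<open>Vb\<close> has a representative vanishing at both ends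
    whose derivative has squared norm \<open>Yb\<close>. All non-positive times qualify because the
    initial value vanishes at both ends.\<close>
  define good where "good r \<longleftrightarrow> (\<exists>w yr. ac 0 1 w yr \<and> w 0 = 0 \<and> w 1 = 0 \<and> yr \<in> carr (L2 I) \<and> (AE x in leb I. Vb (r, x) = w x) \<and> (nI yr)\<^sup>2 = Yb r)" for r
  have good_neg: "good r" if "r \<le> 0" for r
  proof -
    have "AE x in leb I. Vb (r, x) = v0 x" by (rule AE_I2) (use that in \<open>simp add: Vb_nonpos w0_def\<close>)
    then show ?thesis unfolding good_def using v0 that by (intro exI[of _ v0] exI[of _ v0']) (simp add: Yb_def c0_def)
  qed
  have "AE r in leb J. good r"
    using spatial slice_eqs Yb_eq
  proof eventually_elim
    case (elim t)
    obtain v y c d where sp: "spatial_problem v y (Z t) (G t) (\<lambda>x. p (t, x)) c (\<lambda>x. a' (t, x)) d (\<lambda>x. b' (t, x)) q \<alpha> A A1 Bm B1 Q Qm"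
      and ae_v: "AE x in leb I. V (t, x) = v x" and ae_y: "AE x in leb I. X t x = y x" using elim(1) by blast
    interpret sp: spatial_problem v y "Z t" "G t" "\<lambda>x. p (t, x)" c "\<lambda>x. a' (t, x)" d "\<lambda>x. b' (t, x)" q \<alpha> A A1 Bm B1 Q Qm by (rule sp)
    have ae3: "AE x in leb I. y x = X t x" using ae_y by (auto elim: eventually_mono)
    have "nI (X t) = nI y" using L2_cong_AE(2)[OF sp.pieces(2) _ ae3] by simp
    moreover have "AE x in leb I. Vb (t, x) = v x" using ae_v conjunct1[OF elim(2)] by eventually_elim simp
    ultimately show ?case unfolding good_def using sp.v sp.pieces(2) elim(3) by (intro exI[of _ v] exI[of _ y]) simp
  qed
  then have "AE r in lborel. r < T \<longrightarrow> good r"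
    unfolding AE_lebesgue_on_iff[OF borel_open[OF open_greaterThanLessThan]]
    by eventually_elim (use good_neg not_le in auto)
  note good_shift = AE_lborel_shift[OF this]
  define h where "h n = 1 / real (Suc n)" for n
  have h: "0 < h n" "h \<longlonglongrightarrow> 0" for n
    using LIMSEQ_inverse_real_of_nat by (auto simp: h_def[abs_def] inverse_eq_divide)
  note st = steklov_L2_tendsto[OF P(1) P_L2 P(2) h(2,1)]
  define E where "E n t = nI (\<lambda>x. P (t, x) - steklov (h n) P (t, x))" for n t
  have stn: "integrable (leb (QT T)) (\<lambda>z. (norm (P z - steklov (h n) P z))\<^sup>2)" for n using st(2) by (simp add: L2_iff)
  have E_sq: "integrable (leb J) (\<lambda>t. (E n t)\<^sup>2)"
    "(\<integral>t. (E n t)\<^sup>2 \<partial>leb J) = (\<integral>z. (norm (P z - steklov (h n) P z))\<^sup>2 \<partial>leb (QT T))" for n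
    using integrable_integral_lebesgue_on_slice[OF _ _ stn, of n] integral_lebesgue_on_slice[OF _ _ stn, of n]
    by (simp_all add: E_def L2_nrm_sq)
  have YbJ: "integrable (leb J) Yb"
    by (rule integrable_cong_AE_imp[OF nX_sq borel_measurable_lebesgue_onI[OF Yb_m]]) (use Yb_eq in \<open>auto elim: eventually_mono\<close>)
  \<comment> \<open>Shifting by \<open>h n\<close> brings in only a strip of negative times, worth
    \<open>h n * c0\<close>; divided by \<open>2 * h n\<close> it becomes the term
    \<open>c0 / 2\<close> of the final bound.\<close>
  have shift: "integrable (leb J) (\<lambda>s. Yb (s - h n))" "(\<integral>s. Yb (s - h n) \<partial>leb J) \<le> h n * c0 + (\<integral>s. Yb s \<partial>leb J)" for n
  proof -
    have m: "(\<lambda>s. Yb (s - h n)) \<in> borel_measurable borel" by measurable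
    let ?F = "\<lambda>s. indicator J s *\<^sub>R Yb (s - h n)" and ?U = "\<lambda>r. c0 * indicator {- h n<..0} r + indicator J r *\<^sub>R Yb r"
    have iU1: "integrable lborel (\<lambda>r. c0 * indicator {- h n<..0} r :: real)"
      using h(1)[of n] by (intro integrable_mult_right integrable_real_indicator) auto
    have iU2: "integrable lborel (\<lambda>r. indicator J r *\<^sub>R Yb r)" using YbJ by (simp add: integrable_lebesgue_on_borel)
    have le: "?F (h n + 1 * r) \<le> ?U r" for r
      using h(1)[of n] c0 Yb_nonneg[of r] by (auto simp: indicator_def Yb_def)
    have i: "integrable lborel (\<lambda>r. ?F (h n + 1 * r))"
    proof (rule Bochner_Integration.integrable_bound)
      show "integrable lborel ?U" using iU1 iU2 by (rule Bochner_Integration.integrable_add)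
      show "AE r in lborel. norm (?F (h n + 1 * r)) \<le> norm (?U r)"
      proof (rule AE_I2)
        fix r
        have "0 \<le> ?F (h n + 1 * r)" using Yb_nonneg by simp
        then show "norm (?F (h n + 1 * r)) \<le> norm (?U r)" using le[of r] by simp
      qed
    qed measurable
    then have iF: "integrable lborel ?F" using lborel_integrable_real_affine_iff[of 1 ?F "h n"] by simp
    then show "integrable (leb J) (\<lambda>s. Yb (s - h n))" by (simp add: integrable_lebesgue_on_borel[OF _ m])
    have "(\<integral>s. Yb (s - h n) \<partial>leb J) = (\<integral>s. ?F s \<partial>lborel)" by (simp add: integral_lebesgue_on_borel[OF _ m])
    also have "\<dots> = (\<integral>r. ?F (h n + 1 * r) \<partial>lborel)" by (subst lborel_integral_real_affine[of 1 _ "h n"]) simp_all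
    also have "\<dots> \<le> (\<integral>r. ?U r \<partial>lborel)"
      by (rule integral_mono[OF i _ le]) (rule Bochner_Integration.integrable_add[OF iU1 iU2])
    also have "\<dots> = (\<integral>r. c0 * indicator {- h n<..0} r \<partial>lborel) + (\<integral>r. indicator J r *\<^sub>R Yb r \<partial>lborel)"
      by (rule Bochner_Integration.integral_add[OF iU1 iU2])
    also have "(\<integral>r. c0 * indicator {- h n<..0} r \<partial>lborel) = h n * c0" using h(1)[of n] by simp
    also have "(\<integral>r. indicator J r *\<^sub>R Yb r \<partial>lborel) = (\<integral>s. Yb s \<partial>leb J)" by (simp add: integral_lebesgue_on_borel)
    finally show "(\<integral>s. Yb (s - h n) \<partial>leb J) \<le> h n * c0 + (\<integral>s. Yb s \<partial>leb J)" .
  qed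
  \<comment> \<open>V_t is split into the Steklov error and the backward quotient. Tested with V_xx,
    the error is bounded by Cauchy-Schwarz and the quotient by convexity.\<close>
  have pw: "AE s in leb J. \<alpha> / 2 * (nI (Z s))\<^sup>2 \<le> ((E n s)\<^sup>2 + (Hs s)\<^sup>2) / \<alpha> + (Yb (s - h n) - Yb s) / (2 * h n)" for n
  proof -
    have "AE s in leb J. s - h n < T \<longrightarrow> good (s - h n)"
      unfolding AE_lebesgue_on_iff[OF borel_open[OF open_greaterThanLessThan]] using good_shift[of "h n"] by eventually_elim simp
    moreover have "AE s in leb J. integrable (leb I) (\<lambda>x. (norm (P (s, x) - steklov (h n) P (s, x)))\<^sup>2)"
      using AE_integrable_lebesgue_on_slice[OF _ _ stn] by simp
    ultimately show ?thesis
      using spatial slice_eqs Yb_eq G AE_space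
    proof eventually_elim
      case (elim s)
      then have s: "s \<in> J" by simp
      obtain v y c d where sp: "spatial_problem v y (Z s) (G s) (\<lambda>x. p (s, x)) c (\<lambda>x. a' (s, x)) d (\<lambda>x. b' (s, x)) q \<alpha> A A1 Bm B1 Q Qm"
        and ae_v: "AE x in leb I. V (s, x) = v x" and ae_y: "AE x in leb I. X s x = y x" using elim(3) by blast
      interpret sp: spatial_problem v y "Z s" "G s" "\<lambda>x. p (s, x)" c "\<lambda>x. a' (s, x)" d "\<lambda>x. b' (s, x)" q \<alpha> A A1 Bm B1 Q Qm by (rule sp)
      have ae3: "AE x in leb I. y x = X s x" using ae_y by (auto elim: eventually_mono)
      have nX_eq: "nI (X s) = nI y" using L2_cong_AE(2)[OF sp.pieces(2) _ ae3] by simp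
      have ae4: "AE x in leb I. v x = Vb (s, x)" using ae_v conjunct1[OF elim(4)] by eventually_elim simp
      have nV_eq: "sqrt (ysq s) = nI v" unfolding ysq_def using L2_cong_AE(2)[OF sp.pieces(1) _ ae4] by simp
      have "good (s - h n)" using elim(1) s h(1)[of n] by simp
      then obtain w yr where w: "ac 0 1 w yr" "w 0 = 0" "w 1 = 0" "yr \<in> carr (L2 I)" "AE x in leb I. Vb (s - h n, x) = w x" "(nI yr)\<^sup>2 = Yb (s - h n)"
        unfolding good_def by blast
      have dm: "(\<lambda>x. P (s, x) - steklov (h n) P (s, x)) \<in> borel_measurable (leb I)"
        by (intro borel_measurable_lebesgue_onI borel_measurable_diff slice_measurable(2) P steklov_measurable)
      have dL: "(\<lambda>x. P (s, x) - steklov (h n) P (s, x)) \<in> carr (L2 I)" using dm elim(2) by (simp add: L2_iff)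
      have vwL: "(\<lambda>x. v x - w x) \<in> carr (L2 I)" by (rule L2_diff[OF sp.pieces(1) ac_L2[OF w(1)]])
      have ae_p: "AE x in leb I. p (s, x) \<bullet> Z s x = (P (s, x) - steklov (h n) P (s, x)) \<bullet> Z s x + (1 / h n) * ((v x - w x) \<bullet> Z s x)"
        using conjunct2[OF elim(4)] ae4 w(5) P_slice_L2
      proof eventually_elim
        case (elim x)
        have "p (s, x) = (P (s, x) - steklov (h n) P (s, x)) + (1 / h n) *\<^sub>R (v x - w x)"
          using elim steklov_Vb[OF elim(4) h(1), of n s] by simp
        then show ?case by (simp only: inner_add_left inner_scaleR_left)
      qed
      have "(\<integral>x. p (s, x) \<bullet> Z s x \<partial>leb I) = (\<integral>x. (P (s, x) - steklov (h n) P (s, x)) \<bullet> Z s x + (1 / h n) * ((v x - w x) \<bullet> Z s x) \<partial>leb I)"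
        by (rule integral_lebesgue_on_cong_AE[OF _ ae_p]) simp
      also have "\<dots> = (\<integral>x. (P (s, x) - steklov (h n) P (s, x)) \<bullet> Z s x \<partial>leb I) + (1 / h n) * (\<integral>x. (v x - w x) \<bullet> Z s x \<partial>leb I)"
        using L2_inner(1)[OF dL sp.z] L2_inner(1)[OF vwL sp.z] by simp
      also have "\<dots> \<le> E n s * nI (Z s) + (1 / h n) * ((Yb (s - h n) - Yb s) / 2)"
      proof (rule add_mono)
        show "(\<integral>x. (P (s, x) - steklov (h n) P (s, x)) \<bullet> Z s x \<partial>leb I) \<le> E n s * nI (Z s)"
          using L2_inner(2)[OF dL sp.z] unfolding E_def by linarith
        have "(\<integral>x. (v x - w x) \<bullet> Z s x \<partial>leb I) \<le> ((nI yr)\<^sup>2 - (nI y)\<^sup>2) / 2"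
          by (rule convexity_inequality[OF ac_diff[OF sp.v(1) w(1)] _ _ sp.y sp.z w(4)]) (use sp.v w in auto)
        then have "(\<integral>x. (v x - w x) \<bullet> Z s x \<partial>leb I) \<le> (Yb (s - h n) - Yb s) / 2" unfolding w(6) elim(5) nX_eq .
        then show "(1 / h n) * (\<integral>x. (v x - w x) \<bullet> Z s x \<partial>leb I) \<le> (1 / h n) * ((Yb (s - h n) - Yb s) / 2)"
          using h(1)[of n] by (intro mult_left_mono) auto
      qed
      finally have pz: "(\<integral>x. p (s, x) \<bullet> Z s x \<partial>leb I) \<le> E n s * nI (Z s) + (Yb (s - h n) - Yb s) / (2 * h n)" by simp
      have H: "(A1 + Bm) * nI y + Q * nI v + nI (G s) \<le> Hs s" using elim(6) by (simp add: Hs_def nX_eq nV_eq)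
      have "\<alpha> * (nI (Z s))\<^sup>2 \<le> E n s * nI (Z s) + (Yb (s - h n) - Yb s) / (2 * h n) + Hs s * nI (Z s)"
        using sp.inner_z pz mult_right_mono[OF H, of "nI (Z s)"] by simp
      \<comment> \<open>Young's inequality, weighted so that half of the coercive term is absorbed.
        The second square in the proof turns (E + H)^2 into 2 E^2 + 2 H^2.\<close>
      moreover have "(E n s + Hs s) * nI (Z s) \<le> \<alpha> / 2 * (nI (Z s))\<^sup>2 + ((E n s)\<^sup>2 + (Hs s)\<^sup>2) / \<alpha>"
      proof -
        have "0 \<le> (\<alpha> * nI (Z s) - (E n s + Hs s))\<^sup>2 + (E n s - Hs s)\<^sup>2" by simp
        then have "2 * \<alpha> * ((E n s + Hs s) * nI (Z s)) \<le> \<alpha>\<^sup>2 * (nI (Z s))\<^sup>2 + 2 * ((E n s)\<^sup>2 + (Hs s)\<^sup>2)"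
          by (simp add: power2_eq_square algebra_simps)
        then have "((E n s + Hs s) * nI (Z s)) \<le> (\<alpha>\<^sup>2 * (nI (Z s))\<^sup>2 + 2 * ((E n s)\<^sup>2 + (Hs s)\<^sup>2)) / (2 * \<alpha>)"
          using \<alpha> by (simp add: pos_le_divide_eq mult.commute)
        also have "\<dots> = \<alpha> / 2 * (nI (Z s))\<^sup>2 + ((E n s)\<^sup>2 + (Hs s)\<^sup>2) / \<alpha>"
          using \<alpha> by (simp add: add_divide_distrib power2_eq_square)
        finally show ?thesis .
      qed
      ultimately show ?case unfolding distrib_right by linarith
    qed
  qed
  \<comment> \<open>After integration the terms with \<open>Yb\<close> are bounded by
    \<open>c0 / 2\<close> whatever \<open>n\<close> is; only the Steklov error still depends on
    \<open>n\<close>, and it tends to 0.\<close>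
  have int: "\<alpha> / 2 * (\<integral>t. (nI (Z t))\<^sup>2 \<partial>leb J) \<le> (\<integral>t. (E n t)\<^sup>2 \<partial>leb J) / \<alpha> + ((\<integral>t. (Hs t)\<^sup>2 \<partial>leb J) / \<alpha> + c0 / 2)" for n
  proof -
    have iH: "integrable (leb J) (\<lambda>t. (Hs t)\<^sup>2)" using Hs_L2 by (simp add: L2_iff)
    have "(\<integral>t. \<alpha> / 2 * (nI (Z t))\<^sup>2 \<partial>leb J) \<le> (\<integral>s. ((E n s)\<^sup>2 + (Hs s)\<^sup>2) / \<alpha> + (Yb (s - h n) - Yb s) / (2 * h n) \<partial>leb J)"
      by (rule integral_mono_AE[OF _ _ pw]) (use nZ_sq E_sq(1) iH shift(1) YbJ in auto)
    also have "\<dots> = ((\<integral>t. (E n t)\<^sup>2 \<partial>leb J) + (\<integral>t. (Hs t)\<^sup>2 \<partial>leb J)) / \<alpha> + ((\<integral>s. Yb (s - h n) \<partial>leb J) - (\<integral>s. Yb s \<partial>leb J)) / (2 * h n)"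
      using E_sq(1)[of n] iH shift(1)[of n] YbJ by simp
    also have "((\<integral>s. Yb (s - h n) \<partial>leb J) - (\<integral>s. Yb s \<partial>leb J)) / (2 * h n) \<le> (h n * c0) / (2 * h n)"
      using shift(2)[of n] h(1)[of n] by (intro divide_right_mono) auto
    also have "(h n * c0) / (2 * h n) = c0 / 2" using h(1)[of n] by simp
    finally show ?thesis by (simp add: add_divide_distrib)
  qed
  have "(\<lambda>n. (\<integral>t. (E n t)\<^sup>2 \<partial>leb J) / \<alpha> + ((\<integral>t. (Hs t)\<^sup>2 \<partial>leb J) / \<alpha> + c0 / 2)) \<longlonglongrightarrow> 0 / \<alpha> + ((\<integral>t. (Hs t)\<^sup>2 \<partial>leb J) / \<alpha> + c0 / 2)"
    unfolding E_sq(2) using \<alpha> by (intro tendsto_intros st(1)) auto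
  from LIMSEQ_le_const[OF this, of "\<alpha> / 2 * (\<integral>t. (nI (Z t))\<^sup>2 \<partial>leb J)"] int
  have "\<alpha> / 2 * (\<integral>t. (nI (Z t))\<^sup>2 \<partial>leb J) \<le> 0 / \<alpha> + ((\<integral>t. (Hs t)\<^sup>2 \<partial>leb J) / \<alpha> + c0 / 2)" by blast
  then show ?thesis unfolding c0_def by simp
qed

text \<open>The bound of \<open>Hs_L2\<close> with the first energy estimate inserted;
  \<open>D3\<close> below results from solving \<open>second_order_bound\<close> for the norm of
  V_xx.\<close>

definition "D2 = 3 * ((A1 + Bm)\<^sup>2 * (D1 / (2 * \<alpha>)) + Q\<^sup>2 * (2 * T * D0 * exp (2 * Kc * T)) + D0)"
definition "D3 = 2 / \<alpha> * (D2 / \<alpha> + (nI v0')\<^sup>2 / 2)"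

lemma Hs_bound: "(\<integral>t. (Hs t)\<^sup>2 \<partial>leb J) \<le> D2"
proof -
  have "(\<integral>t. (nI (X t))\<^sup>2 \<partial>leb J) \<le> D1 / (2 * \<alpha>)" using gradient_bound \<alpha> by (simp add: pos_le_divide_eq mult.commute)
  moreover have "(\<integral>t. (\<Gamma> t)\<^sup>2 \<partial>leb J) \<le> D0" by (simp add: D0_def)
  ultimately have "3 * ((A1 + Bm)\<^sup>2 * (\<integral>t. (nI (X t))\<^sup>2 \<partial>leb J) + Q\<^sup>2 * (\<integral>t. ysq t \<partial>leb J) + (\<integral>t. (\<Gamma> t)\<^sup>2 \<partial>leb J)) \<le> D2"
    unfolding D2_def using integral_ysq by (intro mult_left_mono add_mono) auto
  then show ?thesis using Hs_L2(2) by linarith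
qed

lemma second_derivative_bound: "(\<integral>t. (nI (Z t))\<^sup>2 \<partial>leb J) \<le> D3"
proof -
  have "\<alpha> / 2 * (\<integral>t. (nI (Z t))\<^sup>2 \<partial>leb J) \<le> D2 / \<alpha> + (nI v0')\<^sup>2 / 2"
    using second_order_bound divide_right_mono[OF Hs_bound less_imp_le[OF \<alpha>]] by linarith
  then have "2 / \<alpha> * (\<alpha> / 2 * (\<integral>t. (nI (Z t))\<^sup>2 \<partial>leb J)) \<le> D3"
    unfolding D3_def using \<alpha> by (intro mult_left_mono) auto
  then show ?thesis using \<alpha> by simp
qed

text \<open>V_t is read off from the equation once V_xx and the lower-order terms are under
  control.\<close>

lemma time_derivative_bound: "(\<integral>z. (norm (p z))\<^sup>2 \<partial>leb (QT T)) \<le> 2 * A\<^sup>2 * D3 + 2 * D2"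
proof -
  have ip: "integrable (leb (QT T)) (\<lambda>z. (norm (p z))\<^sup>2)" using p by (simp add: L2_iff)
  have "(\<integral>z. (norm (p z))\<^sup>2 \<partial>leb (QT T)) = (\<integral>t. (nI (\<lambda>x. p (t, x)))\<^sup>2 \<partial>leb J)"
    using integral_lebesgue_on_slice[OF _ _ ip] by (simp add: L2_nrm_sq)
  also have "\<dots> \<le> (\<integral>t. 2 * A\<^sup>2 * (nI (Z t))\<^sup>2 + 2 * (Hs t)\<^sup>2 \<partial>leb J)"
  proof (rule integral_mono_AE)
    show "integrable (leb J) (\<lambda>t. (nI (\<lambda>x. p (t, x)))\<^sup>2)"
      using integrable_integral_lebesgue_on_slice[OF _ _ ip] by (simp add: L2_nrm_sq)
    show "integrable (leb J) (\<lambda>t. 2 * A\<^sup>2 * (nI (Z t))\<^sup>2 + 2 * (Hs t)\<^sup>2)"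
      using nZ_sq Hs_L2 by (simp add: L2_iff)
    show "AE t in leb J. (nI (\<lambda>x. p (t, x)))\<^sup>2 \<le> 2 * A\<^sup>2 * (nI (Z t))\<^sup>2 + 2 * (Hs t)\<^sup>2"
      using spatial slice_eqs G
    proof eventually_elim
      case (elim t)
      obtain v y c d where sp: "spatial_problem v y (Z t) (G t) (\<lambda>x. p (t, x)) c (\<lambda>x. a' (t, x)) d (\<lambda>x. b' (t, x)) q \<alpha> A A1 Bm B1 Q Qm"
        and ae_v: "AE x in leb I. V (t, x) = v x" and ae_y: "AE x in leb I. X t x = y x" using elim(1) by blast
      interpret sp: spatial_problem v y "Z t" "G t" "\<lambda>x. p (t, x)" c "\<lambda>x. a' (t, x)" d "\<lambda>x. b' (t, x)" q \<alpha> A A1 Bm B1 Q Qm by (rule sp)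
      have ae3: "AE x in leb I. y x = X t x" using ae_y by (auto elim: eventually_mono)
      have nX_eq: "nI (X t) = nI y" using L2_cong_AE(2)[OF sp.pieces(2) _ ae3] by simp
      have ae4: "AE x in leb I. v x = Vb (t, x)" using ae_v conjunct1[OF elim(2)] by eventually_elim simp
      have nV_eq: "sqrt (ysq t) = nI v" unfolding ysq_def using L2_cong_AE(2)[OF sp.pieces(1) _ ae4] by simp
      have "nI (\<lambda>x. p (t, x)) \<le> A * nI (Z t) + Hs t" using sp.p_L2(2) elim(3) by (simp add: Hs_def nX_eq nV_eq)
      then have "(nI (\<lambda>x. p (t, x)))\<^sup>2 \<le> (A * nI (Z t) + Hs t)\<^sup>2" by (rule power_mono) simp
      also have "\<dots> \<le> 2 * A\<^sup>2 * (nI (Z t))\<^sup>2 + 2 * (Hs t)\<^sup>2"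
        using norm_add_squared[of "A * nI (Z t)" "Hs t"] by (simp add: power_mult_distrib)
      finally show ?case .
    qed
  qed
  also have "\<dots> = 2 * A\<^sup>2 * (\<integral>t. (nI (Z t))\<^sup>2 \<partial>leb J) + 2 * (\<integral>t. (Hs t)\<^sup>2 \<partial>leb J)"
    using nZ_sq Hs_L2 by (simp add: L2_iff)
  also have "\<dots> \<le> 2 * A\<^sup>2 * D3 + 2 * D2"
    using second_derivative_bound Hs_bound by (intro add_mono mult_left_mono) auto
  finally show ?thesis .
qed

end

section \<open>Coefficients and functionals\<close>

text \<open>Exchanging the variables twice restores the original order.\<close>

lemma AE_lebesgue_on_pair:
  fixes P :: "'a::euclidean_space \<times> 'b::euclidean_space \<Rightarrow> bool"
  assumes A: "A \<in> sets borel" and B: "B \<in> sets borel" and P: "{z. P z} \<in> sets borel"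
    and ae: "AE t in leb A. AE x in leb B. P (t, x)"
  shows "AE z in leb (A \<times> B). P z"
proof -
  have m: "(\<lambda>z :: 'b \<times> 'a. (snd z, fst z)) \<in> borel_measurable borel"
    by (intro borel_measurable_continuous_onI continuous_intros)
  have "{z. P (snd z, fst z)} \<in> sets borel" using measurable_sets[OF m P] by (simp add: vimage_def)
  from AE_lebesgue_on_swap[OF B A AE_lebesgue_on_commute[OF B A this]] ae show ?thesis by simp
qed

lemma AE_norm_le_pair:
  fixes f :: "'a::euclidean_space \<times> 'b::euclidean_space \<Rightarrow> 'k::euclidean_space"
  assumes A: "A \<in> sets borel" and B: "B \<in> sets borel" and f: "f \<in> borel_measurable (leb (A \<times> B))"
    and ae: "AE t in leb A. AE x in leb B. norm (f (t, x)) \<le> C"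
  shows "AE z in leb (A \<times> B). norm (f z) \<le> C"
proof -
  obtain g where g: "g \<in> borel_measurable borel" and e: "AE z in leb (A \<times> B). f z = g z"
    using borel_representative[OF borel_Times[OF A B] f] .
  have "(\<lambda>z. norm (g z)) \<in> borel_measurable borel" using g by simp
  from measurable_sets[OF this, of "{..C}"] have s: "{z. norm (g z) \<le> C} \<in> sets borel" by (simp add: vimage_def)
  have "AE t in leb A. AE x in leb B. norm (g (t, x)) \<le> C"
    using ae AE_lebesgue_on_slice[OF A B e]
  proof eventually_elim
    case (elim t)
    then show ?case by eventually_elim simp
  qed
  from AE_lebesgue_on_pair[OF A B s this] e show ?thesis by eventually_elim simp
qed

section \<open>Essentially bounded coefficients\<close>

lemma Linf_measurable: "u \<in> carr (Linf \<Omega>) \<Longrightarrow> u \<in> borel_measurable (leb \<Omega>)"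
  by (simp add: Linf_def)

text \<open>The essential supremum can be negative only on a null space, where it is -\<infinity>,
  and \<open>real_of_ereal\<close> sends -\<infinity> to 0.\<close>

lemma Linf_nrm_nonneg [simp]: "0 \<le> nrm (Linf \<Omega>) u"
proof -
  let ?e = "esssup (leb \<Omega>) (\<lambda>x. ereal (norm (u x)))"
  have "0 \<le> ?e \<or> ?e = - \<infinity>"
  proof (rule ccontr)
    assume n: "\<not> (0 \<le> ?e \<or> ?e = - \<infinity>)"
    have "AE x in leb \<Omega>. False"
      using esssup_AE[of "\<lambda>x. ereal (norm (u x))" "leb \<Omega>"]
    proof eventually_elim
      case (elim x)
      have "0 \<le> ereal (norm (u x))" by simp
      then show ?case using elim n by (meson order_trans)
    qed
    then have "ae_filter (leb \<Omega>) = bot" by (simp add: trivial_limit_def)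
    then have z: "emeasure (leb \<Omega>) (space (leb \<Omega>)) = 0" by (simp add: ae_filter_eq_bot_iff)
    show False
    proof (cases "(\<lambda>x. ereal (norm (u x))) \<in> borel_measurable (leb \<Omega>)")
      case True
      then show False using esssup_zero_space[OF z] n by simp
    next
      case False
      then show False using esssup_non_measurable[OF False] n by (simp add: top_ereal_def)
    qed
  qed
  then show ?thesis by (auto simp: Linf_def real_of_ereal_pos)
qed

lemma Linf_AE:
  assumes "u \<in> carr (Linf \<Omega>)" shows "AE x in leb \<Omega>. norm (u x) \<le> nrm (Linf \<Omega>) u"
proof -
  let ?e = "esssup (leb \<Omega>) (\<lambda>x. ereal (norm (u x)))"
  have f: "?e < \<infinity>" using assms by (simp add: Linf_def)
  show ?thesis
    using esssup_AE[of "\<lambda>x. ereal (norm (u x))" "leb \<Omega>"]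
  proof eventually_elim
    case (elim x)
    then have "?e \<noteq> - \<infinity>" by auto
    with f have "ereal (real_of_ereal ?e) = ?e" by (cases ?e) auto
    with elim show ?case by (simp add: Linf_def flip: ereal_less_eq(3))
  qed
qed

lemma Linf_cong_AE:
  assumes u: "u \<in> carr (Linf \<Omega>)" and \<Omega>: "\<Omega> \<in> sets borel" and ae: "AE x in leb \<Omega>. u x = v x"
  shows "v \<in> carr (Linf \<Omega>)"
proof -
  have v: "v \<in> borel_measurable (leb \<Omega>)"
    by (rule borel_measurable_lebesgue_on_AE[OF \<Omega> Linf_measurable[OF u] ae])
  have "esssup (leb \<Omega>) (\<lambda>x. ereal (norm (v x))) = esssup (leb \<Omega>) (\<lambda>x. ereal (norm (u x)))"
    using v Linf_measurable[OF u] ae by (intro esssup_AE_cong) (auto elim: eventually_mono)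
  then show ?thesis using u v by (simp add: Linf_def)
qed

lemma Linf_integrable:
  fixes u :: "'a::euclidean_space \<Rightarrow> 'k::{real_normed_field, euclidean_space}"
  assumes "finite_measure (leb \<Omega>)" "u \<in> borel_measurable (leb \<Omega>)" "AE x in leb \<Omega>. norm (u x) \<le> C"
  shows "integrable (leb \<Omega>) u"
  by (rule L2_imp_integrable[OF bounded_measurable_L2[OF assms] assms(1)])

text \<open>Uniqueness on the rectangle transfers essential boundedness from the derivative granted
  by the definition to the one chosen by \<open>wderiv\<close>.\<close>

lemma W1inf_rectangle:
  fixes u :: "real \<times> real \<Rightarrow> real"
  assumes u: "u \<in> carr (W1inf (QT T))"
  shows "AE z in leb (QT T). \<bar>u z\<bar> \<le> nrm (W1inf (QT T)) u"
    "AE z in leb (QT T). \<bar>wderiv (QT T) (0, 1) u z\<bar> \<le> nrm (W1inf (QT T)) u"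
    "has_wderiv (QT T) (0, 1) u (wderiv (QT T) (0, 1) u)"
    "u \<in> borel_measurable (leb (QT T))" "wderiv (QT T) (0, 1) u \<in> borel_measurable (leb (QT T))"
proof -
  have uL: "u \<in> carr (Linf (QT T))" using u by (simp add: W1inf_def)
  have "\<exists>v\<in>carr (Linf (QT T)). has_wderiv (QT T) (0, 1) u v" using u by (simp add: W1inf_def Basis_real_prod)
  then obtain v where v: "v \<in> carr (Linf (QT T))" "has_wderiv (QT T) (0, 1) u v" by blast
  show w: "has_wderiv (QT T) (0, 1) u (wderiv (QT T) (0, 1) u)" by (rule has_wderiv_wderiv[OF v(2)])
  have wL: "wderiv (QT T) (0, 1) u \<in> carr (Linf (QT T))"
    by (rule Linf_cong_AE[OF v(1) borel_rectangle has_wderiv_unique_rectangle[OF v(2) w]])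
  have n: "nrm (W1inf (QT T)) u = nrm (Linf (QT T)) u + (nrm (Linf (QT T)) (wderiv (QT T) (1, 0) u) + nrm (Linf (QT T)) (wderiv (QT T) (0, 1) u))"
    by (simp add: W1inf_def Basis_real_prod)
  show "AE z in leb (QT T). \<bar>u z\<bar> \<le> nrm (W1inf (QT T)) u"
    using Linf_AE[OF uL]
  proof eventually_elim
    case (elim z)
    have "0 \<le> nrm (Linf (QT T)) (wderiv (QT T) (1, 0) u)" "0 \<le> nrm (Linf (QT T)) (wderiv (QT T) (0, 1) u)" by simp_all
    with elim show ?case unfolding n real_norm_def by linarith
  qed
  show "AE z in leb (QT T). \<bar>wderiv (QT T) (0, 1) u z\<bar> \<le> nrm (W1inf (QT T)) u"
    using Linf_AE[OF wL]
  proof eventually_elim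
    case (elim z)
    have "0 \<le> nrm (Linf (QT T)) (wderiv (QT T) (1, 0) u)" "0 \<le> nrm (Linf (QT T)) u" by simp_all
    with elim show ?case unfolding n real_norm_def by linarith
  qed
  show "u \<in> borel_measurable (leb (QT T))" "wderiv (QT T) (0, 1) u \<in> borel_measurable (leb (QT T))"
    by (rule Linf_measurable[OF uL], rule Linf_measurable[OF wL])
qed

lemma W1inf_nrm_nonneg [simp]: "0 \<le> nrm (W1inf \<Omega>) u"
  by (auto simp: W1inf_def intro!: add_nonneg_nonneg sum_nonneg)

lemma slice_x_ac:
  fixes f g :: "real \<times> real \<Rightarrow> 'k::{real_normed_field, euclidean_space}"
  assumes f: "integrable (leb (QT T)) f" and g: "integrable (leb (QT T)) g" and w: "has_wderiv (QT T) (0, 1) f g"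
  shows "AE t in leb {0<..<T}. \<exists>c. ac 0 1 c (\<lambda>x. g (t, x)) \<and> (AE x in leb {0<..<1}. f (t, x) = c x)"
  using has_wderiv_slice_x[OF zero_less_one f g w] AE_integrable_lebesgue_on_slice[OF _ _ g, simplified]
proof eventually_elim
  case (elim t)
  show ?case using ac_indefinite_integral[OF elim(2)] elim(1) by blast
qed

lemma bochnerQ_Linf:
  fixes b :: "real \<times> real \<Rightarrow> real"
  assumes b: "b \<in> carr (bochnerQ Linf T (W1inf {0<..<1}))"
  shows "AE t in leb {0<..<T}. AE x in leb {0<..<1}. \<bar>b (t, x)\<bar> \<le> nrm (bochnerQ Linf T (W1inf {0<..<1})) b"
    "b \<in> borel_measurable (leb (QT T))"
proof -
  show "b \<in> borel_measurable (leb (QT T))" using b by (simp add: bochnerQ_def)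
  have c: "AE t in leb {0<..<T}. curry b t \<in> carr (W1inf {0<..<1})"
    and L: "(\<lambda>t. nrm (W1inf {0<..<1}) (curry b t)) \<in> carr (Linf {0<..<T})"
    using b by (auto simp: bochnerQ_def bochner_def)
  show "AE t in leb {0<..<T}. AE x in leb {0<..<1}. \<bar>b (t, x)\<bar> \<le> nrm (bochnerQ Linf T (W1inf {0<..<1})) b"
    using c Linf_AE[OF L]
  proof eventually_elim
    case (elim t)
    have "curry b t \<in> carr (Linf {0<..<1})" using elim(1) by (simp add: W1inf_def)
    from Linf_AE[OF this] show ?case
    proof eventually_elim
      case (elim x)
      have "nrm (Linf {0<..<1}) (curry b t) \<le> nrm (W1inf {0<..<1}) (curry b t)" by (simp add: W1inf_def)
      also have "\<dots> \<le> nrm (bochnerQ Linf T (W1inf {0<..<1})) b"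
        using \<open>norm (nrm (W1inf {0<..<1}) (curry b t)) \<le> _\<close> by (simp add: bochnerQ_def bochner_def)
      finally show ?case using elim by simp
    qed
  qed
qed

lemma bochnerQ_Linf_nrm_nonneg [simp]: "0 \<le> nrm (bochnerQ Linf T X) b"
  by (simp add: bochnerQ_def bochner_def)

section \<open>Functions on the rectangle as elements of Bochner spaces\<close>

lemma bochnerQ_L2_iff: "u \<in> carr (bochnerQ L2 T X) \<longleftrightarrow> u \<in> borel_measurable (leb (QT T)) \<and> curry u \<in> carr (bochner L2 T X)"
  by (simp add: bochnerQ_def)

lemma bochnerQ_L2_nrm: "nrm (bochnerQ L2 T X) u = sqrt (\<integral>t. (nrm X (curry u t))\<^sup>2 \<partial>leb {0<..<T})"
  by (simp add: bochnerQ_def bochner_def L2_nrm)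

lemma bochnerQ_L2_diff:
  assumes "seminormed X" "u \<in> carr (bochnerQ L2 T X)" "v \<in> carr (bochnerQ L2 T X)"
  shows "u - v \<in> carr (bochnerQ L2 T X)"
proof -
  have e: "curry (u - v) = (\<lambda>t. curry u t - curry v t)" by (auto simp: fun_eq_iff)
  have "(\<lambda>z. u z - v z) \<in> borel_measurable (leb (QT T))"
    using assms by (intro borel_measurable_diff) (auto simp: bochnerQ_L2_iff)
  moreover have "curry (u - v) \<in> carr (bochner L2 T X)"
    unfolding e using assms by (intro bochner_L2_diff) (auto simp: bochnerQ_L2_iff)
  ultimately show ?thesis unfolding bochnerQ_L2_iff by (simp add: fun_diff_def)
qed

lemma L2_QT_nrm:
  assumes "v \<in> carr (L2 (QT T))"
  shows "nrm (bochnerQ L2 T (L2 {0<..<1})) v = nrm (L2 (QT T)) v"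
proof -
  have "integrable (leb (QT T)) (\<lambda>z. (norm (v z))\<^sup>2)" using assms by (simp add: L2_iff)
  from integral_lebesgue_on_slice[OF _ _ this] show ?thesis
    by (simp add: bochnerQ_L2_nrm L2_nrm_sq L2_nrm)
qed

text \<open>Tonelli applies because joint measurability is built into
  \<open>bochnerQ\<close>.\<close>

lemma bochnerQ_L2_QT:
  assumes u: "u \<in> carr (bochnerQ L2 T (L2 {0<..<1}))"
  shows "u \<in> carr (L2 (QT T))"
proof -
  have m: "u \<in> borel_measurable (leb (QT T))" and c: "AE t in leb {0<..<T}. curry u t \<in> carr (L2 {0<..<1})"
    and n: "(\<lambda>t. nrm (L2 {0<..<1}) (curry u t)) \<in> carr (L2 {0<..<T})"
    using u by (auto simp: bochnerQ_L2_iff bochner_L2_iff)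
  have "integrable (leb (QT T)) (\<lambda>z. (norm (u z))\<^sup>2)"
  proof (rule Tonelli_lebesgue_on)
    show "AE t in leb {0<..<T}. integrable (leb {0<..<1}) (\<lambda>x. (norm (u (t, x)))\<^sup>2)"
      using c by eventually_elim (simp add: L2_iff)
    show "integrable (leb {0<..<T}) (\<lambda>t. \<integral>x. norm ((norm (u (t, x)))\<^sup>2) \<partial>leb {0<..<1})"
      using n by (simp add: L2_iff L2_nrm)
  qed (use m in auto)
  with m show ?thesis by (simp add: L2_iff)
qed

section \<open>Functionals on H^1_0 and their pairings\<close>

lemma Hm1_bounded:
  assumes "F \<in> carr (Hm1 \<Omega>)"
  obtains C where "\<And>\<phi>. \<phi> \<in> carr (H10 \<Omega>) \<Longrightarrow> norm (F \<phi>) \<le> C * nrm (H10 \<Omega>) \<phi>"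
proof -
  have "\<exists>C. \<forall>\<phi>\<in>carr (H10 \<Omega>). norm (F \<phi>) \<le> C * nrm (H10 \<Omega>) \<phi>" using assms by (simp add: Hm1_def)
  then show thesis using that by blast
qed

text \<open>The dual norm is a supremum over the unit ball, so \<open>\<phi>\<close> is scaled into
  it by c = 1 / (N + 1), where the summand 1 avoids a division by 0. Continuity of \<open>F\<close>
  bounds the values from above, without which the real supremum would carry no information.\<close>

lemma Hm1_test_bound:
  assumes \<phi>: "\<phi> \<in> ctest 0 1"
  obtains C where "0 \<le> C" "\<And>F. F \<in> carr (Hm1 {0<..<1::real}) \<Longrightarrow> norm (F (\<lambda>x. of_real (\<phi> x))) \<le> C * nrm (Hm1 {0<..<1}) F"
proof -
  let ?I = "{0<..<1::real}"
  have nrm_test: "nrm (H10 ?I) (\<lambda>x. of_real (c * \<phi> x) :: complex) = \<bar>c\<bar> * sqrt ((\<integral>x. (\<phi> x)\<^sup>2 \<partial>leb ?I) + (\<integral>x. (deriv \<phi> x)\<^sup>2 \<partial>leb ?I))"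
    and mem: "(\<lambda>x. of_real (c * \<phi> x) :: complex) \<in> carr (H10 ?I)" for c
  proof -
    have s: "smooth_real (\<lambda>x. c * \<phi> x)" by (intro smooth_real_mult smooth_real_const ctest_smooth[OF \<phi>])
    have ct: "(\<lambda>x. c * \<phi> x) \<in> ctest 0 1" using \<phi> s unfolding ctest_def by auto
    note t = test_funs_of_real[OF ct, where 'k=complex]
    show "(\<lambda>x. of_real (c * \<phi> x) :: complex) \<in> carr (H10 ?I)" by (rule test_funs_H10(2)[OF t]) simp
    have d: "deriv (\<lambda>x. c * \<phi> x) x = c * deriv \<phi> x" for x
      by (rule DERIV_imp_deriv[OF DERIV_cmult[OF smooth_real_deriv(1)[OF ctest_smooth[OF \<phi>]]]])
    have ae: "AE x in leb ?I. wderiv ?I 1 (\<lambda>x. of_real (c * \<phi> x) :: complex) x = of_real (c * deriv \<phi> x)"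
      using test_funs_H10(3)[OF t] unfolding partials_of_real[OF s] d by simp
    have "(nrm (L2 ?I) (wderiv ?I 1 (\<lambda>x. of_real (c * \<phi> x) :: complex)))\<^sup>2 = (\<integral>x. c\<^sup>2 * (deriv \<phi> x)\<^sup>2 \<partial>leb ?I)"
      unfolding L2_nrm_sq by (rule integral_lebesgue_on_cong_AE) (use ae in \<open>auto elim!: eventually_mono simp: norm_mult power_mult_distrib\<close>)
    moreover have "(nrm (L2 ?I) (\<lambda>x. of_real (c * \<phi> x) :: complex))\<^sup>2 = (\<integral>x. c\<^sup>2 * (\<phi> x)\<^sup>2 \<partial>leb ?I)"
      unfolding L2_nrm_sq by (simp add: norm_mult power_mult_distrib)
    ultimately show "nrm (H10 ?I) (\<lambda>x. of_real (c * \<phi> x) :: complex) = \<bar>c\<bar> * sqrt ((\<integral>x. (\<phi> x)\<^sup>2 \<partial>leb ?I) + (\<integral>x. (deriv \<phi> x)\<^sup>2 \<partial>leb ?I))"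
      by (simp add: H10_def H1_nrm distrib_left[symmetric] real_sqrt_mult)
  qed
  define N where "N = sqrt ((\<integral>x. (\<phi> x)\<^sup>2 \<partial>leb ?I) + (\<integral>x. (deriv \<phi> x)\<^sup>2 \<partial>leb ?I))"
  have N: "0 \<le> N" unfolding N_def by simp
  define c where "c = 1 / (N + 1)"
  have c: "0 < c" "c * N \<le> 1" using N by (auto simp: c_def divide_le_eq)
  show thesis
  proof (rule that[of "1 / c"])
    fix F assume F: "F \<in> carr (Hm1 ?I)"
    let ?S = "{\<phi> :: real \<Rightarrow> complex. \<phi> \<in> carr (H10 ?I) \<and> nrm (H10 ?I) \<phi> \<le> 1}"
    obtain K where K: "\<And>\<phi> :: real \<Rightarrow> complex. \<phi> \<in> carr (H10 ?I) \<Longrightarrow> norm (F \<phi>) \<le> K * nrm (H10 ?I) \<phi>"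
      using Hm1_bounded[OF F] by blast
    have n0: "0 \<le> nrm (H10 ?I) \<psi>" for \<psi> :: "real \<Rightarrow> complex" by (simp add: H10_def H1_nrm)
    have bdd: "bdd_above ((\<lambda>\<phi>. norm (F \<phi>)) ` ?S)"
    proof (rule bdd_aboveI2)
      fix \<phi> :: "real \<Rightarrow> complex" assume \<phi>: "\<phi> \<in> ?S"
      have "K * nrm (H10 ?I) \<phi> \<le> \<bar>K\<bar> * 1" using \<phi> n0[of \<phi>] by (intro mult_mono) auto
      then show "norm (F \<phi>) \<le> \<bar>K\<bar>" using K[of \<phi>] \<phi> by simp
    qed
    let ?\<psi> = "\<lambda>x. of_real (c * \<phi> x) :: complex"
    have "?\<psi> \<in> ?S" using mem[of c] nrm_test[of c] c by (simp add: N_def)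
    then have "norm (F ?\<psi>) \<le> nrm (Hm1 ?I) F" by (simp add: Hm1_def cSUP_upper[OF _ bdd])
    moreover have "F ?\<psi> = cnj (of_real c) * F (\<lambda>x. of_real (\<phi> x))"
    proof -
      have "F (\<lambda>x. of_real c * (\<lambda>x. of_real (\<phi> x)) x) = cnj (of_real c) * F (\<lambda>x. of_real (\<phi> x))"
        using F mem[of 1] unfolding Hm1_def by simp
      then show ?thesis by simp
    qed
    ultimately have "c * norm (F (\<lambda>x. of_real (\<phi> x))) \<le> nrm (Hm1 ?I) F" using c by (simp add: norm_mult)
    then show "norm (F (\<lambda>x. of_real (\<phi> x))) \<le> 1 / c * nrm (Hm1 ?I) F"
      using c by (simp add: pos_le_divide_eq mult.commute)
  qed (use c in auto)
qed

lemma Hm1_diff: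
  assumes "F \<in> carr (Hm1 \<Omega>)" "F' \<in> carr (Hm1 \<Omega>)"
  shows "F - F' \<in> carr (Hm1 \<Omega>)"
proof -
  obtain C where C: "\<And>\<phi> :: 'a \<Rightarrow> complex. \<phi> \<in> carr (H10 \<Omega>) \<Longrightarrow> norm (F \<phi>) \<le> C * nrm (H10 \<Omega>) \<phi>" using Hm1_bounded[OF assms(1)] by blast
  obtain C' where C': "\<And>\<phi> :: 'a \<Rightarrow> complex. \<phi> \<in> carr (H10 \<Omega>) \<Longrightarrow> norm (F' \<phi>) \<le> C' * nrm (H10 \<Omega>) \<phi>" using Hm1_bounded[OF assms(2)] by blast
  have "norm ((F - F') \<phi>) \<le> (C + C') * nrm (H10 \<Omega>) \<phi>" if "\<phi> \<in> carr (H10 \<Omega>)" for \<phi>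
    using C[OF that] C'[OF that] norm_triangle_ineq4[of "F \<phi>" "F' \<phi>"] by (simp add: distrib_right)
  then have "\<exists>C. \<forall>\<phi>\<in>carr (H10 \<Omega>). norm (F \<phi> - F' \<phi>) \<le> C * nrm (H10 \<Omega>) \<phi>" by auto
  then show ?thesis using assms by (simp add: Hm1_def right_diff_distrib)
qed

text \<open>Evaluation at a test function is continuous for the dual norm, so it carries the simple
  approximations of \<open>V\<close> to approximations of the pairing. Measurability in
  \<open>t\<close> follows, and integrability from the L^2 bound on the dual norms.\<close>

lemma Hm1_pairing_integrable:
  assumes V: "V \<in> carr (bochner L2 T (Hm1 {0<..<1::real}))" and \<phi>: "\<phi> \<in> ctest 0 1"
  shows "integrable (leb {0<..<T}) (\<lambda>t. V t (\<lambda>x. of_real (\<phi> x)))"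
proof -
  let ?J = "leb {0<..<T}" and ?\<phi> = "\<lambda>x. of_real (\<phi> x) :: complex"
  obtain C where C: "0 \<le> C" "\<And>F. F \<in> carr (Hm1 {0<..<1}) \<Longrightarrow> norm (F ?\<phi>) \<le> C * nrm (Hm1 {0<..<1}) F"
    using Hm1_test_bound[OF \<phi>] by blast
  have sm: "strongly_measurable T (Hm1 {0<..<1}) V" and c: "AE t in ?J. V t \<in> carr (Hm1 {0<..<1})" and n: "(\<lambda>t. nrm (Hm1 {0<..<1}) (V t)) \<in> carr (L2 {0<..<T})"
    using V by (auto simp: bochner_L2_iff)
  obtain s where s: "\<And>n. simple_function ?J (s n)" "\<And>n t. t \<in> {0<..<T} \<Longrightarrow> s n t \<in> carr (Hm1 {0<..<1})" "AE t in ?J. (\<lambda>n. nrm (Hm1 {0<..<1}) (s n t - V t)) \<longlonglongrightarrow> 0"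
    using sm unfolding strongly_measurable_def by blast
  have "AE t in ?J. lim (\<lambda>n. s n t ?\<phi>) = V t ?\<phi>"
    using s(3) c AE_space
  proof eventually_elim
    case (elim t)
    have "(\<lambda>n. s n t ?\<phi> - V t ?\<phi>) \<longlonglongrightarrow> 0"
    proof (rule Lim_null_comparison)
      show "\<forall>\<^sub>F n in sequentially. norm (s n t ?\<phi> - V t ?\<phi>) \<le> C * nrm (Hm1 {0<..<1}) (s n t - V t)"
        using C(2)[OF Hm1_diff[OF s(2) elim(2)]] elim(3) by (auto intro!: always_eventually)
      show "(\<lambda>n. C * nrm (Hm1 {0<..<1}) (s n t - V t)) \<longlonglongrightarrow> 0" using tendsto_mult[OF tendsto_const elim(1), of C] by simp
    qed
    then show ?case by (intro limI) (simp add: LIM_zero_iff)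
  qed
  moreover have "(\<lambda>t. lim (\<lambda>n. s n t ?\<phi>)) \<in> borel_measurable ?J"
    by (intro borel_measurable_lim_metric borel_measurable_simple_function simple_function_compose1[OF s(1), of "\<lambda>F. F ?\<phi>"])
  ultimately have m: "(\<lambda>t. V t ?\<phi>) \<in> borel_measurable ?J" by (intro borel_measurable_lebesgue_on_AE[where g="\<lambda>t. V t ?\<phi>"]) auto
  show ?thesis
  proof (rule Bochner_Integration.integrable_bound[OF _ m])
    show "integrable ?J (\<lambda>t. C * nrm (Hm1 {0<..<1}) (V t))" using L2_imp_integrable[OF n finite_lebesgue_on_Ioo] by simp
    show "AE t in ?J. norm (V t ?\<phi>) \<le> norm (C * nrm (Hm1 {0<..<1}) (V t))"
      using c
    proof eventually_elim
      case (elim t)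
      show ?case using C(2)[OF elim] by (smt (verit) norm_ge_zero real_norm_def)
    qed
  qed
qed

section \<open>From the weak formulation to the equation almost everywhere\<close>

lemma ac_derivative_unique:
  fixes F G :: "real \<Rightarrow> 'k::{real_normed_field, euclidean_space}"
  assumes F: "ac l u F f" and G: "ac l u G g" and lu: "l < u" and e: "AE x in leb {l<..<u}. F x = G x"
  shows "AE x in leb {l<..<u}. f x = g x"
proof -
  have "has_wderiv {l<..<u} 1 G f" by (rule has_wderiv_cong_AE[OF ac_imp_has_wderiv[OF F lu] _ e]) auto
  from has_wderiv_unique[OF this ac_imp_has_wderiv[OF G lu]] show ?thesis .
qed

lemma sol_space_facts:
  assumes u: "u \<in> carr (sol_space T)"
  shows "u \<in> carr (bochnerQ L2 T (L2 {0<..<1}))" "u \<in> carr (bochnerQ L2 T (H2 {0<..<1}))" "u \<in> carr (L2 (QT T))"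
    "has_wderiv (QT T) (1, 0) u (wderiv (QT T) (1, 0) u)" "wderiv (QT T) (1, 0) u \<in> carr (L2 (QT T))"
    "AE t in leb {0<..<T}. curry u t \<in> carr (H2 {0<..<1})"
    "\<exists>v\<in>carr (bochnerQ L2 T (L2 {0<..<1})). has_wderiv (QT T) (1, 0) u v"
proof -
  show 1: "u \<in> carr (bochnerQ L2 T (L2 {0<..<1}))" and 2: "u \<in> carr (bochnerQ L2 T (H2 {0<..<1}))"
    and 3: "\<exists>v\<in>carr (bochnerQ L2 T (L2 {0<..<1})). has_wderiv (QT T) (1, 0) u v"
    using u by (auto simp: sol_space_def inter_space_def H1_L2_def Let_def)
  show "u \<in> carr (L2 (QT T))" by (rule bochnerQ_L2_QT[OF 1])
  obtain v where v: "v \<in> carr (bochnerQ L2 T (L2 {0<..<1}))" "has_wderiv (QT T) (1, 0) u v" using 3 by blast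
  show w: "has_wderiv (QT T) (1, 0) u (wderiv (QT T) (1, 0) u)" by (rule has_wderiv_wderiv[OF v(2)])
  show "wderiv (QT T) (1, 0) u \<in> carr (L2 (QT T))"
    by (rule L2_cong_AE(1)[OF bochnerQ_L2_QT[OF v(1)] borel_rectangle has_wderiv_unique_rectangle[OF v(2) w]])
  show "AE t in leb {0<..<T}. curry u t \<in> carr (H2 {0<..<1})" using 2 by (simp add: bochnerQ_L2_iff bochner_L2_iff)
qed

lemma snd_times_integrable:
  fixes k :: "real \<times> real \<Rightarrow> 'k::euclidean_space"
  assumes k: "integrable (leb S) k" and h: "h \<in> ctest l r"
  shows "integrable (leb S) (\<lambda>z. h (snd z) *\<^sub>R k z)"
proof -
  obtain C where C: "\<And>x. \<bar>h x\<bar> \<le> C" using ctest_bounded[OF h] by (auto simp: bounded_iff)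
  have [measurable]: "h \<in> borel_measurable borel" by (rule smooth_real_measurable[OF ctest_smooth[OF h]])
  have "(\<lambda>z :: real \<times> real. h (snd z)) \<in> borel_measurable borel" unfolding borel_prod[symmetric] by measurable
  then show ?thesis using C by (intro bounded_times_integrable[OF k borel_measurable_lebesgue_onI])
qed

text \<open>The time derivatives with values in H^-1 and in L^2 satisfy the same distributional
  identity in time. Their pairings with one \<open>\<phi>\<close> thus agree almost everywhere, and
  countability of \<open>prims\<close> gives a common null set.\<close>

lemma time_derivative_pairing:
  fixes u p :: "real \<times> real \<Rightarrow> complex"
  assumes u: "integrable (leb (QT T)) u" and p: "integrable (leb (QT T)) p"
    and d: "has_wderiv (QT T) (1, 0) u p" and V: "V \<in> carr (bochner L2 T (Hm1 {0<..<1}))" and td: "has_time_deriv T u V"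
  shows "AE t in leb {0<..<T}. \<forall>\<phi>\<in>prims 0 1. V t (\<lambda>x. of_real (\<phi> x)) = (\<integral>x. \<phi> x *\<^sub>R p (t, x) \<partial>leb {0<..<1})"
proof -
  let ?J = "leb {0<..<T}" and ?I = "leb {0<..<1::real}"
  have "AE t in ?J. V t (\<lambda>x. of_real (\<phi> x)) - (\<integral>x. \<phi> x *\<^sub>R p (t, x) \<partial>?I) = 0" if \<phi>: "\<phi> \<in> prims 0 1" for \<phi>
  proof (rule fundamental_lemma)
    note c = prims_ctest[OF \<phi>]
    note Vi = Hm1_pairing_integrable[OF V c]
    have int: "integrable ?J (\<lambda>t. \<integral>x. \<phi> x *\<^sub>R k (t, x) \<partial>?I)" if "integrable (leb (QT T)) k" for k :: "real \<times> real \<Rightarrow> complex"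
      using integrable_integral_lebesgue_on_slice[OF _ _ snd_times_integrable[OF that c]] by simp
    show "integrable ?J (\<lambda>t. V t (\<lambda>x. of_real (\<phi> x)) - (\<integral>x. \<phi> x *\<^sub>R p (t, x) \<partial>?I))"
      by (rule Bochner_Integration.integrable_diff[OF Vi int[OF p]])
    fix \<theta> assume "\<theta> \<in> bumps 0 T"
    then have c': "\<theta> \<in> ctest 0 T" by (rule bumps_ctest)
    have e: "(\<integral>t. h t *\<^sub>R (\<integral>x. \<phi> x *\<^sub>R k (t, x) \<partial>?I) \<partial>?J) = (\<integral>z. (h (fst z) * \<phi> (snd z)) *\<^sub>R k z \<partial>leb (QT T))"
      if "h \<in> ctest 0 T" "integrable (leb (QT T)) k" for h and k :: "real \<times> real \<Rightarrow> complex"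
    proof -
      have "(\<integral>t. h t *\<^sub>R (\<integral>x. \<phi> x *\<^sub>R k (t, x) \<partial>?I) \<partial>?J) = (\<integral>t. \<integral>x. (h t * \<phi> x) *\<^sub>R k (t, x) \<partial>?I \<partial>?J)"
        by (simp flip: scaleR_scaleR)
      then show ?thesis using integral_lebesgue_on_slice[OF _ _ tensor_times_integrable[OF that(2,1) c]] by simp
    qed
    have "(\<integral>t. partials [1] (\<lambda>t. of_real (\<theta> t)) t * L2_pairing {0<..<1} (curry u t) (\<lambda>x. of_real (\<phi> x)) \<partial>?J) =
        - (\<integral>t. of_real (\<theta> t) * V t (\<lambda>x. of_real (\<phi> x)) \<partial>?J)"
      using td test_funs_of_real[OF c', where 'k=complex] test_funs_H10(2)[OF test_funs_of_real[OF c, where 'k=complex]]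
      unfolding has_time_deriv_def by simp
    moreover have "of_real (\<theta> t) * V t (\<lambda>x. of_real (\<phi> x)) = \<theta> t *\<^sub>R V t (\<lambda>x. of_real (\<phi> x))" for t
      by (simp add: scaleR_conv_of_real)
    moreover have "partials [1] (\<lambda>t. of_real (\<theta> t)) t * L2_pairing {0<..<1} (curry u t) (\<lambda>x. of_real (\<phi> x)) =
        deriv \<theta> t *\<^sub>R (\<integral>x. \<phi> x *\<^sub>R u (t, x) \<partial>?I)" for t
      unfolding partials_of_real[OF ctest_smooth[OF c']] L2_pairing_def by (simp add: scaleR_conv_of_real mult.commute)
    ultimately have "(\<integral>t. deriv \<theta> t *\<^sub>R (\<integral>x. \<phi> x *\<^sub>R u (t, x) \<partial>?I) \<partial>?J) = - (\<integral>t. \<theta> t *\<^sub>R V t (\<lambda>x. of_real (\<phi> x)) \<partial>?J)"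
      by simp
    then have "(\<integral>t. \<theta> t *\<^sub>R V t (\<lambda>x. of_real (\<phi> x)) \<partial>?J) = (\<integral>t. \<theta> t *\<^sub>R (\<integral>x. \<phi> x *\<^sub>R p (t, x) \<partial>?I) \<partial>?J)"
      using has_wderiv_tensor(2)[OF c' c d] unfolding e[OF ctest_deriv[OF c'] u] e[OF c' p] by simp
    then show "(\<integral>t. \<theta> t *\<^sub>R (V t (\<lambda>x. of_real (\<phi> x)) - (\<integral>x. \<phi> x *\<^sub>R p (t, x) \<partial>?I)) \<partial>?J) = 0"
      using ctest_times_integrable[OF c' Vi] ctest_times_integrable[OF c' int[OF p]] by (simp add: scaleR_diff_right)
  qed
  then show ?thesis by (simp add: AE_ball_countable[OF countable_prims])
qed

lemma L2_slice:
  assumes "f \<in> carr (L2 (QT T))"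
  shows "AE t in leb {0<..<T}. (\<lambda>x. f (t, x)) \<in> carr (L2 {0<..<1})"
proof -
  have i: "integrable (leb (QT T)) (\<lambda>z. (norm (f z))\<^sup>2)" using assms by (simp add: L2_iff)
  show ?thesis
    using measurable_lebesgue_on_slice[OF _ _ L2_measurable[OF assms], simplified] AE_integrable_lebesgue_on_slice[OF _ _ i, simplified]
    by eventually_elim (simp add: L2_iff)
qed

text \<open>The weak formulation says that the flux a u_x has the weak derivative u_t + b u_x + q u
  - f. The flux is also a product of absolutely continuous slices, with derivative a_x u_x + a u_xx,
  and two derivatives of one function agree almost everywhere.\<close>

lemma weak_solution_strong:
  fixes u f :: "real \<times> real \<Rightarrow> complex" and a b :: "real \<times> real \<Rightarrow> real" and q :: "real \<Rightarrow> real"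
  assumes W: "weak_solution T a b q f u0 g0 g1 u" and sol: "u \<in> carr (sol_space T)"
    and a: "a \<in> carr (W1inf (QT T))" and b: "b \<in> carr (bochnerQ Linf T (W1inf {0<..<1}))"
    and q: "q \<in> carr (Linf {0<..<1})" and f: "f \<in> carr (L2 (QT T))"
  shows "AE t in leb {0<..<T}. AE x in leb {0<..<1}.
    wderiv (QT T) (1, 0) u (t, x) = a (t, x) *\<^sub>R wderiv {0<..<1} 1 (wderiv {0<..<1} 1 (curry u t)) x
      + wderiv (QT T) (0, 1) a (t, x) *\<^sub>R wderiv {0<..<1} 1 (curry u t) x
      - b (t, x) *\<^sub>R wderiv {0<..<1} 1 (curry u t) x - q x *\<^sub>R u (t, x) + f (t, x)"
proof -
  let ?I = "{0<..<1::real}" and ?J = "leb {0<..<T}" and ?Q = "leb (QT T)"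
  let ?MI = "leb {0<..<1::real}"
  let ?p = "wderiv (QT T) (1, 0) u" and ?a1 = "wderiv (QT T) (0, 1) a"
  note fQ = finite_lebesgue_on_rectangle[of 0 T 0 1]
  note S = sol_space_facts[OF sol]
  note A = W1inf_rectangle[OF a]
  obtain V where V: "V \<in> carr (bochner L2 T (Hm1 ?I))" "has_time_deriv T u V"
    and eq: "\<And>\<phi>. \<phi> \<in> carr (H10 ?I) \<Longrightarrow> AE t in ?J. V t \<phi>
        + (\<integral>x. of_real (a (t, x)) * wderiv ?I 1 (curry u t) x * cnj (wderiv ?I 1 \<phi> x) \<partial>?MI)
        + (\<integral>x. of_real (b (t, x)) * wderiv ?I 1 (curry u t) x * cnj (\<phi> x) \<partial>?MI)
        + (\<integral>x. of_real (q x) * u (t, x) * cnj (\<phi> x) \<partial>?MI) = (\<integral>x. f (t, x) * cnj (\<phi> x) \<partial>?MI)"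
    using W unfolding weak_solution_def by blast
  have "AE t in ?J. V t (\<lambda>x. of_real (\<phi> x))
        + (\<integral>x. deriv \<phi> x *\<^sub>R (a (t, x) *\<^sub>R wderiv ?I 1 (curry u t) x) \<partial>?MI)
        + (\<integral>x. \<phi> x *\<^sub>R (b (t, x) *\<^sub>R wderiv ?I 1 (curry u t) x) \<partial>?MI)
        + (\<integral>x. \<phi> x *\<^sub>R (q x *\<^sub>R u (t, x)) \<partial>?MI) = (\<integral>x. \<phi> x *\<^sub>R f (t, x) \<partial>?MI)"
    if \<phi>: "\<phi> \<in> prims 0 1" for \<phi>
  proof -
    note c = prims_ctest[OF \<phi>]
    note t = test_funs_of_real[OF c, where 'k=complex]
    note h = test_funs_H10[OF t zero_less_one, unfolded partials_of_real[OF ctest_smooth[OF c]]]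
    show ?thesis
      using eq[OF h(2)]
    proof eventually_elim
      case (elim t)
      have "(\<integral>x. of_real (a (t, x)) * wderiv ?I 1 (curry u t) x * cnj (wderiv ?I 1 (\<lambda>x. of_real (\<phi> x)) x) \<partial>?MI) =
          (\<integral>x. deriv \<phi> x *\<^sub>R (a (t, x) *\<^sub>R wderiv ?I 1 (curry u t) x) \<partial>?MI)"
        by (rule integral_lebesgue_on_cong_AE)
          (use h(3) in \<open>auto elim!: eventually_mono simp: scaleR_conv_of_real\<close>)
      with elim show ?case by (simp add: scaleR_conv_of_real mult.commute mult.left_commute)
    qed
  qed
  \<comment> \<open>The weak formulation provides a null set of times for each single
    \<open>\<phi>\<close>; countability makes it uniform.\<close>
  then have weak: "AE t in ?J. \<forall>\<phi>\<in>prims 0 1. V t (\<lambda>x. of_real (\<phi> x))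
        + (\<integral>x. deriv \<phi> x *\<^sub>R (a (t, x) *\<^sub>R wderiv ?I 1 (curry u t) x) \<partial>?MI)
        + (\<integral>x. \<phi> x *\<^sub>R (b (t, x) *\<^sub>R wderiv ?I 1 (curry u t) x) \<partial>?MI)
        + (\<integral>x. \<phi> x *\<^sub>R (q x *\<^sub>R u (t, x)) \<partial>?MI) = (\<integral>x. \<phi> x *\<^sub>R f (t, x) \<partial>?MI)"
    by (simp add: AE_ball_countable[OF countable_prims])
  have pair: "AE t in ?J. \<forall>\<phi>\<in>prims 0 1. V t (\<lambda>x. of_real (\<phi> x)) = (\<integral>x. \<phi> x *\<^sub>R ?p (t, x) \<partial>?MI)"
    by (rule time_derivative_pairing[OF L2_imp_integrable[OF S(3) fQ] L2_imp_integrable[OF S(5) fQ] S(4) V])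
  have ai: "integrable ?Q a" by (rule Linf_integrable[OF fQ A(4)]) (use A(1) in simp)
  have a1i: "integrable ?Q ?a1" by (rule Linf_integrable[OF fQ A(5)]) (use A(2) in simp)
  have qm: "q \<in> borel_measurable ?MI" and qb: "AE x in ?MI. \<bar>q x\<bar> \<le> nrm (Linf ?I) q"
    using Linf_measurable[OF q] Linf_AE[OF q] by auto
  show ?thesis
    using weak pair S(6) slice_x_ac[OF ai a1i A(3)] AE_lebesgue_on_slice[OF _ _ A(1), simplified]
      bochnerQ_Linf(1)[OF b] measurable_lebesgue_on_slice[OF _ _ bochnerQ_Linf(2)[OF b], simplified] L2_slice[OF S(5)] L2_slice[OF f]
  proof eventually_elim
    case (elim t)
    let ?y = "wderiv ?I 1 (curry u t)" and ?z = "wderiv ?I 1 (wderiv ?I 1 (curry u t))"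
    note h2 = H2_wderiv[OF elim(3)]
    have uL: "(\<lambda>x. u (t, x)) \<in> carr (L2 ?I)" using H1_wderiv(1)[OF h2(1)] by (simp add: curry_def)
    have yL: "?y \<in> carr (L2 ?I)" by (rule H1_wderiv(3)[OF h2(1)])
    obtain c where c: "ac 0 1 c (\<lambda>x. ?a1 (t, x))" and ae_c: "AE x in ?MI. a (t, x) = c x" using elim(4) by blast
    obtain y where y: "ac 0 1 y ?z" and ae_y: "AE x in ?MI. ?y x = y x" using H1_ac[OF zero_less_one h2(2)] by blast
    have am: "(\<lambda>x. a (t, x)) \<in> borel_measurable ?MI"
      by (rule borel_measurable_lebesgue_on_AE[OF _ ac_measurable[OF c]]) (use ae_c in \<open>auto elim: eventually_mono\<close>)
    have FL: "(\<lambda>x. a (t, x) *\<^sub>R ?y x) \<in> carr (L2 ?I)" by (rule L2_times_bounded(1)[OF yL am elim(5)]) simp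
    have bL: "(\<lambda>x. b (t, x) *\<^sub>R ?y x) \<in> carr (L2 ?I)" by (rule L2_times_bounded(1)[OF yL elim(7) elim(6)]) simp
    have qL: "(\<lambda>x. q x *\<^sub>R u (t, x)) \<in> carr (L2 ?I)" by (rule L2_times_bounded(1)[OF uL qm qb]) simp
    let ?R = "\<lambda>x. ?p (t, x) + b (t, x) *\<^sub>R ?y x + q x *\<^sub>R u (t, x) - f (t, x)"
    note fI = finite_lebesgue_on_Ioo[of 0 1]
    have int: "integrable ?MI (\<lambda>x. a (t, x) *\<^sub>R ?y x)" "integrable ?MI (\<lambda>x. ?p (t, x))" "integrable ?MI (\<lambda>x. b (t, x) *\<^sub>R ?y x)"
      "integrable ?MI (\<lambda>x. q x *\<^sub>R u (t, x))" "integrable ?MI (\<lambda>x. f (t, x))"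
      using FL bL qL elim(8,9) fI by (auto intro: L2_imp_integrable)
    have Ri: "integrable ?MI ?R" using int by auto
    have "(\<integral>x. deriv \<phi> x *\<^sub>R (a (t, x) *\<^sub>R ?y x) \<partial>?MI) = - (\<integral>x. \<phi> x *\<^sub>R ?R x \<partial>?MI)" if \<phi>: "\<phi> \<in> prims 0 1" for \<phi>
    proof -
      note c = prims_ctest[OF \<phi>]
      have "(\<integral>x. \<phi> x *\<^sub>R ?R x \<partial>?MI) = (\<integral>x. \<phi> x *\<^sub>R ?p (t, x) \<partial>?MI) + (\<integral>x. \<phi> x *\<^sub>R (b (t, x) *\<^sub>R ?y x) \<partial>?MI) + (\<integral>x. \<phi> x *\<^sub>R (q x *\<^sub>R u (t, x)) \<partial>?MI) - (\<integral>x. \<phi> x *\<^sub>R f (t, x) \<partial>?MI)"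
        unfolding scaleR_add_right scaleR_diff_right
        using ctest_times_integrable[OF c int(2)] ctest_times_integrable[OF c int(3)] ctest_times_integrable[OF c int(4)] ctest_times_integrable[OF c int(5)]
        by (simp only: Bochner_Integration.integral_add Bochner_Integration.integral_diff Bochner_Integration.integrable_add)
      moreover have "d = - (p + b + q - f)" if "v = p" "v + d + b + q = f" for v p d b q f :: complex
        using that by (auto simp: algebra_simps)
      ultimately show ?thesis using bspec[OF elim(1) \<phi>] bspec[OF elim(2) \<phi>] by simp
    qed
    from weak_derivative_ac[OF zero_less_one int(1) Ri this] ac_indefinite_integral[OF Ri]
    obtain F where F: "ac 0 1 F ?R" and ae_F: "AE x in ?MI. a (t, x) *\<^sub>R ?y x = F x" by blast
    have flux: "ac 0 1 (\<lambda>x. c x *\<^sub>R y x) (\<lambda>x. ?a1 (t, x) *\<^sub>R y x + c x *\<^sub>R ?z x)"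
      by (rule ac_bilinear[OF bounded_bilinear_scaleR c y])
    have "AE x in ?MI. F x = c x *\<^sub>R y x" using ae_F ae_c ae_y by eventually_elim simp
    from ac_derivative_unique[OF F flux zero_less_one this] show ?case
      using ae_c ae_y by eventually_elim (simp add: algebra_simps)
  qed
qed

section \<open>The difference of two solutions\<close>

text \<open>A discrepancy at \<open>p\<close>, even at an endpoint, persists on a nondegenerate
  interval inside (l, u), which is not a null set.\<close>

lemma continuous_AE_eq:
  fixes f g :: "real \<Rightarrow> 'k::real_normed_vector"
  assumes f: "continuous_on {l..u} f" and g: "continuous_on {l..u} g" and ae: "AE x in leb {l<..<u}. f x = g x"
    and lu: "l < u" and p: "p \<in> {l..u}"
  shows "f p = g p"
proof (rule ccontr)
  assume n: "f p \<noteq> g p"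
  have "continuous_on {l..u} (\<lambda>x. f x - g x)" by (intro continuous_on_diff f g)
  then obtain \<delta> where \<delta>: "0 < \<delta>" "\<And>x. x \<in> {l..u} \<Longrightarrow> dist x p < \<delta> \<Longrightarrow> dist (f x - g x) (f p - g p) < norm (f p - g p)"
    unfolding continuous_on_iff using p n by (metis zero_less_norm_iff right_minus_eq)
  define l' u' where "l' = max l (p - \<delta>)" and "u' = min u (p + \<delta>)"
  have lu': "l' < u'" using lu \<delta>(1) p by (auto simp: l'_def u'_def)
  have ne: "f x \<noteq> g x" if "x \<in> {l'<..<u'}" for x
  proof -
    have "dist (f x - g x) (f p - g p) < norm (f p - g p)" using that by (intro \<delta>(2)) (auto simp: l'_def u'_def dist_real_def)
    then show ?thesis by auto
  qed
  have "AE x in lborel. x \<in> {l<..<u} \<longrightarrow> f x = g x" using ae by (simp add: AE_lebesgue_on_iff)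
  then have "AE x in lborel. x \<notin> {l'<..<u'}"
    by (rule eventually_mono) (use ne in \<open>auto simp: l'_def u'_def\<close>)
  then have "{l'<..<u'} \<in> null_sets lborel" using AE_iff_null_sets[of "{l'<..<u'}" lborel] by simp
  then show False using lu' by (simp add: null_sets_def)
qed

lemma has_cont_value_ac:
  assumes h: "has_cont_value l u h p c" and W: "ac l u W w" and e: "AE x in leb {l<..<u}. h x = W x"
    and lu: "l < u" and p: "p \<in> {l..u}"
  shows "W p = c"
proof -
  obtain g where g: "continuous_on {l..u} g" "AE x in leb {l<..<u}. g x = h x" "g p = c"
    using h unfolding has_cont_value_def by blast
  have "AE x in leb {l<..<u}. W x = g x" using e g(2) by eventually_elim simp
  from continuous_AE_eq[OF ac_continuous[OF W] g(1) this lu p] g(3) show ?thesis by simp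
qed

lemma has_cont_value_diff:
  assumes "has_cont_value l u h p c" "has_cont_value l u h' p c'"
  shows "has_cont_value l u (h - h') p (c - c')"
proof -
  obtain g where g: "continuous_on {l..u} g" "AE x in leb {l<..<u}. g x = h x" "g p = c"
    using assms(1) unfolding has_cont_value_def by blast
  obtain g' where g': "continuous_on {l..u} g'" "AE x in leb {l<..<u}. g' x = h' x" "g' p = c'"
    using assms(2) unfolding has_cont_value_def by blast
  have "AE x in leb {l<..<u}. g x - g' x = (h - h') x" using g(2) g'(2) by eventually_elim simp
  then show ?thesis unfolding has_cont_value_def
    using continuous_on_diff[OF g(1) g'(1)] g(3) g'(3) by (intro exI[of _ "\<lambda>x. g x - g' x"]) auto
qed

section \<open>Norms of the boundary lifting\<close>

lemma L2_mono:
  assumes v: "v \<in> carr (L2 \<Omega>)" and u: "u \<in> borel_measurable (leb \<Omega>)"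
    and le: "AE x in leb \<Omega>. norm (u x) \<le> norm (v x)"
  shows "u \<in> carr (L2 \<Omega>)" "nrm (L2 \<Omega>) u \<le> nrm (L2 \<Omega>) v"
proof -
  show uL: "u \<in> carr (L2 \<Omega>)" by (rule L2_bound[OF v u, of 1]) (use le in simp)
  show "nrm (L2 \<Omega>) u \<le> nrm (L2 \<Omega>) v" unfolding L2_nrm real_sqrt_le_iff
    using uL v le by (intro integral_mono_AE) (auto simp: L2_iff elim!: eventually_mono intro: power_mono)
qed

lemma L2_unit_interval_bounded:
  fixes f :: "real \<Rightarrow> complex"
  assumes f: "f \<in> borel_measurable (leb {0<..<1})" and b: "AE x in leb {0<..<1}. norm (f x) \<le> C" and C: "0 \<le> C"
  shows "f \<in> carr (L2 {0<..<1})" "nrm (L2 {0<..<1}) f \<le> C"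
proof -
  have c: "(\<lambda>x. C) \<in> carr (L2 {0<..<1::real})"
    by (rule bounded_measurable_L2[OF finite_lebesgue_on_Ioo, where C="\<bar>C\<bar>"]) auto
  have "AE x in leb {0<..<1}. norm (f x) \<le> norm C" using b by eventually_elim simp
  from L2_mono[OF c f this] show "f \<in> carr (L2 {0<..<1})" "nrm (L2 {0<..<1}) f \<le> C"
    using C by (simp_all add: L2_nrm measure_restrict_space)
qed

lemma fst_L2:
  fixes h :: "real \<Rightarrow> complex"
  assumes h: "h \<in> carr (L2 {0<..<T})"
  shows "(\<lambda>z. h (fst z)) \<in> carr (L2 (QT T))" "nrm (L2 (QT T)) (\<lambda>z. h (fst z)) = nrm (L2 {0<..<T}) h"
proof -
  let ?J = "{0<..<T}" and ?I = "{0<..<1::real}"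
  obtain g where g[measurable]: "g \<in> borel_measurable borel" and e: "AE x in leb ?J. h x = g x"
    using borel_representative[OF _ L2_measurable[OF h]] by auto
  obtain N where N: "N \<in> sets borel" "emeasure lborel N = 0" "{x. \<not> (x \<in> ?J \<longrightarrow> h x = g x)} \<subseteq> N"
    using e by (auto simp: AE_lebesgue_on_iff elim: AE_E)
  have "AE t in lborel. t \<notin> N" using N by (intro AE_not_in) (auto simp: null_sets_def)
  then have 1: "AE t in leb ?J. AE x in leb ?I. fst (t, x) \<notin> N" by (auto simp: AE_lebesgue_on_iff)
  \<comment> \<open>A null set of times gives a null set of the rectangle; this makes the
    composition with \<open>fst\<close> measurable for the completed measure.\<close>
  have "{z :: real \<times> real. fst z \<notin> N} = (- N) \<times> UNIV" by auto
  then have "{z :: real \<times> real. fst z \<notin> N} \<in> sets borel" using N(1) by (simp add: borel_Times)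
  from AE_lebesgue_on_pair[OF _ _ this 1] have "AE z in leb (QT T). fst z \<notin> N" by simp
  moreover have "AE z in leb (QT T). z \<in> QT T" by (rule AE_I2) simp
  ultimately have ae: "AE z in leb (QT T). g (fst z) = h (fst z)"
    by eventually_elim (use N(3) in auto)
  have gm: "(\<lambda>z :: real \<times> real. g (fst z)) \<in> borel_measurable borel" unfolding borel_prod[symmetric] by measurable
  have m: "(\<lambda>z. h (fst z)) \<in> borel_measurable (leb (QT T))"
    by (rule borel_measurable_lebesgue_on_AE[OF _ borel_measurable_lebesgue_onI[OF gm] ae]) simp
  have one: "(\<integral>x. c \<partial>leb ?I) = c" "integrable (leb ?I) (\<lambda>x. c)" for c :: real
    using finite_lebesgue_on_Ioo[of 0 1] by (simp_all add: measure_restrict_space finite_measure.integrable_const)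
  have i: "integrable (leb (QT T)) (\<lambda>z. (norm (h (fst z)))\<^sup>2)"
  proof (rule Tonelli_lebesgue_on)
    show "(\<lambda>z. (norm (h (fst z)))\<^sup>2) \<in> borel_measurable (leb (QT T))" using m by measurable
  qed (use h in \<open>auto simp: one L2_iff\<close>)
  show "(\<lambda>z. h (fst z)) \<in> carr (L2 (QT T))" using m i by (simp add: L2_iff)
  show "nrm (L2 (QT T)) (\<lambda>z. h (fst z)) = nrm (L2 ?J) h"
    unfolding L2_nrm using integral_lebesgue_on_slice[OF _ _ i] by (simp add: measure_restrict_space)
qed

lemma boundary_lift_L2:
  fixes h0 h1 :: "real \<Rightarrow> complex"
  assumes h: "h0 \<in> carr (L2 {0<..<T})" "h1 \<in> carr (L2 {0<..<T})"
  shows "(\<lambda>z. (1 - snd z) *\<^sub>R h0 (fst z) + snd z *\<^sub>R h1 (fst z)) \<in> carr (L2 (QT T))"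
    "nrm (L2 (QT T)) (\<lambda>z. (1 - snd z) *\<^sub>R h0 (fst z) + snd z *\<^sub>R h1 (fst z)) \<le> nrm (L2 {0<..<T}) h0 + nrm (L2 {0<..<T}) h1"
proof -
  have m: "(\<lambda>z :: real \<times> real. 1 - snd z) \<in> borel_measurable (leb (QT T))" "(\<lambda>z :: real \<times> real. snd z) \<in> borel_measurable (leb (QT T))"
    by (intro borel_measurable_lebesgue_onI borel_measurable_continuous_onI continuous_intros)+
  have b: "AE z in leb (QT T). \<bar>1 - snd z\<bar> \<le> 1" "AE z in leb (QT T). \<bar>snd z\<bar> \<le> 1"
    by (rule AE_I2; auto)+
  note p0 = L2_times_bounded[OF fst_L2(1)[OF h(1)] m(1) b(1) zero_le_one]
  note p1 = L2_times_bounded[OF fst_L2(1)[OF h(2)] m(2) b(2) zero_le_one]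
  show "(\<lambda>z. (1 - snd z) *\<^sub>R h0 (fst z) + snd z *\<^sub>R h1 (fst z)) \<in> carr (L2 (QT T))" by (rule L2_add[OF p0(1) p1(1)])
  show "nrm (L2 (QT T)) (\<lambda>z. (1 - snd z) *\<^sub>R h0 (fst z) + snd z *\<^sub>R h1 (fst z)) \<le> nrm (L2 {0<..<T}) h0 + nrm (L2 {0<..<T}) h1"
    using L2_triangle(1)[OF p0(1) p1(1)] p0(2) p1(2) fst_L2(2)[OF h(1)] fst_L2(2)[OF h(2)] by simp
qed

lemma affine_ac: "ac 0 1 (\<lambda>x. (1 - x) *\<^sub>R c0 + x *\<^sub>R c1 :: complex) (\<lambda>x. c1 - c0)"
  by (rule ac_C1) (auto intro!: derivative_eq_intros)

lemma affine_L2: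
  "(\<lambda>x. (1 - x) *\<^sub>R c0 + x *\<^sub>R c1 :: complex) \<in> carr (L2 {0<..<1})"
  "nrm (L2 {0<..<1}) (\<lambda>x. (1 - x) *\<^sub>R c0 + x *\<^sub>R c1 :: complex) \<le> norm c0 + norm c1"
proof -
  have m: "(\<lambda>x. (1 - x) *\<^sub>R c0 + x *\<^sub>R c1 :: complex) \<in> borel_measurable (leb {0<..<1})"
    by (rule ac_measurable[OF affine_ac])
  have b: "AE x in leb {0<..<1}. norm ((1 - x) *\<^sub>R c0 + x *\<^sub>R c1) \<le> norm c0 + norm c1"
  proof (rule AE_I2)
    fix x :: real assume "x \<in> space (leb {0<..<1})"
    then have x: "0 < x" "x < 1" by auto
    have "norm ((1 - x) *\<^sub>R c0 + x *\<^sub>R c1) \<le> \<bar>1 - x\<bar> * norm c0 + \<bar>x\<bar> * norm c1" by (rule norm_triangle_mono) auto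
    also have "\<dots> \<le> 1 * norm c0 + 1 * norm c1" using x by (intro add_mono mult_right_mono) auto
    finally show "norm ((1 - x) *\<^sub>R c0 + x *\<^sub>R c1) \<le> norm c0 + norm c1" by simp
  qed
  show "(\<lambda>x. (1 - x) *\<^sub>R c0 + x *\<^sub>R c1 :: complex) \<in> carr (L2 {0<..<1})"
    "nrm (L2 {0<..<1}) (\<lambda>x. (1 - x) *\<^sub>R c0 + x *\<^sub>R c1 :: complex) \<le> norm c0 + norm c1"
    by (rule L2_unit_interval_bounded[OF m b]; simp)+
qed

text \<open>Both spaces carry the same norm, so only the carrier is enlarged.\<close>

lemma bochner_H10_imp_H1:
  assumes "U \<in> carr (bochner L2 T (H10 {0<..<1::real}))"
  shows "U \<in> carr (bochner L2 T (H1 {0<..<1}))"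
proof -
  have s: "carr (H10 {0<..<1::real}) \<subseteq> carr (H1 {0<..<1})" and n: "nrm (H10 {0<..<1::real}) = nrm (H1 {0<..<1})"
    by (auto simp: H10_def)
  show ?thesis using assms s unfolding bochner_L2_iff strongly_measurable_def n
    by (auto elim!: eventually_mono)
qed

text \<open>The negative part is dominated by |q| and hence lies in \<open>Linf\<close>, where its
  norm is an almost everywhere bound.\<close>

lemma Linf_negative_part:
  fixes q :: "real \<Rightarrow> real"
  assumes q: "q \<in> carr (Linf {0<..<1})"
  shows "AE x in leb {0<..<1}. - q x \<le> nrm (Linf {0<..<1}) (\<lambda>x. max (- q x) 0)"
proof -
  have m: "q \<in> borel_measurable (leb {0<..<1})" by (rule Linf_measurable[OF q])
  then have m': "(\<lambda>x. max (- q x) 0) \<in> borel_measurable (leb {0<..<1})" by measurable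
  have "AE x in leb {0<..<1}. ereal (norm (max (- q x) 0)) \<le> ereal (nrm (Linf {0<..<1}) q)"
    using Linf_AE[OF q] by eventually_elim auto
  then have "esssup (leb {0<..<1}) (\<lambda>x. ereal (norm (max (- q x) 0))) \<le> ereal (nrm (Linf {0<..<1}) q)"
    by (intro esssup_I) (use m' in measurable)
  also have "\<dots> < \<infinity>" by simp
  finally have "(\<lambda>x. max (- q x) 0) \<in> carr (Linf {0<..<1})" using m' by (simp add: Linf_def)
  from Linf_AE[OF this] show ?thesis by eventually_elim auto
qed

lemma slice_nrm_L2:
  fixes F :: "real \<times> real \<Rightarrow> complex"
  assumes F: "F \<in> carr (L2 (QT T))"
  shows "(\<lambda>t. nrm (L2 {0<..<1}) (\<lambda>x. F (t, x))) \<in> carr (L2 {0<..<T})"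
    "nrm (L2 {0<..<T}) (\<lambda>t. nrm (L2 {0<..<1}) (\<lambda>x. F (t, x))) = nrm (L2 (QT T)) F"
proof -
  have i: "integrable (leb (QT T)) (\<lambda>z. (norm (F z))\<^sup>2)" using F by (simp add: L2_iff)
  have j: "integrable (leb {0<..<T}) (\<lambda>t. \<integral>x. (norm (F (t, x)))\<^sup>2 \<partial>leb {0<..<1})"
    using integrable_integral_lebesgue_on_slice[OF _ _ i] by simp
  show "(\<lambda>t. nrm (L2 {0<..<1}) (\<lambda>x. F (t, x))) \<in> carr (L2 {0<..<T})"
    unfolding L2_iff L2_nrm using j by (auto intro: borel_measurable_sqrt borel_measurable_integrable)
  show "nrm (L2 {0<..<T}) (\<lambda>t. nrm (L2 {0<..<1}) (\<lambda>x. F (t, x))) = nrm (L2 (QT T)) F"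
    unfolding L2_nrm using integral_lebesgue_on_slice[OF _ _ i] by simp
qed

text \<open>Records an \<open>L\<^sup>2\<close> bound together with membership, so that both can be derived by one
  syntactic descent through a sum of terms.\<close>

definition L2_le :: "real set \<Rightarrow> (real \<Rightarrow> 'k::{real_normed_field, euclidean_space}) \<Rightarrow> real \<Rightarrow> bool" where
  "L2_le S f C \<longleftrightarrow> f \<in> carr (L2 S) \<and> nrm (L2 S) f \<le> C"

lemma L2_le_nrm: "f \<in> carr (L2 S) \<Longrightarrow> L2_le S f (nrm (L2 S) f)"
  by (simp add: L2_le_def)

lemma L2_le_weaken: "L2_le S f C \<Longrightarrow> C \<le> D \<Longrightarrow> L2_le S f D"
  by (auto simp: L2_le_def)

lemma L2_le_add: "L2_le S f C \<Longrightarrow> L2_le S g D \<Longrightarrow> L2_le S (\<lambda>x. f x + g x) (C + D)"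
  unfolding L2_le_def using L2_add[of f _ g] L2_triangle(1)[of f _ g] by fastforce

lemma L2_le_diff: "L2_le S f C \<Longrightarrow> L2_le S g D \<Longrightarrow> L2_le S (\<lambda>x. f x - g x) (C + D)"
  unfolding L2_le_def using L2_diff[of f _ g] L2_triangle(2)[of f _ g] by fastforce

lemma L2_le_scale:
  fixes f :: "real \<Rightarrow> complex"
  assumes "L2_le S f C" "c \<in> borel_measurable (leb S)" "AE x in leb S. \<bar>c x\<bar> \<le> B" "0 \<le> B"
  shows "L2_le S (\<lambda>x. c x *\<^sub>R f x) (B * C)"
  using L2_times_bounded[OF _ assms(2-4), of f] assms(1) mult_left_mono[OF _ assms(4), of "nrm (L2 S) f" C]
  unfolding L2_le_def by auto

lemma L2_le_cmult:
  fixes c :: real and f :: "real \<Rightarrow> real"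
  assumes "L2_le S f C" "0 \<le> c"
  shows "L2_le S (\<lambda>x. c * f x) (c * C)"
proof -
  have "nrm (L2 S) (\<lambda>x. c * f x) = c * nrm (L2 S) f"
    using assms(2) by (simp add: L2_nrm power_mult_distrib real_sqrt_mult)
  then show ?thesis using assms by (auto simp: L2_le_def L2_cmult mult_left_mono)
qed

lemma L2_le_norm:
  fixes f :: "real \<Rightarrow> complex"
  shows "L2_le S f C \<Longrightarrow> L2_le S (\<lambda>x. norm (f x)) C"
  unfolding L2_le_def by (auto simp: L2_iff L2_nrm)

lemma L2_le_mono:
  assumes "L2_le S g C" "f \<in> borel_measurable (leb S)" "AE x in leb S. norm (f x) \<le> norm (g x)"
  shows "L2_le S f C"
  using L2_mono[OF _ assms(2,3)] assms(1) by (auto simp: L2_le_def)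

text \<open>The estimates use the coefficients of the first problem only; those of the second one enter
  through the differences. Since \<open>\<psi>\<close> is affine in \<open>x\<close>, \<open>V = w - \<psi>\<close> and \<open>w\<close> have the same second
  derivative \<open>Z\<close>.\<close>

locale two_solutions =
  fixes T \<alpha> B1 Qm :: real and a a' b b' b1 :: "real \<times> real \<Rightarrow> real" and q q' :: "real \<Rightarrow> real"
    and f f' u u' :: "real \<times> real \<Rightarrow> complex" and u0 u0' g0 g0' g1 g1' :: "real \<Rightarrow> complex"
  assumes T: "0 < T" and \<alpha>: "0 < \<alpha>"
    and W: "weak_solution T a b q f u0 g0 g1 u" and W': "weak_solution T a' b' q' f' u0' g0' g1' u'"
    and sol: "u \<in> carr (sol_space T)" and sol': "u' \<in> carr (sol_space T)"
    and a: "a \<in> carr (W1inf (QT T))" and a': "a' \<in> carr (W1inf (QT T))" and da: "a - a' \<in> carr (W1inf (QT T))"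
    and lower: "AE z in leb (QT T). \<alpha> \<le> a z"
    and b: "b \<in> carr (bochnerQ Linf T (W1inf {0<..<1}))" and b': "b' \<in> carr (bochnerQ Linf T (W1inf {0<..<1}))"
    and db: "b - b' \<in> carr (bochnerQ Linf T (W1inf {0<..<1}))"
    and b1: "has_wderiv (QT T) (0, 1) b b1" "b1 \<in> carr (Linf (QT T))" "nrm (Linf (QT T)) b1 \<le> B1"
    and q: "q \<in> carr (Linf {0<..<1})" and q': "q' \<in> carr (Linf {0<..<1})" and dq: "q - q' \<in> carr (Linf {0<..<1})"
    and Qm: "nrm (Linf {0<..<1}) (\<lambda>x. max (- q x) 0) \<le> Qm"
    and f: "f \<in> carr (L2 (QT T))" and f': "f' \<in> carr (L2 (QT T))"
    and u0: "u0 \<in> carr (H1 {0<..<1})" "u0' \<in> carr (H1 {0<..<1})"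
    and g0: "g0 \<in> carr (H1 {0<..<T})" "g0' \<in> carr (H1 {0<..<T})"
    and g1: "g1 \<in> carr (H1 {0<..<T})" "g1' \<in> carr (H1 {0<..<T})"
    and corner0: "\<exists>c. has_cont_value 0 1 u0 0 c \<and> has_cont_value 0 T g0 0 c"
      "\<exists>c. has_cont_value 0 1 u0' 0 c \<and> has_cont_value 0 T g0' 0 c"
    and corner1: "\<exists>c. has_cont_value 0 1 u0 1 c \<and> has_cont_value 0 T g1 0 c"
      "\<exists>c. has_cont_value 0 1 u0' 1 c \<and> has_cont_value 0 T g1' 0 c"
begin

section \<open>The lifted difference of the solutions and its initial value\<close>

abbreviation "I \<equiv> {0<..<1::real}"
abbreviation "J \<equiv> {0<..<T}"
abbreviation "MI \<equiv> leb I"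
abbreviation "MJ \<equiv> leb J"
abbreviation "nI h \<equiv> nrm (L2 I) (h :: real \<Rightarrow> complex)"

definition "w = u - u'"
definition "\<gamma>0 = g0 - g0'"
definition "\<gamma>1 = g1 - g1'"
definition "d0 = wderiv J 1 \<gamma>0"
definition "d1 = wderiv J 1 \<gamma>1"
definition "\<kappa> t = \<gamma>1 t - \<gamma>0 t"
definition "\<psi> t x = (1 - x) *\<^sub>R \<gamma>0 t + x *\<^sub>R \<gamma>1 t"
definition "\<psi>t t x = (1 - x) *\<^sub>R d0 t + x *\<^sub>R d1 t"
definition "ut = wderiv (QT T) (1, 0) u"
definition "ut' = wderiv (QT T) (1, 0) u'"
definition "V z = w z - \<psi> (fst z) (snd z)"
text \<open>\<open>p\<close>, \<open>X\<close> and \<open>Z\<close> play the roles of V_t, V_x and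
  V_xx, expressed through the derivatives of the solutions and of the lifting.\<close>

definition "p z = (ut z - ut' z) - \<psi>t (fst z) (snd z)"
definition "X t x = wderiv I 1 (curry w t) x - \<kappa> t"
definition "Z t = wderiv I 1 (wderiv I 1 (curry w t))"
definition "N0 = nrm (H1 J) \<gamma>0"
definition "N1 = nrm (H1 J) \<gamma>1"
text \<open>The coefficients of \<open>ac_sup_bound_L2\<close> on an interval of length
  \<open>T\<close>, added up; they control the traces of the boundary data at time 0.\<close>

definition "CT = 1 / sqrt T + sqrt T"

lemma \<gamma>: "\<gamma>0 \<in> carr (H1 J)" "\<gamma>1 \<in> carr (H1 J)"
  unfolding \<gamma>0_def \<gamma>1_def by (rule H1_diff(1)[OF g0], rule H1_diff(1)[OF g1])

lemma \<gamma>_le: "L2_le J \<gamma>0 N0" "L2_le J \<gamma>1 N1" "L2_le J d0 N0" "L2_le J d1 N1"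
  using H1_wderiv[OF \<gamma>(1)] H1_wderiv[OF \<gamma>(2)] by (auto simp: L2_le_def N0_def N1_def d0_def d1_def H1_nrm real_le_rsqrt)

lemma \<gamma>_L2: "\<gamma>0 \<in> carr (L2 J)" "\<gamma>1 \<in> carr (L2 J)" "d0 \<in> carr (L2 J)" "d1 \<in> carr (L2 J)"
  using \<gamma>_le by (auto simp: L2_le_def)

lemma N_nonneg: "0 \<le> N0" "0 \<le> N1" "0 \<le> CT"
  using T by (auto simp: N0_def N1_def CT_def H1_nrm)

lemma boundary_sum_le: "L2_le J (\<lambda>t. norm (\<gamma>0 t) + norm (\<gamma>1 t)) (N0 + N1)" "L2_le J (\<lambda>t. norm (d0 t) + norm (d1 t)) (N0 + N1)"
  by (intro L2_le_add L2_le_norm \<gamma>_le)+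

lemma lift_L2:
  "(\<lambda>z. \<psi> (fst z) (snd z)) \<in> carr (L2 (QT T))" "nrm (L2 (QT T)) (\<lambda>z. \<psi> (fst z) (snd z)) \<le> N0 + N1"
  "(\<lambda>z. \<psi>t (fst z) (snd z)) \<in> carr (L2 (QT T))" "nrm (L2 (QT T)) (\<lambda>z. \<psi>t (fst z) (snd z)) \<le> N0 + N1"
  unfolding \<psi>_def \<psi>t_def using boundary_lift_L2[OF \<gamma>_L2(1,2)] boundary_lift_L2[OF \<gamma>_L2(3,4)] \<gamma>_le by (auto simp: L2_le_def)

lemma w_L2: "w \<in> carr (L2 (QT T))" and V_L2: "V \<in> carr (L2 (QT T))" and p_L2: "p \<in> carr (L2 (QT T))"
proof -
  note S = sol_space_facts[OF sol] and S' = sol_space_facts[OF sol']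
  show 1: "w \<in> carr (L2 (QT T))" using L2_diff[OF S(3) S'(3)] by (simp add: w_def fun_diff_def)
  have 2: "(\<lambda>z. ut z - ut' z) \<in> carr (L2 (QT T))" using L2_diff[OF S(5) S'(5)] by (simp add: ut_def ut'_def)
  show "V \<in> carr (L2 (QT T))" using L2_diff[OF 1 lift_L2(1)] by (simp add: V_def[abs_def])
  show "p \<in> carr (L2 (QT T))" using L2_diff[OF 2 lift_L2(3)] by (simp add: p_def[abs_def])
qed

lemma w_sol: "w \<in> carr (sol_space T)" and w_t: "AE z in leb (QT T). wderiv (QT T) (1, 0) w z = ut z - ut' z"
  and w_H2: "w \<in> carr (bochnerQ L2 T (H2 I))" and w_H1: "w \<in> carr (bochnerQ L2 T (H1 I))"
proof -
  note S = sol_space_facts[OF sol] and S' = sol_space_facts[OF sol']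
  have b: "(1, 0) \<in> (Basis :: (real \<times> real) set)" by (simp add: Basis_prod_def)
  show H2: "w \<in> carr (bochnerQ L2 T (H2 I))" unfolding w_def by (rule bochnerQ_L2_diff[OF seminormed_H2 S(2) S'(2)])
  show "w \<in> carr (bochnerQ L2 T (H1 I))" unfolding w_def
    by (rule bochnerQ_L2_diff[OF seminormed_H1]) (use W W' in \<open>auto simp: weak_solution_def\<close>)
  have wL: "w \<in> carr (bochnerQ L2 T (L2 I))" unfolding w_def by (rule bochnerQ_L2_diff[OF seminormed_L2 S(1) S'(1)])
  obtain v v' where v: "v \<in> carr (bochnerQ L2 T (L2 I))" "has_wderiv (QT T) (1, 0) u v"
    and v': "v' \<in> carr (bochnerQ L2 T (L2 I))" "has_wderiv (QT T) (1, 0) u' v'" using S(7) S'(7) by blast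
  have d: "has_wderiv (QT T) (1, 0) w (v - v')"
    using has_wderiv_diff[OF v(2) v'(2) borel_rectangle b] by (simp add: w_def fun_diff_def)
  have "v - v' \<in> carr (bochnerQ L2 T (L2 I))" by (rule bochnerQ_L2_diff[OF seminormed_L2 v(1) v'(1)])
  then show "w \<in> carr (sol_space T)" using wL H2 d by (auto simp: sol_space_def inter_space_def H1_L2_def Let_def)
  have "has_wderiv (QT T) (1, 0) w (\<lambda>z. ut z - ut' z)"
    using has_wderiv_diff[OF S(4) S'(4) borel_rectangle b] by (simp add: w_def fun_diff_def ut_def ut'_def)
  from has_wderiv_unique_rectangle[OF has_wderiv_wderiv[OF d] this]
  show "AE z in leb (QT T). wderiv (QT T) (1, 0) w z = ut z - ut' z" .
qed

lemma curry_w: "curry w t = curry u t - curry u' t"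
  by (auto simp: w_def)

lemma w_slice_H2: "AE t in MJ. curry w t \<in> carr (H2 I)" and u'_slice_H2: "AE t in MJ. curry u' t \<in> carr (H2 I)"
  and u_slice_H2: "AE t in MJ. curry u t \<in> carr (H2 I)"
  using sol_space_facts(6)[OF w_sol] sol_space_facts(6)[OF sol'] sol_space_facts(6)[OF sol] by auto

lemma Z_L2: "AE t in MJ. Z t \<in> carr (L2 I)"
  using w_slice_H2 by eventually_elim (simp add: Z_def H1_wderiv(3) H2_wderiv(2))

lemma X_ac: "AE t in MJ. \<exists>y. ac 0 1 y (Z t) \<and> (AE x in MI. X t x = y x)"
  using w_slice_H2
proof eventually_elim
  case (elim t)
  obtain y where y: "ac 0 1 y (Z t)" "AE x in MI. wderiv I 1 (curry w t) x = y x"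
    using H1_ac[OF zero_less_one H2_wderiv(2)[OF elim]] unfolding Z_def by blast
  have "ac 0 1 (\<lambda>x. y x - \<kappa> t) (Z t)" using ac_diff[OF y(1) ac_const[of _ _ "\<kappa> t"]] by simp
  moreover have "AE x in MI. X t x = y x - \<kappa> t" using y(2) by eventually_elim (simp add: X_def)
  ultimately show ?case by blast
qed

abbreviation "lifted v h0 h1 \<equiv> (\<lambda>(t, x). v (t, x) - ((1 - of_real x) * h0 t + of_real x * h1 t)) :: real \<times> real \<Rightarrow> complex"

lemma lifted:
  "lifted u g0 g1 \<in> carr (bochnerQ L2 T (H10 I))" "lifted u' g0' g1' \<in> carr (bochnerQ L2 T (H10 I))"
  "V (t, x) = lifted u g0 g1 (t, x) - lifted u' g0' g1' (t, x)"
  using W W' by (auto simp: weak_solution_def V_def w_def \<psi>_def \<gamma>0_def \<gamma>1_def scaleR_conv_of_real algebra_simps)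

lemma V_H1: "curry V \<in> carr (bochner L2 T (H1 I))"
proof -
  have h: "curry (lifted u g0 g1) \<in> carr (bochner L2 T (H1 I))" "curry (lifted u' g0' g1') \<in> carr (bochner L2 T (H1 I))"
    using lifted(1,2) by (auto simp: bochnerQ_L2_iff intro: bochner_H10_imp_H1)
  have "curry V = (\<lambda>t. curry (lifted u g0 g1) t - curry (lifted u' g0' g1') t)"
    by (intro ext) (simp add: lifted(3) del: case_prod_conv)
  with bochner_L2_diff[OF seminormed_H1 h] show ?thesis by simp
qed

text \<open>The representative of \<open>V\<close> built from that of \<open>w\<close> agrees almost
  everywhere with the difference of the H^1_0 representatives of the two lifted solutions;
  continuity carries the zero boundary values over.\<close>

lemma V_ac: "AE t in MJ. \<exists>v. ac 0 1 v (X t) \<and> v 0 = 0 \<and> v 1 = 0 \<and> (AE x in MI. V (t, x) = v x)"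
proof -
  have "AE t in MJ. curry (lifted u g0 g1) t \<in> carr (H10 I)" "AE t in MJ. curry (lifted u' g0' g1') t \<in> carr (H10 I)"
    using lifted(1,2) by (auto simp: bochnerQ_L2_iff bochner_L2_iff)
  then show ?thesis using w_slice_H2
  proof eventually_elim
    case (elim t)
    obtain F where F: "ac 0 1 F (wderiv I 1 (curry (lifted u g0 g1) t))" "AE x in MI. curry (lifted u g0 g1) t x = F x" "F 0 = 0" "F 1 = 0"
      by (rule H10_ac[OF zero_less_one elim(1)])
    obtain F' where F': "ac 0 1 F' (wderiv I 1 (curry (lifted u' g0' g1') t))" "AE x in MI. curry (lifted u' g0' g1') t x = F' x" "F' 0 = 0" "F' 1 = 0"
      by (rule H10_ac[OF zero_less_one elim(2)])
    obtain y where y: "ac 0 1 y (wderiv I 1 (curry w t))" "AE x in MI. curry w t x = y x"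
      using H1_ac[OF zero_less_one H2_wderiv(1)[OF elim(3)]] by blast
    define v where "v x = y x - ((1 - x) *\<^sub>R \<gamma>0 t + x *\<^sub>R \<gamma>1 t)" for x
    have v: "ac 0 1 v (X t)" using ac_diff[OF y(1) affine_ac[of "\<gamma>0 t" "\<gamma>1 t"]] by (simp add: v_def[abs_def] X_def[abs_def] \<kappa>_def)
    have Vv: "AE x in MI. V (t, x) = v x" using y(2) by eventually_elim (simp add: V_def v_def \<psi>_def)
    have e: "AE x in MI. v x = F x - F' x"
      using Vv F(2) F'(2) by eventually_elim (simp add: lifted(3) del: case_prod_conv)
    note eq = continuous_AE_eq[OF ac_continuous[OF v] ac_continuous[OF ac_diff[OF F(1) F'(1)]] e zero_less_one]
    have "v 0 = 0" "v 1 = 0" using eq[of 0] eq[of 1] F(3,4) F'(3,4) by auto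
    with v Vv show ?case by blast
  qed
qed

text \<open>Measurability in \<open>t\<close> is not evident for the norm of derivatives chosen
  slice by slice. It is recovered by subtracting the squared L^2 norm of \<open>V\<close>,
  measurable by Fubini, from the squared H^1 norm, measurable as a Bochner norm.\<close>

lemma nX: "(\<lambda>t. nI (X t)) \<in> carr (L2 J)"
proof -
  let ?h = "\<lambda>t. nrm (H1 I) (curry V t)"
  have h: "?h \<in> carr (L2 J)" using V_H1 by (simp add: bochner_L2_iff)
  have m[measurable]: "?h \<in> borel_measurable MJ" "(\<lambda>t. nI (\<lambda>x. V (t, x))) \<in> borel_measurable MJ"
    by (rule L2_measurable[OF h], rule L2_measurable[OF slice_nrm_L2(1)[OF V_L2]])
  have e: "AE t in MJ. (?h t)\<^sup>2 = (nI (\<lambda>x. V (t, x)))\<^sup>2 + (nI (X t))\<^sup>2"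
    using V_ac w_slice_H2 
  proof eventually_elim
    case (elim t)
    then obtain v where v: "ac 0 1 v (X t)" "AE x in MI. V (t, x) = v x" by blast
    have "AE x in MI. v x = curry V t x" using v(2) by eventually_elim simp
    from has_wderiv_cong_AE[OF ac_imp_has_wderiv[OF v(1) zero_less_one] _ this, of "X t"]
    have "AE x in MI. wderiv I 1 (curry V t) x = X t x" by (intro wderiv_eq) (simp add: curry_def)
    then have "AE x in MI. (norm (wderiv I 1 (curry V t) x))\<^sup>2 = (norm (X t x))\<^sup>2" by eventually_elim simp
    then have "nI (wderiv I 1 (curry V t)) = nI (X t)"
      unfolding L2_nrm by (subst integral_lebesgue_on_cong_AE(1)) auto
    then show ?case by (simp add: H1_nrm curry_def)
  qed
  have "AE t in MJ. sqrt ((?h t)\<^sup>2 - (nI (\<lambda>x. V (t, x)))\<^sup>2) = nI (X t)" using e by eventually_elim simp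
  then have m: "(\<lambda>t. nI (X t)) \<in> borel_measurable MJ" by (rule borel_measurable_lebesgue_on_AE[rotated 2]) auto
  show ?thesis
  proof (rule L2_bound[OF h m, of 1])
    show "AE t in MJ. norm (nI (X t)) \<le> 1 * norm (?h t)" using e
    proof eventually_elim
      case (elim t)
      then have "(nI (X t))\<^sup>2 \<le> (?h t)\<^sup>2" by simp
      then show ?case using abs_le_square_iff[of "nI (X t)" "?h t"] by simp
    qed
  qed
qed

text \<open>Measurability by subtraction again, now of the squared H^1 norm of \<open>w\<close> from
  its squared H^2 norm.\<close>

lemma nZ: "(\<lambda>t. nI (Z t)) \<in> carr (L2 J)"
proof -
  let ?h = "\<lambda>t. nrm (H2 I) (curry w t)" and ?k = "\<lambda>t. nrm (H1 I) (curry w t)"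
  have h: "?h \<in> carr (L2 J)" "?k \<in> carr (L2 J)" using w_H2 w_H1 by (simp_all add: bochnerQ_L2_iff bochner_L2_iff)
  have m[measurable]: "?h \<in> borel_measurable MJ" "?k \<in> borel_measurable MJ"
    by (rule L2_measurable[OF h(1)], rule L2_measurable[OF h(2)])
  have e: "(?h t)\<^sup>2 = (?k t)\<^sup>2 + (nI (Z t))\<^sup>2" for t by (simp add: H2_nrm H1_nrm Z_def)
  have "nI (Z t) = sqrt ((?h t)\<^sup>2 - (?k t)\<^sup>2)" for t by (simp add: e)
  then have m: "(\<lambda>t. nI (Z t)) \<in> borel_measurable MJ" by simp
  show ?thesis
  proof (rule L2_bound[OF h(1) m, of 1], rule always_eventually, rule allI)
    fix t have "(nI (Z t))\<^sup>2 \<le> (?h t)\<^sup>2" by (simp add: e)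
    then show "norm (nI (Z t)) \<le> 1 * norm (?h t)" using abs_le_square_iff[of "nI (Z t)" "?h t"] by simp
  qed
qed

text \<open>The initial value of \<open>V\<close> is that of \<open>w\<close> minus the affine
  interpolation of the traces of \<open>\<gamma>0\<close> and \<open>\<gamma>1\<close> at time 0;
  compatibility at the two corners makes it vanish at both ends.\<close>

lemma initial_lift:
  obtains v0 v0' where "ac 0 1 v0 v0'" "v0 0 = 0" "v0 1 = 0" "L2_le I v0 (nrm (H1 I) (u0 - u0') + CT * (N0 + N1))"
    "L2_le I v0' (nrm (H1 I) (u0 - u0') + CT * (N0 + N1))"
    "AE x in MI. AE t in MJ. V (t, x) = v0 x + (\<integral>s. p (s, x) \<partial>leb {0<..<t})"
proof -
  let ?U = "u0 - u0'"
  have U: "?U \<in> carr (H1 I)" by (rule H1_diff(1)[OF u0])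
  obtain W0 where W0: "ac 0 T W0 d0" "AE t in MJ. \<gamma>0 t = W0 t" using H1_ac[OF T \<gamma>(1)] unfolding d0_def by blast
  obtain W1 where W1: "ac 0 T W1 d1" "AE t in MJ. \<gamma>1 t = W1 t" using H1_ac[OF T \<gamma>(2)] unfolding d1_def by blast
  obtain U0 where U0: "ac 0 1 U0 (wderiv I 1 ?U)" "AE x in MI. ?U x = U0 x" using H1_ac[OF zero_less_one U] by blast
  obtain c c' where "has_cont_value 0 1 u0 0 c" "has_cont_value 0 T g0 0 c" "has_cont_value 0 1 u0' 0 c'" "has_cont_value 0 T g0' 0 c'"
    using corner0 by blast
  then have "has_cont_value 0 1 ?U 0 (c - c')" "has_cont_value 0 T \<gamma>0 0 (c - c')" unfolding \<gamma>0_def by (auto intro: has_cont_value_diff)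
  from has_cont_value_ac[OF this(1) U0 zero_less_one] has_cont_value_ac[OF this(2) W0 T] T
  have e0: "U0 0 = W0 0" by simp
  obtain c c' where "has_cont_value 0 1 u0 1 c" "has_cont_value 0 T g1 0 c" "has_cont_value 0 1 u0' 1 c'" "has_cont_value 0 T g1' 0 c'"
    using corner1 by blast
  then have "has_cont_value 0 1 ?U 1 (c - c')" "has_cont_value 0 T \<gamma>1 0 (c - c')" unfolding \<gamma>1_def by (auto intro: has_cont_value_diff)
  from has_cont_value_ac[OF this(1) U0 zero_less_one] has_cont_value_ac[OF this(2) W1 T] T
  have e1: "U0 1 = W1 0" by simp
  \<comment> \<open>The sup bound at time 0 controls the traces of the boundary data by their H^1
    norms.\<close>
  have trace: "norm (F 0) \<le> CT * n" if F: "ac 0 T F d" "AE t in MJ. \<gamma> t = F t" "L2_le J \<gamma> n" "L2_le J d n" for F d \<gamma> :: "real \<Rightarrow> complex" and n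
  proof -
    have L: "\<gamma> \<in> carr (L2 J)" "nrm (L2 J) \<gamma> \<le> n" "d \<in> carr (L2 J)" "nrm (L2 J) d \<le> n" using F(3,4) by (auto simp: L2_le_def)
    have "norm (F 0) \<le> 1 / sqrt T * nrm (L2 J) F + sqrt T * nrm (L2 J) d"
      using ac_sup_bound_L2[OF F(1) L(3) _ T, of 0] T by simp
    also have "nrm (L2 J) F = nrm (L2 J) \<gamma>" by (rule L2_cong_AE(2)[OF L(1) _ F(2)]) simp
    also have "1 / sqrt T * nrm (L2 J) \<gamma> + sqrt T * nrm (L2 J) d \<le> 1 / sqrt T * n + sqrt T * n"
      using L T by (intro add_mono mult_left_mono) auto
    finally show ?thesis by (simp add: CT_def distrib_right)
  qed
  note t0 = trace[OF W0 \<gamma>_le(1,3)] and t1 = trace[OF W1 \<gamma>_le(2,4)]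
  define v0 where "v0 x = U0 x - ((1 - x) *\<^sub>R W0 0 + x *\<^sub>R W1 0)" for x
  define v0' where "v0' x = wderiv I 1 ?U x - (W1 0 - W0 0)" for x
  have cn: "L2_le I (\<lambda>x. W1 0 - W0 0) (CT * (N0 + N1))"
  proof -
    have "norm (W1 0 - W0 0) \<le> CT * (N0 + N1)" using norm_triangle_ineq4[of "W1 0" "W0 0"] t0 t1 by (simp add: distrib_left)
    then show ?thesis using L2_unit_interval_bounded[of "\<lambda>x. W1 0 - W0 0" "CT * (N0 + N1)"] N_nonneg by (auto simp: L2_le_def)
  qed
  have af: "L2_le I (\<lambda>x. (1 - x) *\<^sub>R W0 0 + x *\<^sub>R W1 0) (CT * (N0 + N1))"
    using affine_L2[of "W0 0" "W1 0"] t0 t1 by (simp add: L2_le_def distrib_left)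
  note HU = H1_wderiv[OF U]
  have "nI U0 = nI ?U" "U0 \<in> carr (L2 I)" by (rule L2_cong_AE[OF HU(1) _ U0(2)]; simp)+
  then have lU: "L2_le I U0 (nrm (H1 I) ?U)" by (auto simp: L2_le_def H1_nrm real_le_rsqrt)
  have lU': "L2_le I (wderiv I 1 ?U) (nrm (H1 I) ?U)" using HU(3) by (auto simp: L2_le_def H1_nrm real_le_rsqrt)
  have rep: "AE x in MI. AE t in MJ. V (t, x) = v0 x + (\<integral>s. p (s, x) \<partial>leb {0<..<t})"
  proof -
    note S = sol_space_facts[OF sol] and S' = sol_space_facts[OF sol']
    have iv: "has_initial_value T u u0" "has_initial_value T u' u0'" using W W' by (auto simp: weak_solution_def)
    note r = initial_value_primitive(1)[OF T S(3) S(5) S(4) iv(1)] and r' = initial_value_primitive(1)[OF T S'(3) S'(5) S'(4) iv(2)]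
    have int: "AE x in MI. integrable MJ (\<lambda>s. v (s, x))" if "v \<in> carr (L2 (QT T))" for v :: "real \<times> real \<Rightarrow> complex"
      using AE_integrable_lebesgue_on_slice[OF _ _ integrable_lebesgue_on_swap[OF _ _ L2_imp_integrable[OF that finite_lebesgue_on_rectangle]]] by simp
    have J: "AE t in MJ. t \<in> J" by (rule AE_I2) simp
    show ?thesis
      using r r' U0(2) int[OF S(5)] int[OF S'(5)]
    proof eventually_elim
      case (elim x)
      note x = elim
      show ?case using x(1,2) W0(2) W1(2) J
      proof eventually_elim
        case (elim t)
        have sub: "{0<..<t} \<subseteq> J" and t: "t \<in> {0..T}" using elim(5) by auto
        have i: "integrable (leb {0<..<t}) (\<lambda>s. ut (s, x))" "integrable (leb {0<..<t}) (\<lambda>s. ut' (s, x))"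
          "integrable (leb {0<..<t}) d0" "integrable (leb {0<..<t}) d1"
          using x(4,5) ac_integrable[OF W0(1)] ac_integrable[OF W1(1)]
          by (auto simp: ut_def ut'_def intro: integrable_lebesgue_on_subset[OF _ sub])
        have "(\<integral>s. p (s, x) \<partial>leb {0<..<t}) = (\<integral>s. ut (s, x) \<partial>leb {0<..<t}) - (\<integral>s. ut' (s, x) \<partial>leb {0<..<t})
            - ((1 - x) *\<^sub>R (\<integral>s. d0 s \<partial>leb {0<..<t}) + x *\<^sub>R (\<integral>s. d1 s \<partial>leb {0<..<t}))"
          unfolding p_def \<psi>t_def using i by simp
        moreover have "\<gamma>0 t = W0 0 + (\<integral>s. d0 s \<partial>leb {0<..<t})" using elim(3) ac_eq[OF W0(1) t] by simp
        moreover have "\<gamma>1 t = W1 0 + (\<integral>s. d1 s \<partial>leb {0<..<t})" using elim(4) ac_eq[OF W1(1) t] by simp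
        moreover have "u0 x = U0 x + u0' x" using x(3) by (simp add: algebra_simps)
        ultimately show ?case using elim(1,2)
          by (simp add: V_def w_def v0_def \<psi>_def ut_def[symmetric] ut'_def[symmetric] scaleR_add_right)
      qed
    qed
  qed
  show thesis
  proof (rule that[of v0 v0'])
    show "ac 0 1 v0 v0'" using ac_diff[OF U0(1) affine_ac[of "W0 0" "W1 0"]] by (simp add: v0_def[abs_def] v0'_def[abs_def])
    show "v0 0 = 0" "v0 1 = 0" by (simp_all add: v0_def e0 e1)
    show "L2_le I v0 (nrm (H1 I) ?U + CT * (N0 + N1))" unfolding v0_def[abs_def] by (rule L2_le_diff[OF lU af])
    show "L2_le I v0' (nrm (H1 I) ?U + CT * (N0 + N1))" unfolding v0'_def[abs_def] by (rule L2_le_diff[OF lU' cn])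
  qed (rule rep)
qed

end

text \<open>Bounds the solution when all data have norm at most \<open>1\<close>; the four square roots bound the
  \<open>L\<^sup>2\<close> norms of \<open>V\<close>, \<open>p\<close>, \<open>X\<close> and \<open>Z\<close>.\<close>

definition energy_factor :: "real \<Rightarrow> real \<Rightarrow> real \<Rightarrow> real \<Rightarrow> real \<Rightarrow> real \<Rightarrow> real" where
  "energy_factor T \<alpha> A Bm Q K = (let e = exp (2 * K * T); m1 = 2 * (1 + 2 * K * T) * e;
     m2 = 3 * ((A + Bm)\<^sup>2 * (m1 / (2 * \<alpha>)) + Q\<^sup>2 * (4 * T * e) + 2); m3 = 2 / \<alpha> * (m2 / \<alpha> + 1 / 2)
     in 2 * sqrt (4 * T * e) + sqrt (2 * A\<^sup>2 * m3 + 2 * m2) + sqrt (m1 / (2 * \<alpha>)) + sqrt m3 + 4)"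

lemma square_le_imp_le_mult_sqrt:
  assumes "x\<^sup>2 \<le> E\<^sup>2 * m" "0 \<le> E" "0 \<le> (m :: real)"
  shows "x \<le> E * sqrt m"
  by (rule power2_le_imp_le) (use assms in \<open>simp_all add: power_mult_distrib\<close>)

section \<open>Forcing term and stability estimate\<close>

context two_solutions
begin

definition "A = nrm (W1inf (QT T)) a"
definition "Bm = nrm (bochnerQ Linf T (W1inf I)) b"
definition "Q = nrm (Linf I) q"
definition "Da = a - a'"
definition "Db = b - b'"
definition "Dq = q - q'"
definition "Df = f - f'"
definition "\<delta>a = nrm (W1inf (QT T)) Da"
definition "\<delta>b = nrm (bochnerQ Linf T (W1inf I)) Db"
definition "\<delta>q = nrm (Linf I) Dq"
definition "a1 = wderiv (QT T) (0, 1) a"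
definition "Da1 = wderiv (QT T) (0, 1) Da"
definition "y' t = wderiv I 1 (curry u' t)"
definition "z' t = wderiv I 1 (y' t)"
definition "h2 t = nrm (H2 I) (curry u' t)"
text \<open>What is left on the right when the second equation is subtracted from the first:
  differences of the coefficients multiply \<open>u'\<close> and its derivatives, and the last
  bracket is minus the operator of the first problem applied to the lifting, whose second derivative
  in \<open>x\<close> is 0.\<close>

definition "G t x = ((((Df (t, x) + Da (t, x) *\<^sub>R z' t x) + Da1 (t, x) *\<^sub>R y' t x) - Db (t, x) *\<^sub>R y' t x) - Dq x *\<^sub>R u' (t, x))
  + (((a1 (t, x) *\<^sub>R \<kappa> t - b (t, x) *\<^sub>R \<kappa> t) - q x *\<^sub>R \<psi> t x) - \<psi>t t x)"
text \<open>The factor 2 of \<open>\<delta>a\<close> arises because \<open>Da\<close> and its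
  derivative in \<open>x\<close> both occur and are bounded by the same norm; \<open>h2\<close>
  dominates \<open>u'\<close> and its first two derivatives alike.\<close>

definition "\<Gamma> t = nI (\<lambda>x. Df (t, x)) + (2 * \<delta>a + \<delta>b + \<delta>q) * h2 t + (A + Bm + Q) * (norm (\<gamma>0 t) + norm (\<gamma>1 t)) + (norm (d0 t) + norm (d1 t))"
definition "E0 = nrm (L2 (QT T)) Df + (2 * \<delta>a + \<delta>b + \<delta>q) * nrm (bochnerQ L2 T (H2 I)) u' + (A + Bm + Q) * (N0 + N1) + (N0 + N1)"
definition "data_size = E0 + (nrm (H1 I) (u0 - u0') + CT * (N0 + N1))"

lemma nonneg [simp]: "0 \<le> A" "0 \<le> Bm" "0 \<le> Q" "0 \<le> \<delta>a" "0 \<le> \<delta>b" "0 \<le> \<delta>q" "0 \<le> h2 t" "0 \<le> N0" "0 \<le> N1" "0 \<le> CT"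
  by (simp_all add: A_def Bm_def Q_def \<delta>a_def \<delta>b_def \<delta>q_def h2_def H2_nrm N_nonneg)

lemma coefficient_bounds:
  "AE t in MJ. AE x in MI. \<alpha> \<le> a (t, x) \<and> a (t, x) \<le> A \<and> \<bar>a1 (t, x)\<bar> \<le> A \<and>
     \<bar>b (t, x)\<bar> \<le> Bm \<and> \<bar>b1 (t, x)\<bar> \<le> B1 \<and> \<bar>q x\<bar> \<le> Q \<and> - q x \<le> Qm"
proof -
  note WA = W1inf_rectangle[OF a]
  have q0: "AE x in MI. \<bar>q x\<bar> \<le> Q \<and> - q x \<le> Qm"
    using Linf_AE[OF q] Linf_negative_part[OF q] by eventually_elim (use Qm in \<open>auto simp: Q_def\<close>)
  have "AE t in MJ. AE x in MI. \<bar>b (t, x)\<bar> \<le> Bm" using bochnerQ_Linf(1)[OF b] by (simp add: Bm_def)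
  then show ?thesis
    using AE_lebesgue_on_slice[OF _ _ lower, simplified] AE_lebesgue_on_slice[OF _ _ WA(1), simplified]
      AE_lebesgue_on_slice[OF _ _ WA(2), simplified] AE_lebesgue_on_slice[OF _ _ Linf_AE[OF b1(2)], simplified]
  proof eventually_elim
    case (elim t)
    show ?case using elim q0 by eventually_elim (use b1(3) in \<open>auto simp: A_def a1_def\<close>)
  qed
qed

lemma G_le: "AE t in MJ. L2_le I (G t) (\<Gamma> t)"
proof -
  note WA = W1inf_rectangle[OF a] and WD = W1inf_rectangle[OF da, folded Da_def, folded \<delta>a_def Da1_def]
  have DfL: "Df \<in> carr (L2 (QT T))" using L2_diff[OF f f'] by (simp add: Df_def fun_diff_def)
  note meas = measurable_lebesgue_on_slice[OF _ _ WD(4), simplified] measurable_lebesgue_on_slice[OF _ _ WD(5), simplified]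
    measurable_lebesgue_on_slice[OF _ _ bochnerQ_Linf(2)[OF db, folded Db_def], simplified]
    measurable_lebesgue_on_slice[OF _ _ bochnerQ_Linf(2)[OF b], simplified]
    measurable_lebesgue_on_slice[OF _ _ WA(5)[folded a1_def], simplified]
  note bds = AE_lebesgue_on_slice[OF _ _ WD(1), simplified] AE_lebesgue_on_slice[OF _ _ WD(2), simplified]
    bochnerQ_Linf(1)[OF db, folded Db_def, folded \<delta>b_def] coefficient_bounds
  have qm: "q \<in> borel_measurable MI" "Dq \<in> borel_measurable MI" "AE x in MI. \<bar>q x\<bar> \<le> Q" "AE x in MI. \<bar>Dq x\<bar> \<le> \<delta>q"
    using Linf_measurable[OF q] Linf_measurable[OF dq] Linf_AE[OF q] Linf_AE[OF dq] by (simp_all add: Dq_def Q_def \<delta>q_def del: minus_apply)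
  show ?thesis
    using meas bds L2_slice[OF DfL] u'_slice_H2
  proof eventually_elim
    case (elim t)
    note H = H2_wderiv[OF elim(11)]
    have uL: "L2_le I (\<lambda>x. u' (t, x)) (h2 t)" using H1_wderiv(1)[OF H(1)] by (simp add: L2_le_def h2_def H2_nrm real_le_rsqrt curry_def)
    have yL: "L2_le I (y' t) (h2 t)" using H1_wderiv(1)[OF H(2)]
      by (auto simp: L2_le_def h2_def H2_nrm H1_nrm y'_def intro!: real_le_rsqrt)
    have zL: "L2_le I (z' t) (h2 t)" using H1_wderiv(3)[OF H(2)]
      by (auto simp: L2_le_def h2_def H2_nrm H1_nrm y'_def z'_def intro!: real_le_rsqrt)
    let ?k = "norm (\<gamma>0 t) + norm (\<gamma>1 t)"
    have \<kappa>L: "L2_le I (\<lambda>x. \<kappa> t) ?k"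
      using L2_unit_interval_bounded[of "\<lambda>x. \<kappa> t" ?k] norm_triangle_ineq4[of "\<gamma>1 t" "\<gamma>0 t"] by (auto simp: L2_le_def \<kappa>_def)
    have \<psi>L: "L2_le I (\<psi> t) ?k" "L2_le I (\<psi>t t) (norm (d0 t) + norm (d1 t))"
      using affine_L2[of "\<gamma>0 t" "\<gamma>1 t"] affine_L2[of "d0 t" "d1 t"] by (auto simp: L2_le_def \<psi>_def[abs_def] \<psi>t_def[abs_def])
    have bd: "AE x in MI. \<bar>a1 (t, x)\<bar> \<le> A" "AE x in MI. \<bar>b (t, x)\<bar> \<le> Bm" using elim(9) by (auto elim: eventually_mono)
    have fL: "L2_le I (\<lambda>x. Df (t, x)) (nI (\<lambda>x. Df (t, x)))" by (rule L2_le_nrm[OF elim(10)])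
    have "L2_le I (G t) (((((nI (\<lambda>x. Df (t, x)) + \<delta>a * h2 t) + \<delta>a * h2 t) + \<delta>b * h2 t) + \<delta>q * h2 t)
      + (((A * ?k + Bm * ?k) + Q * ?k) + (norm (d0 t) + norm (d1 t))))"
      unfolding G_def[abs_def]
      by (intro L2_le_add L2_le_diff fL L2_le_scale uL yL zL \<kappa>L \<psi>L qm elim bd nonneg)
    then show ?case by (rule L2_le_weaken) (simp add: \<Gamma>_def algebra_simps)
  qed
qed

lemma \<Gamma>_le: "L2_le J \<Gamma> E0"
proof -
  have DfL: "Df \<in> carr (L2 (QT T))" using L2_diff[OF f f'] by (simp add: Df_def fun_diff_def)
  have 1: "L2_le J (\<lambda>t. nI (\<lambda>x. Df (t, x))) (nrm (L2 (QT T)) Df)" using slice_nrm_L2[OF DfL] by (simp add: L2_le_def)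
  have "h2 \<in> carr (L2 J)" using sol_space_facts(2)[OF sol'] by (simp add: bochnerQ_L2_iff bochner_L2_iff h2_def[abs_def])
  then have 2: "L2_le J h2 (nrm (bochnerQ L2 T (H2 I)) u')" by (simp add: L2_le_def L2_nrm bochnerQ_L2_nrm h2_def)
  show ?thesis unfolding \<Gamma>_def[abs_def] E0_def by (intro L2_le_add[OF L2_le_add[OF L2_le_add[OF 1]]] L2_le_cmult 2 boundary_sum_le) simp_all
qed

text \<open>Once the derivatives of the differences are identified almost everywhere, what remains
  is the pointwise algebraic identity \<open>alg\<close>.\<close>

lemma equation:
  "AE t in MJ. AE x in MI. p (t, x) = a (t, x) *\<^sub>R Z t x + a1 (t, x) *\<^sub>R X t x - b (t, x) *\<^sub>R X t x - q x *\<^sub>R V (t, x) + G t x"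
proof -
  have alg: "(a *\<^sub>R uxx + a1 *\<^sub>R ux - b *\<^sub>R ux - q *\<^sub>R u + f) - (a' *\<^sub>R uxx' + a1' *\<^sub>R ux' - b' *\<^sub>R ux' - q' *\<^sub>R u' + f') - pt
    = a *\<^sub>R (uxx - uxx') + a1 *\<^sub>R ((ux - ux') - k) - b *\<^sub>R ((ux - ux') - k) - q *\<^sub>R ((u - u') - ps)
      + (((((f - f') + (a - a') *\<^sub>R uxx') + (a1 - a1') *\<^sub>R ux') - (b - b') *\<^sub>R ux') - (q - q') *\<^sub>R u'
      + (((a1 *\<^sub>R k - b *\<^sub>R k) - q *\<^sub>R ps) - pt))"
    for a a' a1 a1' b b' q q' :: real and u u' ux ux' uxx uxx' f f' pt k ps :: complex
    by (simp add: scaleR_diff_left scaleR_diff_right)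
  have b01: "(0, 1) \<in> (Basis :: (real \<times> real) set)" by (simp add: Basis_prod_def)
  have "has_wderiv (QT T) (0, 1) Da (\<lambda>z. a1 z - wderiv (QT T) (0, 1) a' z)"
    using has_wderiv_diff[OF W1inf_rectangle(3)[OF a] W1inf_rectangle(3)[OF a'] borel_rectangle b01] by (simp add: Da_def a1_def fun_diff_def)
  from has_wderiv_unique_rectangle[OF W1inf_rectangle(3)[OF da, folded Da_def] this]
  have D: "AE t in MJ. AE x in MI. Da1 (t, x) = a1 (t, x) - wderiv (QT T) (0, 1) a' (t, x)"
    using AE_lebesgue_on_slice[of J I "\<lambda>z. Da1 z = a1 z - wderiv (QT T) (0, 1) a' z"] by (simp add: Da1_def)
  show ?thesis
    using weak_solution_strong[OF W sol a b q f] weak_solution_strong[OF W' sol' a' b' q' f'] D u_slice_H2 u'_slice_H2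
  proof eventually_elim
    case (elim t)
    note H = H2_wderiv[OF elim(4)] and H' = H2_wderiv[OF elim(5)]
    have wx: "AE x in MI. wderiv I 1 (curry w t) x = wderiv I 1 (curry u t) x - y' t x"
      unfolding curry_w y'_def by (rule H1_diff(2)[OF H(1) H'(1)])
    have wx': "AE x in MI. (wderiv I 1 (curry u t) - y' t) x = wderiv I 1 (curry w t) x" using wx by eventually_elim simp
    have "AE x in MI. Z t x = wderiv I 1 (wderiv I 1 (curry u t) - y' t) x"
      unfolding Z_def by (rule H1_cong_AE(2)[OF _ wx']) (unfold y'_def, rule H1_diff(1)[OF H(2) H'(2)])
    then have wxx: "AE x in MI. Z t x = wderiv I 1 (wderiv I 1 (curry u t)) x - z' t x"
      using H1_diff(2)[OF H(2) H'(2)] unfolding z'_def y'_def by eventually_elim simp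
    show ?case using elim(1-3) wx wxx
    proof eventually_elim
      case (elim x)
      show ?case
        unfolding p_def V_def X_def fst_conv snd_conv ut_def ut'_def elim(1) elim(2) elim(4) elim(5)
        unfolding w_def minus_apply
          G_def elim(3) Df_def Da_def Db_def Dq_def y'_def[symmetric] z'_def[symmetric] a1_def[symmetric]
        by (rule alg)
    qed
  qed
qed

text \<open>Both summands of the norm contain the L^2 norm of \<open>w\<close>, whence the factor 2.
  The lifting is paid for four times: twice in \<open>w\<close>, once in its time derivative and
  once in its derivative in \<open>x\<close>.\<close>

lemma solution_norm_le:
  "nrm (sol_space T) w \<le> 2 * nrm (L2 (QT T)) V + nrm (L2 (QT T)) p + nrm (L2 J) (\<lambda>t. nI (X t)) + nrm (L2 J) (\<lambda>t. nI (Z t)) + 4 * (N0 + N1)"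
proof -
  let ?n = "nrm (L2 (QT T))" and ?N = "N0 + N1"
  have "?n w = ?n (\<lambda>z. V z + \<psi> (fst z) (snd z))" by (simp add: V_def)
  then have w: "?n w \<le> ?n V + ?N" using L2_triangle(1)[OF V_L2 lift_L2(1)] lift_L2(2) by simp
  have "?n (\<lambda>z. ut z - ut' z) = ?n (\<lambda>z. p z + \<psi>t (fst z) (snd z))" by (simp add: p_def)
  then have ut: "?n (\<lambda>z. ut z - ut' z) \<le> ?n p + ?N" using L2_triangle(1)[OF p_L2 lift_L2(3)] lift_L2(4) by simp
  note S = sol_space_facts[OF w_sol]
  have wt: "?n (wderiv (QT T) (1, 0) w) = ?n (\<lambda>z. ut z - ut' z)"
    by (rule L2_cong_AE(2)[OF S(5) _ w_t, symmetric]) simp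
  have hm: "(\<lambda>t. nrm (H2 I) (curry w t)) \<in> carr (L2 J)" using w_H2 by (simp add: bochnerQ_L2_iff bochner_L2_iff)
  have "L2_le J (\<lambda>t. nrm (H2 I) (curry w t)) ((?n w + (nrm (L2 J) (\<lambda>t. nI (X t)) + ?N)) + nrm (L2 J) (\<lambda>t. nI (Z t)))"
  proof (rule L2_le_mono)
    show "L2_le J (\<lambda>t. (nI (\<lambda>x. w (t, x)) + (nI (X t) + (norm (\<gamma>0 t) + norm (\<gamma>1 t)))) + nI (Z t))
      ((?n w + (nrm (L2 J) (\<lambda>t. nI (X t)) + ?N)) + nrm (L2 J) (\<lambda>t. nI (Z t)))"
      using slice_nrm_L2[OF w_L2] by (intro L2_le_add[OF L2_le_add[OF _ L2_le_add]] L2_le_nrm nX nZ boundary_sum_le) (simp add: L2_le_def)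
    show "(\<lambda>t. nrm (H2 I) (curry w t)) \<in> borel_measurable MJ" by (rule L2_measurable[OF hm])
    show "AE t in MJ. norm (nrm (H2 I) (curry w t)) \<le> norm ((nI (\<lambda>x. w (t, x)) + (nI (X t) + (norm (\<gamma>0 t) + norm (\<gamma>1 t)))) + nI (Z t))"
      using w_slice_H2
    proof eventually_elim
      case (elim t)
      let ?y = "wderiv I 1 (curry w t)"
      have yL: "?y \<in> carr (L2 I)" by (rule H1_wderiv(3)[OF H2_wderiv(1)[OF elim]])
      have nk: "norm (\<kappa> t) \<le> norm (\<gamma>0 t) + norm (\<gamma>1 t)" using norm_triangle_ineq4[of "\<gamma>1 t" "\<gamma>0 t"] by (simp add: \<kappa>_def)
      have kL: "(\<lambda>x. \<kappa> t) \<in> carr (L2 I)" "nI (\<lambda>x. \<kappa> t) \<le> norm (\<gamma>0 t) + norm (\<gamma>1 t)"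
        using L2_unit_interval_bounded[of "\<lambda>x. \<kappa> t" "norm (\<gamma>0 t) + norm (\<gamma>1 t)"] nk by auto
      have XL: "X t \<in> carr (L2 I)" using L2_diff[OF yL kL(1)] by (simp add: X_def[abs_def])
      have "nI ?y = nI (\<lambda>x. X t x + \<kappa> t)" by (simp add: X_def)
      then have y: "nI ?y \<le> nI (X t) + (norm (\<gamma>0 t) + norm (\<gamma>1 t))" using L2_triangle(1)[OF XL kL(1)] kL(2) by simp
      have "nrm (H2 I) (curry w t) \<le> nI (curry w t) + nrm (H1 I) ?y" unfolding H2_nrm
        by (rule sqrt_sum_squares_le_sum) (simp_all add: H1_nrm)
      moreover have "nrm (H1 I) ?y \<le> nI ?y + nI (Z t)" unfolding H1_nrm Z_def by (rule sqrt_sum_squares_le_sum) simp_all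
      moreover have "0 \<le> nrm (H2 I) (curry w t)" by (simp add: H2_nrm)
      ultimately show ?case using y by (simp add: curry_def)
    qed
  qed
  then have "nrm (bochnerQ L2 T (H2 I)) w \<le> ((?n w + (nrm (L2 J) (\<lambda>t. nI (X t)) + ?N)) + nrm (L2 J) (\<lambda>t. nI (Z t)))"
    by (simp add: L2_le_def L2_nrm bochnerQ_L2_nrm)
  moreover have "nrm (H1_L2 T) w \<le> ?n w + ?n (\<lambda>z. ut z - ut' z)"
    unfolding H1_L2_def Let_def by (simp add: L2_QT_nrm[OF w_L2] L2_QT_nrm[OF S(5)] wt sqrt_sum_squares_le_sum)
  ultimately show ?thesis using w ut by (simp add: sol_space_def inter_space_def)
qed

theorem difference_estimate: "nrm (sol_space T) w \<le> energy_factor T \<alpha> A Bm Q (B1 + 2 * Qm + 1) * data_size"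
proof -
  let ?E = data_size
  obtain v0 v0' where v0: "ac 0 1 v0 v0'" "v0 0 = 0" "v0 1 = 0" "L2_le I v0 (nrm (H1 I) (u0 - u0') + CT * (N0 + N1))"
    "L2_le I v0' (nrm (H1 I) (u0 - u0') + CT * (N0 + N1))"
    "AE x in MI. AE t in MJ. V (t, x) = v0 x + (\<integral>s. p (s, x) \<partial>leb {0<..<t})"
    by (rule initial_lift)
  note fQ = finite_lebesgue_on_rectangle[of 0 T 0 1]
  have bm: "b \<in> borel_measurable (leb (QT T))" by (rule bochnerQ_Linf(2)[OF b])
  \<comment> \<open>The Bochner norm bounds slices only; joint measurability of \<open>b\<close>
    turns this into a bound on the rectangle.\<close>
  have bAE: "AE z in leb (QT T). norm (b z) \<le> Bm"
    using bochnerQ_Linf(1)[OF b] by (intro AE_norm_le_pair[OF _ _ bm]) (simp_all add: Bm_def)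
  have B1: "0 \<le> B1" using b1(3) Linf_nrm_nonneg[of "QT T" b1] by linarith
  have Qm0: "0 \<le> Qm" using Qm Linf_nrm_nonneg[of I "\<lambda>x. max (- q x) 0"] by linarith
  have v0L: "v0' \<in> carr (L2 I)" and \<Gamma>L: "\<Gamma> \<in> carr (L2 J)" using v0(5) \<Gamma>_le by (simp_all add: L2_le_def)
  note WA = W1inf_rectangle[OF a]
  have ints: "integrable (leb (QT T)) a" "integrable (leb (QT T)) a1" "integrable (leb (QT T)) b" "integrable (leb (QT T)) b1"
    using Linf_integrable[OF fQ WA(4), of A] Linf_integrable[OF fQ WA(5), of A] Linf_integrable[OF fQ bm bAE]
      Linf_integrable[OF fQ Linf_measurable[OF b1(2)] Linf_AE[OF b1(2)]] WA(1,2) by (simp_all add: A_def a1_def)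
  \<comment> \<open>The norm in \<open>W1inf\<close> bounds \<open>a\<close> as well as its
    derivative in \<open>x\<close>, so \<open>A\<close> takes both places.\<close>
  interpret pp: parabolic_problem T \<alpha> A A Bm B1 Q Qm a a1 b b1 q V p v0 v0' X Z G \<Gamma>
  proof
    show "AE t in MJ. \<exists>c. ac 0 1 c (\<lambda>x. a1 (t, x)) \<and> (AE x in MI. a (t, x) = c x)"
      by (rule slice_x_ac[OF ints(1,2) WA(3)[folded a1_def]])
    show "AE t in MJ. \<exists>c. ac 0 1 c (\<lambda>x. b1 (t, x)) \<and> (AE x in MI. b (t, x) = c x)"
      by (rule slice_x_ac[OF ints(3,4) b1(1)])
    show "AE t in MJ. G t \<in> carr (L2 I) \<and> nI (G t) \<le> \<Gamma> t" using G_le by (simp add: L2_le_def)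
  qed (rule T \<alpha> nonneg B1 Qm0 V_L2 p_L2 v0(1-3,6) v0L V_ac X_ac Z_L2 nX nZ Linf_measurable[OF q] coefficient_bounds \<Gamma>L equation)+
  define K where "K = B1 + 2 * Qm + 1"
  have K: "pp.Kc = K" by (simp add: K_def pp.Kc_def)
  define e where "e = exp (2 * K * T)"
  \<comment> \<open>The bounds \<open>D1\<close>, \<open>D2\<close> and \<open>D3\<close> are linear
    in the squared data. \<open>m1\<close>, \<open>m2\<close> and \<open>m3\<close> are their values
    for \<open>D0\<close> equal to 2 and an initial derivative of norm 1, so each bound becomes the
    squared data size times one of these.\<close>
  define m1 where "m1 = 2 * (1 + 2 * K * T) * e"
  define m2 where "m2 = 3 * ((A + Bm)\<^sup>2 * (m1 / (2 * \<alpha>)) + Q\<^sup>2 * (4 * T * e) + 2)"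
  define m3 where "m3 = 2 / \<alpha> * (m2 / \<alpha> + 1 / 2)"
  have K0: "0 \<le> K" using B1 Qm0 by (simp add: K_def)
  have e0: "0 < e" by (simp add: e_def)
  have m: "0 \<le> m1" "0 \<le> m2" "0 \<le> m3" using K0 e0 T \<alpha> by (simp_all add: m1_def m2_def m3_def)
  have E0: "0 \<le> E0" unfolding E0_def by (intro add_nonneg_nonneg mult_nonneg_nonneg) (simp_all add: bochnerQ_L2_nrm)
  have U: "0 \<le> nrm (H1 I) (u0 - u0') + CT * (N0 + N1)" by (simp add: H1_nrm)
  have E: "0 \<le> ?E" using E0 U by (simp add: data_size_def)
  have leE: "nI v0 \<le> ?E" "nI v0' \<le> ?E" "nrm (L2 J) \<Gamma> \<le> ?E" using v0(4,5) \<Gamma>_le E0 U by (auto simp: L2_le_def data_size_def)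
  have NE: "N0 + N1 \<le> ?E"
  proof -
    have "0 \<le> nrm (L2 (QT T)) Df + (2 * \<delta>a + \<delta>b + \<delta>q) * nrm (bochnerQ L2 T (H2 I)) u' + (A + Bm + Q) * (N0 + N1)"
      by (intro add_nonneg_nonneg mult_nonneg_nonneg) (simp_all add: bochnerQ_L2_nrm)
    then show ?thesis using U by (simp add: data_size_def E0_def)
  qed
  have "(\<integral>t. (\<Gamma> t)\<^sup>2 \<partial>MJ) = (nrm (L2 J) \<Gamma>)\<^sup>2" by (simp add: L2_nrm_sq)
  then have D0: "pp.D0 \<le> 2 * ?E\<^sup>2" unfolding pp.D0_def using power_mono[OF leE(1), of 2] power_mono[OF leE(3), of 2] by simp
  have v0'E: "(nI v0')\<^sup>2 \<le> ?E\<^sup>2" using leE(2) by (intro power_mono) auto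
  have D1: "pp.D1 \<le> ?E\<^sup>2 * m1"
  proof -
    have "pp.D1 = pp.D0 * ((1 + 2 * K * T) * e)" by (simp add: pp.D1_def K e_def)
    also have "\<dots> \<le> (2 * ?E\<^sup>2) * ((1 + 2 * K * T) * e)" using K0 T e0 by (intro mult_right_mono[OF D0]) simp
    also have "\<dots> = ?E\<^sup>2 * m1" by (simp add: m1_def algebra_simps)
    finally show ?thesis .
  qed
  have Y: "2 * T * pp.D0 * e \<le> ?E\<^sup>2 * (4 * T * e)"
  proof -
    have "2 * T * e * pp.D0 \<le> 2 * T * e * (2 * ?E\<^sup>2)" using T e0 by (intro mult_left_mono[OF D0]) simp
    then show ?thesis by (simp add: mult_ac)
  qed
  have D2: "pp.D2 \<le> ?E\<^sup>2 * m2"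
  proof -
    have "(A + Bm)\<^sup>2 * (pp.D1 / (2 * \<alpha>)) \<le> (A + Bm)\<^sup>2 * (?E\<^sup>2 * m1 / (2 * \<alpha>))"
      using D1 \<alpha> by (intro mult_left_mono divide_right_mono) simp_all
    moreover have "Q\<^sup>2 * (2 * T * pp.D0 * e) \<le> Q\<^sup>2 * (?E\<^sup>2 * (4 * T * e))" by (rule mult_left_mono[OF Y]) simp
    ultimately have "(A + Bm)\<^sup>2 * (pp.D1 / (2 * \<alpha>)) + Q\<^sup>2 * (2 * T * pp.D0 * e) + pp.D0
        \<le> (A + Bm)\<^sup>2 * (?E\<^sup>2 * m1 / (2 * \<alpha>)) + Q\<^sup>2 * (?E\<^sup>2 * (4 * T * e)) + 2 * ?E\<^sup>2"
      using D0 by (intro add_mono)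
    then have "pp.D2 \<le> 3 * ((A + Bm)\<^sup>2 * (?E\<^sup>2 * m1 / (2 * \<alpha>)) + Q\<^sup>2 * (?E\<^sup>2 * (4 * T * e)) + 2 * ?E\<^sup>2)"
      unfolding pp.D2_def K e_def[symmetric] by (rule mult_left_mono) simp
    also have "\<dots> = ?E\<^sup>2 * m2" by (simp add: m2_def algebra_simps)
    finally show ?thesis .
  qed
  have D3: "pp.D3 \<le> ?E\<^sup>2 * m3"
  proof -
    have "pp.D2 / \<alpha> + (nI v0')\<^sup>2 / 2 \<le> ?E\<^sup>2 * m2 / \<alpha> + ?E\<^sup>2 / 2" using D2 v0'E \<alpha> by (intro add_mono divide_right_mono) simp_all
    then have "pp.D3 \<le> 2 / \<alpha> * (?E\<^sup>2 * m2 / \<alpha> + ?E\<^sup>2 / 2)" unfolding pp.D3_def using \<alpha> by (intro mult_left_mono) simp_all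
    also have "\<dots> = ?E\<^sup>2 * m3" by (simp add: m3_def algebra_simps)
    finally show ?thesis .
  qed
  have nV: "nrm (L2 (QT T)) V \<le> ?E * sqrt (4 * T * e)"
  proof (rule square_le_imp_le_mult_sqrt[OF _ E])
    have "(nrm (L2 (QT T)) V)\<^sup>2 = (\<integral>t. (nI (\<lambda>x. V (t, x)))\<^sup>2 \<partial>MJ)"
      using slice_nrm_L2(2)[OF V_L2] L2_nrm_sq[of J "\<lambda>t. nI (\<lambda>x. V (t, x))"] by simp
    also have "\<dots> = (\<integral>t. pp.ysq t \<partial>MJ)" using pp.ysq_eq by (intro integral_lebesgue_on_cong_AE(1)) (auto elim: eventually_mono)
    also have "\<dots> \<le> ?E\<^sup>2 * (4 * T * e)" using pp.integral_ysq Y unfolding K e_def[symmetric] by linarith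
    finally show "(nrm (L2 (QT T)) V)\<^sup>2 \<le> ?E\<^sup>2 * (4 * T * e)" .
  qed (use T e0 in simp)
  have nX': "nrm (L2 J) (\<lambda>t. nI (X t)) \<le> ?E * sqrt (m1 / (2 * \<alpha>))"
  proof (rule square_le_imp_le_mult_sqrt[OF _ E])
    have "2 * \<alpha> * (nrm (L2 J) (\<lambda>t. nI (X t)))\<^sup>2 \<le> ?E\<^sup>2 * m1" using pp.gradient_bound D1 by (simp add: L2_nrm_sq)
    then show "(nrm (L2 J) (\<lambda>t. nI (X t)))\<^sup>2 \<le> ?E\<^sup>2 * (m1 / (2 * \<alpha>))" using \<alpha> by (simp add: field_simps)
  qed (use m \<alpha> in simp)
  have nZ': "nrm (L2 J) (\<lambda>t. nI (Z t)) \<le> ?E * sqrt m3"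
    by (rule square_le_imp_le_mult_sqrt[OF _ E m(3)]) (use pp.second_derivative_bound D3 in \<open>simp add: L2_nrm_sq\<close>)
  have np: "nrm (L2 (QT T)) p \<le> ?E * sqrt (2 * A\<^sup>2 * m3 + 2 * m2)"
  proof (rule square_le_imp_le_mult_sqrt[OF _ E])
    have "2 * A\<^sup>2 * pp.D3 \<le> 2 * A\<^sup>2 * (?E\<^sup>2 * m3)" using D3 by (intro mult_left_mono) simp_all
    then have "(nrm (L2 (QT T)) p)\<^sup>2 \<le> 2 * A\<^sup>2 * (?E\<^sup>2 * m3) + 2 * (?E\<^sup>2 * m2)" using pp.time_derivative_bound D2 by (simp add: L2_nrm_sq)
    then show "(nrm (L2 (QT T)) p)\<^sup>2 \<le> ?E\<^sup>2 * (2 * A\<^sup>2 * m3 + 2 * m2)" by (simp add: algebra_simps)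
  qed (use m in simp)
  have "nrm (sol_space T) w \<le> 2 * (?E * sqrt (4 * T * e)) + ?E * sqrt (2 * A\<^sup>2 * m3 + 2 * m2) + ?E * sqrt (m1 / (2 * \<alpha>)) + ?E * sqrt m3 + 4 * ?E"
    by (rule order_trans[OF solution_norm_le]) (intro add_mono mult_left_mono nV np nX' nZ' NE; simp)
  also have "\<dots> = energy_factor T \<alpha> A Bm Q K * ?E"
    unfolding energy_factor_def Let_def e_def[symmetric] m1_def[symmetric] m2_def[symmetric] m3_def[symmetric] by (simp add: algebra_simps)
  finally show ?thesis by (simp add: K_def)
qed

end

section \<open>Moderate and negligible nets\<close>

text \<open>Moderateness of real-valued nets, with natural powers of 1 / \<epsilon>, whose products
  and comparisons are simpler than those of \<open>powr\<close>.\<close>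

definition moderate :: "(real \<Rightarrow> real) \<Rightarrow> bool" where
  "moderate f \<longleftrightarrow> (\<exists>C\<ge>0. \<exists>N::nat. \<forall>\<epsilon>\<in>{0<..1}. \<bar>f \<epsilon>\<bar> \<le> C * (1 / \<epsilon>) ^ N)"

definition negligible_rate :: "(real \<Rightarrow> real) \<Rightarrow> bool" where
  "negligible_rate f \<longleftrightarrow> (\<forall>m::nat. \<exists>C\<ge>0. \<forall>\<epsilon>\<in>{0<..1}. \<bar>f \<epsilon>\<bar> \<le> C * \<epsilon> ^ m)"

lemma moderateI:
  "0 \<le> C \<Longrightarrow> (\<And>\<epsilon>. \<epsilon> \<in> {0<..1} \<Longrightarrow> \<bar>f \<epsilon>\<bar> \<le> C * (1 / \<epsilon>) ^ N) \<Longrightarrow> moderate f"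
  unfolding moderate_def by blast

lemma moderate_mono:
  assumes "moderate g" "\<And>\<epsilon>. \<epsilon> \<in> {0<..1} \<Longrightarrow> \<bar>f \<epsilon>\<bar> \<le> \<bar>g \<epsilon>\<bar>" shows "moderate f"
  using assms unfolding moderate_def by (meson order_trans)

lemma moderate_const: "moderate (\<lambda>_. c)"
  unfolding moderate_def by (rule exI[of _ "\<bar>c\<bar>"]) (auto intro: exI[of _ 0])

lemma moderate_mult:
  assumes "moderate f" "moderate g" shows "moderate (\<lambda>\<epsilon>. f \<epsilon> * g \<epsilon>)"
proof -
  obtain C N where 1: "0 \<le> C" "\<And>\<epsilon>. \<epsilon> \<in> {0<..1} \<Longrightarrow> \<bar>f \<epsilon>\<bar> \<le> C * (1 / \<epsilon>) ^ N" using assms(1) unfolding moderate_def by blast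
  obtain D M where 2: "0 \<le> D" "\<And>\<epsilon>. \<epsilon> \<in> {0<..1} \<Longrightarrow> \<bar>g \<epsilon>\<bar> \<le> D * (1 / \<epsilon>) ^ M" using assms(2) unfolding moderate_def by blast
  have "\<bar>f \<epsilon> * g \<epsilon>\<bar> \<le> C * D * (1 / \<epsilon>) ^ (N + M)" if "\<epsilon> \<in> {0<..1}" for \<epsilon>
  proof -
    have "\<bar>f \<epsilon> * g \<epsilon>\<bar> \<le> (C * (1 / \<epsilon>) ^ N) * (D * (1 / \<epsilon>) ^ M)"
      unfolding abs_mult using that 1 2 by (intro mult_mono) auto
    then show ?thesis unfolding power_add by (simp only: mult_ac)
  qed
  with 1(1) 2(1) show ?thesis by (intro moderateI[of "C * D"]) auto
qed

lemma moderate_add: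
  assumes "moderate f" "moderate g" shows "moderate (\<lambda>\<epsilon>. f \<epsilon> + g \<epsilon>)"
proof -
  obtain C N where 1: "0 \<le> C" "\<And>\<epsilon>. \<epsilon> \<in> {0<..1} \<Longrightarrow> \<bar>f \<epsilon>\<bar> \<le> C * (1 / \<epsilon>) ^ N" using assms(1) unfolding moderate_def by blast
  obtain D M where 2: "0 \<le> D" "\<And>\<epsilon>. \<epsilon> \<in> {0<..1} \<Longrightarrow> \<bar>g \<epsilon>\<bar> \<le> D * (1 / \<epsilon>) ^ M" using assms(2) unfolding moderate_def by blast
  have "\<bar>f \<epsilon> + g \<epsilon>\<bar> \<le> (C + D) * (1 / \<epsilon>) ^ (N + M)" if e: "\<epsilon> \<in> {0<..1}" for \<epsilon>
  proof -
    have o: "1 \<le> 1 / \<epsilon>" using e by simp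
    have "\<bar>f \<epsilon> + g \<epsilon>\<bar> \<le> C * (1 / \<epsilon>) ^ N + D * (1 / \<epsilon>) ^ M" using 1(2)[OF e] 2(2)[OF e] by linarith
    also have "\<dots> \<le> C * (1 / \<epsilon>) ^ (N + M) + D * (1 / \<epsilon>) ^ (N + M)"
      using 1 2 o by (intro add_mono mult_left_mono power_increasing) auto
    finally show ?thesis by (simp only: distrib_right)
  qed
  with 1(1) 2(1) show ?thesis by (intro moderateI[of "C + D"]) auto
qed

lemma moderate_divide: "moderate f \<Longrightarrow> moderate (\<lambda>\<epsilon>. f \<epsilon> / c)"
  unfolding divide_inverse by (rule moderate_mult[OF _ moderate_const])

lemma moderate_power2: "moderate f \<Longrightarrow> moderate (\<lambda>\<epsilon>. (f \<epsilon>)\<^sup>2)"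
  unfolding power2_eq_square by (rule moderate_mult)

text \<open>The bound 1 + f^2 dominates the root for small and for large values alike; the absolute
  value enters because \<open>sqrt\<close> is an odd function here.\<close>

lemma moderate_sqrt:
  assumes "moderate f" shows "moderate (\<lambda>\<epsilon>. sqrt (f \<epsilon>))"
proof (rule moderate_mono)
  show "moderate (\<lambda>\<epsilon>. 1 + f \<epsilon> * f \<epsilon>)" by (intro moderate_add moderate_mult moderate_const assms)
  fix \<epsilon>
  have "\<bar>sqrt (f \<epsilon>)\<bar> = sqrt \<bar>f \<epsilon>\<bar>" by (simp add: real_sqrt_abs2 abs_if real_sqrt_minus)
  also have "\<dots> \<le> 1 + f \<epsilon> * f \<epsilon>"
  proof (rule real_le_lsqrt)
    have "\<bar>f \<epsilon>\<bar> \<le> 1 + f \<epsilon> * f \<epsilon>" using zero_le_square[of "\<bar>f \<epsilon>\<bar> - 1"] by (simp add: algebra_simps)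
    also have "\<dots> \<le> (1 + f \<epsilon> * f \<epsilon>)\<^sup>2" by (rule self_le_power) simp_all
    finally show "\<bar>f \<epsilon>\<bar> \<le> (1 + f \<epsilon> * f \<epsilon>)\<^sup>2" .
  qed simp_all
  finally show "\<bar>sqrt (f \<epsilon>)\<bar> \<le> \<bar>1 + f \<epsilon> * f \<epsilon>\<bar>" by simp
qed

text \<open>Here logarithmic growth is decisive: exp (d |ln \<epsilon>|) is \<epsilon> to the power
  -d on (0, 1], and \<open>N\<close> rounds |d| up to a natural exponent.\<close>

lemma moderate_exp_ln: "moderate (\<lambda>\<epsilon>. exp (c + d * \<bar>ln \<epsilon>\<bar>))"
proof -
  define N where "N = nat \<lceil>\<bar>d\<bar>\<rceil>"
  have N: "d \<le> real N" unfolding N_def by linarith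
  have "exp (c + d * \<bar>ln \<epsilon>\<bar>) \<le> exp c * (1 / \<epsilon>) ^ N" if e: "\<epsilon> \<in> {0<..1}" for \<epsilon>
  proof -
    have l: "\<bar>ln \<epsilon>\<bar> = ln (1 / \<epsilon>)" using e by (simp add: ln_div)
    have "d * \<bar>ln \<epsilon>\<bar> \<le> real N * ln (1 / \<epsilon>)" unfolding l[symmetric] using N by (intro mult_right_mono) auto
    then have "exp (d * \<bar>ln \<epsilon>\<bar>) \<le> exp (real N * ln (1 / \<epsilon>))" by simp
    also have "\<dots> = (1 / \<epsilon>) ^ N" using e by (simp add: exp_of_nat_mult)
    finally show ?thesis by (simp add: exp_add)
  qed
  then show ?thesis by (intro moderateI[of "exp c" _ N]) (simp_all only: abs_exp_cancel exp_ge_zero)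
qed

lemma moderate_abs_ln: "moderate (\<lambda>\<epsilon>. \<bar>ln \<epsilon>\<bar>)"
proof (rule moderate_mono[OF moderate_exp_ln[of 0 1]])
  fix \<epsilon> :: real
  have "\<bar>ln \<epsilon>\<bar> \<le> exp \<bar>ln \<epsilon>\<bar>" using exp_ge_add_one_self[of "\<bar>ln \<epsilon>\<bar>"] by linarith
  then show "\<bar>\<bar>ln \<epsilon>\<bar>\<bar> \<le> \<bar>exp (0 + 1 * \<bar>ln \<epsilon>\<bar>)\<bar>" by simp
qed

lemma negligible_rate_add:
  assumes "negligible_rate f" "negligible_rate g" shows "negligible_rate (\<lambda>\<epsilon>. f \<epsilon> + g \<epsilon>)"
  unfolding negligible_rate_def
proof
  fix m
  obtain C where C: "0 \<le> C" "\<And>\<epsilon>. \<epsilon> \<in> {0<..1} \<Longrightarrow> \<bar>f \<epsilon>\<bar> \<le> C * \<epsilon> ^ m" using assms(1) unfolding negligible_rate_def by blast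
  obtain D where D: "0 \<le> D" "\<And>\<epsilon>. \<epsilon> \<in> {0<..1} \<Longrightarrow> \<bar>g \<epsilon>\<bar> \<le> D * \<epsilon> ^ m" using assms(2) unfolding negligible_rate_def by blast
  have "\<bar>f \<epsilon> + g \<epsilon>\<bar> \<le> (C + D) * \<epsilon> ^ m" if "\<epsilon> \<in> {0<..1}" for \<epsilon>
    using C(2)[OF that] D(2)[OF that] by (simp add: distrib_right)
  then show "\<exists>C\<ge>0. \<forall>\<epsilon>\<in>{0<..1}. \<bar>f \<epsilon> + g \<epsilon>\<bar> \<le> C * \<epsilon> ^ m" using C D by (intro exI[of _ "C + D"]) auto
qed

text \<open>Growth of order \<open>N\<close> in \<open>f\<close> is compensated by asking
  \<open>g\<close> for decay of order N + m.\<close>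

lemma negligible_rate_mult:
  assumes "moderate f" "negligible_rate g" shows "negligible_rate (\<lambda>\<epsilon>. f \<epsilon> * g \<epsilon>)"
  unfolding negligible_rate_def
proof
  fix m
  obtain C N where C: "0 \<le> C" "\<And>\<epsilon>. \<epsilon> \<in> {0<..1} \<Longrightarrow> \<bar>f \<epsilon>\<bar> \<le> C * (1 / \<epsilon>) ^ N" using assms(1) unfolding moderate_def by blast
  obtain D where D: "0 \<le> D" "\<And>\<epsilon>. \<epsilon> \<in> {0<..1} \<Longrightarrow> \<bar>g \<epsilon>\<bar> \<le> D * \<epsilon> ^ (N + m)" using assms(2) unfolding negligible_rate_def by blast
  have "\<bar>f \<epsilon> * g \<epsilon>\<bar> \<le> C * D * \<epsilon> ^ m" if e: "\<epsilon> \<in> {0<..1}" for \<epsilon>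
  proof -
    have "\<bar>f \<epsilon> * g \<epsilon>\<bar> \<le> (C * (1 / \<epsilon>) ^ N) * (D * \<epsilon> ^ (N + m))"
      unfolding abs_mult using e C D by (intro mult_mono) auto
    also have "\<dots> = C * D * \<epsilon> ^ m" using e by (simp add: power_add power_divide)
    finally show ?thesis .
  qed
  then show "\<exists>C\<ge>0. \<forall>\<epsilon>\<in>{0<..1}. \<bar>f \<epsilon> * g \<epsilon>\<bar> \<le> C * \<epsilon> ^ m" using C D by (intro exI[of _ "C * D"]) auto
qed

lemma moderate_netD:
  assumes "moderate_net X v" "\<And>\<epsilon>. 0 \<le> nrm X (v \<epsilon>)" shows "moderate (\<lambda>\<epsilon>. nrm X (v \<epsilon>))"
proof -
  obtain C N where C: "0 < C" "\<And>\<epsilon>. \<epsilon> \<in> {0<..1} \<Longrightarrow> nrm X (v \<epsilon>) \<le> C * \<epsilon> powr (- real N)"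
    using assms(1) unfolding moderate_net_def by blast
  have "\<epsilon> powr (- real N) = (1 / \<epsilon>) ^ N" if "\<epsilon> \<in> {0<..1}" for \<epsilon>
    using that by (simp add: powr_minus powr_realpow power_one_over inverse_eq_divide)
  then show ?thesis using C assms(2) by (intro moderateI[of C _ N]) auto
qed

lemma negligible_netD:
  assumes "negligible_net X v" "\<And>\<epsilon>. 0 \<le> nrm X (v \<epsilon>)" shows "negligible_rate (\<lambda>\<epsilon>. nrm X (v \<epsilon>))"
  using assms unfolding negligible_net_def negligible_rate_def by (metis abs_of_nonneg less_imp_le)

text \<open>The exponent is affine in |ln \<epsilon>|, so the exponential is moderate; all other
  operations in the factor preserve moderateness.\<close>

lemma moderate_energy_factor:
  assumes "moderate A" "moderate Bm" "moderate Q"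
  shows "moderate (\<lambda>\<epsilon>. energy_factor T \<alpha> (A \<epsilon>) (Bm \<epsilon>) (Q \<epsilon>) (c + d * \<bar>ln \<epsilon>\<bar>))"
proof -
  have "exp (2 * (c + d * \<bar>ln \<epsilon>\<bar>) * T) = exp (2 * T * c + 2 * T * d * \<bar>ln \<epsilon>\<bar>)" for \<epsilon> by (simp add: algebra_simps)
  then have e: "moderate (\<lambda>\<epsilon>. exp (2 * (c + d * \<bar>ln \<epsilon>\<bar>) * T))" using moderate_exp_ln[of "2 * T * c" "2 * T * d"] by simp
  show ?thesis unfolding energy_factor_def Let_def
    by (intro moderate_add moderate_mult moderate_divide moderate_sqrt moderate_power2 moderate_const moderate_abs_ln e assms)
qed

lemma H1_nrm_nonneg: "0 \<le> nrm (H1 \<Omega>) u"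
  by (simp add: H1_def sum_nonneg)

lemma bochnerQ_L2_nrm_nonneg: "0 \<le> nrm (bochnerQ L2 T X) u"
  by (simp add: bochnerQ_L2_nrm)

lemma bochnerQ_L2_le_sol_space: "nrm (bochnerQ L2 T (H2 {0<..<1})) u \<le> nrm (sol_space T) u"
  by (simp add: sol_space_def inter_space_def H1_L2_def Let_def)

lemma sol_space_nrm_nonneg: "0 \<le> nrm (sol_space T) u"
  using bochnerQ_L2_le_sol_space[of T u] by (rule order_trans[OF bochnerQ_L2_nrm_nonneg])

theorem theorem3p3:
  fixes T :: real and P :: problem_data and R R' :: reg_family
    and u u' :: "real \<Rightarrow> real \<times> real \<Rightarrow> complex"
  assumes "T > 0"
    and "admissible_data T P"
    and "very_weak_solution T P R u"
    and "very_weak_solution T P R' u'"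
    and "negligible_net (W1inf (QT T)) (\<lambda>\<epsilon>. ra R \<epsilon> - ra R' \<epsilon>)"
    and "negligible_net (bochnerQ Linf T (W1inf {0<..<1})) (\<lambda>\<epsilon>. rb R \<epsilon> - rb R' \<epsilon>)"
    and "negligible_net (Linf {0<..<1}) (\<lambda>\<epsilon>. rq R \<epsilon> - rq R' \<epsilon>)"
    and "negligible_net (L2 (QT T)) (\<lambda>\<epsilon>. rf R \<epsilon> - rf R' \<epsilon>)"
    and "negligible_net (H1 {0<..<1}) (\<lambda>\<epsilon>. ru0 R \<epsilon> - ru0 R' \<epsilon>)"
    and "negligible_net (H1 {0<..<T}) (\<lambda>\<epsilon>. rg0 R \<epsilon> - rg0 R' \<epsilon>)"
    and "negligible_net (H1 {0<..<T}) (\<lambda>\<epsilon>. rg1 R \<epsilon> - rg1 R' \<epsilon>)"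
  shows "negligible_net (sol_space T) (\<lambda>\<epsilon>. u \<epsilon> - u' \<epsilon>)"
proof -
  let ?I = "{0<..<1::real}" and ?J = "{0<..<T}"
  have \<alpha>: "0 < p\<alpha> P" using assms(2) by (simp add: admissible_data_def)
  have F: "regularising_family T P R" and F': "regularising_family T P R'" using assms(3,4) by (simp_all add: very_weak_solution_def)
  have m: "moderate_net (W1inf (QT T)) (ra R)" "moderate_net (bochnerQ Linf T (W1inf ?I)) (rb R)" "moderate_net (Linf ?I) (rq R)"
    "moderate_net (L2 (QT T)) (rf R)" "moderate_net (H1 ?I) (ru0 R)" "moderate_net (H1 ?J) (rg0 R)" "moderate_net (H1 ?J) (rg1 R)"
    using F by (simp_all add: regularising_family_def R1_def R2_def R3_def R4_def)
  have m': "moderate_net (W1inf (QT T)) (ra R')" "moderate_net (bochnerQ Linf T (W1inf ?I)) (rb R')" "moderate_net (Linf ?I) (rq R')"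
    "moderate_net (L2 (QT T)) (rf R')" "moderate_net (H1 ?I) (ru0 R')" "moderate_net (H1 ?J) (rg0 R')" "moderate_net (H1 ?J) (rg1 R')"
    using F' by (simp_all add: regularising_family_def R1_def R2_def R3_def R4_def)
  have mu: "moderate_net (sol_space T) u" "moderate_net (sol_space T) u'" using assms(3,4) by (simp_all add: very_weak_solution_def)
  obtain Cb where Cb: "\<And>\<epsilon>. \<epsilon> \<in> {0<..1} \<Longrightarrow> \<exists>b'. has_wderiv (QT T) (0, 1) (rb R \<epsilon>) b' \<and> b' \<in> carr (Linf (QT T)) \<and>
        nrm (Linf (QT T)) b' \<le> Cb * (1 + \<bar>ln \<epsilon>\<bar>)"
    using F unfolding regularising_family_def R2_def by blast
  obtain Cq where Cq: "\<And>\<epsilon>. \<epsilon> \<in> {0<..1} \<Longrightarrow> nrm (Linf ?I) (\<lambda>x. max (- rq R \<epsilon> x) 0) \<le> Cq * (1 + \<bar>ln \<epsilon>\<bar>)"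
    using F unfolding regularising_family_def R3_def by blast
  let ?a = "\<lambda>\<epsilon>. nrm (W1inf (QT T)) (ra R \<epsilon>)" and ?b = "\<lambda>\<epsilon>. nrm (bochnerQ Linf T (W1inf ?I)) (rb R \<epsilon>)" and ?q = "\<lambda>\<epsilon>. nrm (Linf ?I) (rq R \<epsilon>)"
  let ?da = "\<lambda>\<epsilon>. nrm (W1inf (QT T)) (ra R \<epsilon> - ra R' \<epsilon>)" and ?db = "\<lambda>\<epsilon>. nrm (bochnerQ Linf T (W1inf ?I)) (rb R \<epsilon> - rb R' \<epsilon>)"
    and ?dq = "\<lambda>\<epsilon>. nrm (Linf ?I) (rq R \<epsilon> - rq R' \<epsilon>)" and ?df = "\<lambda>\<epsilon>. nrm (L2 (QT T)) (rf R \<epsilon> - rf R' \<epsilon>)"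
    and ?du = "\<lambda>\<epsilon>. nrm (H1 ?I) (ru0 R \<epsilon> - ru0 R' \<epsilon>)"
    and ?N = "\<lambda>\<epsilon>. nrm (H1 ?J) (rg0 R \<epsilon> - rg0 R' \<epsilon>) + nrm (H1 ?J) (rg1 R \<epsilon> - rg1 R' \<epsilon>)"
    and ?s = "\<lambda>\<epsilon>. nrm (bochnerQ L2 T (H2 ?I)) (u' \<epsilon>)"
  \<comment> \<open>The last argument is B1 + 2 Qm + 1 for B1 = Cb (1 + |ln \<epsilon>|) and Qm = Cq
    (1 + |ln \<epsilon>|), sorted by powers of the logarithm.\<close>
  let ?K = "\<lambda>\<epsilon>. energy_factor T (p\<alpha> P) (?a \<epsilon>) (?b \<epsilon>) (?q \<epsilon>) ((Cb + 2 * Cq + 1) + (Cb + 2 * Cq) * \<bar>ln \<epsilon>\<bar>)"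
  \<comment> \<open>The data size of the stability estimate: every summand contains a negligible
    difference, and the norm \<open>?s\<close> of the second solution is moderate by the definition
    of a very weak solution.\<close>
  let ?E = "\<lambda>\<epsilon>. ?df \<epsilon> + ?s \<epsilon> * (2 * ?da \<epsilon> + ?db \<epsilon> + ?dq \<epsilon>) + (?a \<epsilon> + ?b \<epsilon> + ?q \<epsilon>) * ?N \<epsilon> + ?N \<epsilon> + (?du \<epsilon> + (1 / sqrt T + sqrt T) * ?N \<epsilon>)"
  have estimate: "u \<epsilon> - u' \<epsilon> \<in> carr (sol_space T)" "nrm (sol_space T) (u \<epsilon> - u' \<epsilon>) \<le> ?K \<epsilon> * ?E \<epsilon>" if e: "\<epsilon> \<in> {0<..1}" for \<epsilon>
  proof -
    obtain b1 where b1: "has_wderiv (QT T) (0, 1) (rb R \<epsilon>) b1" "b1 \<in> carr (Linf (QT T))" "nrm (Linf (QT T)) b1 \<le> Cb * (1 + \<bar>ln \<epsilon>\<bar>)"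
      using Cb[OF e] by blast
    have ws: "weak_solution T (ra R \<epsilon>) (rb R \<epsilon>) (rq R \<epsilon>) (rf R \<epsilon>) (ru0 R \<epsilon>) (rg0 R \<epsilon>) (rg1 R \<epsilon>) (u \<epsilon>)"
      "weak_solution T (ra R' \<epsilon>) (rb R' \<epsilon>) (rq R' \<epsilon>) (rf R' \<epsilon>) (ru0 R' \<epsilon>) (rg0 R' \<epsilon>) (rg1 R' \<epsilon>) (u' \<epsilon>)"
      using assms(3,4) e by (simp_all add: very_weak_solution_def unique_weak_solution_def)
    have lower: "AE z in leb (QT T). p\<alpha> P \<le> ra R \<epsilon> z" using F e by (simp add: regularising_family_def R1_def)
    have r5: "R5 T R" "R5 T R'" using F F' by (simp_all add: regularising_family_def)
    interpret ts: two_solutions T "p\<alpha> P" "Cb * (1 + \<bar>ln \<epsilon>\<bar>)" "Cq * (1 + \<bar>ln \<epsilon>\<bar>)" "ra R \<epsilon>" "ra R' \<epsilon>" "rb R \<epsilon>" "rb R' \<epsilon>" b1 "rq R \<epsilon>" "rq R' \<epsilon>"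
      "rf R \<epsilon>" "rf R' \<epsilon>" "u \<epsilon>" "u' \<epsilon>" "ru0 R \<epsilon>" "ru0 R' \<epsilon>" "rg0 R \<epsilon>" "rg0 R' \<epsilon>" "rg1 R \<epsilon>" "rg1 R' \<epsilon>"
      by unfold_locales (use assms(1,5-11) \<alpha> m m' mu ws lower b1 Cq[OF e] r5 e in \<open>simp_all only: moderate_net_def negligible_net_def R5_def\<close>)
    show "u \<epsilon> - u' \<epsilon> \<in> carr (sol_space T)" using ts.w_sol by (simp add: ts.w_def)
    have "Cb * (1 + \<bar>ln \<epsilon>\<bar>) + 2 * (Cq * (1 + \<bar>ln \<epsilon>\<bar>)) + 1 = (Cb + 2 * Cq + 1) + (Cb + 2 * Cq) * \<bar>ln \<epsilon>\<bar>" by (simp add: algebra_simps)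
    then show "nrm (sol_space T) (u \<epsilon> - u' \<epsilon>) \<le> ?K \<epsilon> * ?E \<epsilon>"
      using ts.difference_estimate
      unfolding ts.w_def ts.A_def ts.Bm_def ts.Q_def ts.data_size_def ts.E0_def ts.\<delta>a_def ts.\<delta>b_def ts.\<delta>q_def
        ts.Da_def ts.Db_def ts.Dq_def ts.Df_def ts.N0_def ts.N1_def ts.\<gamma>0_def ts.\<gamma>1_def ts.CT_def
      by (simp only: mult.commute[of _ "?s \<epsilon>"])
  qed
  have "moderate ?s"
    by (rule moderate_mono[OF moderate_netD[OF mu(2) sol_space_nrm_nonneg]])
      (simp add: bochnerQ_L2_le_sol_space sol_space_nrm_nonneg bochnerQ_L2_nrm_nonneg)
  moreover have "moderate ?a" "moderate ?b" "moderate ?q" using m(1-3) by (auto intro: moderate_netD)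
  moreover have neg: "negligible_rate ?da" "negligible_rate ?db" "negligible_rate ?dq" "negligible_rate ?df" "negligible_rate ?du"
    "negligible_rate (\<lambda>\<epsilon>. nrm (H1 ?J) (rg0 R \<epsilon> - rg0 R' \<epsilon>))" "negligible_rate (\<lambda>\<epsilon>. nrm (H1 ?J) (rg1 R \<epsilon> - rg1 R' \<epsilon>))"
    using assms(5-11) by (auto intro: negligible_netD H1_nrm_nonneg)
  ultimately have "negligible_rate (\<lambda>\<epsilon>. ?K \<epsilon> * ?E \<epsilon>)"
    by (intro negligible_rate_mult negligible_rate_add moderate_energy_factor moderate_add moderate_const)
  then have "\<exists>C>0. \<forall>\<epsilon>\<in>{0<..1}. nrm (sol_space T) (u \<epsilon> - u' \<epsilon>) \<le> C * \<epsilon> ^ k" for k :: nat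
  proof -
    assume n: "negligible_rate (\<lambda>\<epsilon>. ?K \<epsilon> * ?E \<epsilon>)"
    obtain C where C: "0 \<le> C" "\<And>\<epsilon>. \<epsilon> \<in> {0<..1} \<Longrightarrow> \<bar>?K \<epsilon> * ?E \<epsilon>\<bar> \<le> C * \<epsilon> ^ k"
      using n unfolding negligible_rate_def by blast
    \<comment> \<open>\<open>negligible_rate\<close> admits C = 0, whereas
      \<open>negligible_net\<close> asks for a positive constant.\<close>
    have "nrm (sol_space T) (u \<epsilon> - u' \<epsilon>) \<le> (C + 1) * \<epsilon> ^ k" if "\<epsilon> \<in> {0<..1}" for \<epsilon>
    proof -
      have "nrm (sol_space T) (u \<epsilon> - u' \<epsilon>) \<le> C * \<epsilon> ^ k" using estimate(2)[OF that] C(2)[OF that] by linarith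
      also have "\<dots> \<le> (C + 1) * \<epsilon> ^ k" using that by (intro mult_right_mono) auto
      finally show ?thesis .
    qed
    then show ?thesis using C(1) by (intro exI[of _ "C + 1"]) auto
  qed
  then show ?thesis using estimate(1) by (simp add: negligible_net_def)
qed

end
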